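(* Let $d\ge 2$ and fix $\lambda\in I_d$ arbitrarily. Then from the S-matrix $\mathcal S(\lambda)$ of $\widehat H=\widehat H_0+\widehat V$, where $\widehat V$ is real-valued and finitely supported, one can uniquely reconstruct the potential $\widehat V$. That is, $\widehat V$ is uniquely determined by $\mathcal S(\lambda)$ at the single fixed energy $\lambda$: if $\widehat V_1,\widehat V_2:\mathbf Z^d\to\mathbf R$ are two finitely supported potentials whose S-matrices satisfy $\mathcal S_1(\lambda)=\mathcal S_2(\lambda)$, then $\widehat V_1=\widehat V_2$.
   Context: Let $e_1,\dots,e_d$ be the standard basis of $\mathbf Z^d$. On $\ell^2(\mathbf Z^d)$ let $\widehat H=\widehat H_0+\widehat V$ with $(\widehat H_0\widehat f)(n)=-\frac14\sum_{j=1}^d\{\widehat f(n+e_j)+\widehat f(n-e_j)\}+\frac d2\widehat f(n)$ and $(\widehat V\widehat f)(n)=\widehat V(n)\widehat f(n)$. Here $\widehat V$ is real-valued and $\widehat V(n)=0$ except for finitely many $n$. $I_d=(0,1)\cup(1,2)$ for $d=2$, and $I_d=(0,1/2)\cup(d-1/2,d)$ for $d\ge3$. Let $\mathbf T^d=\mathbf R^d/(2\pi\mathbf Z)^d$, $h(x)=\frac12\big(d-\sum_{j=1}^d\cos x_j\big)$, and $M_\lambda=\{x\in\mathbf T^d: h(x)=\lambda\}$ with measure $d\widetilde M_\lambda=dM_\lambda/|\nabla h(x)|$, where $dM_\lambda$ is the surface measure induced from $dx$; $L^2(M_\lambda)$ is taken with respect to $d\widetilde M_\lambda$. For $\lambda\in(0,d)\setminus\mathbf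 Z$ put $(\widehat{\mathcal F}_0(\lambda)\widehat f)(x)=(2\pi)^{-d/2}\sum_{n\in\mathbf Z^d}e^{-in\cdot x}\widehat f(n)$ for $x\in M_\lambda$, with adjoint $(\widehat{\mathcal F}_0(\lambda)^*\phi)(n)=(2\pi)^{-d/2}\int_{M_\lambda}e^{in\cdot x}\phi(x)\,d\widetilde M_\lambda$. Let $\widehat R(z)=(\widehat H-z)^{-1}$; for $\lambda\in(0,d)\setminus\mathbf Z$ the limits $\widehat R(\lambda\pm i0)=\lim_{\epsilon\downarrow0}\widehat R(\lambda\pm i\epsilon)$ exist (in $\mathbf B(\widehat{\mathcal H}^s;\widehat{\mathcal H}^{-s})$, $s>1/2$, where $\|\widehat f\|^2_{\widehat{\mathcal H}^s}=\sum_n(1+|n|^2)^s|\widehat f(n)|^2$). The S-matrix is the unitary operator on $L^2(M_\lambda)$ obtained from the direct integral decomposition $\widehat{\mathcal F}_0\widehat S\widehat{\mathcal F}_0^*=\int_{(0,d)}\oplus\,\mathcal S(\lambda)\,d\lambda$ of the scattering operator $\widehat S=(\widehat W^{(+)})^*\widehat W^{(-)}$, where $\widehat W^{(\pm)}=\mathop{\mathrm{s\text{-}lim}}_{t\to\pm\infty}e^{it\widehat H}e^{-it\widehat H_0}$ and $\widehat{\mathcal F}_0$ is the spectral representation of $\widehat H_0$ given by $(\widehat{\mathcal F}_0\widehat f)(\lambda)=\widehat{\mathcal F}_0(\lambda)\widehat f$. For every $\lambda\in(0,d)\setminus\mathbf Z$ it is given by $\mathcal S(\lambda)=1-2\pi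 i A(\lambda)$ with $A(\lambda)=\widehat{\mathcal F}_0(\lambda)\big(1-\widehat V\widehat R(\lambda+i0)\big)\widehat V\widehat{\mathcal F}_0(\lambda)^*$. *)

theory Defs
  imports "HOL-Analysis.Analysis"
begin

section \<open>The discrete Schroedinger operator and its resolvent\<close>

text \<open>
  The lattice of dimension \<open>d = CARD('d)\<close> is the type \<open>int ^ 'd\<close>, and \<open>axis j 1\<close> is its
  \<open>j\<close>-th standard basis vector.
\<close>

definition H0 :: "(int ^ 'd \<Rightarrow> complex) \<Rightarrow> int ^ 'd \<Rightarrow> complex" where
  "H0 f n = - (1 / 4) * (\<Sum>j\<in>UNIV. f (n + axis j 1) + f (n - axis j 1))
            + of_nat CARD('d) / 2 * f n"

definition mult_op :: "(int ^ 'd \<Rightarrow> real) \<Rightarrow> (int ^ 'd \<Rightarrow> complex) \<Rightarrow> int ^ 'd \<Rightarrow> complex" where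
  "mult_op V f n = complex_of_real (V n) * f n"

definition Hop :: "(int ^ 'd \<Rightarrow> real) \<Rightarrow> (int ^ 'd \<Rightarrow> complex) \<Rightarrow> int ^ 'd \<Rightarrow> complex" where
  "Hop V f n = H0 f n + mult_op V f n"

definition ell2 :: "(int ^ 'd \<Rightarrow> complex) set" where
  "ell2 = {f. (\<lambda>n. (cmod (f n))\<^sup>2) summable_on UNIV}"

definition resolvent ::
    "(int ^ 'd \<Rightarrow> real) \<Rightarrow> complex \<Rightarrow> (int ^ 'd \<Rightarrow> complex) \<Rightarrow> int ^ 'd \<Rightarrow> complex" where
  "resolvent V z = the_inv_into ell2 (\<lambda>g n. Hop V g n - z * g n)"


section \<open>Weighted spaces and the boundary value of the resolvent\<close>

definition weight :: "real \<Rightarrow> int ^ 'd \<Rightarrow> real" where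
  "weight s n = (1 + (\<Sum>j\<in>UNIV. (real_of_int (n $ j))\<^sup>2)) powr s"

definition Hs :: "real \<Rightarrow> (int ^ 'd \<Rightarrow> complex) set" where
  "Hs s = {f. (\<lambda>n. weight s n * (cmod (f n))\<^sup>2) summable_on UNIV}"

definition Hs_norm :: "real \<Rightarrow> (int ^ 'd \<Rightarrow> complex) \<Rightarrow> real" where
  "Hs_norm s f = sqrt (\<Sum>\<^sub>\<infinity>n. weight s n * (cmod (f n))\<^sup>2)"

text \<open>
  Bounded operators from \<open>Hs s\<close> to \<open>Hs t\<close>. They are represented by functions on all
  sequences; the values outside \<open>Hs s\<close> are irrelevant.
\<close>

definition bounded_ops ::
    "real \<Rightarrow> real \<Rightarrow> ((int ^ 'd \<Rightarrow> complex) \<Rightarrow> int ^ 'd \<Rightarrow> complex) set" where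
  "bounded_ops s t = {T.
     (\<forall>f\<in>Hs s. T f \<in> Hs t) \<and>
     (\<forall>f\<in>Hs s. \<forall>g\<in>Hs s. \<forall>a b. T (\<lambda>n. a * f n + b * g n) = (\<lambda>n. a * T f n + b * T g n)) \<and>
     (\<exists>C. \<forall>f\<in>Hs s. Hs_norm t (T f) \<le> C * Hs_norm s f)}"

definition op_norm ::
    "real \<Rightarrow> real \<Rightarrow> ((int ^ 'd \<Rightarrow> complex) \<Rightarrow> int ^ 'd \<Rightarrow> complex) \<Rightarrow> real" where
  "op_norm s t T = Inf {C. 0 \<le> C \<and> (\<forall>f\<in>Hs s. Hs_norm t (T f) \<le> C * Hs_norm s f)}"

definition is_boundary_resolvent ::
    "(int ^ 'd \<Rightarrow> real) \<Rightarrow> real \<Rightarrow> real \<Rightarrow> ((int ^ 'd \<Rightarrow> complex) \<Rightarrow> int ^ 'd \<Rightarrow> complex) \<Rightarrow> bool" where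
  "is_boundary_resolvent V E s T \<longleftrightarrow>
     T \<in> bounded_ops s (- s) \<and>
     ((\<lambda>\<epsilon>. op_norm s (- s) (\<lambda>f n. resolvent V (Complex E \<epsilon>) f n - T f n)) \<longlongrightarrow> 0) (at_right 0)"

text \<open>
  \<open>R(E + i0)\<close> on the union of the spaces \<open>Hs s\<close>, \<open>s > 1/2\<close>. The value at \<open>f\<close> does not depend
  on \<open>s\<close>, since convergence in any of the operator norms implies pointwise convergence
  of the sequences \<open>R(E + i\<epsilon>) f\<close>.
\<close>

definition boundary_resolvent ::
    "(int ^ 'd \<Rightarrow> real) \<Rightarrow> real \<Rightarrow> (int ^ 'd \<Rightarrow> complex) \<Rightarrow> int ^ 'd \<Rightarrow> complex" where
  "boundary_resolvent V E f =
     (THE g. \<exists>s T. s > 1 / 2 \<and> f \<in> Hs s \<and> is_boundary_resolvent V E s T \<and> g = T f)"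


section \<open>Hausdorff measure\<close>

text \<open>
  The \<open>k\<close>-dimensional Hausdorff measure, normalised so that it is the usual surface measure
  on \<open>k\<close>-dimensional submanifolds. The case distinction only matters for \<open>k = 0\<close>, as
  \<open>diameter {} = 0\<close>.
\<close>

definition hausdorff_pre :: "nat \<Rightarrow> real \<Rightarrow> 'a::euclidean_space set \<Rightarrow> ennreal" where
  "hausdorff_pre k \<delta> A =
     (INF C \<in> {C :: nat \<Rightarrow> 'a set. A \<subseteq> (\<Union>i. C i) \<and> (\<forall>i. bounded (C i) \<and> diameter (C i) \<le> \<delta>)}.
        \<Sum>i. if C i = {} then 0 else ennreal (unit_ball_vol (real k) * (diameter (C i) / 2) ^ k))"

definition hausdorff_outer :: "nat \<Rightarrow> 'a::euclidean_space set \<Rightarrow> ennreal" where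
  "hausdorff_outer k A = (SUP \<delta>\<in>{0<..}. hausdorff_pre k \<delta> A)"

definition hausdorff_measure :: "nat \<Rightarrow> 'a::euclidean_space measure" where
  "hausdorff_measure k = measure_of UNIV (sets borel) (hausdorff_outer k)"


section \<open>The energy surface\<close>

definition symb :: "real ^ 'd \<Rightarrow> real" where
  "symb x = 1 / 2 * (real CARD('d) - (\<Sum>j\<in>UNIV. cos (x $ j)))"

definition gradient :: "('a::real_inner \<Rightarrow> real) \<Rightarrow> 'a \<Rightarrow> 'a" where
  "gradient f x = (THE D. GDERIV f x :> D)"

text \<open>The torus is represented by the fundamental domain with coordinates in \<open>[-\<pi>, \<pi>)\<close>.\<close>

definition energy_surface :: "real \<Rightarrow> (real ^ 'd) set" where
  "energy_surface E = {x. (\<forall>j. - pi \<le> x $ j \<and> x $ j < pi) \<and> symb x = E}"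

definition surface_measure :: "real \<Rightarrow> (real ^ 'd) measure" where
  "surface_measure E =
     density (restrict_space (hausdorff_measure (CARD('d) - 1)) (energy_surface E))
       (\<lambda>x. ennreal (1 / norm (gradient symb x)))"

text \<open>
  Representatives of the elements of \<open>L\<^sup>2\<close> of the energy surface; they are identified when
  they agree almost everywhere.
\<close>

definition L2_surface :: "real \<Rightarrow> (real ^ 'd \<Rightarrow> complex) set" where
  "L2_surface E = {\<phi>. \<phi> \<in> borel_measurable (surface_measure E) \<and>
                      integrable (surface_measure E) (\<lambda>x. (cmod (\<phi> x))\<^sup>2)}"


section \<open>The S-matrix\<close>

definition pairing :: "int ^ 'd \<Rightarrow> real ^ 'd \<Rightarrow> real" where
  "pairing n x = (\<Sum>j\<in>UNIV. real_of_int (n $ j) * x $ j)"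

text \<open>
  \<open>F0\<close> is the restriction to the energy surface of the Fourier transform, and does not mention
  the energy; below it is applied to finitely supported sequences only.
\<close>

definition F0 :: "(int ^ 'd \<Rightarrow> complex) \<Rightarrow> real ^ 'd \<Rightarrow> complex" where
  "F0 f x = complex_of_real ((2 * pi) powr (- (real CARD('d) / 2))) *
            (\<Sum>\<^sub>\<infinity>n. exp (- (\<i> * complex_of_real (pairing n x))) * f n)"

definition F0_adj :: "real \<Rightarrow> (real ^ 'd \<Rightarrow> complex) \<Rightarrow> int ^ 'd \<Rightarrow> complex" where
  "F0_adj E \<phi> n = complex_of_real ((2 * pi) powr (- (real CARD('d) / 2))) *
     (LINT x|surface_measure E. exp (\<i> * complex_of_real (pairing n x)) * \<phi> x)"

definition scattering_amplitude ::
    "(int ^ 'd \<Rightarrow> real) \<Rightarrow> real \<Rightarrow> (real ^ 'd \<Rightarrow> complex) \<Rightarrow> real ^ 'd \<Rightarrow> complex" where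
  "scattering_amplitude V E \<phi> =
     (let g = mult_op V (F0_adj E \<phi>)
      in F0 (\<lambda>n. g n - mult_op V (boundary_resolvent V E g) n))"

text \<open>
  The direct integral decomposition of the scattering operator determines the S-matrix only
  for almost every energy. Its value at an individual energy is the one given by the
  following stationary formula, which makes sense at every non-integer \<open>E\<close> between \<open>0\<close> and \<open>d\<close>.
\<close>

definition S_matrix ::
    "(int ^ 'd \<Rightarrow> real) \<Rightarrow> real \<Rightarrow> (real ^ 'd \<Rightarrow> complex) \<Rightarrow> real ^ 'd \<Rightarrow> complex" where
  "S_matrix V E \<phi> x = \<phi> x - 2 * complex_of_real pi * \<i> * scattering_amplitude V E \<phi> x"

definition energy_range :: "nat \<Rightarrow> real set" where
  "energy_range d = (if d = 2 then {0<..<1} \<union> {1<..<2}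
                     else {0<..<1 / 2} \<union> {real d - 1 / 2<..<real d})"

end

theory Submission
  imports Defs
begin

text \<open>
  The proof turns the equality of the S-matrices into an orthogonality relation between solutions of
  the two difference equations and then tests it with two solutions whose product meets the support
  of \<open>V1 - V2\<close> in a single site.

  Division by the symbol. A finitely supported sequence whose Fourier transform vanishes on an open
  piece of the energy surface has the form \<open>(H0 - E) v\<close> with \<open>v\<close> finitely supported
  (\<open>division_by_symbol\<close>). The symbol is quadratic in \<open>\<zeta> = exp (\<i> x\<^bsub>j0\<^esub>)\<close>, so that polynomial division
  leaves a remainder \<open>A \<zeta> + B\<close> with coefficients depending on the other momenta. If \<open>A\<close> or \<open>B\<close> were
  not zero, the vanishing of the remainder would make the discriminant a square of rational functions
  of \<open>exp (\<i> x\<^bsub>j1\<^esub>)\<close>. For \<open>E\<close> in \<open>(0, 1)\<close> or \<open>(d - 1, d)\<close> this is impossible, since the discriminant has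
  a simple zero. This set contains the range of energies of the theorem.

  Limiting absorption. The homogeneous perturbed equation has no nonzero outgoing solution: its flux
  would be zero, so by the division theorem it would be finitely supported, and then zero by unique
  continuation. The boundary values \<open>R(E + \<i>0)\<close> therefore exist and are symmetric
  kernels; they are obtained from the free Green function by adding the sites of the potential one at
  a time (\<open>limiting_absorption_exists\<close>). The free Green function is explicit in one direction, and
  in the others it is an integral over the transverse momenta that is dominated, uniformly up to the
  real axis, by integrable inverse square roots.

  From the S-matrix to the amplitudes. Write \<open>A\<^sub>i = V\<^sub>i - V\<^sub>i R\<^sub>i V\<^sub>i\<close> for the amplitudes. Equality of the
  S-matrices says that the Fourier transform of \<open>(A\<^sub>1 - A\<^sub>2) w\<close> vanishes on the surface for every
  superposition \<open>w\<close> of plane waves. By the division theorem \<open>(A\<^sub>1 - A\<^sub>2) w\<close> lies in the range of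
  \<open>H0 - E\<close> on finitely supported sequences, and is thus orthogonal to all solutions of
  \<open>(H0 - E) w' = 0\<close>, exponentially growing ones included. By symmetry of the amplitudes the same is then
  true of all solutions \<open>w\<close> (\<open>S_matrix_amplitudes\<close>). For this one needs to know of the surface measure
  that it is a measure, that a piece of the surface has finite measure, and that open parts of the
  piece do not have measure zero.

  Orthogonality of products. If \<open>u\<close> solves the equation with potential \<open>V\<^sub>i\<close>, then \<open>w = u + R\<^sub>0 V\<^sub>i u\<close>
  solves the free equation, without any growth condition, and \<open>A\<^sub>i w = V\<^sub>i u\<close>. Inserting such \<open>w\<^sub>1\<close>, \<open>w\<^sub>2\<close>
  gives \<open>\<Sum>n. (V\<^sub>1 n - V\<^sub>2 n) * u\<^sub>1 n * u\<^sub>2 n = 0\<close> for all solutions \<open>u\<^sub>1\<close>, \<open>u\<^sub>2\<close> of the two perturbed equations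
  (\<open>orthogonality_of_products\<close>).

  Choice of solutions. On the lattice the equation can be solved by recursion from suitable Cauchy
  data. Let \<open>n0\<close> be a site where the potentials differ, farthest in the direction \<open>j0\<close>. One takes
  \<open>u\<^sub>1\<close> supported in the half space on or above the diagonal \<open>n $ j0 + n $ j1\<close> through \<open>n0\<close>
  (\<open>half_space_solution\<close>), and \<open>u\<^sub>2\<close> which in the half space \<open>n $ j0 \<le> n0 $ j0\<close> is supported, apart from
  \<open>n0\<close>, strictly below this diagonal (\<open>slab_solution\<close>). Both have the value \<open>1\<close> at \<open>n0\<close>, and the
  orthogonality relation reduces to \<open>V1 n0 = V2 n0\<close>.
\<close>


section \<open>Square-summable sequences and the resolvent at non-real energies\<close>

text \<open>
  Bilinear, not sesquilinear: for this pairing the resolvents are symmetric, at non-real energies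
  and in the limit alike, whereas the adjoint of a boundary value is the boundary value from the
  other side of the spectrum.
\<close>

definition pair :: "('a \<Rightarrow> complex) \<Rightarrow> ('a \<Rightarrow> complex) \<Rightarrow> complex" where
  "pair f g = (\<Sum>\<^sub>\<infinity>n. f n * g n)"

definition nrm :: "('a \<Rightarrow> complex) \<Rightarrow> real" where
  "nrm f = sqrt (\<Sum>\<^sub>\<infinity>n. (cmod (f n))\<^sup>2)"

abbreviation l2 :: "('a \<Rightarrow> complex) set" where
  "l2 \<equiv> {f. (\<lambda>n. (cmod (f n))\<^sup>2) summable_on UNIV}"

definition site :: "'a \<Rightarrow> 'a \<Rightarrow> complex" where
  "site m n = (if n = m then 1 else 0)"

lemma ell2_eq_l2: "ell2 = l2"
  by (simp add: ell2_def)

lemma nrm_nonneg [simp]: "nrm f \<ge> 0"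
  by (simp add: nrm_def infsum_nonneg)

lemma nrm_power2: "(nrm f)\<^sup>2 = (\<Sum>\<^sub>\<infinity>n. (cmod (f n))\<^sup>2)"
  by (simp add: nrm_def infsum_nonneg)

lemma l2_bounded_sums:
  assumes "\<And>F. finite F \<Longrightarrow> (\<Sum>n\<in>F. (cmod (f n))\<^sup>2) \<le> C\<^sup>2" "C \<ge> 0"
  shows "f \<in> l2" "nrm f \<le> C"
proof -
  show *: "f \<in> l2"
    using assms(1) by (intro CollectI nonneg_bdd_above_summable_on) (auto intro!: bdd_aboveI)
  have "(\<Sum>\<^sub>\<infinity>n. (cmod (f n))\<^sup>2) \<le> C\<^sup>2"
    using * assms(1) by (intro infsum_le_finite_sums) auto
  then show "nrm f \<le> C"
    unfolding nrm_def using assms(2) by (simp add: real_le_lsqrt)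
qed

lemma finite_sum_le_nrm:
  assumes "f \<in> l2" "finite F"
  shows "(\<Sum>n\<in>F. (cmod (f n))\<^sup>2) \<le> (nrm f)\<^sup>2"
  unfolding nrm_power2 using assms by (intro finite_sum_le_infsum) auto

lemma norm_le_nrm: "f \<in> l2 \<Longrightarrow> cmod (f n) \<le> nrm f"
  using finite_sum_le_nrm[of f "{n}"] by (simp add: power2_le_iff_abs_le)

lemma nrm_eq_0D: "f \<in> l2 \<Longrightarrow> nrm f = 0 \<Longrightarrow> f n = 0"
  using norm_le_nrm[of f n] by simp

lemma L2_sum_mult_le:
  assumes "f \<in> l2" "g \<in> l2" "finite F"
  shows "(\<Sum>n\<in>F. cmod (f n) * cmod (g n)) \<le> nrm f * nrm g"
proof -
  have "(\<Sum>n\<in>F. cmod (f n) * cmod (g n)) \<le> L2_set (\<lambda>n. cmod (f n)) F * L2_set (\<lambda>n. cmod (g n)) F"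
    using L2_set_mult_ineq[of "\<lambda>n. cmod (f n)" "\<lambda>n. cmod (g n)" F] by simp
  also have "\<dots> \<le> nrm f * nrm g"
    unfolding L2_set_def using finite_sum_le_nrm[OF assms(1,3)] finite_sum_le_nrm[OF assms(2,3)]
    by (intro mult_mono real_le_lsqrt) (auto simp: sum_nonneg)
  finally show ?thesis .
qed

lemma l2_mult_abs_summable:
  assumes "f \<in> l2" "g \<in> l2"
  shows "(\<lambda>n. norm (f n * g n)) summable_on UNIV"
  using L2_sum_mult_le[OF assms]
  by (intro nonneg_bdd_above_summable_on) (auto simp: norm_mult intro!: bdd_aboveI)

lemma l2_mult_summable:
  "f \<in> l2 \<Longrightarrow> g \<in> l2 \<Longrightarrow> (\<lambda>n. f n * g n) summable_on UNIV"
  by (rule abs_summable_summable[OF l2_mult_abs_summable])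

lemma norm_pair_le:
  assumes "f \<in> l2" "g \<in> l2"
  shows "cmod (pair f g) \<le> nrm f * nrm g"
proof -
  have "cmod (pair f g) \<le> (\<Sum>\<^sub>\<infinity>n. cmod (f n * g n))"
    unfolding pair_def by (rule norm_infsum_bound[OF l2_mult_abs_summable[OF assms]])
  also have "\<dots> \<le> nrm f * nrm g"
    using L2_sum_mult_le[OF assms] l2_mult_abs_summable[OF assms]
    by (intro infsum_le_finite_sums) (auto simp: norm_mult)
  finally show ?thesis .
qed

lemma l2_cnj [simp]: "(\<lambda>n. cnj (f n)) \<in> l2 \<longleftrightarrow> f \<in> l2"
  by simp

lemma nrm_cnj [simp]: "nrm (\<lambda>n. cnj (f n)) = nrm f"
  by (simp add: nrm_def)

lemma l2_scale: "f \<in> l2 \<Longrightarrow> (\<lambda>n. c * f n) \<in> l2"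
  by (auto simp: norm_mult power_mult_distrib intro: summable_on_cmult_right)

lemma nrm_scale: "nrm (\<lambda>n. c * f n) = cmod c * nrm f"
  by (simp add: nrm_def norm_mult power_mult_distrib infsum_cmult_right' real_sqrt_mult)

lemma pair_cnj_self: "pair f (\<lambda>n. cnj (f n)) = of_real ((nrm f)\<^sup>2)"
proof -
  have *: "(\<Sum>\<^sub>\<infinity>n. complex_of_real ((cmod (f n))\<^sup>2)) = of_real (\<Sum>\<^sub>\<infinity>n. (cmod (f n))\<^sup>2)"
  proof (cases "(\<lambda>n. (cmod (f n))\<^sup>2) summable_on UNIV")
    case True
    then show ?thesis
      by (intro infsumI has_sum_of_real has_sum_infsum)
  next
    case False
    then have "\<not> (\<lambda>n. complex_of_real ((cmod (f n))\<^sup>2)) summable_on UNIV"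
      using summable_on_Re[of "\<lambda>n. complex_of_real ((cmod (f n))\<^sup>2)" UNIV] by auto
    with False show ?thesis
      by (simp add: infsum_not_exists)
  qed
  show ?thesis
    unfolding pair_def nrm_power2 *[symmetric] complex_norm_square ..
qed

lemma l2_add_nrm:
  assumes "f \<in> l2" "g \<in> l2"
  shows "(\<lambda>n. f n + g n) \<in> l2" "nrm (\<lambda>n. f n + g n) \<le> nrm f + nrm g"
proof -
  have "(\<Sum>n\<in>F. (cmod (f n + g n))\<^sup>2) \<le> (nrm f + nrm g)\<^sup>2" if F: "finite F" for F
  proof -
    have "L2_set (\<lambda>n. cmod (f n + g n)) F \<le> L2_set (\<lambda>n. cmod (f n) + cmod (g n)) F"
      by (intro L2_set_mono) (auto simp: norm_triangle_ineq)
    also have "\<dots> \<le> L2_set (\<lambda>n. cmod (f n)) F + L2_set (\<lambda>n. cmod (g n)) F"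
      by (rule L2_set_triangle_ineq)
    also have "\<dots> \<le> nrm f + nrm g"
      unfolding L2_set_def
      using finite_sum_le_nrm[OF assms(1) F] finite_sum_le_nrm[OF assms(2) F]
      by (intro add_mono real_le_lsqrt) auto
    finally show ?thesis
      unfolding L2_set_def by (simp add: sqrt_le_D)
  qed
  then show "(\<lambda>n. f n + g n) \<in> l2" "nrm (\<lambda>n. f n + g n) \<le> nrm f + nrm g"
    using l2_bounded_sums[of "\<lambda>n. f n + g n" "nrm f + nrm g"] by auto
qed

lemma l2_diff: "f \<in> l2 \<Longrightarrow> g \<in> l2 \<Longrightarrow> (\<lambda>n. f n - g n) \<in> l2"
  using l2_add_nrm(1)[of f "\<lambda>n. - 1 * g n"] l2_scale[of g "- 1"] by simp

lemma nrm_diff_le: "f \<in> l2 \<Longrightarrow> g \<in> l2 \<Longrightarrow> nrm (\<lambda>n. f n - g n) \<le> nrm f + nrm g"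
  using l2_add_nrm(2)[of f "\<lambda>n. - 1 * g n"] l2_scale[of g "- 1"] nrm_scale[of "- 1" g] by simp

lemma l2_sum_nrm:
  assumes "finite I" "\<And>i. i \<in> I \<Longrightarrow> f i \<in> l2"
  shows "(\<lambda>n. \<Sum>i\<in>I. f i n) \<in> l2 \<and> nrm (\<lambda>n. \<Sum>i\<in>I. f i n) \<le> (\<Sum>i\<in>I. nrm (f i))"
  using assms
proof (induction I rule: finite_induct)
  case empty
  then show ?case by (simp add: nrm_def)
next
  case (insert i I)
  then have "(\<lambda>n. \<Sum>i\<in>I. f i n) \<in> l2" "nrm (\<lambda>n. \<Sum>i\<in>I. f i n) \<le> (\<Sum>i\<in>I. nrm (f i))"
    "f i \<in> l2"
    by auto
  then show ?case
    using l2_add_nrm[of "f i" "\<lambda>n. \<Sum>i\<in>I. f i n"] insert.hyps by auto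
qed

lemma l2_shift_nrm:
  fixes f :: "'a::group_add \<Rightarrow> complex"
  shows "(\<lambda>n. f (n + e)) \<in> l2 \<longleftrightarrow> f \<in> l2" "nrm (\<lambda>n. f (n + e)) = nrm f"
proof -
  have bij: "bij_betw (\<lambda>n. n + e) UNIV UNIV"
    by (rule bij_betwI[where g = "\<lambda>n. n - e"]) auto
  show "(\<lambda>n. f (n + e)) \<in> l2 \<longleftrightarrow> f \<in> l2"
    using summable_on_reindex_bij_betw[OF bij, of "\<lambda>n. (cmod (f n))\<^sup>2"] by simp
  show "nrm (\<lambda>n. f (n + e)) = nrm f"
    using infsum_reindex_bij_betw[OF bij, of "\<lambda>n. (cmod (f n))\<^sup>2"] by (simp add: nrm_def)
qed

lemma l2_bounded_mult:
  assumes "f \<in> l2" "\<And>n. cmod (a n) \<le> C"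
  shows "(\<lambda>n. a n * f n) \<in> l2" "nrm (\<lambda>n. a n * f n) \<le> C * nrm f"
proof -
  have C: "C \<ge> 0"
    using assms(2) norm_ge_zero order_trans by blast
  have "(\<Sum>n\<in>F. (cmod (a n * f n))\<^sup>2) \<le> (C * nrm f)\<^sup>2" if F: "finite F" for F
  proof -
    have "(\<Sum>n\<in>F. (cmod (a n * f n))\<^sup>2) \<le> (\<Sum>n\<in>F. C\<^sup>2 * (cmod (f n))\<^sup>2)"
      using assms(2) C by (intro sum_mono) (auto simp: norm_mult power_mult_distrib intro!: mult_right_mono power_mono)
    also have "\<dots> \<le> C\<^sup>2 * (nrm f)\<^sup>2"
      using finite_sum_le_nrm[OF assms(1) F] C by (simp add: sum_distrib_left[symmetric] mult_left_mono)
    finally show ?thesis by (simp add: power_mult_distrib)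
  qed
  then show "(\<lambda>n. a n * f n) \<in> l2" "nrm (\<lambda>n. a n * f n) \<le> C * nrm f"
    using l2_bounded_sums[of "\<lambda>n. a n * f n" "C * nrm f"] C by auto
qed

lemma finite_support_l2:
  assumes "finite {n. f n \<noteq> 0}"
  shows "f \<in> l2"
  using assms by (intro CollectI finite_nonzero_values_imp_summable_on) simp

lemma finite_support_site [simp]: "finite {n. site m n \<noteq> 0}"
  by (rule finite_subset[of _ "{m}"]) (auto simp: site_def)

lemma site_l2 [simp]: "site m \<in> l2"
  by (rule finite_support_l2) simp

lemma pair_commute: "pair f g = pair g f"
  by (simp add: pair_def mult.commute)

lemma infsum_finite_support:
  assumes "finite F" "\<And>n. n \<notin> F \<Longrightarrow> f n = 0"
  shows "(\<Sum>\<^sub>\<infinity>n. f n) = (\<Sum>n\<in>F. f n)"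
proof -
  have "(\<Sum>\<^sub>\<infinity>n. f n) = (\<Sum>\<^sub>\<infinity>n\<in>F. f n)"
    using assms by (intro infsum_cong_neutral) auto
  then show ?thesis
    using assms(1) by simp
qed

lemma has_sum_sum:
  fixes f :: "'i \<Rightarrow> 'a \<Rightarrow> 'b::topological_comm_monoid_add"
  assumes "finite I" "\<And>i. i \<in> I \<Longrightarrow> (f i has_sum s i) A"
  shows "((\<lambda>x. \<Sum>i\<in>I. f i x) has_sum (\<Sum>i\<in>I. s i)) A"
  using assms
proof (induction I rule: finite_induct)
  case (insert x F)
  then show ?case
    using has_sum_add[of "f x" A "s x" "\<lambda>y. \<Sum>i\<in>F. f i y" "\<Sum>i\<in>F. s i"] by simp
qed simp

lemma pair_finite_support:
  assumes "finite F" "\<And>n. n \<notin> F \<Longrightarrow> f n = 0"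
  shows "pair f g = (\<Sum>n\<in>F. f n * g n)"
  unfolding pair_def using assms by (intro infsum_finite_support) auto

lemma pair_site_left [simp]: "pair (site m) f = f m"
  using pair_finite_support[of "{m}" "site m" f] by (simp add: site_def)

lemma pair_site_right [simp]: "pair f (site m) = f m"
  using pair_commute pair_site_left by metis

subsection \<open>The Schroedinger operator\<close>

lemma Hop_eq:
  "Hop V f n = - (1 / 4) * (\<Sum>j\<in>UNIV. f (n + axis j 1) + f (n - axis j 1))
            + (of_nat CARD('d) / 2 + of_real (V n)) * f n" for n :: "int ^ 'd"
  by (simp add: Hop_def H0_def mult_op_def algebra_simps)

lemma Hop_0: "Hop (\<lambda>_. 0) = H0"
  by (simp add: fun_eq_iff Hop_def mult_op_def)

lemma Hop_lin:
  "Hop V (\<lambda>n. a * f n + b * g n) n = a * Hop V f n + b * Hop V g n"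
  by (simp add: Hop_eq algebra_simps sum.distrib sum_distrib_left)

lemma H0_lin:
  "H0 (\<lambda>n. a * f n + b * g n) n = a * H0 f n + b * H0 g n"
  using Hop_lin[of "\<lambda>_. 0"] by (simp add: Hop_0)

lemma Hop_cnj: "Hop V (\<lambda>n. cnj (f n)) n = cnj (Hop V f n)"
  by (simp add: Hop_eq)

lemma infsum_shift_pair:
  fixes f g :: "'a::ab_group_add \<Rightarrow> complex"
  shows "(\<lambda>n. f (n + e) * g n) summable_on UNIV \<longleftrightarrow> (\<lambda>n. f n * g (n - e)) summable_on UNIV"
    "(\<Sum>\<^sub>\<infinity>n. f (n + e) * g n) = (\<Sum>\<^sub>\<infinity>n. f n * g (n - e))"
proof -
  have bij: "bij_betw (\<lambda>n. n + e) UNIV UNIV"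
    by (rule bij_betwI[where g = "\<lambda>n. n - e"]) auto
  show "(\<lambda>n. f (n + e) * g n) summable_on UNIV \<longleftrightarrow> (\<lambda>n. f n * g (n - e)) summable_on UNIV"
    using summable_on_reindex_bij_betw[OF bij, of "\<lambda>n. f n * g (n - e)"] by simp
  show "(\<Sum>\<^sub>\<infinity>n. f (n + e) * g n) = (\<Sum>\<^sub>\<infinity>n. f n * g (n - e))"
    using infsum_reindex_bij_betw[OF bij, of "\<lambda>n. f n * g (n - e)"] by simp
qed

text \<open>
  Summation by parts. The summability hypotheses cover two cases: both sequences square summable,
  and one of them finitely supported with no condition on the other.
\<close>

lemma pair_Hop_symmetric:
  fixes f g :: "int ^ 'd \<Rightarrow> complex"
  assumes shift: "\<And>e. (\<lambda>n. f (n + e) * g n) summable_on UNIV"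
    and V: "(\<lambda>n. of_real (V n) * (f n * g n)) summable_on UNIV"
  shows "pair (Hop V f) g = pair f (Hop V g)"
proof -
  let ?h = "\<lambda>n. (of_nat CARD('d) / 2 + of_real (V n)) * (f n * g n)"
  have h: "?h summable_on UNIV"
    using summable_on_add[OF summable_on_cmult_right[OF shift[of 0], of "of_nat CARD('d) / 2"] V]
    by (simp add: algebra_simps)
  have shift': "(\<lambda>n. f (n - e) * g n) summable_on UNIV" for e
    using shift[of "- e"] by simp
  have shift2: "(\<lambda>n. f n * g (n - e)) summable_on UNIV" "(\<lambda>n. f n * g (n + e)) summable_on UNIV" for e
    using infsum_shift_pair(1)[of f e g] shift[of e] infsum_shift_pair(1)[of f "-e" g] shift[of "- e"] by simp_all
  have "((\<lambda>n. - (1/4) * (\<Sum>j\<in>UNIV. f (n + axis j 1) * g n + f (n - axis j 1) * g n) + ?h n)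
     has_sum (- (1/4) * (\<Sum>j\<in>UNIV. (\<Sum>\<^sub>\<infinity>n. f (n + axis j 1) * g n) + (\<Sum>\<^sub>\<infinity>n. f (n - axis j 1) * g n)) + infsum ?h UNIV)) UNIV"
    by (intro has_sum_add has_sum_cmult_right has_sum_sum finite has_sum_infsum shift shift' h) 
  moreover have "((\<lambda>n. - (1/4) * (\<Sum>j\<in>UNIV. f n * g (n - axis j 1) + f n * g (n + axis j 1)) + ?h n)
     has_sum (- (1/4) * (\<Sum>j\<in>UNIV. (\<Sum>\<^sub>\<infinity>n. f n * g (n - axis j 1)) + (\<Sum>\<^sub>\<infinity>n. f n * g (n + axis j 1))) + infsum ?h UNIV)) UNIV"
    by (intro has_sum_add has_sum_cmult_right has_sum_sum finite has_sum_infsum shift2 h)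
  moreover have "(\<Sum>\<^sub>\<infinity>n. f n * g (n - e)) = (\<Sum>\<^sub>\<infinity>n. f (n + e) * g n)"
     "(\<Sum>\<^sub>\<infinity>n. f n * g (n + e)) = (\<Sum>\<^sub>\<infinity>n. f (n - e) * g n)" for e
    using infsum_shift_pair(2)[of f e g] infsum_shift_pair(2)[of f "-e" g] by simp_all
  ultimately have "(\<Sum>\<^sub>\<infinity>n. - (1/4) * (\<Sum>j\<in>UNIV. f (n + axis j 1) * g n + f (n - axis j 1) * g n) + ?h n)
     = (\<Sum>\<^sub>\<infinity>n. - (1/4) * (\<Sum>j\<in>UNIV. f n * g (n - axis j 1) + f n * g (n + axis j 1)) + ?h n)"
    by (simp add: infsumI)
  then show ?thesis
    unfolding pair_def Hop_eq
    by (simp add: algebra_simps sum_distrib_left sum_distrib_right sum.distrib)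
qed

lemma potential_bounded:
  fixes V :: "'a \<Rightarrow> real"
  assumes "finite {n. V n \<noteq> 0}"
  obtains C where "C \<ge> 0" "\<And>n. \<bar>V n\<bar> \<le> C"
proof
  show "(\<Sum>n | V n \<noteq> 0. \<bar>V n\<bar>) \<ge> 0"
    by (simp add: sum_nonneg)
  show "\<bar>V n\<bar> \<le> (\<Sum>n | V n \<noteq> 0. \<bar>V n\<bar>)" for n
    using assms member_le_sum[of n "{n. V n \<noteq> 0}" "\<lambda>n. \<bar>V n\<bar>"] by (cases "V n = 0") (auto simp: sum_nonneg)
qed

lemma Hop_l2:
  fixes V :: "int ^ 'd \<Rightarrow> real"
  assumes "finite {n. V n \<noteq> 0}"
  obtains M where "M > 0" "\<And>f. f \<in> l2 \<Longrightarrow> (\<lambda>n. Hop V f n - z * f n) \<in> l2"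
    "\<And>f. f \<in> l2 \<Longrightarrow> nrm (\<lambda>n. Hop V f n - z * f n) \<le> M * nrm f"
proof -
  obtain C where C: "C \<ge> 0" "\<And>n. \<bar>V n\<bar> \<le> C"
    using potential_bounded[OF assms] by blast
  let ?a = "\<lambda>n. of_nat CARD('d) / 2 + of_real (V n) - z"
  let ?S = "\<lambda>f n. \<Sum>j\<in>(UNIV :: 'd set). f (n + axis j 1) + f (n + - axis j 1)"
  let ?A = "CARD('d) / 2 + C + cmod z"
  define M where "M = 2 * CARD('d) + ?A + 1"
  have eq: "(\<lambda>n. Hop V f n - z * f n) = (\<lambda>n. - (1/4) * ?S f n + ?a n * f n)" for f
    by (simp add: fun_eq_iff Hop_eq algebra_simps)
  have a: "cmod (?a n) \<le> ?A" for n
  proof -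
    have "cmod (?a n) \<le> cmod (of_nat CARD('d) / 2 + of_real (V n)) + cmod z"
      by (rule norm_triangle_ineq4)
    also have "\<dots> \<le> cmod (of_nat CARD('d) / 2) + cmod (of_real (V n)) + cmod z"
      by (intro add_mono norm_triangle_ineq) auto
    finally show ?thesis
      using C(2)[of n] by (simp add: norm_divide)
  qed
  have *: "(\<lambda>n. Hop V f n - z * f n) \<in> l2 \<and> nrm (\<lambda>n. Hop V f n - z * f n) \<le> M * nrm f" if f: "f \<in> l2" for f
  proof -
    have 1: "(\<lambda>n. f (n + axis j 1) + f (n + - axis j 1)) \<in> l2"
      "nrm (\<lambda>n. f (n + axis j 1) + f (n + - axis j 1)) \<le> 2 * nrm f" for j
      using l2_add_nrm[of "\<lambda>n. f (n + axis j 1)" "\<lambda>n. f (n + - axis j 1)"] f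
      unfolding l2_shift_nrm by auto
    have S: "?S f \<in> l2" "nrm (?S f) \<le> 2 * CARD('d) * nrm f"
      using l2_sum_nrm[of UNIV "\<lambda>j n. f (n + axis j 1) + f (n + - axis j 1)", OF _ 1(1)]
        sum_mono[of UNIV "\<lambda>j. nrm (\<lambda>n. f (n + axis j 1) + f (n + - axis j 1))" "\<lambda>_. 2 * nrm f", OF 1(2)]
      by auto
    note b = l2_bounded_mult[OF f, of ?a ?A, OF a]
    have "nrm (\<lambda>n. - (1/4) * ?S f n + ?a n * f n) \<le> nrm (\<lambda>n. - (1/4) * ?S f n) + nrm (\<lambda>n. ?a n * f n)"
      by (rule l2_add_nrm(2)[OF l2_scale[OF S(1)] b(1)])
    also have "nrm (\<lambda>n. - (1/4) * ?S f n) \<le> 2 * CARD('d) * nrm f"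
      unfolding nrm_scale using S(2) nrm_nonneg[of "?S f"] by (simp del: nrm_nonneg)
    finally have "nrm (\<lambda>n. - (1/4) * ?S f n + ?a n * f n) \<le> 2 * CARD('d) * nrm f + ?A * nrm f"
      using b(2) by simp
    also have "\<dots> \<le> M * nrm f"
      by (simp add: M_def algebra_simps)
    finally have "nrm (\<lambda>n. - (1/4) * ?S f n + ?a n * f n) \<le> M * nrm f" .
    then show ?thesis
      unfolding eq using l2_add_nrm(1)[OF l2_scale[OF S(1), of "- (1/4)"] b(1)] by blast
  qed
  have "M > 0"
    using C(1) by (simp add: M_def add_nonneg_pos)
  with * that show ?thesis by blast
qed

lemma Hop_l2_closed:
  assumes "finite {n. V n \<noteq> 0}" "f \<in> l2"
  shows "(\<lambda>n. Hop V f n - z * f n) \<in> l2"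
  using Hop_l2[OF assms(1), where z = z] assms(2) by blast

lemma pair_Hop_l2:
  assumes V: "finite {n. V n \<noteq> 0}" and "f \<in> l2" "g \<in> l2"
  shows "pair (Hop V f) g = pair f (Hop V g)"
proof (rule pair_Hop_symmetric)
  show "(\<lambda>n. f (n + e) * g n) summable_on UNIV" for e
    using assms l2_shift_nrm(1)[of f e] by (intro l2_mult_summable) auto
  show "(\<lambda>n. of_real (V n) * (f n * g n)) summable_on UNIV"
    by (intro finite_nonzero_values_imp_summable_on finite_subset[OF _ V]) auto
qed

lemma pair_Hop_finite_support:
  assumes f: "finite {n. f n \<noteq> 0}"
  shows "pair (Hop V f) g = pair f (Hop V g)"
proof (rule pair_Hop_symmetric)
  have "finite {n. f (n + e) \<noteq> 0}" for e
    using finite_vimageI[OF f, of "\<lambda>n. n + e"] by (simp add: vimage_def inj_def)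
  then show "(\<lambda>n. f (n + e) * g n) summable_on UNIV" for e
    by (intro finite_nonzero_values_imp_summable_on finite_subset[OF _ \<open>finite {n. f (n + e) \<noteq> 0}\<close>]) auto
  show "(\<lambda>n. of_real (V n) * (f n * g n)) summable_on UNIV"
    by (intro finite_nonzero_values_imp_summable_on finite_subset[OF _ f]) auto
qed

lemma pair_add_left: "f \<in> l2 \<Longrightarrow> g \<in> l2 \<Longrightarrow> h \<in> l2 \<Longrightarrow>
   pair (\<lambda>n. a * f n + b * g n) h = a * pair f h + b * pair g h"
  unfolding pair_def
  using infsum_add[OF summable_on_cmult_right[OF l2_mult_summable[of f h], of a]
     summable_on_cmult_right[OF l2_mult_summable[of g h], of b]]
  by (simp add: algebra_simps infsum_cmult_right')

text \<open>
  \<open>H\<close> is symmetric and commutes with complex conjugation, so that \<open>\<langle>H f, f\<rangle>\<close> is real and only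
  \<open>- z\<close> contributes an imaginary part.
\<close>

lemma Hop_numerical_range:
  assumes V: "finite {n. V n \<noteq> 0}" and f: "f \<in> l2"
  shows "Im (pair (\<lambda>n. Hop V f n - z * f n) (\<lambda>n. cnj (f n))) = - Im z * (nrm f)\<^sup>2"
proof -
  have Hf: "Hop V f \<in> l2"
    using Hop_l2_closed[OF V f, of 0] by simp
  have cf: "(\<lambda>n. cnj (f n)) \<in> l2"
    using f by simp
  have "pair (\<lambda>n. Hop V f n - z * f n) (\<lambda>n. cnj (f n))
      = pair (Hop V f) (\<lambda>n. cnj (f n)) - z * of_real ((nrm f)\<^sup>2)"
    using pair_add_left[OF Hf f cf, of 1 "- z"] by (simp add: pair_cnj_self)
  moreover have "pair (Hop V f) (\<lambda>n. cnj (f n)) = cnj (pair (Hop V f) (\<lambda>n. cnj (f n)))"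
    using pair_Hop_l2[OF V f cf] unfolding pair_def infsum_cnj[symmetric]
    by (simp add: Hop_cnj mult.commute)
  then have "Im (pair (Hop V f) (\<lambda>n. cnj (f n))) = 0"
    by (metis Reals_cnj_iff complex_is_Real_iff)
  ultimately show ?thesis
    by simp
qed

lemma nrm_le_Hop:
  assumes V: "finite {n. V n \<noteq> 0}" and f: "f \<in> l2"
  shows "\<bar>Im z\<bar> * nrm f \<le> nrm (\<lambda>n. Hop V f n - z * f n)"
proof -
  note M = Hop_l2_closed[OF V, where z = z]
  have cf: "(\<lambda>n. cnj (f n)) \<in> l2"
    using f by simp
  have "\<bar>Im z\<bar> * (nrm f)\<^sup>2 = \<bar>Im (pair (\<lambda>n. Hop V f n - z * f n) (\<lambda>n. cnj (f n)))\<bar>"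
    unfolding Hop_numerical_range[OF V f] by (simp add: abs_mult)
  also have "\<dots> \<le> nrm (\<lambda>n. Hop V f n - z * f n) * nrm f"
    using norm_pair_le[OF M[OF f] cf] abs_Im_le_cmod order_trans by fastforce
  finally have *: "(\<bar>Im z\<bar> * nrm f) * nrm f \<le> nrm (\<lambda>n. Hop V f n - z * f n) * nrm f"
    by (simp add: power2_eq_square mult.assoc)
  show ?thesis
  proof (cases "nrm f = 0")
    case False
    then have "nrm f > 0"
      using nrm_nonneg[of f] by linarith
    with * show ?thesis
      by (simp only: mult_le_cancel_right_pos)
  qed simp
qed

text \<open>
  Expanding the square, \<open>\<parallel>g - \<tau> \<i> (H - z) g\<parallel>\<^sup>2 = \<parallel>g\<parallel>\<^sup>2 - 2 \<tau> Im z \<parallel>g\<parallel>\<^sup>2 + \<tau>\<^sup>2 \<parallel>(H - z) g\<parallel>\<^sup>2\<close>: for small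
  \<open>\<tau>\<close> the linear term wins over the quadratic one. Solving \<open>(H - z) g = f\<close> is finding the fixed point
  of the contraction \<open>g \<mapsto> g - \<tau> \<i> ((H - z) g - f)\<close>.
\<close>

lemma Hop_contraction:
  assumes V: "finite {n. V n \<noteq> 0}" and z: "Im z > 0"
  obtains \<tau> \<rho> :: real where "\<tau> > 0" "0 \<le> \<rho>" "\<rho> < 1"
    "\<And>g. g \<in> l2 \<Longrightarrow> (\<lambda>n. g n - \<tau> * \<i> * (Hop V g n - z * g n)) \<in> l2"
    "\<And>g. g \<in> l2 \<Longrightarrow> nrm (\<lambda>n. g n - \<tau> * \<i> * (Hop V g n - z * g n)) \<le> \<rho> * nrm g"
proof -
  obtain M where M: "M > 0" "\<And>f. f \<in> l2 \<Longrightarrow> (\<lambda>n. Hop V f n - z * f n) \<in> l2"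
    "\<And>f. f \<in> l2 \<Longrightarrow> nrm (\<lambda>n. Hop V f n - z * f n) \<le> M * nrm f"
    using Hop_l2[OF V, where z = z] by blast
  define N where "N = M + Im z"
  have N: "N > 0" "Im z < N" "M \<le> N"
    using M(1) z by (auto simp: N_def)
  define \<tau> where "\<tau> = Im z / N\<^sup>2"
  define q where "q = 1 - (Im z / N)\<^sup>2"
  have q: "0 \<le> q" "q < 1"
    using N z by (auto simp: q_def power_le_one)
  have *: "(\<lambda>n. g n - \<tau> * \<i> * (Hop V g n - z * g n)) \<in> l2 \<and>
      nrm (\<lambda>n. g n - \<tau> * \<i> * (Hop V g n - z * g n)) \<le> sqrt q * nrm g" if g: "g \<in> l2" for g
  proof -
    let ?B = "\<lambda>n. Hop V g n - z * g n"
    let ?c = "\<lambda>n. cnj (g n)"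
    let ?f = "\<lambda>n. 1 * g n + (- \<tau> * \<i>) * ?B n"
    note B = M(2,3)[OF g]
    have f: "?f \<in> l2"
      using l2_add_nrm(1)[OF g l2_scale[OF B(1), of "- \<tau> * \<i>"]] by simp
    have c: "?c \<in> l2" "(\<lambda>n. cnj (?B n)) \<in> l2"
      using g B(1) unfolding l2_cnj by auto
    have cB: "pair g (\<lambda>n. cnj (?B n)) = cnj (pair ?B ?c)"
      unfolding pair_def infsum_cnj[symmetric] by (simp add: mult.commute)
    have "pair ?f (\<lambda>n. cnj (?f n)) = pair ?f (\<lambda>n. 1 * ?c n + (\<tau> * \<i>) * cnj (?B n))"
      by simp
    also have "\<dots> = pair ?f ?c + \<tau> * \<i> * pair ?f (\<lambda>n. cnj (?B n))"
      using pair_add_left[OF c f, of 1 "\<tau> * \<i>"] by (simp only: pair_commute mult_1)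
    also have "pair ?f ?c = of_real ((nrm g)\<^sup>2) - \<tau> * \<i> * pair ?B ?c"
      using pair_add_left[OF g B(1) c(1), of 1 "- \<tau> * \<i>"] by (simp add: pair_cnj_self)
    also have "pair ?f (\<lambda>n. cnj (?B n)) = cnj (pair ?B ?c) - \<tau> * \<i> * of_real ((nrm ?B)\<^sup>2)"
      using pair_add_left[OF g B(1) c(2), of 1 "- \<tau> * \<i>"] by (simp only: pair_cnj_self cB) simp
    finally have "of_real ((nrm ?f)\<^sup>2) = of_real ((nrm g)\<^sup>2) - \<tau> * \<i> * pair ?B ?c +
       \<tau> * \<i> * (cnj (pair ?B ?c) - \<tau> * \<i> * of_real ((nrm ?B)\<^sup>2))"
      unfolding pair_cnj_self .
    from arg_cong[OF this, of Re] have "(nrm ?f)\<^sup>2 = (nrm g)\<^sup>2 + 2 * \<tau> * Im (pair ?B ?c) + \<tau>\<^sup>2 * (nrm ?B)\<^sup>2"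
      by (simp add: power2_eq_square algebra_simps)
    also have "\<dots> \<le> (nrm g)\<^sup>2 - 2 * \<tau> * Im z * (nrm g)\<^sup>2 + \<tau>\<^sup>2 * (N * nrm g)\<^sup>2"
      unfolding Hop_numerical_range[OF V g]
      using order_trans[OF B(2) mult_right_mono[OF N(3) nrm_nonneg]]
      by (intro add_mono mult_left_mono power_mono) auto
    also have "\<dots> = q * (nrm g)\<^sup>2"
      using N(1) by (simp add: q_def \<tau>_def field_simps power2_eq_square)
    finally have "nrm ?f \<le> sqrt (q * (nrm g)\<^sup>2)"
      by (rule real_le_rsqrt)
    then have "nrm ?f \<le> sqrt q * nrm g"
      by (simp add: real_sqrt_mult)
    with f show ?thesis
      by simp
  qed
  show ?thesis
  proof (rule that[of \<tau> "sqrt q"])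
    show "\<tau> > 0" using z N by (simp add: \<tau>_def)
  qed (use q * in auto)
qed

lemma tendsto_Hop:
  assumes "\<And>n. ((\<lambda>k. g k n) \<longlongrightarrow> h n) F"
  shows "((\<lambda>k. Hop V (g k) n) \<longlongrightarrow> Hop V h n) F"
  unfolding Hop_eq by (intro tendsto_intros assms)

text \<open>
  The iterates of the contraction converge site by site, and the equation passes to the limit
  because at each site it involves finitely many values. The limit is square summable since the norms
  of the iterates are bounded.
\<close>

lemma Hop_surjective:
  assumes V: "finite {n. V n \<noteq> 0}" and z: "Im z > 0" and f: "f \<in> l2"
  obtains g where "g \<in> l2" "\<And>n. Hop V g n - z * g n = f n"
proof -
  obtain \<tau> \<rho> :: real where \<tau>: "\<tau> > 0" and \<rho>: "0 \<le> \<rho>" "\<rho> < 1"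
    and B: "\<And>g. g \<in> l2 \<Longrightarrow> (\<lambda>n. g n - \<tau> * \<i> * (Hop V g n - z * g n)) \<in> l2"
      "\<And>g. g \<in> l2 \<Longrightarrow> nrm (\<lambda>n. g n - \<tau> * \<i> * (Hop V g n - z * g n)) \<le> \<rho> * nrm g"
    using Hop_contraction[OF V z] by blast
  define T where "T g = (\<lambda>n. g n - \<tau> * \<i> * (Hop V g n - z * g n))" for g
  define h where "h n = \<tau> * \<i> * f n" for n
  have h: "h \<in> l2"
    unfolding h_def by (rule l2_scale[OF f])
  define G where "G = rec_nat (\<lambda>_. 0) (\<lambda>k g n. T g n + h n)"
  have G: "G 0 = (\<lambda>_. 0)" "\<And>k. G (Suc k) = (\<lambda>n. T (G k) n + h n)"
    by (simp_all add: G_def)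
  have Gl2: "G k \<in> l2" for k
  proof (induction k)
    case (Suc k)
    show ?case
      unfolding G T_def by (rule l2_add_nrm(1)[OF B(1)[OF Suc] h])
  qed (simp add: G)
  define C where "C = nrm h / (1 - \<rho>)"
  have C: "C \<ge> 0" "\<rho> * C + nrm h = C"
    using \<rho> by (auto simp: C_def field_simps)
  have bound: "nrm (G k) \<le> C" for k
  proof (induction k)
    case (Suc k)
    have "nrm (G (Suc k)) \<le> nrm (T (G k)) + nrm h"
      unfolding G using B(1)[OF Gl2] h by (intro l2_add_nrm(2)) (auto simp: T_def)
    also have "nrm (T (G k)) \<le> \<rho> * C"
      using B(2)[OF Gl2, of k] mult_left_mono[OF Suc \<rho>(1)] by (simp add: T_def)
    finally show ?case using C by simp
  qed (use C in \<open>simp add: G nrm_def\<close>)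
  have step: "nrm (\<lambda>n. G (Suc k) n - G k n) \<le> \<rho> ^ k * nrm h" for k
  proof (induction k)
    case 0
    then show ?case by (simp add: G T_def Hop_eq)
  next
    case (Suc k)
    let ?D = "\<lambda>n. G (Suc k) n - G k n"
    have "(\<lambda>n. G (Suc (Suc k)) n - G (Suc k) n) = T ?D"
      using Hop_lin[of V 1 "G (Suc k)" "-1" "G k"]
      by (simp add: fun_eq_iff G(2)[of "Suc k"] G(2)[of k] T_def[of "\<lambda>n. _ n - _ n"]) (simp add: G(2)[symmetric] T_def algebra_simps)
    then have "nrm (\<lambda>n. G (Suc (Suc k)) n - G (Suc k) n) = nrm (T ?D)"
      by simp
    also have "\<dots> \<le> \<rho> * nrm ?D"
      unfolding T_def by (rule B(2)[OF l2_diff[OF Gl2 Gl2]])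
    also have "\<dots> \<le> \<rho> * (\<rho> ^ k * nrm h)"
      by (rule mult_left_mono[OF Suc \<rho>(1)])
    finally show ?case by simp
  qed
  have "\<exists>l. (\<lambda>k. G k n) \<longlonglongrightarrow> l" for n
  proof -
    have "cmod (G (Suc k) n - G k n) \<le> \<rho> ^ k * nrm h" for k
      using norm_le_nrm[OF l2_diff[OF Gl2[of "Suc k"] Gl2[of k]], of n] step[of k] by simp
    moreover have "summable (\<lambda>k. \<rho> ^ k * nrm h)"
      using \<rho> by (intro summable_mult2 summable_geometric) auto
    ultimately have "summable (\<lambda>k. G (Suc k) n - G k n)"
      by (rule summable_comparison_test'[rotated, where N = 0])
    then have "(\<lambda>m. \<Sum>k<m. G (Suc k) n - G k n) \<longlonglongrightarrow> (\<Sum>k. G (Suc k) n - G k n)"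
      by (rule summable_LIMSEQ)
    then have "(\<lambda>m. G m n - G 0 n) \<longlonglongrightarrow> (\<Sum>k. G (Suc k) n - G k n)"
      by (simp only: sum_lessThan_telescope[of "\<lambda>k. G k n"])
    from tendsto_add[OF this tendsto_const[of "G 0 n"]] show ?thesis
      by auto
  qed
  then obtain g where g: "\<And>n. (\<lambda>k. G k n) \<longlonglongrightarrow> g n"
    by metis
  have "(\<Sum>n\<in>F. (cmod (g n))\<^sup>2) \<le> C\<^sup>2" if F: "finite F" for F
  proof (rule tendsto_upperbound)
    show "(\<lambda>k. \<Sum>n\<in>F. (cmod (G k n))\<^sup>2) \<longlonglongrightarrow> (\<Sum>n\<in>F. (cmod (g n))\<^sup>2)"
      by (intro tendsto_intros g)
    show "\<forall>\<^sub>F k in sequentially. (\<Sum>n\<in>F. (cmod (G k n))\<^sup>2) \<le> C\<^sup>2"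
      using order_trans[OF finite_sum_le_nrm[OF Gl2 F] power_mono[OF bound nrm_nonneg]] by auto
  qed simp
  then have gl2: "g \<in> l2"
    using l2_bounded_sums(1)[of g C] C(1) by blast
  have "Hop V g n - z * g n = f n" for n
  proof -
    have "(\<lambda>k. G (Suc k) n) \<longlonglongrightarrow> g n - \<tau> * \<i> * (Hop V g n - z * g n) + h n"
      unfolding G T_def by (intro tendsto_intros g tendsto_Hop)
    moreover have "(\<lambda>k. G (Suc k) n) \<longlonglongrightarrow> g n"
      using g[of n] by (rule LIMSEQ_Suc)
    ultimately have "g n - \<tau> * \<i> * (Hop V g n - z * g n) + h n = g n"
      by (rule LIMSEQ_unique)
    then have "\<tau> * \<i> * (Hop V g n - z * g n) = \<tau> * \<i> * f n"
      by (simp add: h_def algebra_simps)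
    then show ?thesis
      using \<tau> by simp
  qed
  with gl2 that show ?thesis by blast
qed

lemma Hop_injective:
  assumes V: "finite {n. V n \<noteq> 0}" and z: "Im z > 0" and "f \<in> l2" "g \<in> l2"
    and eq: "\<And>n. Hop V f n - z * f n = Hop V g n - z * g n"
  shows "f = g"
proof -
  let ?D = "\<lambda>n. f n - g n"
  have D: "?D \<in> l2"
    by (rule l2_diff[OF assms(3,4)])
  have *: "Hop V ?D n = Hop V f n - Hop V g n" for n
    using Hop_lin[of V 1 f "- 1" g n] by simp
  have "Hop V ?D n - z * ?D n = (Hop V f n - z * f n) - (Hop V g n - z * g n)" for n
    unfolding * by (simp add: algebra_simps)
  then have "Hop V ?D n - z * ?D n = 0" for n
    using eq[of n] by simp
  then have "nrm (\<lambda>n. Hop V ?D n - z * ?D n) = 0"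
    by (simp add: nrm_def)
  with nrm_le_Hop[OF V D, of z] have "\<bar>Im z\<bar> * nrm ?D \<le> 0"
    by metis
  then have "nrm ?D = 0"
    using z nrm_nonneg[of ?D] by (simp add: mult_le_0_iff)
  then show ?thesis
    using nrm_eq_0D[OF D] by (simp add: fun_eq_iff)
qed

lemma resolvent_props:
  assumes V: "finite {n. V n \<noteq> 0}" and z: "Im z > 0" and f: "f \<in> l2"
  shows resolvent_l2: "resolvent V z f \<in> l2"
    and Hop_resolvent: "Hop V (resolvent V z f) n - z * resolvent V z f n = f n"
proof -
  let ?A = "\<lambda>g n. Hop V g n - z * g n"
  have inj: "inj_on ?A ell2"
  proof (rule inj_onI)
    fix f g assume "f \<in> ell2" "g \<in> ell2" "?A f = ?A g"
    then show "f = g"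
      by (intro Hop_injective[OF V z]) (auto simp: ell2_eq_l2 dest: fun_cong)
  qed
  obtain g where g: "g \<in> l2" "\<And>n. Hop V g n - z * g n = f n"
    using Hop_surjective[OF V z f] by metis
  then have "f = ?A g" "g \<in> ell2"
    by (auto simp: ell2_eq_l2)
  then have "resolvent V z f = g"
    unfolding resolvent_def using the_inv_into_f_f[OF inj, of g] by simp
  then show "resolvent V z f \<in> l2" "Hop V (resolvent V z f) n - z * resolvent V z f n = f n"
    using g by auto
qed

lemma resolvent_eqI:
  assumes V: "finite {n. V n \<noteq> 0}" and z: "Im z > 0" and "g \<in> l2" "f \<in> l2"
    and "\<And>n. Hop V g n - z * g n = f n"
  shows "resolvent V z f = g"
  using resolvent_props[OF V z \<open>f \<in> l2\<close>] assms(3,5) by (intro Hop_injective[OF V z]) auto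

lemma nrm_resolvent_le:
  assumes V: "finite {n. V n \<noteq> 0}" and z: "Im z > 0" and f: "f \<in> l2"
  shows "nrm (resolvent V z f) \<le> nrm f / Im z"
  using nrm_le_Hop[OF V resolvent_l2[OF V z f], of z] z
  by (simp add: Hop_resolvent[OF V z f] field_simps)

lemma pair_resolvent:
  assumes V: "finite {n. V n \<noteq> 0}" and z: "Im z > 0" and f: "f \<in> l2" and g: "g \<in> l2"
  shows "pair (resolvent V z f) g = pair f (resolvent V z g)"
proof -
  note R = resolvent_props[OF V z f] resolvent_props[OF V z g]
  have H: "Hop V f \<in> l2" if "f \<in> l2" for f
    using Hop_l2_closed[OF V that, of 0] by simp
  have "pair (resolvent V z f) (\<lambda>n. 1 * Hop V (resolvent V z g) n + (- z) * resolvent V z g n)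
     = pair (\<lambda>n. 1 * Hop V (resolvent V z f) n + (- z) * resolvent V z f n) (resolvent V z g)"
    unfolding pair_add_left[OF H[OF R(1)] R(1) R(3)]
    unfolding pair_commute[of "resolvent V z f" "\<lambda>n. _ n + _ n"] pair_add_left[OF H[OF R(3)] R(3) R(1)]
    using pair_Hop_l2[OF V R(1,3)] by (simp add: pair_commute)
  then show ?thesis
    using R(2,4) by simp
qed

text \<open>
  By symmetry the resolvent on all of the sequence space is determined by its values on single
  sites. Everything below is about this kernel.
\<close>

lemma resolvent_kernel:
  assumes V: "finite {n. V n \<noteq> 0}" and z: "Im z > 0" and f: "f \<in> l2"
  shows "resolvent V z f n = pair (resolvent V z (site n)) f"
  using pair_resolvent[OF V z site_l2 f, of n] by simp

lemma resolvent_kernel_symmetric: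
  assumes V: "finite {n. V n \<noteq> 0}" and z: "Im z > 0"
  shows "resolvent V z (site n) m = resolvent V z (site m) n"
  using resolvent_kernel[OF V z site_l2, of m n] by simp

section \<open>Weighted spaces and the boundary value of the resolvent\<close>

lemma weight_base_pos: "1 + (\<Sum>j\<in>UNIV. (real_of_int (n $ j))\<^sup>2) \<ge> 1"
  by (simp add: sum_nonneg)

lemma weight_pos [simp]: "weight s n > 0"
  using weight_base_pos[of n] unfolding weight_def by (intro powr_gt_zero[THEN iffD2]) linarith

lemma weight_nonneg [simp]: "weight s n \<ge> 0"
  using weight_pos[of s n] by (rule less_imp_le)

lemma weight_mult: "weight s n * weight t n = weight (s + t) n"
  by (simp add: weight_def powr_add)

lemma weight_0 [simp]: "weight 0 n = 1"
  using weight_base_pos[of n] by (simp add: weight_def)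

lemma weight_mult_minus [simp]: "weight (- s) n * weight s n = 1" "weight s n * weight (- s) n = 1"
  by (simp_all add: weight_mult)

lemma weight_ge_1: "s \<ge> 0 \<Longrightarrow> weight s n \<ge> 1"
  using weight_base_pos[of n] by (simp add: weight_def ge_one_powr_ge_zero)

lemma weight_half_power2: "(weight (s / 2) n)\<^sup>2 = weight s n"
  by (simp add: power2_eq_square weight_mult)

definition weighted :: "real \<Rightarrow> (int ^ 'd \<Rightarrow> complex) \<Rightarrow> int ^ 'd \<Rightarrow> complex" where
  "weighted s f n = complex_of_real (weight (s / 2) n) * f n"

lemma norm_weighted_power2: "(cmod (weighted s f n))\<^sup>2 = weight s n * (cmod (f n))\<^sup>2"
  by (simp add: weighted_def norm_mult power_mult_distrib weight_half_power2)

lemma Hs_iff: "f \<in> Hs s \<longleftrightarrow> weighted s f \<in> l2"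
  by (simp add: Hs_def norm_weighted_power2)

lemma Hs_norm_eq: "Hs_norm s f = nrm (weighted s f)"
  by (simp add: Hs_norm_def nrm_def norm_weighted_power2)

lemma Hs_norm_nonneg [simp]: "Hs_norm s f \<ge> 0"
  by (simp add: Hs_norm_eq)

lemma weighted_lin: "weighted s (\<lambda>n. a * f n + b * g n) = (\<lambda>n. a * weighted s f n + b * weighted s g n)"
  by (simp add: weighted_def fun_eq_iff algebra_simps)

lemma Hs_lin:
  assumes "f \<in> Hs s" "g \<in> Hs s"
  shows "(\<lambda>n. a * f n + b * g n) \<in> Hs s"
  using assms unfolding Hs_iff weighted_lin by (intro l2_add_nrm(1) l2_scale)

lemma Hs_norm_diff_le:
  assumes "f \<in> Hs s" "g \<in> Hs s"
  shows "Hs_norm s (\<lambda>n. f n - g n) \<le> Hs_norm s f + Hs_norm s g"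
proof -
  have "weighted s (\<lambda>n. f n - g n) = (\<lambda>n. weighted s f n - weighted s g n)"
    by (simp add: weighted_def fun_eq_iff algebra_simps)
  then show ?thesis
    using assms nrm_diff_le[of "weighted s f" "weighted s g"] by (simp only: Hs_norm_eq Hs_iff)
qed

lemma Hs_l2:
  assumes s: "s \<ge> 0" and f: "f \<in> Hs s"
  shows "f \<in> l2" "nrm f \<le> Hs_norm s f"
proof -
  have f': "weighted s f \<in> l2"
    using f by (simp only: Hs_iff)
  have "cmod (of_real (weight (- (s / 2)) n)) \<le> 1" for n :: "int ^ 'a"
  proof -
    have "weight (- (s / 2)) n * 1 \<le> weight (- (s / 2)) n * weight (s / 2) n"
      using s by (intro mult_left_mono weight_ge_1) auto
    then show ?thesis by simp
  qed
  note * = l2_bounded_mult[where a = "\<lambda>n. of_real (weight (- (s / 2)) n)" and C = 1, OF f' this]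
  moreover have "(\<lambda>n. of_real (weight (- (s / 2)) n) * weighted s f n) = f"
    unfolding weighted_def mult.assoc[symmetric] of_real_mult[symmetric] by simp
  ultimately show "f \<in> l2" "nrm f \<le> Hs_norm s f"
    by (simp_all only: Hs_norm_eq mult_1)
qed

lemma l2_Hs:
  assumes s: "s \<ge> 0" and f: "f \<in> l2"
  shows "f \<in> Hs (- s)" "Hs_norm (- s) f \<le> nrm f"
proof -
  have "cmod (of_real (weight (- s / 2) n)) \<le> 1" for n :: "int ^ 'a"
  proof -
    have "weight (- (s / 2)) n * 1 \<le> weight (- (s / 2)) n * weight (s / 2) n"
      using s by (intro mult_left_mono weight_ge_1) auto
    then show ?thesis by simp
  qed
  from l2_bounded_mult[OF f this] show "f \<in> Hs (- s)" "Hs_norm (- s) f \<le> nrm f"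
    by (auto simp: Hs_iff Hs_norm_eq weighted_def[abs_def])
qed

lemma finite_support_Hs:
  assumes "finite {n. f n \<noteq> 0}"
  shows "f \<in> Hs s"
  unfolding Hs_iff by (rule finite_support_l2, rule finite_subset[OF _ assms]) (auto simp: weighted_def)

lemma pair_weighted:
  "pair f g = pair (weighted (- s) f) (weighted s g)"
proof -
  have "weighted (- s) f n * weighted s g n = of_real (weight (- (s / 2)) n * weight (s / 2) n) * (f n * g n)" for n
    unfolding weighted_def by (simp only: of_real_mult minus_divide_left mult_ac)
  then show ?thesis
    by (simp add: pair_def)
qed

lemma Hs_mult_summable:
  assumes "f \<in> Hs (- s)" "g \<in> Hs s"
  shows "(\<lambda>n. f n * g n) summable_on UNIV"
proof -
  have "weighted (- s) f n * weighted s g n = of_real (weight (- (s / 2)) n * weight (s / 2) n) * (f n * g n)" for n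
    unfolding weighted_def by (simp only: of_real_mult minus_divide_left mult_ac)
  then show ?thesis
    using l2_mult_summable[of "weighted (- s) f" "weighted s g"] assms unfolding Hs_iff by simp
qed

lemma norm_pair_Hs_le:
  assumes "f \<in> Hs (- s)" "g \<in> Hs s"
  shows "cmod (pair f g) \<le> Hs_norm (- s) f * Hs_norm s g"
  using norm_pair_le[of "weighted (- s) f" "weighted s g"] assms
  unfolding pair_weighted[of f g s] Hs_norm_eq Hs_iff by blast

lemma norm_le_Hs_norm:
  assumes "f \<in> Hs (- s)"
  shows "cmod (f n) \<le> weight (s / 2) n * Hs_norm (- s) f"
proof -
  have "cmod (f n) = weight (s / 2) n * cmod (weighted (- s) f n)"
    unfolding weighted_def by (simp add: norm_mult mult.assoc[symmetric])
  also have "\<dots> \<le> weight (s / 2) n * Hs_norm (- s) f"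
    using norm_le_nrm[of "weighted (- s) f" n] assms unfolding Hs_iff Hs_norm_eq
    by (intro mult_left_mono) auto
  finally show ?thesis .
qed

lemma summable_int_inverse_squares: "(\<lambda>i::int. 1 / (1 + (real_of_int i)\<^sup>2)) summable_on UNIV"
proof -
  have nat: "(\<lambda>k::nat. 1 / (1 + (real k)\<^sup>2)) summable_on UNIV"
  proof (rule summable_on_UNIV_nonneg_real_iff[THEN iffD2])
    show "summable (\<lambda>k::nat. 1 / (1 + (real k)\<^sup>2))"
    proof (rule summable_comparison_test'[where N = 1])
      show "summable (\<lambda>k::nat. 1 / (real k)\<^sup>2)"
        using inverse_power_summable[of 2, where 'a = real] by (simp add: divide_inverse)
    qed (auto intro!: divide_left_mono mult_pos_pos add_pos_nonneg)
  qed auto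
  have "(\<lambda>i::int. 1 / (1 + (real_of_int i)\<^sup>2)) summable_on range int"
    by (subst summable_on_reindex) (use nat in \<open>auto simp: o_def\<close>)
  moreover have "(\<lambda>i::int. 1 / (1 + (real_of_int i)\<^sup>2)) summable_on range (\<lambda>k. - int k)"
    by (subst summable_on_reindex) (use nat in \<open>auto simp: o_def inj_def\<close>)
  moreover have "UNIV = range int \<union> range (\<lambda>k. - int k)"
  proof -
    have "i \<in> range int \<union> range (\<lambda>k. - int k)" for i :: int
      by (cases i rule: int_cases2) auto
    then show ?thesis by blast
  qed
  ultimately show ?thesis
    using summable_on_union by metis
qed

text \<open>
  The product on the right is summable coordinate by coordinate, which a negative power of the
  Euclidean norm is not.
\<close>

lemma weight_le_prod:
  "weight (- real CARD('d)) n \<le> (\<Prod>j\<in>UNIV. 1 / (1 + (real_of_int (n $ j))\<^sup>2))" for n :: "int ^ 'd"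
proof -
  let ?b = "1 + (\<Sum>j\<in>UNIV. (real_of_int (n $ j))\<^sup>2)"
  have b: "?b > 0"
    using weight_base_pos[of n] by linarith
  have "(\<Prod>j\<in>(UNIV :: 'd set). 1 + (real_of_int (n $ j))\<^sup>2) \<le> (\<Prod>j\<in>(UNIV :: 'd set). ?b)"
    by (intro prod_mono) (auto intro!: member_le_sum add_nonneg_nonneg)
  moreover have "0 < (\<Prod>j\<in>(UNIV :: 'd set). 1 + (real_of_int (n $ j))\<^sup>2)"
    by (intro prod_pos) (auto intro: add_pos_nonneg)
  ultimately have "inverse (\<Prod>j\<in>(UNIV :: 'd set). ?b) \<le> inverse (\<Prod>j\<in>(UNIV :: 'd set). 1 + (real_of_int (n $ j))\<^sup>2)"
    by (intro le_imp_inverse_le)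
  then show ?thesis
    using b unfolding weight_def
    by (simp add: powr_minus powr_realpow prod_dividef inverse_eq_divide)
qed

lemma weight_summable: "weight (- real CARD('d)) summable_on (UNIV :: (int ^ 'd) set)"
proof -
  let ?g = "\<lambda>i::int. 1 / (1 + (real_of_int i)\<^sup>2)"
  let ?S = "infsum ?g UNIV"
  have g: "?g i \<ge> 0" for i
    by simp
  have "(\<Sum>n\<in>F. weight (- real CARD('d)) n) \<le> ?S ^ CARD('d)" if F: "finite F" for F :: "(int ^ 'd) set"
  proof -
    define I where "I = (\<Union>n\<in>F. \<Union>j\<in>(UNIV :: 'd set). {n $ j})"
    have I: "finite I" "\<And>n j. n \<in> F \<Longrightarrow> n $ j \<in> I"
      using F by (auto simp: I_def)
    have "(\<Sum>n\<in>F. weight (- real CARD('d)) n) \<le> (\<Sum>n\<in>F. \<Prod>j\<in>UNIV. ?g (n $ j))"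
      by (intro sum_mono weight_le_prod)
    also have "\<dots> = (\<Sum>h\<in>(\<lambda>n. ($) n) ` F. \<Prod>j\<in>UNIV. ?g (h j))"
      by (subst sum.reindex) (auto simp: inj_on_def vec_eq_iff dest: fun_cong)
    also have "\<dots> \<le> (\<Sum>h\<in>PiE (UNIV :: 'd set) (\<lambda>_. I). \<Prod>j\<in>UNIV. ?g (h j))"
      using I by (intro sum_mono2 finite_PiE prod_nonneg) auto
    also have "\<dots> = (\<Prod>j\<in>(UNIV :: 'd set). \<Sum>i\<in>I. ?g i)"
      using I by (subst prod_sum_PiE) auto
    also have "\<dots> = (\<Sum>i\<in>I. ?g i) ^ CARD('d)"
      by simp
    also have "\<dots> \<le> ?S ^ CARD('d)"
      using finite_sum_le_infsum[OF summable_int_inverse_squares I(1)] g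
      by (intro power_mono sum_nonneg) auto
    finally show ?thesis .
  qed
  then show ?thesis
    by (intro nonneg_bdd_above_summable_on) (auto intro!: bdd_aboveI)
qed

text \<open>
  Tannery's theorem: a finite set carries all but a small part of the sum of \<open>W\<close>, and on it
  convergence is uniform.
\<close>

lemma tannery_infsum:
  fixes W :: "'a \<Rightarrow> real" and a :: "'b \<Rightarrow> 'a \<Rightarrow> real"
  assumes W: "W summable_on UNIV" "\<And>n. W n \<ge> 0"
    and lim: "\<And>n. ((\<lambda>\<epsilon>. a \<epsilon> n) \<longlongrightarrow> 0) F"
    and bound: "\<forall>\<^sub>F \<epsilon> in F. \<forall>n. 0 \<le> a \<epsilon> n \<and> a \<epsilon> n \<le> B"
  shows "((\<lambda>\<epsilon>. \<Sum>\<^sub>\<infinity>n. W n * a \<epsilon> n) \<longlongrightarrow> 0) F"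
proof (cases "F = bot")
  case False
  have "B \<ge> 0"
    using eventually_happens'[OF False bound] by (meson order_trans)
  show ?thesis
  proof (rule tendstoI)
    fix e :: real assume e: "e > 0"
    define e' where "e' = e / (2 * (B + 1))"
    have e': "e' > 0" "B * e' < e / 2"
      using e \<open>B \<ge> 0\<close> by (auto simp: e'_def field_simps)
    obtain G where G: "finite G" "dist (sum W G) (infsum W UNIV) \<le> e'"
      using infsum_finite_approximation[OF W(1) e'(1)] by auto
    have "((\<lambda>\<epsilon>. \<Sum>n\<in>G. W n * a \<epsilon> n) \<longlongrightarrow> (\<Sum>n\<in>G. W n * 0)) F"
      by (intro tendsto_intros lim)
    then have "((\<lambda>\<epsilon>. \<Sum>n\<in>G. W n * a \<epsilon> n) \<longlongrightarrow> 0) F"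
      by simp
    then have "\<forall>\<^sub>F \<epsilon> in F. (\<Sum>n\<in>G. W n * a \<epsilon> n) < e / 2"
      using e by (intro order_tendstoD(2)) auto
    with bound show "\<forall>\<^sub>F \<epsilon> in F. dist (\<Sum>\<^sub>\<infinity>n. W n * a \<epsilon> n) 0 < e"
    proof eventually_elim
      case (elim \<epsilon>)
      have nn: "W n * a \<epsilon> n \<ge> 0" for n
        using elim W(2) by simp
      have "(\<Sum>\<^sub>\<infinity>n. W n * a \<epsilon> n) \<le> (\<Sum>n\<in>G. W n * a \<epsilon> n) + B * e'"
      proof (rule infsum_le_finite_sums)
        have "(\<lambda>n. W n * B) summable_on UNIV"
          by (rule summable_on_cmult_left[OF W(1)])
        then show "(\<lambda>n. W n * a \<epsilon> n) summable_on UNIV"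
          using elim W(2) nn by (rule_tac summable_on_comparison_test) (auto intro: mult_left_mono)
        fix H :: "'a set" assume H: "finite H"
        have "(\<Sum>n\<in>H. W n * a \<epsilon> n) \<le> (\<Sum>n\<in>G \<union> (H - G). W n * a \<epsilon> n)"
          using nn G H by (intro sum_mono2) auto
        also have "\<dots> = (\<Sum>n\<in>G. W n * a \<epsilon> n) + (\<Sum>n\<in>H - G. W n * a \<epsilon> n)"
          using G H by (intro sum.union_disjoint) auto
        also have "(\<Sum>n\<in>H - G. W n * a \<epsilon> n) \<le> (\<Sum>n\<in>H - G. B * W n)"
          using elim W(2) by (intro sum_mono) (auto simp: mult.commute[of B] intro!: mult_left_mono)
        also have "\<dots> = B * (\<Sum>n\<in>H - G. W n)"
          by (simp add: sum_distrib_left)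
        also have "(\<Sum>n\<in>H - G. W n) \<le> e'"
        proof -
          have "sum W G + sum W (H - G) = sum W (G \<union> (H - G))"
            using G H by (intro sum.union_disjoint[symmetric]) auto
          also have "\<dots> \<le> infsum W UNIV"
            using G H W by (intro finite_sum_le_infsum) auto
          finally show ?thesis
            using G(2) by (simp add: dist_real_def)
        qed
        finally show "(\<Sum>n\<in>H. W n * a \<epsilon> n) \<le> (\<Sum>n\<in>G. W n * a \<epsilon> n) + B * e'"
          using \<open>B \<ge> 0\<close> by (simp add: mult_left_mono)
      qed
      moreover have "(\<Sum>\<^sub>\<infinity>n. W n * a \<epsilon> n) \<ge> 0"
        by (rule infsum_nonneg[OF nn])
      ultimately show ?case
        using elim e'(2) by (simp add: dist_real_def)
    qed
  qed
qed simp

text \<open>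
  The Hilbert-Schmidt norm of a kernel as an operator from \<open>Hs d\<close> to \<open>Hs (- d)\<close>; with the
  exponent \<open>d\<close> it is finite for all bounded kernels.
\<close>

definition hs_norm :: "(int ^ 'd \<Rightarrow> int ^ 'd \<Rightarrow> complex) \<Rightarrow> real" where
  "hs_norm D = sqrt (\<Sum>\<^sub>\<infinity>n. weight (- real CARD('d)) n * (\<Sum>\<^sub>\<infinity>m. weight (- real CARD('d)) m * (cmod (D n m))\<^sup>2))"

lemma bounded_Hs:
  fixes f :: "int ^ 'd \<Rightarrow> complex"
  assumes "\<And>n. cmod (f n) \<le> B"
  shows "f \<in> Hs (- real CARD('d))"
proof -
  have "(\<lambda>n. weight (- real CARD('d)) n * B\<^sup>2) summable_on (UNIV :: (int ^ 'd) set)"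
    by (intro summable_on_cmult_left weight_summable)
  then show ?thesis
    unfolding Hs_def using assms
    by (intro CollectI, elim summable_on_comparison_test) (auto intro!: mult_left_mono power_mono)
qed

lemma hilbert_schmidt_bound:
  fixes D :: "int ^ 'd \<Rightarrow> int ^ 'd \<Rightarrow> complex" and f
  assumes D: "\<And>n m. cmod (D n m) \<le> B" and f: "f \<in> Hs (real CARD('d))"
  shows "(\<lambda>n. pair (D n) f) \<in> Hs (- real CARD('d))"
    "Hs_norm (- real CARD('d)) (\<lambda>n. pair (D n) f) \<le> hs_norm D * Hs_norm (real CARD('d)) f"
proof -
  let ?s = "real CARD('d)"
  let ?W = "weight (- ?s) :: int ^ 'd \<Rightarrow> real"
  let ?q = "\<lambda>n. \<Sum>\<^sub>\<infinity>m. ?W m * (cmod (D n m))\<^sup>2"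
  have q: "(Hs_norm (- ?s) (D n))\<^sup>2 = ?q n" "?q n \<ge> 0" for n
    by (simp_all add: Hs_norm_def infsum_nonneg)
  have qB: "?q n \<le> infsum ?W UNIV * B\<^sup>2" for n
  proof -
    have "?q n \<le> (\<Sum>\<^sub>\<infinity>m. ?W m * B\<^sup>2)"
    proof (intro infsum_mono mult_left_mono power_mono)
      show "(\<lambda>m. ?W m * (cmod (D n m))\<^sup>2) summable_on UNIV"
        using bounded_Hs[of "D n", OF D] by (simp add: Hs_def)
      show "(\<lambda>m. ?W m * B\<^sup>2) summable_on UNIV"
        by (intro summable_on_cmult_left weight_summable)
    qed (use D in auto)
    then show ?thesis
      by (simp add: infsum_cmult_left')
  qed
  have sq: "(\<lambda>n. ?W n * ?q n) summable_on UNIV"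
    by (rule summable_on_comparison_test[OF summable_on_cmult_left[OF weight_summable, of "infsum ?W UNIV * B\<^sup>2"]])
      (use qB q(2) in \<open>auto intro!: mult_left_mono mult_nonneg_nonneg\<close>)
  have pt: "cmod (pair (D n) f) \<le> Hs_norm (- ?s) (D n) * Hs_norm ?s f" for n
    by (rule norm_pair_Hs_le[OF bounded_Hs[OF D] f])
  have pt2: "?W n * (cmod (pair (D n) f))\<^sup>2 \<le> ?W n * ?q n * (Hs_norm ?s f)\<^sup>2" for n
    using power_mono[OF pt[of n], of 2] unfolding power_mult_distrib q mult.assoc
    by (intro mult_left_mono) auto
  have s2: "(\<lambda>n. ?W n * ?q n * (Hs_norm ?s f)\<^sup>2) summable_on UNIV"
    by (rule summable_on_cmult_left[OF sq])
  then show *: "(\<lambda>n. pair (D n) f) \<in> Hs (- ?s)"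
    unfolding Hs_def using pt2 by (intro CollectI, elim summable_on_comparison_test) auto
  have "(\<Sum>\<^sub>\<infinity>n. ?W n * (cmod (pair (D n) f))\<^sup>2) \<le> (\<Sum>\<^sub>\<infinity>n. ?W n * ?q n * (Hs_norm ?s f)\<^sup>2)"
    using * s2 pt2 by (intro infsum_mono) (auto simp: Hs_def)
  also have "\<dots> = (\<Sum>\<^sub>\<infinity>n. ?W n * ?q n) * (Hs_norm ?s f)\<^sup>2"
    by (rule infsum_cmult_left')
  finally have "sqrt (\<Sum>\<^sub>\<infinity>n. ?W n * (cmod (pair (D n) f))\<^sup>2) \<le> sqrt ((\<Sum>\<^sub>\<infinity>n. ?W n * ?q n) * (Hs_norm ?s f)\<^sup>2)"
    by (rule real_sqrt_le_mono)
  then show "Hs_norm (- ?s) (\<lambda>n. pair (D n) f) \<le> hs_norm D * Hs_norm ?s f"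
    unfolding hs_norm_def Hs_norm_def[of "- ?s"] by (simp add: real_sqrt_mult)
qed

lemma hs_norm_tendsto_0:
  fixes D :: "'b \<Rightarrow> int ^ 'd \<Rightarrow> int ^ 'd \<Rightarrow> complex"
  assumes lim: "\<And>n m. ((\<lambda>\<epsilon>. D \<epsilon> n m) \<longlongrightarrow> 0) F"
    and bound: "\<forall>\<^sub>F \<epsilon> in F. \<forall>n m. cmod (D \<epsilon> n m) \<le> B"
  shows "((\<lambda>\<epsilon>. hs_norm (D \<epsilon>)) \<longlongrightarrow> 0) F"
proof -
  let ?W = "weight (- real CARD('d)) :: int ^ 'd \<Rightarrow> real"
  have sq: "\<forall>\<^sub>F \<epsilon> in F. \<forall>n m. 0 \<le> (cmod (D \<epsilon> n m))\<^sup>2 \<and> (cmod (D \<epsilon> n m))\<^sup>2 \<le> B\<^sup>2"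
    using bound by eventually_elim (auto intro: power_mono)
  have 1: "((\<lambda>\<epsilon>. \<Sum>\<^sub>\<infinity>m. ?W m * (cmod (D \<epsilon> n m))\<^sup>2) \<longlongrightarrow> 0) F" for n
  proof (rule tannery_infsum[OF weight_summable])
    show "((\<lambda>\<epsilon>. (cmod (D \<epsilon> n m))\<^sup>2) \<longlongrightarrow> 0) F" for m
      using tendsto_power[OF tendsto_norm[OF lim[of n m]], of 2] by simp
    show "\<forall>\<^sub>F \<epsilon> in F. \<forall>m. 0 \<le> (cmod (D \<epsilon> n m))\<^sup>2 \<and> (cmod (D \<epsilon> n m))\<^sup>2 \<le> B\<^sup>2"
      using sq by eventually_elim auto
  qed simp
  have "((\<lambda>\<epsilon>. \<Sum>\<^sub>\<infinity>n. ?W n * (\<Sum>\<^sub>\<infinity>m. ?W m * (cmod (D \<epsilon> n m))\<^sup>2)) \<longlongrightarrow> 0) F"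
  proof (rule tannery_infsum[OF weight_summable _ 1])
    show "\<forall>\<^sub>F \<epsilon> in F. \<forall>n. 0 \<le> (\<Sum>\<^sub>\<infinity>m. ?W m * (cmod (D \<epsilon> n m))\<^sup>2) \<and>
        (\<Sum>\<^sub>\<infinity>m. ?W m * (cmod (D \<epsilon> n m))\<^sup>2) \<le> infsum ?W UNIV * B\<^sup>2"
      using bound
    proof eventually_elim
      case (elim \<epsilon>)
      have "(\<Sum>\<^sub>\<infinity>m. ?W m * (cmod (D \<epsilon> n m))\<^sup>2) \<le> (\<Sum>\<^sub>\<infinity>m. ?W m * B\<^sup>2)" for n
        using elim bounded_Hs[of "D \<epsilon> n" B]
        by (intro infsum_mono summable_on_cmult_left weight_summable mult_left_mono power_mono) (auto simp: Hs_def)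
      then show ?case
        by (auto simp: infsum_cmult_left' intro!: infsum_nonneg)
    qed
  qed simp
  from tendsto_real_sqrt[OF this] show ?thesis
    by (simp add: hs_norm_def)
qed

text \<open>
  The bound \<open>C\<close> keeps the set under the infimum in \<open>op_norm\<close> from being empty; without it the
  infimum carries no information.
\<close>

lemma op_norm_props:
  assumes "\<And>f. f \<in> Hs s \<Longrightarrow> Hs_norm t (T f) \<le> C * Hs_norm s f" "C \<ge> 0"
  shows op_norm_nonneg: "op_norm s t T \<ge> 0"
    and op_norm_le: "op_norm s t T \<le> C"
    and le_op_norm: "f \<in> Hs s \<Longrightarrow> Hs_norm t (T f) \<le> op_norm s t T * Hs_norm s f"
proof -
  let ?X = "{C. 0 \<le> C \<and> (\<forall>f\<in>Hs s. Hs_norm t (T f) \<le> C * Hs_norm s f)}"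
  have X: "C \<in> ?X"
    using assms by simp
  have bdd: "bdd_below ?X"
    by (rule bdd_belowI[of _ 0]) simp
  show "op_norm s t T \<ge> 0"
    unfolding op_norm_def using X by (intro cInf_greatest) auto
  show "op_norm s t T \<le> C"
    unfolding op_norm_def by (rule cInf_lower[OF X bdd])
  assume f: "f \<in> Hs s"
  show "Hs_norm t (T f) \<le> op_norm s t T * Hs_norm s f"
  proof (cases "Hs_norm s f = 0")
    case True
    then show ?thesis
      using assms(1)[OF f] by simp
  next
    case False
    then have pos: "Hs_norm s f > 0"
      using Hs_norm_nonneg[of s f] by linarith
    have "Hs_norm t (T f) / Hs_norm s f \<le> op_norm s t T"
      unfolding op_norm_def using X f pos by (intro cInf_greatest) (auto simp: field_simps)
    then show ?thesis
      using pos by (simp add: field_simps)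
  qed
qed

text \<open>A boundary value in any of the operator norms is a pointwise limit, hence unique.\<close>

lemma is_boundary_resolvent_pointwise:
  assumes V: "finite {n. V n \<noteq> 0}" and T: "is_boundary_resolvent V E s T"
    and s: "s \<ge> 0" and f: "f \<in> Hs s"
  shows "((\<lambda>\<epsilon>. resolvent V (Complex E \<epsilon>) f n) \<longlongrightarrow> T f n) (at_right 0)"
proof -
  let ?D = "\<lambda>\<epsilon> f n. resolvent V (Complex E \<epsilon>) f n - T f n"
  let ?N = "\<lambda>\<epsilon>. op_norm s (- s) (?D \<epsilon>)"
  have T': "\<And>f. f \<in> Hs s \<Longrightarrow> T f \<in> Hs (- s)" and lim: "(?N \<longlongrightarrow> 0) (at_right 0)"
    using T by (auto simp: is_boundary_resolvent_def bounded_ops_def)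
  obtain C where "\<And>f. f \<in> Hs s \<Longrightarrow> Hs_norm (- s) (T f) \<le> C * Hs_norm s f"
    using T unfolding is_boundary_resolvent_def bounded_ops_def by blast
  then have C: "Hs_norm (- s) (T f) \<le> \<bar>C\<bar> * Hs_norm s f" if "f \<in> Hs s" for f
    using that order_trans[OF _ mult_right_mono[OF abs_ge_self Hs_norm_nonneg]] by blast
  have key: "cmod (?D \<epsilon> f n) \<le> weight (s / 2) n * (?N \<epsilon> * Hs_norm s f)" if \<epsilon>: "\<epsilon> > 0" for \<epsilon>
  proof -
    have z: "Im (Complex E \<epsilon>) > 0"
      using \<epsilon> by simp
    have R: "resolvent V (Complex E \<epsilon>) g \<in> Hs (- s)"
      "Hs_norm (- s) (resolvent V (Complex E \<epsilon>) g) \<le> 1 / \<epsilon> * Hs_norm s g" if g: "g \<in> Hs s" for g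
    proof -
      note g' = Hs_l2[OF s g]
      note r = l2_Hs[OF s resolvent_l2[OF V z g'(1)]]
      show "resolvent V (Complex E \<epsilon>) g \<in> Hs (- s)"
        by (rule r(1))
      have "Hs_norm (- s) (resolvent V (Complex E \<epsilon>) g) \<le> nrm g / \<epsilon>"
        using order_trans[OF r(2) nrm_resolvent_le[OF V z g'(1)]] by simp
      also have "\<dots> \<le> Hs_norm s g / \<epsilon>"
        using g'(2) \<epsilon> by (simp add: divide_right_mono)
      finally show "Hs_norm (- s) (resolvent V (Complex E \<epsilon>) g) \<le> 1 / \<epsilon> * Hs_norm s g"
        by simp
    qed
    have D: "Hs_norm (- s) (?D \<epsilon> g) \<le> (1 / \<epsilon> + \<bar>C\<bar>) * Hs_norm s g" if g: "g \<in> Hs s" for g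
      using Hs_norm_diff_le[OF R(1)[OF g] T'[OF g]] R(2)[OF g] C[OF g] by (simp add: algebra_simps)
    have "Hs_norm (- s) (?D \<epsilon> f) \<le> ?N \<epsilon> * Hs_norm s f"
      using \<epsilon> by (intro le_op_norm[OF D _ f]) auto
    moreover have "?D \<epsilon> f \<in> Hs (- s)"
      using Hs_lin[OF R(1)[OF f] T'[OF f], of 1 "- 1"] by simp
    then have "cmod (?D \<epsilon> f n) \<le> weight (s / 2) n * Hs_norm (- s) (?D \<epsilon> f)"
      by (rule norm_le_Hs_norm)
    ultimately show ?thesis
      by (meson mult_left_mono order_trans weight_nonneg)
  qed
  have "((\<lambda>\<epsilon>. weight (s / 2) n * (?N \<epsilon> * Hs_norm s f)) \<longlongrightarrow> weight (s / 2) n * (0 * Hs_norm s f)) (at_right 0)"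
    by (intro tendsto_intros lim)
  then have "((\<lambda>\<epsilon>. weight (s / 2) n * (?N \<epsilon> * Hs_norm s f)) \<longlongrightarrow> 0) (at_right 0)"
    by simp
  then have "((\<lambda>\<epsilon>. ?D \<epsilon> f n) \<longlongrightarrow> 0) (at_right 0)"
    by (rule Lim_null_comparison[rotated])
      (use key in \<open>auto simp: eventually_at_right_less intro!: eventually_at_right_less[THEN eventually_mono]\<close>)
  then show ?thesis
    by (simp add: LIM_zero_cancel)
qed

text \<open>
  A form of the limiting absorption principle that survives adding a single site to the potential:
  it speaks of the kernel only and of no weights. It implies convergence in an operator norm, since
  in a space with a large enough weight bounded kernels are Hilbert-Schmidt.
\<close>

definition limiting_absorption ::
    "(int ^ 'd \<Rightarrow> real) \<Rightarrow> real \<Rightarrow> (int ^ 'd \<Rightarrow> int ^ 'd \<Rightarrow> complex) \<Rightarrow> bool" where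
  "limiting_absorption V E K \<longleftrightarrow>
     (\<forall>n m. ((\<lambda>\<epsilon>. resolvent V (Complex E \<epsilon>) (site n) m) \<longlongrightarrow> K n m) (at_right 0)) \<and>
     (\<exists>B. \<forall>\<^sub>F \<epsilon> in at_right 0. \<forall>n m. cmod (resolvent V (Complex E \<epsilon>) (site n) m) \<le> B)"

lemma eventually_pos_at_right: "\<forall>\<^sub>F \<epsilon> in at_right (0::real). \<epsilon> > 0"
  by (rule eventually_at_right_less)

text \<open>
  Existence: with weight exponent \<open>d\<close> the differences of the kernels tend to \<open>0\<close> in the
  Hilbert-Schmidt norm by dominated convergence. Uniqueness over all exponents and operators: each
  of them is a pointwise limit of the same resolvents.
\<close>

lemma boundary_resolvent_eq:
  fixes V :: "int ^ 'd \<Rightarrow> real"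
  assumes V: "finite {n. V n \<noteq> 0}" and K: "limiting_absorption V E K"
    and f: "finite {n. f n \<noteq> 0}"
  shows "boundary_resolvent V E f = (\<lambda>n. pair (K n) f)"
proof -
  let ?s = "real CARD('d)"
  let ?k = "\<lambda>\<epsilon> n. resolvent V (Complex E \<epsilon>) (site n)"
  define T where "T = (\<lambda>f n. pair (K n) f)"
  have lim: "((\<lambda>\<epsilon>. ?k \<epsilon> n m) \<longlongrightarrow> K n m) (at_right 0)" for n m
    using K by (simp add: limiting_absorption_def)
  obtain B where B: "\<forall>\<^sub>F \<epsilon> in at_right 0. \<forall>n m. cmod (?k \<epsilon> n m) \<le> B"
    using K by (auto simp: limiting_absorption_def)
  have KB: "cmod (K n m) \<le> B" for n m
  proof (rule tendsto_upperbound[OF tendsto_norm[OF lim]])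
    show "\<forall>\<^sub>F \<epsilon> in at_right 0. cmod (?k \<epsilon> n m) \<le> B"
      using B by eventually_elim blast
  qed simp
  let ?D = "\<lambda>\<epsilon> n m. ?k \<epsilon> n m - K n m"
  have DB: "\<forall>\<^sub>F \<epsilon> in at_right 0. \<forall>n m. cmod (?D \<epsilon> n m) \<le> B + B"
    using B
  proof eventually_elim
    case (elim \<epsilon>)
    then show ?case
      using KB by (intro allI order_trans[OF norm_triangle_ineq4] add_mono) auto
  qed
  have hs: "((\<lambda>\<epsilon>. hs_norm (?D \<epsilon>)) \<longlongrightarrow> 0) (at_right 0)"
    using lim by (intro hs_norm_tendsto_0[OF _ DB]) (simp add: LIM_zero)
  have hs0: "hs_norm D \<ge> 0" for D :: "int ^ 'd \<Rightarrow> int ^ 'd \<Rightarrow> complex"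
    by (auto simp: hs_norm_def intro!: infsum_nonneg mult_nonneg_nonneg)
  have T: "is_boundary_resolvent V E ?s T"
    unfolding is_boundary_resolvent_def
  proof
    note h = hilbert_schmidt_bound[of K B, OF KB]
    have "T (\<lambda>n. a * f n + b * g n) = (\<lambda>n. a * T f n + b * T g n)" if "f \<in> Hs ?s" "g \<in> Hs ?s" for f g a b
    proof
      fix n
      have "(\<lambda>m. K n m * f m) summable_on UNIV" "(\<lambda>m. K n m * g m) summable_on UNIV"
        using that by (auto intro!: Hs_mult_summable bounded_Hs[OF KB])
      from infsum_add[OF summable_on_cmult_right[OF this(1), of a] summable_on_cmult_right[OF this(2), of b]]
      show "T (\<lambda>n. a * f n + b * g n) n = a * T f n + b * T g n"
        by (simp add: T_def pair_def algebra_simps infsum_cmult_right')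
    qed
    then show "T \<in> bounded_ops ?s (- ?s)"
      unfolding bounded_ops_def using h by (auto simp: T_def intro!: exI[of _ "hs_norm K"])
    have ev: "\<forall>\<^sub>F \<epsilon> in at_right 0. norm (op_norm ?s (- ?s) (\<lambda>f n. resolvent V (Complex E \<epsilon>) f n - T f n)) \<le> hs_norm (?D \<epsilon>)"
      using DB eventually_pos_at_right
    proof eventually_elim
      case (elim \<epsilon>)
      have *: "resolvent V (Complex E \<epsilon>) f n - T f n = pair (?D \<epsilon> n) f" if f: "f \<in> Hs ?s" for f n
      proof -
        have f2: "f \<in> l2"
          using Hs_l2(1)[OF _ f] by simp
        have "(\<lambda>m. ?k \<epsilon> n m * f m) summable_on UNIV"
          using elim(2) by (intro l2_mult_summable resolvent_l2[OF V] site_l2 f2) auto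
        moreover have "(\<lambda>m. K n m * f m) summable_on UNIV"
          by (rule Hs_mult_summable[OF bounded_Hs f]) (rule KB)
        ultimately have "(\<Sum>\<^sub>\<infinity>m. ?k \<epsilon> n m * f m + - (K n m * f m)) = pair (?k \<epsilon> n) f - T f n"
          unfolding pair_def T_def
          by (subst infsum_add) (simp_all add: summable_on_uminus infsum_uminus)
        then show ?thesis
          using resolvent_kernel[OF V _ f2, of "Complex E \<epsilon>" n] elim(2)
          by (simp add: pair_def[of "?D \<epsilon> n"] algebra_simps)
      qed
      have "Hs_norm (- ?s) (\<lambda>n. resolvent V (Complex E \<epsilon>) f n - T f n) \<le> hs_norm (?D \<epsilon>) * Hs_norm ?s f"
        if f: "f \<in> Hs ?s" for f
        using hilbert_schmidt_bound(2)[of "?D \<epsilon>" "B + B" f] elim(1) f *[OF f] by simp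
      from op_norm_nonneg[OF this hs0] op_norm_le[OF this hs0] show ?case
        by simp
    qed
    show "((\<lambda>\<epsilon>. op_norm ?s (- ?s) (\<lambda>f n. resolvent V (Complex E \<epsilon>) f n - T f n)) \<longlongrightarrow> 0) (at_right 0)"
      by (rule Lim_null_comparison[OF ev hs])
  qed
  have s: "?s > 1 / 2"
    using zero_less_card_finite[where 'a = 'd] by linarith
  show ?thesis
    unfolding boundary_resolvent_def
  proof (rule the_equality)
    show "\<exists>s T. s > 1 / 2 \<and> f \<in> Hs s \<and> is_boundary_resolvent V E s T \<and> (\<lambda>n. pair (K n) f) = T f"
      using s T finite_support_Hs[OF f] by (intro exI[of _ ?s] exI[of _ T]) (auto simp: T_def)
    fix g assume "\<exists>s T. s > 1 / 2 \<and> f \<in> Hs s \<and> is_boundary_resolvent V E s T \<and> g = T f"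
    then obtain s' T' where *: "s' > 1 / 2" "f \<in> Hs s'" "is_boundary_resolvent V E s' T'" "g = T' f"
      by blast
    show "g = (\<lambda>n. pair (K n) f)"
    proof
      fix n
      have "((\<lambda>\<epsilon>. resolvent V (Complex E \<epsilon>) f n) \<longlongrightarrow> g n) (at_right 0)"
        unfolding *(4) using *(1) by (intro is_boundary_resolvent_pointwise[OF V *(3) _ *(2)]) simp
      moreover have "((\<lambda>\<epsilon>. resolvent V (Complex E \<epsilon>) f n) \<longlongrightarrow> T f n) (at_right 0)"
        using finite_support_Hs[OF f] by (intro is_boundary_resolvent_pointwise[OF V T]) simp_all
      ultimately show "g n = pair (K n) f"
        unfolding T_def by (rule tendsto_unique[rotated]) simp
    qed
  qed
qed

section \<open>The free Green function\<close>

subsection \<open>The one-dimensional Green function\<close>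

text \<open>
  Continuous on the whole plane, but a square root only on the closed upper half plane; this
  avoids the jump of the principal branch along the negative axis, where the boundary values are
  taken.
\<close>

definition upper_sqrt :: "complex \<Rightarrow> complex" where
  "upper_sqrt z = Complex (sqrt ((cmod z + Re z) / 2)) (sqrt ((cmod z - Re z) / 2))"

lemma Re_le_cmod: "0 \<le> cmod z + Re z" "0 \<le> cmod z - Re z"
  using abs_Re_le_cmod[of z] by linarith+

lemma upper_sqrt_power2: "Im z \<ge> 0 \<Longrightarrow> (upper_sqrt z)\<^sup>2 = z"
proof -
  assume z: "Im z \<ge> 0"
  have "sqrt ((cmod z + Re z) / 2) * sqrt ((cmod z - Re z) / 2) = sqrt ((Im z / 2)\<^sup>2)"
    unfolding real_sqrt_mult[symmetric]
    by (simp add: cmod_power2 algebra_simps power_divide flip: power2_eq_square)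
  also have "\<dots> = Im z / 2"
    using z by simp
  finally show ?thesis
    using Re_le_cmod[of z]
    by (auto simp: upper_sqrt_def complex_eq_iff power2_eq_square algebra_simps simp flip: real_sqrt_mult)
      (simp_all add: field_simps)
qed

lemma upper_sqrt_nonneg: "Re (upper_sqrt z) \<ge> 0" "Im (upper_sqrt z) \<ge> 0"
  using Re_le_cmod[of z] by (auto simp: upper_sqrt_def)

lemma upper_sqrt_pos:
  assumes "Im z \<noteq> 0"
  shows "Re (upper_sqrt z) > 0" "Im (upper_sqrt z) > 0"
proof -
  have "\<bar>Re z\<bar> < cmod z"
    using assms abs_Re_le_cmod[of z] by (metis cmod_eq_Re complex_eq_iff norm_zero order_le_less
        real_sqrt_unique cmod_power2 power2_abs add_cancel_right_right power_eq_0_iff abs_ge_zero)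
  then show "Re (upper_sqrt z) > 0" "Im (upper_sqrt z) > 0"
    by (auto simp: upper_sqrt_def)
qed

lemma continuous_on_upper_sqrt: "continuous_on A upper_sqrt"
  unfolding upper_sqrt_def complex_eq by (intro continuous_intros) auto

lemma upper_sqrt_of_real:
  "x \<ge> 0 \<Longrightarrow> upper_sqrt (of_real x) = of_real (sqrt x)"
  "x \<le> 0 \<Longrightarrow> upper_sqrt (of_real x) = \<i> * of_real (sqrt (- x))"
  by (auto simp: upper_sqrt_def complex_eq_iff)

text \<open>
  On the closed lower half plane \<open>disc w\<close> is the continuous square root of \<open>1 - w\<^sup>2\<close> for which
  the root \<open>decay w = w + \<i> disc w\<close> of \<open>\<zeta> + 1 / \<zeta> = 2 w\<close> lies in the closed unit disc.
\<close>

definition root_minus :: "complex \<Rightarrow> complex" where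
  "root_minus w = upper_sqrt (1 - w)"

definition root_plus :: "complex \<Rightarrow> complex" where
  "root_plus w = cnj (upper_sqrt (cnj (1 + w)))"

definition disc :: "complex \<Rightarrow> complex" where
  "disc w = root_minus w * root_plus w"

definition decay :: "complex \<Rightarrow> complex" where
  "decay w = w + \<i> * disc w"

lemma root_power2:
  assumes "Im w \<le> 0"
  shows "(root_minus w)\<^sup>2 = 1 - w" "(root_plus w)\<^sup>2 = 1 + w"
proof -
  show "(root_minus w)\<^sup>2 = 1 - w"
    using assms by (simp add: root_minus_def upper_sqrt_power2)
  have "(root_plus w)\<^sup>2 = cnj ((upper_sqrt (cnj (1 + w)))\<^sup>2)"
    by (simp add: root_plus_def)
  also have "\<dots> = 1 + w"
    using assms by (subst upper_sqrt_power2) auto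
  finally show "(root_plus w)\<^sup>2 = 1 + w" .
qed

lemma disc_power2: "Im w \<le> 0 \<Longrightarrow> (disc w)\<^sup>2 = 1 - w\<^sup>2"
  by (simp add: disc_def power_mult_distrib root_power2) (simp add: algebra_simps power2_eq_square)

lemma decay_eq: "Im w \<le> 0 \<Longrightarrow> decay w = (root_plus w + \<i> * root_minus w)\<^sup>2 / 2"
  using root_power2[of w]
  by (simp add: decay_def disc_def power2_sum power_mult_distrib algebra_simps)

lemma decay_inverse:
  assumes "Im w \<le> 0"
  shows "decay w * (w - \<i> * disc w) = 1" "decay w \<noteq> 0" "inverse (decay w) = w - \<i> * disc w"
proof -
  have "decay w * (w - \<i> * disc w) = w\<^sup>2 + (disc w)\<^sup>2"
    by (simp add: decay_def algebra_simps power2_eq_square)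
  then show *: "decay w * (w - \<i> * disc w) = 1"
    using disc_power2[OF assms] by simp
  then show "decay w \<noteq> 0" by auto
  then show "inverse (decay w) = w - \<i> * disc w"
    using * by (simp add: field_simps)
qed

lemma decay_inverse_eq: "Im w \<le> 0 \<Longrightarrow> inverse (decay w) = (root_plus w - \<i> * root_minus w)\<^sup>2 / 2"
  by (subst decay_inverse(3))
    (use root_power2[of w] in \<open>simp_all add: disc_def power2_diff power_mult_distrib algebra_simps\<close>)

text \<open>
  The two roots of \<open>\<zeta> + 1 / \<zeta> = 2 w\<close> are half the squares of \<open>b + \<i> a\<close> and \<open>b - \<i> a\<close>, where \<open>a\<close> lies
  in the first and \<open>b\<close> in the fourth quadrant; the former is the shorter one.
\<close>

lemma norm_decay:
  assumes "Im w \<le> 0"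
  shows norm_decay_le: "cmod (decay w) \<le> 1" and norm_decay_less: "Im w < 0 \<Longrightarrow> cmod (decay w) < 1"
proof -
  let ?a = "root_minus w" and ?b = "root_plus w"
  have prod: "cmod (decay w) * cmod (inverse (decay w)) = 1"
    using decay_inverse(2)[OF assms] by (simp add: norm_inverse)
  have eq: "(cmod (?b + \<i> * ?a))\<^sup>2 = (cmod (?b - \<i> * ?a))\<^sup>2 - 4 * (Re ?b * Im ?a - Im ?b * Re ?a)"
    unfolding cmod_power2 by (simp add: power2_eq_square algebra_simps)
  have signs: "Re ?a \<ge> 0" "Im ?a \<ge> 0" "Re ?b \<ge> 0" "Im ?b \<le> 0"
    using upper_sqrt_nonneg by (auto simp: root_minus_def root_plus_def)
  have c: "cmod (decay w) = (cmod (?b + \<i> * ?a))\<^sup>2 / 2" "cmod (inverse (decay w)) = (cmod (?b - \<i> * ?a))\<^sup>2 / 2"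
    unfolding decay_inverse_eq[OF assms] by (simp_all add: decay_eq[OF assms] norm_divide norm_power)
  have "Re ?b * Im ?a - Im ?b * Re ?a \<ge> 0"
    using mult_nonneg_nonneg[OF signs(3,2)] mult_nonpos_nonneg[OF signs(4,1)] by linarith
  then have le: "cmod (decay w) \<le> cmod (inverse (decay w))"
    unfolding c eq by simp
  then have "cmod (decay w) * cmod (decay w) \<le> 1"
    unfolding prod[symmetric] by (intro mult_left_mono) auto
  then show "cmod (decay w) \<le> 1"
    by (metis abs_le_square_iff abs_norm_cancel abs_one power2_eq_square power_one)
  assume "Im w < 0"
  then have nz: "Im (1 - w) \<noteq> 0" "Im (cnj (1 + w)) \<noteq> 0"
    by simp_all
  have "Im ?a > 0" "Re ?b > 0"
    using upper_sqrt_pos(2)[OF nz(1)] upper_sqrt_pos(1)[OF nz(2)] unfolding root_minus_def root_plus_def cnj.simps .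
  then have "Re ?b * Im ?a - Im ?b * Re ?a > 0"
    using mult_pos_pos[of "Re ?b" "Im ?a"] mult_nonpos_nonneg[OF signs(4,1)] by linarith
  then have le: "cmod (decay w) < cmod (inverse (decay w))"
    unfolding c eq by simp
  then have "cmod (decay w) * cmod (decay w) < 1"
    unfolding prod[symmetric] using decay_inverse(2)[OF assms] by (intro mult_strict_left_mono) auto
  then show "cmod (decay w) < 1"
    using \<open>cmod (decay w) \<le> 1\<close> by (cases "cmod (decay w) = 1") auto
qed

lemma continuous_on_roots:
  "continuous_on A root_minus" "continuous_on A root_plus" "continuous_on A disc" "continuous_on A decay"
proof -
  show r: "continuous_on A root_minus" "continuous_on A root_plus"
    unfolding root_minus_def root_plus_def
    by (intro continuous_intros continuous_on_compose2[OF continuous_on_upper_sqrt[of UNIV]]; auto)+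
  show d: "continuous_on A disc"
    unfolding disc_def by (intro continuous_intros r)
  show "continuous_on A decay"
    unfolding decay_def by (intro continuous_intros d)
qed

lemma norm_disc:
  assumes "Im w \<le> 0"
  shows "(cmod (disc w))\<^sup>2 = cmod (1 - w) * cmod (1 + w)"
  using root_power2[OF assms] unfolding disc_def norm_mult power_mult_distrib norm_power[symmetric] by simp

lemma norm_disc_ge:
  assumes "Im w \<le> 0"
  shows "cmod (disc w) \<ge> sqrt \<bar>1 - Re w\<bar> * sqrt \<bar>1 + Re w\<bar>" "cmod (disc w) \<ge> - Im w"
proof -
  have "\<bar>1 - Re w\<bar> * \<bar>1 + Re w\<bar> \<le> (cmod (disc w))\<^sup>2"
    unfolding norm_disc[OF assms] using abs_Re_le_cmod[of "1 - w"] abs_Re_le_cmod[of "1 + w"]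
    by (intro mult_mono) auto
  then show "cmod (disc w) \<ge> sqrt \<bar>1 - Re w\<bar> * sqrt \<bar>1 + Re w\<bar>"
    by (simp add: real_sqrt_mult[symmetric] real_le_lsqrt)
  have "(- Im w) * (- Im w) \<le> cmod (1 - w) * cmod (1 + w)"
    using abs_Im_le_cmod[of "1 - w"] abs_Im_le_cmod[of "1 + w"] assms by (intro mult_mono) auto
  then have "(- Im w)\<^sup>2 \<le> (cmod (disc w))\<^sup>2"
    unfolding norm_disc[OF assms] power2_eq_square[of "- Im w"] .
  then show "cmod (disc w) \<ge> - Im w"
    by (rule power2_le_imp_le) simp
qed

text \<open>
  The decaying solution of the three-term recursion with a unit source at \<open>0\<close>. For \<open>w\<close> in the
  lower half plane it is square summable; for real \<open>w\<close> it is outgoing inside \<open>(- 1, 1)\<close> and real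
  outside.
\<close>

definition green1 :: "complex \<Rightarrow> int \<Rightarrow> complex" where
  "green1 w k = 2 * \<i> * decay w ^ nat \<bar>k\<bar> / disc w"

lemma green1_equation:
  assumes "Im w \<le> 0" "disc w \<noteq> 0"
  shows "- (1 / 4) * (green1 w (k + 1) + green1 w (k - 1)) + w / 2 * green1 w k = (if k = 0 then 1 else 0)"
proof -
  note d = decay_inverse[OF assms(1)]
  have quad: "decay w ^ 2 + 1 = 2 * w * decay w"
    using d(1) by (simp add: decay_def algebra_simps power2_eq_square)
  have balance: "- (1 / 4) * (2 * \<i> * Z / D + 2 * \<i> * Y / D) + w / 2 * (2 * \<i> * X / D) = 0"
    if "Z + Y = 2 * w * X" for X Y Z D :: complex
  proof -
    have Z: "Z = 2 * w * X - Y"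
      using that by (simp add: eq_diff_eq)
    show ?thesis
      unfolding Z by (cases "D = 0") (simp_all add: field_simps)
  qed
  consider "k = 0" | "k > 0" | "k < 0" by linarith
  then show ?thesis
  proof cases
    case 1
    then show ?thesis
      using assms(2) by (simp add: green1_def decay_def field_simps)
  next
    case 2
    define m where "m = nat (k - 1)"
    have nat: "nat \<bar>k\<bar> = Suc m" "nat \<bar>k + 1\<bar> = Suc (Suc m)" "nat \<bar>k - 1\<bar> = m" "k \<noteq> 0"
      using 2 by (auto simp: m_def)
    have "decay w ^ Suc (Suc m) + decay w ^ m = 2 * w * decay w ^ Suc m"
      using arg_cong[OF quad, of "\<lambda>t. t * decay w ^ m"] by (simp add: algebra_simps power2_eq_square)
    from balance[OF this, of "disc w"] show ?thesis
      by (simp only: green1_def nat if_False)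
  next
    case 3
    define m where "m = nat (- k - 1)"
    have nat: "nat \<bar>k\<bar> = Suc m" "nat \<bar>k - 1\<bar> = Suc (Suc m)" "nat \<bar>k + 1\<bar> = m" "k \<noteq> 0"
      using 3 by (auto simp: m_def)
    have "decay w ^ m + decay w ^ Suc (Suc m) = 2 * w * decay w ^ Suc m"
      using arg_cong[OF quad, of "\<lambda>t. t * decay w ^ m"] by (simp add: algebra_simps power2_eq_square)
    from balance[OF this, of "disc w"] show ?thesis
      by (simp only: green1_def nat if_False)
  qed
qed

lemma norm_green1_le:
  assumes "Im w \<le> 0"
  shows "cmod (green1 w k) \<le> 2 / cmod (disc w)"
proof -
  have "cmod (decay w) ^ nat \<bar>k\<bar> \<le> 1"
    using norm_decay_le[OF assms] by (intro power_le_one) auto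
  then show ?thesis
    by (simp add: green1_def norm_divide norm_mult norm_power divide_right_mono)
qed

lemma green1_minus: "green1 w (- k) = green1 w k"
  by (simp add: green1_def)

lemma green1_measurable [measurable]: "(\<lambda>w. green1 w k) \<in> borel_measurable borel"
proof -
  have [measurable]: "disc \<in> borel_measurable borel" "decay \<in> borel_measurable borel"
    by (auto intro: borel_measurable_continuous_onI continuous_on_roots)
  show ?thesis
    unfolding green1_def by measurable
qed

lemma Im_green1_inside:
  assumes "\<bar>s\<bar> < 1"
  shows "Im (green1 (of_real s) k) = 2 * cos (of_int k * arccos s) / sqrt (1 - s\<^sup>2)"
proof -
  have disc: "disc (of_real s) = of_real (sqrt (1 - s\<^sup>2))"
  proof -
    have "disc (of_real s) = of_real (sqrt (1 - s)) * of_real (sqrt (1 + s))"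
      using assms upper_sqrt_of_real(1)[of "1 - s"] upper_sqrt_of_real(1)[of "1 + s"]
      by (simp add: disc_def root_minus_def root_plus_def)
    also have "\<dots> = of_real (sqrt ((1 - s) * (1 + s)))"
      by (simp add: real_sqrt_mult)
    also have "(1 - s) * (1 + s) = 1 - s\<^sup>2"
      by (simp add: algebra_simps power2_eq_square)
    finally show ?thesis .
  qed
  have "decay (of_real s) = cis (arccos s)"
    using assms by (simp add: decay_def disc complex_eq_iff sin_arccos_abs)
  then have "green1 (of_real s) k = 2 * \<i> * cis (real (nat \<bar>k\<bar>) * arccos s) / of_real (sqrt (1 - s\<^sup>2))"
    by (simp only: green1_def Complex.DeMoivre disc)
  then have "Im (green1 (of_real s) k) = 2 * cos (real (nat \<bar>k\<bar>) * arccos s) / sqrt (1 - s\<^sup>2)"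
    by (simp add: Im_divide_of_real)
  moreover have "cos (real (nat \<bar>k\<bar>) * arccos s) = cos (of_int k * arccos s)"
    by (cases "k \<ge> 0") auto
  ultimately show ?thesis by simp
qed

lemma Im_green1_outside:
  assumes "\<bar>s\<bar> > 1"
  shows "Im (green1 (of_real s) k) = 0"
proof -
  have "\<exists>r. disc (of_real s) = \<i> * of_real r"
  proof (cases "s > 0")
    case True
    then have "disc (of_real s) = (\<i> * of_real (sqrt (s - 1))) * of_real (sqrt (1 + s))"
      using assms upper_sqrt_of_real(2)[of "1 - s"] upper_sqrt_of_real(1)[of "1 + s"]
      by (simp add: disc_def root_minus_def root_plus_def)
    then show ?thesis
      by (intro exI[of _ "sqrt (s - 1) * sqrt (1 + s)"]) (simp add: mult.assoc)
  next
    case False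
    then have "disc (of_real s) = of_real (sqrt (1 - s)) * cnj (\<i> * of_real (sqrt (- 1 - s)))"
      using assms upper_sqrt_of_real(1)[of "1 - s"] upper_sqrt_of_real(2)[of "1 + s"]
      by (simp add: disc_def root_minus_def root_plus_def)
    then show ?thesis
      by (intro exI[of _ "- (sqrt (1 - s) * sqrt (- 1 - s))"]) simp
  qed
  then obtain r where r: "disc (of_real s) = \<i> * of_real r" ..
  have dec: "decay (of_real s) = of_real (s - r)"
    by (simp add: decay_def r algebra_simps flip: mult.assoc)
  have "green1 (of_real s) k = of_real (2 * (s - r) ^ nat \<bar>k\<bar> / r)"
    unfolding green1_def r dec by (cases "r = 0") (auto simp: field_simps)
  then show ?thesis by (simp only: Im_complex_of_real)
qed

subsection \<open>Integration over the torus\<close>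

definition circle :: "real measure" where
  "circle = density lborel (\<lambda>t. ennreal (indicator {- pi..pi} t / (2 * pi)))"

text \<open>
  All \<open>d\<close> coordinates are kept, although the integrands below do not depend on one of them: the
  measure is normalised, so that the idle coordinate contributes a factor \<open>1\<close>.
\<close>

definition torus :: "('d::finite \<Rightarrow> real) measure" where
  "torus = PiM UNIV (\<lambda>_. circle)"

lemma sets_circle [simp, measurable_cong]: "sets circle = sets borel"
  by (simp add: circle_def)

lemma space_circle [simp]: "space circle = UNIV"
  by (simp add: circle_def)

lemma nn_integral_circle:
  "f \<in> borel_measurable borel \<Longrightarrow>
     (\<integral>\<^sup>+ t. f t \<partial>circle) = (\<integral>\<^sup>+ t. ennreal (indicator {- pi..pi} t / (2 * pi)) * f t \<partial>lborel)"
  by (simp add: circle_def nn_integral_density)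

lemma nn_integral_circle_le:
  assumes [measurable]: "f \<in> borel_measurable borel"
  shows "(\<integral>\<^sup>+ t. f t \<partial>circle) \<le> (\<integral>\<^sup>+ t. indicator {- pi..pi} t * f t \<partial>lborel)"
proof -
  have *: "ennreal (indicator {- pi..pi} t / (2 * pi)) \<le> indicator {- pi..pi} t" for t
  proof -
    have "1 / (2 * pi) \<le> 1"
      using pi_ge_two by simp
    then show ?thesis
      by (auto simp: indicator_def ennreal_le_1)
  qed
  show ?thesis
    unfolding nn_integral_circle[OF assms]
    using * by (intro nn_integral_mono mult_right_mono) auto
qed

lemma emeasure_circle: "emeasure circle UNIV = 1"
proof -
  have "emeasure circle UNIV = (\<integral>\<^sup>+ t. ennreal (1 / (2 * pi)) * indicator {- pi..pi} t \<partial>lborel)"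
    by (simp add: circle_def emeasure_density)
      (auto intro!: nn_integral_cong simp: indicator_def)
  also have "\<dots> = ennreal (1 / (2 * pi)) * ennreal (2 * pi)"
    by (simp add: nn_integral_cmult_indicator)
  also have "\<dots> = 1"
    by (subst ennreal_mult[symmetric]) auto
  finally show ?thesis .
qed

lemma emeasure_circle_pos:
  assumes "a < b" "- pi \<le> a" "b \<le> pi"
  shows "emeasure circle {a<..<b} > 0"
proof -
  have "emeasure circle {a<..<b} = (\<integral>\<^sup>+ t. ennreal (1 / (2 * pi)) * indicator {a<..<b} t \<partial>lborel)"
    using assms by (subst circle_def, subst emeasure_density)
      (auto intro!: nn_integral_cong simp: indicator_def)
  also have "\<dots> = ennreal (1 / (2 * pi)) * ennreal (b - a)"
    using assms by (simp add: nn_integral_cmult_indicator)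
  also have "\<dots> > 0"
    using assms by (simp add: ennreal_zero_less_mult_iff)
  finally show ?thesis .
qed

interpretation circle: finite_measure circle
  by (rule finite_measureI) (simp add: emeasure_circle)

interpretation circle_product: product_sigma_finite "\<lambda>_. circle"
  by standard

lemma emeasure_PiM_circle: "finite I \<Longrightarrow> emeasure (PiM I (\<lambda>_. circle)) (space (PiM I (\<lambda>_. circle))) = 1"
  using circle_product.emeasure_PiM[of I "\<lambda>_. UNIV"] by (simp add: space_PiM emeasure_circle)

lemma space_torus [simp]: "space torus = UNIV"
  by (simp add: torus_def space_PiM)

lemma emeasure_torus: "emeasure (torus :: ('d::finite \<Rightarrow> real) measure) UNIV = 1"
  using emeasure_PiM_circle[of "UNIV :: 'd set"] by (simp add: torus_def space_PiM)

interpretation torus: finite_measure torus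
  by (rule finite_measureI) (simp add: emeasure_torus)

lemma torus_component [measurable]: "(\<lambda>x. x j) \<in> borel_measurable torus"
proof -
  have "(\<lambda>x. x j) \<in> measurable torus circle"
    unfolding torus_def by (rule measurable_component_singleton) simp
  then show ?thesis
    by (simp cong: measurable_cong_sets)
qed

lemma inverse_ennreal_le: "a \<le> b \<Longrightarrow> inverse (ennreal b) \<le> inverse (ennreal a)"
proof (cases "a > 0")
  case True
  assume "a \<le> b"
  with True show ?thesis
    by (simp add: inverse_ennreal ennreal_leI le_imp_inverse_le)
next
  case False
  then show ?thesis by (simp add: ennreal_neg)
qed

text \<open>The derivative of the cosine at an intermediate point is at least \<open>c\<close>, the sine being unimodal on \<open>[0, \<pi>]\<close>.\<close>

lemma cos_diff_lower_bound:
  assumes "0 \<le> t" "t \<le> pi" "0 \<le> u" "u \<le> pi" "c \<le> sin t" "c \<le> sin u"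
  shows "c * \<bar>t - u\<bar> \<le> \<bar>cos t - cos u\<bar>"
proof -
  have *: "c * (u - t) \<le> cos t - cos u"
    if "0 \<le> t" "t < u" "u \<le> pi" "c \<le> sin t" "c \<le> sin u" for t u
  proof -
    obtain z where z: "t < z" "z < u" "cos u - cos t = (u - t) * - sin z"
      using MVT2[OF \<open>t < u\<close>, of cos "\<lambda>x. - sin x"] DERIV_cos by blast
    have "c \<le> sin z"
    proof (cases "z \<le> pi / 2")
      case True
      then have "sin t \<le> sin z"
        using that z by (intro sin_monotone_2pi_le) auto
      with that show ?thesis by linarith
    next
      case False
      then have "sin (pi - u) \<le> sin (pi - z)"
        using that z by (intro sin_monotone_2pi_le) auto
      with that show ?thesis by simp
    qed
    then have "(u - t) * c \<le> (u - t) * sin z"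
      using that by (intro mult_left_mono) auto
    moreover have "cos t - cos u = (u - t) * sin z"
      using z mult_minus_right[of "u - t" "sin z"] by linarith
    ultimately show ?thesis
      by (simp add: mult.commute)
  qed
  consider "t < u" | "u < t" | "t = u" by linarith
  then show ?thesis
    using *[of t u] *[of u t] assms by cases (auto simp: abs_if split: if_splits)
qed

lemma nn_integral_inverse_sqrt_finite:
  assumes "c > 0"
  shows "(\<integral>\<^sup>+ u. indicator {- L..L} u * inverse (ennreal (sqrt (c * \<bar>u\<bar>))) \<partial>lborel) < top"
proof (cases "L \<ge> 0")
  case True
  let ?h = "\<lambda>u. inverse (ennreal (sqrt (c * \<bar>u\<bar>)))"
  let ?p = "\<lambda>u::real. c powr (- (1/2)) * u powr (- (1/2))"
  have "((\<lambda>u. u powr (- (1/2))) has_integral (L powr (- (1/2) + 1) / (- (1/2) + 1))) {0..L}"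
    using True by (intro has_integral_powr_from_0) auto
  then have "(?p has_integral c powr (- (1/2)) * (L powr (- (1/2) + 1) / (- (1/2) + 1))) {0..L}"
    by (rule has_integral_mult_right)
  then have "(\<integral>\<^sup>+ u. indicator {0..L} u * ?p u \<partial>lborel) = ennreal (c powr (- (1/2)) * (L powr (- (1/2) + 1) / (- (1/2) + 1)))"
    using True by (intro nn_integral_has_integral_lebesgue) auto
  moreover have "(\<integral>\<^sup>+ u. indicator {0..L} u * ?h u \<partial>lborel) = (\<integral>\<^sup>+ u. indicator {0..L} u * ?p u \<partial>lborel)"
  proof (rule nn_integral_cong_AE)
    have "AE u in lborel. u \<noteq> (0::real)"
      by (rule AE_lborel_singleton)
    then show "AE u in lborel. indicator {0..L} u * ?h u = ennreal (indicator {0..L} u * ?p u)"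
    proof eventually_elim
      case (elim u)
      have "?h u = ennreal (?p u)" if "u > 0"
        using assms that by (simp add: inverse_ennreal powr_minus powr_half_sqrt[symmetric] powr_mult)
      with elim show ?case
        by (auto simp: indicator_def)
    qed
  qed
  ultimately have half: "(\<integral>\<^sup>+ u. indicator {0..L} u * ?h u \<partial>lborel) < top"
    by simp
  have "(\<integral>\<^sup>+ u. indicator {0..L} u * ?h u \<partial>lborel) = (\<integral>\<^sup>+ u. indicator {0..L} (- u) * ?h (- u) \<partial>lborel)"
    by (subst nn_integral_real_affine[where c = "-1" and t = 0]) auto
  with half have half': "(\<integral>\<^sup>+ u. indicator {0..L} (- u) * ?h (- u) \<partial>lborel) < top"
    by simp
  have "(\<integral>\<^sup>+ u. indicator {- L..L} u * ?h u \<partial>lborel)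
      \<le> (\<integral>\<^sup>+ u. indicator {0..L} u * ?h u + indicator {0..L} (- u) * ?h (- u) \<partial>lborel)"
    by (intro nn_integral_mono) (auto simp: indicator_def)
  also have "\<dots> = (\<integral>\<^sup>+ u. indicator {0..L} u * ?h u \<partial>lborel) + (\<integral>\<^sup>+ u. indicator {0..L} (- u) * ?h (- u) \<partial>lborel)"
    by (rule nn_integral_add; simp only: measurable_lborel2; measurable)
  also have "\<dots> < top"
    using half half' by simp
  finally show ?thesis .
qed simp

text \<open>
  Away from the critical points of the cosine, \<open>\<bar>\<kappa> - cos t\<bar>\<close> vanishes at most to first order, and
  an inverse square root of it is integrable uniformly in \<open>\<kappa>\<close>. The function \<open>inverse\<close> of \<open>ennreal\<close>
  takes the value \<open>\<infinity>\<close> at \<open>0\<close>, so that finiteness of the integral also shows that \<open>\<kappa> = cos t\<close> holds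
  on a null set only.
\<close>

lemma circle_inverse_sqrt_bound:
  assumes c: "c > 0"
  obtains C where "C < top"
    "\<And>\<kappa>. (\<integral>\<^sup>+ t. indicator {t. c \<le> \<bar>sin t\<bar>} t * inverse (ennreal (sqrt \<bar>\<kappa> - cos t\<bar>)) \<partial>circle) \<le> C"
proof
  let ?h = "\<lambda>u. inverse (ennreal (sqrt (c / 2 * \<bar>u\<bar>)))"
  define C where "C = (\<integral>\<^sup>+ u. indicator {- (2 * pi)..2 * pi} u * ?h u \<partial>lborel)"
  have C: "C < top"
    unfolding C_def using c by (intro nn_integral_inverse_sqrt_finite) simp
  show "C + C < top"
    using C by simp
  fix \<kappa> :: real
  let ?f = "\<lambda>t. indicator {t. c \<le> \<bar>sin t\<bar>} t * inverse (ennreal (sqrt \<bar>\<kappa> - cos t\<bar>))"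
  define J where "J = {t \<in> {0..pi}. c \<le> sin t}"
  show "(\<integral>\<^sup>+ t. ?f t \<partial>circle) \<le> C + C"
  proof (cases "J = {}")
    case True
    have "indicator {- pi..pi} t * ?f t = 0" for t
    proof (cases "t \<in> {- pi..pi} \<and> c \<le> \<bar>sin t\<bar>")
      case in_set: True
      then have "\<bar>t\<bar> \<in> J"
        using sin_ge_zero[of "\<bar>t\<bar>"] by (auto simp: J_def abs_if split: if_splits)
      with True show ?thesis by simp
    next
      case False
      then show ?thesis by (simp add: indicator_def)
    qed
    then have "(\<integral>\<^sup>+ t. indicator {- pi..pi} t * ?f t \<partial>lborel) = 0"
      by (simp only: nn_integral_const mult_zero_left)
    moreover have "(\<integral>\<^sup>+ t. ?f t \<partial>circle) \<le> (\<integral>\<^sup>+ t. indicator {- pi..pi} t * ?f t \<partial>lborel)"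
      by (rule nn_integral_circle_le) measurable
    ultimately show ?thesis by simp
  next
    case False
    have "compact J"
    proof -
      have "J = {0..pi} \<inter> {t. c \<le> sin t}"
        by (auto simp: J_def)
      moreover have "closed {t. c \<le> sin t}"
        by (intro closed_Collect_le continuous_intros)
      ultimately show ?thesis
        by (simp add: compact_Int_closed)
    qed
    \<comment> \<open>Comparing with a point of \<open>J\<close> that minimises \<open>\<bar>\<kappa> - cos t\<bar>\<close> costs a factor \<open>2\<close> only.\<close>
    moreover have "continuous_on J (\<lambda>t. \<bar>\<kappa> - cos t\<bar>)"
      by (intro continuous_intros)
    ultimately obtain t0 where t0: "t0 \<in> J" "\<And>t. t \<in> J \<Longrightarrow> \<bar>\<kappa> - cos t0\<bar> \<le> \<bar>\<kappa> - cos t\<bar>"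
      using continuous_attains_inf[OF _ False, of "\<lambda>t. \<bar>\<kappa> - cos t\<bar>"] by blast
    have low: "c / 2 * \<bar>t - t0\<bar> \<le> \<bar>\<kappa> - cos t\<bar>" if t: "t \<in> J" for t
    proof -
      have "c * \<bar>t - t0\<bar> \<le> \<bar>cos t - cos t0\<bar>"
        using t t0(1) by (intro cos_diff_lower_bound) (auto simp: J_def)
      moreover have "c / 2 * \<bar>t - t0\<bar> = c * \<bar>t - t0\<bar> / 2"
        by simp
      ultimately show ?thesis
        using t0(2)[OF t] by linarith
    qed
    have pt: "indicator {- pi..pi} t * ?f t \<le>
        indicator {- (2 * pi)..2 * pi} (t - t0) * ?h (t - t0) + indicator {- (2 * pi)..2 * pi} (t + t0) * ?h (t + t0)" for t
    proof (cases "t \<in> {- pi..pi} \<and> c \<le> \<bar>sin t\<bar>")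
      case True
      then have J: "\<bar>t\<bar> \<in> J"
        using sin_ge_zero[of "\<bar>t\<bar>"] by (auto simp: J_def abs_if split: if_splits)
      have "c / 2 * \<bar>\<bar>t\<bar> - t0\<bar> \<le> \<bar>\<kappa> - cos t\<bar>"
        using low[OF J] by (simp add: abs_if split: if_splits)
      then have le: "inverse (ennreal (sqrt \<bar>\<kappa> - cos t\<bar>)) \<le> ?h (\<bar>t\<bar> - t0)"
        by (intro inverse_ennreal_le real_sqrt_le_mono)
      have rng: "t - t0 \<in> {- (2 * pi)..2 * pi}" "t + t0 \<in> {- (2 * pi)..2 * pi}"
        using True t0(1) by (auto simp: J_def)
      have ab: "?h (\<bar>t\<bar> - t0) = ?h (t - t0) \<or> ?h (\<bar>t\<bar> - t0) = ?h (t + t0)"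
      proof (cases "t \<ge> 0")
        case False
        then have "\<bar>\<bar>t\<bar> - t0\<bar> = \<bar>t + t0\<bar>" by linarith
        then show ?thesis by simp
      qed simp
      from ab have "?h (\<bar>t\<bar> - t0) \<le> ?h (t - t0) + ?h (t + t0)"
        by (elim disjE) (simp_all add: add_increasing add_increasing2)
      then show ?thesis
        using le rng True by (simp add: indicator_def)
    next
      case False
      then have "indicator {- pi..pi} t * ?f t = 0"
        by (auto simp: indicator_def)
      then show ?thesis by (simp only: zero_le)
    qed
    have shift: "(\<integral>\<^sup>+ t. indicator {- (2 * pi)..2 * pi} (t + a) * ?h (t + a) \<partial>lborel) = C" for a
      unfolding C_def by (subst (2) nn_integral_real_affine[where c = 1 and t = a]) (auto simp: add.commute)
    have meas: "(\<lambda>t. indicator {- (2 * pi)..2 * pi} (t + a) * ?h (t + a)) \<in> borel_measurable borel" for a :: real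
      by measurable
    have "(\<integral>\<^sup>+ t. ?f t \<partial>circle) \<le> (\<integral>\<^sup>+ t. indicator {- pi..pi} t * ?f t \<partial>lborel)"
      by (rule nn_integral_circle_le) measurable
    also have "\<dots> \<le> (\<integral>\<^sup>+ t. indicator {- (2 * pi)..2 * pi} (t + - t0) * ?h (t + - t0)
        + indicator {- (2 * pi)..2 * pi} (t + t0) * ?h (t + t0) \<partial>lborel)"
      using pt by (intro nn_integral_mono) simp
    also have "\<dots> = C + C"
      by (subst nn_integral_add) (simp_all only: measurable_lborel2 meas shift)
    finally show ?thesis .
  qed
qed

lemma not_int_distance:
  assumes "\<theta> \<notin> \<int>"
  obtains \<eta> :: real where "\<eta> > 0" "\<And>m::int. \<eta> \<le> \<bar>\<theta> - of_int m\<bar>"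
proof
  let ?\<eta> = "min (frac \<theta>) (1 - frac \<theta>)"
  show "?\<eta> > 0"
    using assms frac_lt_1[of \<theta>] by (simp add: frac_gt_0_iff)
  show "?\<eta> \<le> \<bar>\<theta> - of_int m\<bar>" for m
  proof (cases "m \<le> \<lfloor>\<theta>\<rfloor>")
    case True
    then have "of_int m \<le> (of_int \<lfloor>\<theta>\<rfloor> :: real)" by simp
    then show ?thesis unfolding frac_def by linarith
  next
    case False
    then have "of_int \<lfloor>\<theta>\<rfloor> + 1 \<le> (of_int m :: real)" by linarith
    then show ?thesis unfolding frac_def by linarith
  qed
qed

text \<open>
  Near the points where all sines vanish the sum of the cosines is close to
  \<open>card J - 2 m\<close> for an integer \<open>m\<close>; only there could the level set be singular.
\<close>

lemma cos_sum_near_critical: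
  assumes J: "finite J" and \<theta>: "\<theta> \<notin> \<int>"
  obtains \<delta> :: real where "\<delta> > 0"
    "\<And>x. (\<And>j. j \<in> J \<Longrightarrow> \<bar>sin (x j)\<bar> < \<delta>) \<Longrightarrow> \<delta> \<le> \<bar>real (card J) - 2 * \<theta> - (\<Sum>j\<in>J. cos (x j))\<bar>"
proof -
  obtain \<eta> where \<eta>: "\<eta> > 0" "\<And>m::int. \<eta> \<le> \<bar>\<theta> - of_int m\<bar>"
    using not_int_distance[OF \<theta>] by blast
  define \<delta> where "\<delta> = min 1 (\<eta> / (real (card J) + 1))"
  have \<delta>: "\<delta> > 0" "\<delta> \<le> 1" "(real (card J) + 1) * \<delta> \<le> \<eta>"
  proof -
    have pos: "real (card J) + 1 > 0"
      by (simp add: add_nonneg_pos)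
    have "\<delta> \<le> \<eta> / (real (card J) + 1)"
      by (simp add: \<delta>_def)
    then show "(real (card J) + 1) * \<delta> \<le> \<eta>"
      using pos by (simp add: pos_le_divide_eq mult.commute)
    show "\<delta> > 0" "\<delta> \<le> 1"
      using \<eta>(1) pos by (auto simp: \<delta>_def)
  qed
  have "\<delta> \<le> \<bar>real (card J) - 2 * \<theta> - (\<Sum>j\<in>J. cos (x j))\<bar>"
    if x: "\<And>j. j \<in> J \<Longrightarrow> \<bar>sin (x j)\<bar> < \<delta>" for x
  proof -
    define m where "m = (\<Sum>j\<in>J. if cos (x j) \<ge> 0 then 0 else (1::int))"
    have "\<bar>cos (x j) - (1 - 2 * of_int (if cos (x j) \<ge> 0 then 0 else (1::int)))\<bar> \<le> \<delta>" if "j \<in> J" for j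
    proof -
      have "\<bar>sin (x j)\<bar> * \<bar>sin (x j)\<bar> \<le> \<delta> * 1"
        using x[OF that] \<delta> by (intro mult_mono) auto
      then have "1 - \<delta> \<le> (cos (x j))\<^sup>2"
        using sin_cos_squared_add[of "x j"] by (simp add: power2_eq_square)
      also have "(cos (x j))\<^sup>2 \<le> \<bar>cos (x j)\<bar> * 1"
        using mult_left_mono[OF abs_cos_le_one[of "x j"] abs_ge_zero[of "cos (x j)"]]
        by (simp add: power2_eq_square)
      finally have "1 - \<delta> \<le> \<bar>cos (x j)\<bar>" by simp
      show ?thesis
      proof (cases "cos (x j) \<ge> 0")
          case True
          then show ?thesis
            using \<open>1 - \<delta> \<le> \<bar>cos (x j)\<bar>\<close> cos_le_one[of "x j"]
            by (simp only: if_True of_int_0 mult_zero_right diff_zero)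
        next
          case False
          then show ?thesis
            using \<open>1 - \<delta> \<le> \<bar>cos (x j)\<bar>\<close> cos_ge_minus_one[of "x j"]
            by (simp only: if_False of_int_1 mult_1_right)
        qed
    qed
    then have "(\<Sum>j\<in>J. \<bar>cos (x j) - (1 - 2 * of_int (if cos (x j) \<ge> 0 then 0 else (1::int)))\<bar>) \<le> real (card J) * \<delta>"
      by (rule sum_bounded_above)
    moreover have "\<bar>\<Sum>j\<in>J. cos (x j) - (1 - 2 * of_int (if cos (x j) \<ge> 0 then 0 else (1::int)))\<bar>
      \<le> (\<Sum>j\<in>J. \<bar>cos (x j) - (1 - 2 * of_int (if cos (x j) \<ge> 0 then 0 else (1::int)))\<bar>)"
      by (rule sum_abs)
    moreover have "(\<Sum>j\<in>J. cos (x j) - (1 - 2 * of_int (if cos (x j) \<ge> 0 then 0 else (1::int))))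
      = (\<Sum>j\<in>J. cos (x j)) - (real (card J) - 2 * of_int m)"
      by (simp add: m_def sum_subtractf sum_distrib_left)
    ultimately have "\<bar>(\<Sum>j\<in>J. cos (x j)) - (real (card J) - 2 * of_int m)\<bar> \<le> real (card J) * \<delta>"
      by linarith
    moreover have "real (card J) * \<delta> + \<delta> \<le> 2 * \<bar>\<theta> - of_int m\<bar>"
      by (intro order_trans[OF \<delta>(3)[unfolded distrib_right mult_1] order_trans[OF \<eta>(2)[of m]]]) simp
    ultimately show ?thesis
      by (simp add: abs_if split: if_splits)
  qed
  with \<delta>(1) that show ?thesis by blast
qed

text \<open>
  At each point either some sine is not small, and the integral over that coordinate is bounded
  uniformly in the others, or the argument of the square root is bounded below.
\<close>

lemma torus_inverse_sqrt_finite: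
  fixes j0 :: "'d::finite"
  assumes \<theta>: "\<theta> \<notin> \<int>"
  shows "(\<integral>\<^sup>+ x. inverse (ennreal (sqrt \<bar>real CARD('d) - 1 - 2 * \<theta> - (\<Sum>j\<in>UNIV - {j0}. cos (x j))\<bar>)) \<partial>torus) < top"
proof -
  let ?J = "UNIV - {j0}"
  let ?\<kappa> = "real CARD('d) - 1 - 2 * \<theta>"
  let ?h = "\<lambda>x. inverse (ennreal (sqrt \<bar>?\<kappa> - (\<Sum>j\<in>?J. cos (x j))\<bar>))"
  have card: "real (card ?J) = real CARD('d) - 1"
    using zero_less_card_finite[where 'a = 'd] by (simp add: card_Diff_singleton of_nat_diff Suc_le_eq)
  obtain \<delta> where \<delta>: "\<delta> > 0"
    "\<And>x. (\<And>j. j \<in> ?J \<Longrightarrow> \<bar>sin (x j)\<bar> < \<delta>) \<Longrightarrow> \<delta> \<le> \<bar>?\<kappa> - (\<Sum>j\<in>?J. cos (x j))\<bar>"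
    using cos_sum_near_critical[of ?J \<theta>] \<theta> unfolding card by (metis finite)
  obtain C where C: "C < top"
    "\<And>\<kappa>. (\<integral>\<^sup>+ t. indicator {t. \<delta> \<le> \<bar>sin t\<bar>} t * inverse (ennreal (sqrt \<bar>\<kappa> - cos t\<bar>)) \<partial>circle) \<le> C"
    using circle_inverse_sqrt_bound[OF \<delta>(1)] by blast
  let ?f = "\<lambda>j x. indicator {t. \<delta> \<le> \<bar>sin t\<bar>} (x j) * ?h x"
  have f_meas [measurable]: "?f j \<in> borel_measurable torus" for j
    by measurable
  have fC: "(\<integral>\<^sup>+ x. ?f j x \<partial>torus) \<le> C" if j: "j \<in> ?J" for j
  proof -
    let ?I = "UNIV - {j}"
    have ins: "insert j ?I = UNIV" by auto
    have "(\<integral>\<^sup>+ x. ?f j x \<partial>torus) = (\<integral>\<^sup>+ x. (\<integral>\<^sup>+ y. ?f j (x(j := y)) \<partial>circle) \<partial>PiM ?I (\<lambda>_. circle))"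
      using circle_product.product_nn_integral_insert[of ?I j "?f j"] f_meas[of j] unfolding ins torus_def by simp
    also have "\<dots> \<le> (\<integral>\<^sup>+ x. C \<partial>PiM ?I (\<lambda>_. circle))"
    proof (rule nn_integral_mono)
      fix x :: "'d \<Rightarrow> real"
      have "(\<Sum>i\<in>?J. cos ((x(j := y)) i)) = cos y + (\<Sum>i\<in>?J - {j}. cos (x i))" for y
        using j by (subst sum.remove[of _ j]) (auto intro!: sum.cong)
      then have "?f j (x(j := y)) = indicator {t. \<delta> \<le> \<bar>sin t\<bar>} y *
          inverse (ennreal (sqrt \<bar>(?\<kappa> - (\<Sum>i\<in>?J - {j}. cos (x i))) - cos y\<bar>))" for y
        by (simp add: algebra_simps)
      then show "(\<integral>\<^sup>+ y. ?f j (x(j := y)) \<partial>circle) \<le> C"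
        using C(2) by simp
    qed
    also have "\<dots> = C"
      by (simp add: emeasure_PiM_circle)
    finally show ?thesis .
  qed
  have "?h x \<le> inverse (ennreal (sqrt \<delta>)) + (\<Sum>j\<in>?J. ?f j x)" for x
  proof (cases "\<exists>j\<in>?J. \<delta> \<le> \<bar>sin (x j)\<bar>")
    case True
    then obtain j where j: "j \<in> ?J" "\<delta> \<le> \<bar>sin (x j)\<bar>" by blast
    then have "?h x = ?f j x" by simp
    also have "\<dots> \<le> (\<Sum>j\<in>?J. ?f j x)"
      using j(1) by (intro member_le_sum) auto
    finally show ?thesis
      by (simp add: add_increasing)
  next
    case False
    then have "\<delta> \<le> \<bar>?\<kappa> - (\<Sum>j\<in>?J. cos (x j))\<bar>"
      by (intro \<delta>(2)) force
    then have "?h x \<le> inverse (ennreal (sqrt \<delta>))"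
      by (intro inverse_ennreal_le real_sqrt_le_mono)
    then show ?thesis
      by (simp add: add_increasing2)
  qed
  then have "(\<integral>\<^sup>+ x. ?h x \<partial>torus) \<le> (\<integral>\<^sup>+ x. inverse (ennreal (sqrt \<delta>)) + (\<Sum>j\<in>?J. ?f j x) \<partial>torus)"
    by (intro nn_integral_mono)
  also have "\<dots> = (\<integral>\<^sup>+ x. inverse (ennreal (sqrt \<delta>)) \<partial>(torus :: ('d \<Rightarrow> real) measure)) + (\<integral>\<^sup>+ x. (\<Sum>j\<in>?J. ?f j x) \<partial>torus)"
    by (intro nn_integral_add borel_measurable_const borel_measurable_sum f_meas)
  also have "\<dots> = inverse (ennreal (sqrt \<delta>)) + (\<Sum>j\<in>?J. \<integral>\<^sup>+ x. ?f j x \<partial>torus)"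
    by (simp only: nn_integral_const space_torus emeasure_torus mult_1_right nn_integral_sum[OF f_meas])
  also have "\<dots> \<le> inverse (ennreal (sqrt \<delta>)) + (\<Sum>j\<in>?J. C)"
    using fC by (intro add_left_mono sum_mono)
  also have "\<dots> < top"
    using \<delta>(1) C(1) by (simp add: inverse_ennreal ennreal_mult_less_top of_nat_less_top)
  finally have "(\<integral>\<^sup>+ x. ?h x \<partial>torus) < top"
    by simp
  then show ?thesis
    by simp
qed

subsection \<open>The Green function as an integral over the transverse momenta\<close>

lemma circle_integral_exp: "(LINT t|circle. exp (\<i> * of_real (of_int k * t))) = (if k = 0 then 1 else 0)"
proof -
  let ?f = "\<lambda>t::real. exp (\<i> * of_real (of_int k * t))"
  have *: "(LINT t|circle. ?f t) = (LINT t|lborel. (indicator {- pi..pi} t / (2 * pi)) *\<^sub>R ?f t)"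
    unfolding circle_def
    by (rule integral_density) (auto intro!: borel_measurable_continuous_onI continuous_intros)
  also have "\<dots> = (LINT t|lborel. (1 / (2 * pi)) *\<^sub>R (indicator {- pi..pi} t *\<^sub>R ?f t))"
    by (intro Bochner_Integration.integral_cong) auto
  also have "\<dots> = (1 / (2 * pi)) *\<^sub>R (LINT t|lborel. indicator {- pi..pi} t *\<^sub>R ?f t)"
    by (rule integral_scaleR_right)
  also have "\<dots> = (if k = 0 then 1 else 0)"
  proof (cases "k = 0")
    case True
    then show ?thesis by simp
  next
    case False
    let ?F = "\<lambda>t::real. exp (\<i> * of_real (of_int k * t)) / (\<i> * of_int k)"
    have "(?F has_vector_derivative ?f t) (at t within {- pi..pi})" for t
      using False by (auto intro!: derivative_eq_intros has_vector_derivative_real_field simp: field_simps)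
    then have *: "(LINT t|lborel. indicator {- pi..pi} t *\<^sub>R ?f t) = ?F pi - ?F (- pi)"
      by (intro integral_FTC_Icc) (auto intro!: continuous_intros)
    have "?f pi = exp (2 * of_int k * of_real pi * \<i>) * ?f (- pi)"
      unfolding exp_add[symmetric] by (rule arg_cong[of _ _ exp]) (simp add: algebra_simps)
    then have "?f pi = ?f (- pi)"
      using exp_integer_2pi[of "of_int k"] by simp
    with * show ?thesis
      using False by simp
  qed
  finally show ?thesis .
qed

text \<open>
  The spectral parameter left for the direction \<open>j0\<close>, scaled so that the one-dimensional equation
  becomes \<open>cos (x j0) = transverse_energy j0 E x\<close>.
\<close>

definition transverse_energy :: "'d \<Rightarrow> real \<Rightarrow> ('d::finite \<Rightarrow> real) \<Rightarrow> real" where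
  "transverse_energy j0 E x = real CARD('d) - 2 * E - (\<Sum>j\<in>UNIV - {j0}. cos (x j))"

definition transverse_phase :: "'d \<Rightarrow> int ^ 'd \<Rightarrow> ('d::finite \<Rightarrow> real) \<Rightarrow> complex" where
  "transverse_phase j0 n x = exp (\<i> * of_real (\<Sum>j\<in>UNIV - {j0}. real_of_int (n $ j) * x j))"

definition green_integrand :: "'d \<Rightarrow> real \<Rightarrow> real \<Rightarrow> int ^ 'd \<Rightarrow> ('d::finite \<Rightarrow> real) \<Rightarrow> complex" where
  "green_integrand j0 E \<epsilon> n x =
     transverse_phase j0 n x * green1 (Complex (transverse_energy j0 E x) (- 2 * \<epsilon>)) (n $ j0)"

text \<open>
  Fourier transform in all directions but \<open>j0\<close>, where the one-dimensional Green function is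
  explicit. At \<open>\<epsilon> = 0\<close> the formula makes sense and is the boundary value from above.
\<close>

definition green :: "'d \<Rightarrow> real \<Rightarrow> real \<Rightarrow> int ^ 'd::finite \<Rightarrow> complex" where
  "green j0 E \<epsilon> n = (LINT x|torus. green_integrand j0 E \<epsilon> n x)"

text \<open>
  An integrable majorant of the integrand of \<open>green\<close> for all \<open>\<epsilon> \<ge> 0\<close> and all sites at once.
\<close>

definition envelope :: "'d \<Rightarrow> real \<Rightarrow> ('d::finite \<Rightarrow> real) \<Rightarrow> real" where
  "envelope j0 E x = 2 / (sqrt \<bar>1 - transverse_energy j0 E x\<bar> * sqrt \<bar>1 + transverse_energy j0 E x\<bar>)"

lemma transverse_measurable [measurable]:
  "transverse_energy j0 E \<in> borel_measurable torus"
  "transverse_phase j0 n \<in> borel_measurable torus"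
  "envelope j0 E \<in> borel_measurable torus"
proof -
  show 1[measurable]: "transverse_energy j0 E \<in> borel_measurable torus"
    unfolding transverse_energy_def by measurable
  show "transverse_phase j0 n \<in> borel_measurable torus"
    unfolding transverse_phase_def by measurable
  show "envelope j0 E \<in> borel_measurable torus"
    unfolding envelope_def by measurable
qed

lemma Complex_measurable [measurable (raw)]:
  assumes [measurable]: "f \<in> borel_measurable M" "g \<in> borel_measurable M"
  shows "(\<lambda>x. Complex (f x) (g x)) \<in> borel_measurable M"
  unfolding Complex_eq by measurable

lemma cnj_measurable [measurable (raw)]:
  assumes "f \<in> borel_measurable M"
  shows "(\<lambda>x. cnj (f x)) \<in> borel_measurable M"
  by (rule measurable_compose[OF assms]) (intro borel_measurable_continuous_onI continuous_intros)

lemma green_integrand_measurable [measurable]: "green_integrand j0 E \<epsilon> n \<in> borel_measurable torus"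
  unfolding green_integrand_def by measurable

lemma norm_transverse_phase [simp]: "cmod (transverse_phase j0 n x) = 1"
  by (simp add: transverse_phase_def)

lemma transverse_phase_add: "transverse_phase j0 (n + m) x = transverse_phase j0 n x * transverse_phase j0 m x"
  by (simp add: transverse_phase_def exp_add[symmetric] algebra_simps sum.distrib)

lemma transverse_phase_minus: "transverse_phase j0 (- n) x = cnj (transverse_phase j0 n x)"
  by (simp add: transverse_phase_def exp_cnj sum_negf)

lemma transverse_phase_axis:
  "transverse_phase j0 (axis j 1) x = (if j = j0 then 1 else exp (\<i> * of_real (x j)))"
proof -
  have "(\<Sum>i\<in>UNIV - {j0}. real_of_int (axis j 1 $ i) * x i) = (\<Sum>i\<in>UNIV - {j0}. if i = j then x j else 0)"
    by (intro sum.cong) (auto simp: axis_def)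
  then show ?thesis
    by (auto simp: transverse_phase_def sum.delta')
qed

lemma transverse_phase_integral:
  "(LINT x|torus. transverse_phase j0 n x) = (if \<forall>j. j \<noteq> j0 \<longrightarrow> n $ j = 0 then 1 else 0)"
proof -
  let ?f = "\<lambda>j t. if j = j0 then 1 else exp (\<i> * of_real (of_int (n $ j) * t))"
  have meas: "(\<lambda>t::real. exp (\<i> * of_real (of_int k * t))) \<in> borel_measurable borel" for k
    by (intro borel_measurable_continuous_onI continuous_intros)
  have int: "integrable circle (?f j)" for j
  proof (rule circle.integrable_const_bound[of _ 1])
    show "?f j \<in> borel_measurable circle"
      using meas[of "n $ j"] by (cases "j = j0") (simp_all add: measurable_cong_sets[OF sets_circle refl])
  qed simp
  have "transverse_phase j0 n x = (\<Prod>j\<in>UNIV. ?f j (x j))" for x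
  proof -
    have "(\<Prod>j\<in>UNIV. ?f j (x j)) = (\<Prod>j\<in>UNIV - {j0}. ?f j (x j))"
      by (subst prod.remove[of _ j0]) auto
    also have "\<dots> = (\<Prod>j\<in>UNIV - {j0}. exp (\<i> * of_real (of_int (n $ j) * x j)))"
      by (intro prod.cong) auto
    also have "\<dots> = transverse_phase j0 n x"
      by (simp add: transverse_phase_def exp_sum sum_distrib_left)
    finally show ?thesis ..
  qed
  then have "(LINT x|torus. transverse_phase j0 n x) = (\<Prod>j\<in>UNIV. LINT t|circle. ?f j t)"
    using circle_product.product_integral_prod[of UNIV ?f, OF _ int] by (simp add: torus_def)
  moreover have "(LINT t|circle. ?f j t) = (if j \<noteq> j0 \<longrightarrow> n $ j = 0 then 1 else 0)" for j
    using circle_integral_exp[of "n $ j"] by (cases "j = j0") (auto simp: measure_def emeasure_circle)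
  ultimately have "(LINT x|torus. transverse_phase j0 n x) = (\<Prod>j\<in>UNIV. if j \<noteq> j0 \<longrightarrow> n $ j = 0 then 1 else 0)"
    by simp
  also have "\<dots> = (if \<forall>j. j \<noteq> j0 \<longrightarrow> n $ j = 0 then 1 else 0)"
    by (auto intro!: prod_zero)
  finally show ?thesis .
qed

lemma ennreal_inverse_product_le:
  fixes p q :: real
  assumes "p \<ge> 0" "q \<ge> 0" "p \<ge> 1 \<or> q \<ge> 1"
  shows "ennreal (2 / (p * q)) \<le> 2 * (inverse (ennreal p) + inverse (ennreal q))"
proof (cases "p = 0 \<or> q = 0")
  case True
  then show ?thesis by auto
next
  case False
  then have pq: "p > 0" "q > 0"
    using assms by auto
  have "2 / (p * q) \<le> 2 * (inverse p + inverse q)"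
    using pq assms(3) by (auto simp: field_simps)
  then have "ennreal (2 / (p * q)) \<le> ennreal (2 * (inverse p + inverse q))"
    by (rule ennreal_leI)
  moreover have "ennreal (2 * (inverse p + inverse q)) = 2 * (inverse (ennreal p) + inverse (ennreal q))"
    using pq by (simp add: ennreal_mult inverse_ennreal)
  ultimately show ?thesis by simp
qed

text \<open>
  The singularities \<open>\<plusminus> 1\<close> of the one-dimensional Green function are reached where a sum of \<open>d - 1\<close>
  cosines equals \<open>d - 2 E \<minusplus> 1\<close>. These level sets are regular unless \<open>E\<close> is an integer.
\<close>

lemma transverse_critical:
  assumes E: "E \<notin> \<int>"
  shows envelope_integrable: "integrable torus (envelope j0 E)"
    and transverse_energy_AE: "AE x in torus. \<bar>transverse_energy j0 E x\<bar> \<noteq> 1"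
proof -
  let ?s = "transverse_energy j0 E"
  let ?h = "\<lambda>a x. inverse (ennreal (sqrt \<bar>a + ?s x\<bar>))"
  have E': "E - 1 \<notin> \<int>"
    using E by (metis Ints_1 Ints_add diff_add_cancel)
  have fin: "(\<integral>\<^sup>+ x. ?h (- 1) x \<partial>torus) < top" "(\<integral>\<^sup>+ x. ?h 1 x \<partial>torus) < top"
    using torus_inverse_sqrt_finite[OF E, of j0] torus_inverse_sqrt_finite[OF E', of j0]
    by (simp_all add: transverse_energy_def algebra_simps)
  have AE: "AE x in torus. ?h a x \<noteq> top" if "(\<integral>\<^sup>+ x. ?h a x \<partial>torus) < top" for a
    using nn_integral_PInf_AE[of "?h a" torus] that by simp
  show "AE x in torus. \<bar>?s x\<bar> \<noteq> 1"
    using AE[OF fin(1)] AE[OF fin(2)]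
  proof eventually_elim
    case (elim x)
    then show ?case
      by (auto simp: abs_if split: if_splits)
  qed
  have le: "ennreal (envelope j0 E x) \<le> 2 * (?h (- 1) x + ?h 1 x)" for x
  proof -
    have "\<bar>1 - ?s x\<bar> \<ge> 1 \<or> \<bar>1 + ?s x\<bar> \<ge> 1"
      by linarith
    then have "ennreal (envelope j0 E x)
       \<le> 2 * (inverse (ennreal (sqrt \<bar>1 - ?s x\<bar>)) + inverse (ennreal (sqrt \<bar>1 + ?s x\<bar>)))"
      unfolding envelope_def by (intro ennreal_inverse_product_le) auto
    then show ?thesis
      by (simp add: abs_minus_commute[of 1])
  qed
  have "(\<integral>\<^sup>+ x. ennreal (norm (envelope j0 E x)) \<partial>torus) \<le> (\<integral>\<^sup>+ x. 2 * (?h (- 1) x + ?h 1 x) \<partial>torus)"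
    using le by (intro nn_integral_mono) (simp add: envelope_def)
  also have "\<dots> = 2 * ((\<integral>\<^sup>+ x. ?h (- 1) x \<partial>torus) + (\<integral>\<^sup>+ x. ?h 1 x \<partial>torus))"
    by (subst nn_integral_cmult) (auto simp: nn_integral_add)
  also have "\<dots> < top"
    using fin by (simp add: ennreal_mult_less_top)
  finally show "integrable torus (envelope j0 E)"
    by (intro integrableI_bounded) auto
qed

lemma norm_green_integrand_le:
  assumes "\<epsilon> \<ge> 0" "\<bar>transverse_energy j0 E x\<bar> \<noteq> 1"
  shows "cmod (green_integrand j0 E \<epsilon> n x) \<le> envelope j0 E x"
    and disc_nonzero: "disc (Complex (transverse_energy j0 E x) (- 2 * \<epsilon>)) \<noteq> 0"
proof -
  let ?w = "Complex (transverse_energy j0 E x) (- 2 * \<epsilon>)"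
  let ?d = "sqrt \<bar>1 - transverse_energy j0 E x\<bar> * sqrt \<bar>1 + transverse_energy j0 E x\<bar>"
  have w: "Im ?w \<le> 0" using assms by simp
  have d: "?d > 0" "?d \<le> cmod (disc ?w)"
    using assms(2) norm_disc_ge(1)[OF w] by (auto simp: abs_if split: if_splits)
  then show "disc ?w \<noteq> 0" by auto
  have "cmod (green_integrand j0 E \<epsilon> n x) \<le> 2 / cmod (disc ?w)"
    using norm_green1_le[OF w] by (simp add: green_integrand_def norm_mult)
  also have "\<dots> \<le> 2 / ?d"
    using divide_left_mono[OF d(2) _ mult_pos_pos[OF less_le_trans[OF d] d(1)], of 2] by simp
  finally show "cmod (green_integrand j0 E \<epsilon> n x) \<le> envelope j0 E x"
    by (simp add: envelope_def)
qed

lemma green_integrand_integrable: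
  assumes "E \<notin> \<int>" "\<epsilon> \<ge> 0"
  shows "integrable torus (green_integrand j0 E \<epsilon> n)"
proof (rule Bochner_Integration.integrable_bound[OF envelope_integrable[OF assms(1), of j0]])
  show "AE x in torus. cmod (green_integrand j0 E \<epsilon> n x) \<le> norm (envelope j0 E x)"
    using transverse_energy_AE[OF assms(1), of j0]
  proof eventually_elim
    case (elim x)
    have "envelope j0 E x \<le> norm (envelope j0 E x)"
      unfolding real_norm_def by (rule abs_ge_self)
    then show ?case
      using norm_green_integrand_le(1)[OF assms(2) elim, of n] by (rule order_trans[rotated])
  qed
next
  show "green_integrand j0 E \<epsilon> n \<in> borel_measurable torus"
    by (rule green_integrand_measurable)
qed

lemma norm_green_le:
  assumes "E \<notin> \<int>" "\<epsilon> \<ge> 0"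
  shows "cmod (green j0 E \<epsilon> n) \<le> (LINT x|torus. envelope j0 E x)"
proof -
  have "cmod (green j0 E \<epsilon> n) \<le> (LINT x|torus. cmod (green_integrand j0 E \<epsilon> n x))"
    unfolding green_def by (rule integral_norm_bound)
  also have "\<dots> \<le> (LINT x|torus. envelope j0 E x)"
  proof (rule integral_mono_AE)
    show "AE x in torus. cmod (green_integrand j0 E \<epsilon> n x) \<le> envelope j0 E x"
      using transverse_energy_AE[OF assms(1), of j0]
      by eventually_elim (rule norm_green_integrand_le(1)[OF assms(2)])
  next
    show "integrable torus (\<lambda>x. cmod (green_integrand j0 E \<epsilon> n x))"
      by (intro integrable_norm green_integrand_integrable assms)
  next
    show "integrable torus (envelope j0 E)"
      by (rule envelope_integrable[OF assms(1)])
  qed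
  finally show ?thesis .
qed

lemma green_tendsto:
  assumes E: "E \<notin> \<int>"
  shows "((\<lambda>\<epsilon>. green j0 E \<epsilon> n) \<longlongrightarrow> green j0 E 0 n) (at_right 0)"
  unfolding tendsto_at_iff_sequentially
proof (intro allI impI)
  fix X :: "nat \<Rightarrow> real"
  assume X: "\<forall>i. X i \<in> {0<..} - {0}" "X \<longlonglongrightarrow> 0"
  then have X0: "X i \<ge> 0" for i
    by (simp add: less_imp_le)
  have "(\<lambda>i. LINT x|torus. green_integrand j0 E (X i) n x) \<longlonglongrightarrow> (LINT x|torus. green_integrand j0 E 0 n x)"
  proof (rule integral_dominated_convergence[OF _ _ envelope_integrable[OF E, of j0]])
    show "AE x in torus. cmod (green_integrand j0 E (X i) n x) \<le> envelope j0 E x" for i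
      using transverse_energy_AE[OF E, of j0] by eventually_elim (rule norm_green_integrand_le(1)[OF X0])
    show "AE x in torus. (\<lambda>i. green_integrand j0 E (X i) n x) \<longlonglongrightarrow> green_integrand j0 E 0 n x"
      using transverse_energy_AE[OF E, of j0]
    proof eventually_elim
      case (elim x)
      have w: "(\<lambda>i. Complex (transverse_energy j0 E x) (- 2 * X i)) \<longlonglongrightarrow> Complex (transverse_energy j0 E x) (- 2 * 0)"
        by (intro tendsto_intros X)
      have lim: "(\<lambda>i. f (Complex (transverse_energy j0 E x) (- 2 * X i))) \<longlonglongrightarrow> f (Complex (transverse_energy j0 E x) (- 2 * 0))"
        if "continuous_on UNIV f" for f :: "complex \<Rightarrow> complex"
        using continuous_on_tendsto_compose[OF that w] by simp
      show ?case
        unfolding green_integrand_def green1_def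
        using disc_nonzero[of 0, OF _ elim]
        by (intro tendsto_intros lim continuous_on_roots) auto
    qed
  qed (rule green_integrand_measurable)+
  then show "((\<lambda>\<epsilon>. green j0 E \<epsilon> n) \<circ> X) \<longlonglongrightarrow> green j0 E 0 n"
    by (simp add: green_def o_def)
qed

text \<open>
  Each direction other than \<open>j0\<close> contributes a factor \<open>cos (x j)\<close> to the integrand and thereby turns
  the equation into the one-dimensional one.
\<close>

lemma green_equation:
  fixes j0 :: "'d::finite"
  assumes E: "E \<notin> \<int>" and \<epsilon>: "\<epsilon> > 0"
  shows "H0 (green j0 E \<epsilon>) n - Complex E \<epsilon> * green j0 E \<epsilon> n = site 0 n"
proof -
  let ?g = "\<lambda>n x. green_integrand j0 E \<epsilon> n x"
  note int = green_integrand_integrable[OF E less_imp_le[OF \<epsilon>], of j0]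
  let ?c = "of_nat CARD('d) / 2 - Complex E \<epsilon>"
  have "H0 (green j0 E \<epsilon>) n - Complex E \<epsilon> * green j0 E \<epsilon> n
     = (LINT x|torus. - (1/4) * (\<Sum>j\<in>UNIV. ?g (n + axis j 1) x + ?g (n - axis j 1) x) + ?c * ?g n x)"
    unfolding H0_def green_def using int by (simp add: algebra_simps)
  also have "\<dots> = (LINT x|torus. transverse_phase j0 n x * (if n $ j0 = 0 then 1 else 0))"
  proof (rule integral_cong_AE)
    show "AE x in torus. - (1/4) * (\<Sum>j\<in>UNIV. ?g (n + axis j 1) x + ?g (n - axis j 1) x) + ?c * ?g n x
       = transverse_phase j0 n x * (if n $ j0 = 0 then 1 else 0)"
      using transverse_energy_AE[OF E, of j0]
    proof eventually_elim
      case (elim x)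
      let ?w = "Complex (transverse_energy j0 E x) (- 2 * \<epsilon>)"
      let ?p = "transverse_phase j0 n x"
      let ?k = "n $ j0"
      have other: "?g (n + axis j 1) x + ?g (n - axis j 1) x = 2 * of_real (cos (x j)) * ?g n x" if "j \<noteq> j0" for j
      proof -
        have cos2: "exp (\<i> * of_real (x j)) + exp (- (\<i> * of_real (x j))) = 2 * of_real (cos (x j))"
          by (simp add: cos_exp_eq cos_of_real[symmetric] del: cos_of_real)
        have "transverse_phase j0 (n - axis j 1) x = ?p * exp (- (\<i> * of_real (x j)))"
          using transverse_phase_add[of j0 n "- axis j 1" x] that
          by (simp add: transverse_phase_minus transverse_phase_axis exp_cnj)
        moreover have "transverse_phase j0 (n + axis j 1) x = ?p * exp (\<i> * of_real (x j))"
          using that by (simp add: transverse_phase_add transverse_phase_axis)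
        moreover have "(n + axis j 1) $ j0 = ?k" "(n - axis j 1) $ j0 = ?k"
          using that by (auto simp: axis_def)
        ultimately have "?g (n + axis j 1) x + ?g (n - axis j 1) x
            = (exp (\<i> * of_real (x j)) + exp (- (\<i> * of_real (x j)))) * ?g n x"
          by (simp add: green_integrand_def algebra_simps)
        then show ?thesis
          by (simp only: cos2)
      qed
      have long: "?g (n + axis j0 1) x + ?g (n - axis j0 1) x = ?p * (green1 ?w (?k + 1) + green1 ?w (?k - 1))"
      proof -
        have phase: "transverse_phase j0 (n - axis j0 1) x = ?p" "transverse_phase j0 (n + axis j0 1) x = ?p"
          using transverse_phase_add[of j0 n "- axis j0 1" x] transverse_phase_add[of j0 n "axis j0 1" x]
          by (simp_all add: transverse_phase_minus transverse_phase_axis)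
        have "(n + axis j0 1) $ j0 = ?k + 1" "(n - axis j0 1) $ j0 = ?k - 1"
          by (simp_all add: axis_def)
        then show ?thesis
          by (simp only: green_integrand_def phase distrib_left)
      qed
      have "(\<Sum>j\<in>UNIV. ?g (n + axis j 1) x + ?g (n - axis j 1) x)
        = ?p * (green1 ?w (?k + 1) + green1 ?w (?k - 1)) + (\<Sum>j\<in>UNIV - {j0}. 2 * of_real (cos (x j)) * ?g n x)"
        by (subst sum.remove[of _ j0]) (auto simp: long other intro!: sum.cong)
      also have "(\<Sum>j\<in>UNIV - {j0}. 2 * of_real (cos (x j)) * ?g n x)
         = 2 * of_real (\<Sum>j\<in>UNIV - {j0}. cos (x j)) * (?p * green1 ?w ?k)"
        by (simp add: sum_distrib_left sum_distrib_right green_integrand_def)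
      also have "of_real (\<Sum>j\<in>UNIV - {j0}. cos (x j)) = 2 * ?c - ?w"
        by (simp add: transverse_energy_def complex_eq_iff)
      finally have S: "(\<Sum>j\<in>UNIV. ?g (n + axis j 1) x + ?g (n - axis j 1) x)
        = ?p * (green1 ?w (?k + 1) + green1 ?w (?k - 1)) + 2 * (2 * ?c - ?w) * (?p * green1 ?w ?k)" .
      have "- (1/4) * (\<Sum>j\<in>UNIV. ?g (n + axis j 1) x + ?g (n - axis j 1) x) + ?c * ?g n x
        = ?p * (- (1/4) * (green1 ?w (?k + 1) + green1 ?w (?k - 1)) + ?w / 2 * green1 ?w ?k)"
        unfolding S by (simp add: green_integrand_def field_simps)
      also have "\<dots> = ?p * (if ?k = 0 then 1 else 0)"
        using \<epsilon> disc_nonzero[OF less_imp_le[OF \<epsilon>] elim] by (subst green1_equation) auto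
      finally show ?case .
    qed
  next
    have [measurable]: "green_integrand j0 E \<epsilon> m \<in> borel_measurable torus" for m
      by (rule green_integrand_measurable)
    show "(\<lambda>x. - (1/4) * (\<Sum>j\<in>UNIV. ?g (n + axis j 1) x + ?g (n - axis j 1) x) + ?c * ?g n x) \<in> borel_measurable torus"
      by measurable
    show "(\<lambda>x. transverse_phase j0 n x * (if n $ j0 = 0 then 1 else 0)) \<in> borel_measurable torus"
      by (simp add: transverse_measurable(2))
  qed
  also have "\<dots> = (LINT x|torus. transverse_phase j0 n x) * (if n $ j0 = 0 then 1 else 0)"
    by simp
  also have "\<dots> = site 0 n"
    unfolding transverse_phase_integral by (auto simp: site_def vec_eq_iff)
  finally show ?thesis .
qed

text \<open>On one slice the transverse characters are orthonormal, so that this is Bessel's inequality.\<close>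

lemma bessel_slice:
  assumes F: "finite F" "\<And>n. n \<in> F \<Longrightarrow> n $ j0 = k"
    and \<Phi> [measurable]: "\<Phi> \<in> borel_measurable torus" and B: "\<And>x. cmod (\<Phi> x) \<le> B"
  shows "(\<Sum>n\<in>F. (cmod (LINT x|torus. transverse_phase j0 n x * \<Phi> x))\<^sup>2) \<le> B\<^sup>2"
proof -
  let ?e = "transverse_phase j0"
  define c where "c n = (LINT x|torus. ?e n x * \<Phi> x)" for n
  define T where "T x = (\<Sum>n\<in>F. c n * cnj (?e n x))" for x
  have [measurable]: "T \<in> borel_measurable torus"
    unfolding T_def by measurable
  have B0: "B \<ge> 0"
    using B norm_ge_zero order_trans by blast
  have bT: "cmod (T x) \<le> (\<Sum>n\<in>F. cmod (c n))" for x
    unfolding T_def by (rule sum_norm_le) (simp add: norm_mult)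
  have int: "integrable torus f" if "f \<in> borel_measurable torus" "\<And>x. cmod (f x) \<le> C" for f :: "('a \<Rightarrow> real) \<Rightarrow> complex" and C
    using that by (intro torus.integrable_const_bound[of _ C]) auto
  have ie\<Phi>: "integrable torus (\<lambda>x. ?e n x * \<Phi> x)" for n
    using B by (intro int[of _ B]) (auto simp: norm_mult)
  have iee: "integrable torus (\<lambda>x. ?e m x * cnj (?e n x))" for m n
    by (intro int[of _ 1]) (auto simp: norm_mult)
  have i1: "integrable torus (\<lambda>x. cnj (T x) * \<Phi> x)"
    using bT B by (intro int[of _ "(\<Sum>n\<in>F. cmod (c n)) * B"]) (auto simp: norm_mult intro!: mult_mono sum_nonneg)
  have i2: "integrable torus (\<lambda>x. cnj (T x) * T x)"
    using bT by (intro int[of _ "(\<Sum>n\<in>F. cmod (c n)) * (\<Sum>n\<in>F. cmod (c n))"]) (auto simp: norm_mult intro!: mult_mono sum_nonneg)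
  have i3: "integrable torus (\<lambda>x. cnj (\<Phi> x) * \<Phi> x)"
    using B B0 by (intro int[of _ "B * B"]) (auto simp: norm_mult intro!: mult_mono)
  have orth: "(LINT x|torus. ?e m x * cnj (?e n x)) = (if m = n then 1 else 0)" if "m \<in> F" "n \<in> F" for m n
  proof -
    have "(LINT x|torus. ?e m x * cnj (?e n x)) = (LINT x|torus. ?e (m - n) x)"
      using transverse_phase_add[of j0 m "- n"] by (simp add: transverse_phase_minus)
    also have "\<dots> = (if m = n then 1 else 0)"
      unfolding transverse_phase_integral using F(2)[OF that(1)] F(2)[OF that(2)] by (auto simp: vec_eq_iff) metis
    finally show ?thesis .
  qed
  let ?S = "\<Sum>n\<in>F. (cmod (c n))\<^sup>2"
  have "(LINT x|torus. cnj (T x) * \<Phi> x) = (LINT x|torus. (\<Sum>n\<in>F. cnj (c n) * (?e n x * \<Phi> x)))"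
    by (simp add: T_def sum_distrib_right mult.assoc)
  also have "\<dots> = (\<Sum>n\<in>F. cnj (c n) * c n)"
    using ie\<Phi> by (simp add: c_def)
  also have "\<dots> = of_real ?S"
    by (simp add: complex_norm_square mult.commute del: of_real_power)
  finally have T\<Phi>: "(LINT x|torus. cnj (T x) * \<Phi> x) = of_real ?S" .
  have "(LINT x|torus. cnj (T x) * T x) = (LINT x|torus. (\<Sum>m\<in>F. \<Sum>n\<in>F. cnj (c m) * c n * (?e m x * cnj (?e n x))))"
    by (simp only: T_def cnj_sum complex_cnj_mult complex_cnj_cnj sum_product) (simp add: mult_ac)
  also have "\<dots> = (\<Sum>m\<in>F. \<Sum>n\<in>F. cnj (c m) * c n * (LINT x|torus. ?e m x * cnj (?e n x)))"
    using iee by simp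
  also have "\<dots> = (\<Sum>m\<in>F. \<Sum>n\<in>F. if n = m then cnj (c m) * c m else 0)"
    by (intro sum.cong refl) (auto simp: orth)
  also have "\<dots> = of_real ?S"
    using F(1) by (simp add: complex_norm_square mult.commute del: of_real_power)
  finally have TT: "(LINT x|torus. cnj (T x) * T x) = of_real ?S" .
  have "of_real ?S = (LINT x|torus. cnj (cnj (T x) * \<Phi> x))"
    by (simp only: Bochner_Integration.integral_cnj T\<Phi> complex_cnj_complex_of_real)
  then have \<Phi>T: "(LINT x|torus. cnj (\<Phi> x) * T x) = of_real ?S"
    by (simp add: mult.commute)
  have i4: "integrable torus (\<lambda>x. cnj (\<Phi> x) * T x)"
    using bT B B0 by (intro int[of _ "B * (\<Sum>n\<in>F. cmod (c n))"]) (auto simp: norm_mult intro!: mult_mono)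
  have "(LINT x|torus. of_real ((cmod (\<Phi> x - T x))\<^sup>2))
     = (LINT x|torus. cnj (\<Phi> x) * \<Phi> x - cnj (\<Phi> x) * T x - cnj (T x) * \<Phi> x + cnj (T x) * T x)"
    by (simp add: complex_norm_square algebra_simps del: of_real_power)
  also have "\<dots> = (LINT x|torus. cnj (\<Phi> x) * \<Phi> x) - of_real ?S - of_real ?S + of_real ?S"
    using i1 i2 i3 i4 by (simp add: T\<Phi> \<Phi>T TT)
  also have "(LINT x|torus. cnj (\<Phi> x) * \<Phi> x) = (LINT x|torus. complex_of_real ((cmod (\<Phi> x))\<^sup>2))"
    by (simp add: complex_norm_square mult.commute del: of_real_power)
  finally have "complex_of_real (LINT x|torus. (cmod (\<Phi> x - T x))\<^sup>2) = of_real ((LINT x|torus. (cmod (\<Phi> x))\<^sup>2) - ?S)"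
    by (simp only: integral_complex_of_real of_real_diff diff_add_cancel)
  then have "(LINT x|torus. (cmod (\<Phi> x))\<^sup>2) - ?S = (LINT x|torus. (cmod (\<Phi> x - T x))\<^sup>2)"
    by (simp only: of_real_eq_iff)
  also have "\<dots> \<ge> 0"
    by (intro integral_nonneg_AE) auto
  finally have "?S \<le> (LINT x|torus. (cmod (\<Phi> x))\<^sup>2)"
    by simp
  also have "\<dots> \<le> (LINT x|(torus :: ('a \<Rightarrow> real) measure). B\<^sup>2)"
  proof (rule Bochner_Integration.integral_mono)
    show "integrable torus (\<lambda>x. (cmod (\<Phi> x))\<^sup>2)"
      using B B0 by (intro torus.integrable_const_bound[of _ "B\<^sup>2"]) (auto intro!: power_mono)
  qed (use B in \<open>auto intro!: power_mono\<close>)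
  also have "\<dots> = B\<^sup>2"
    by (simp add: measure_def emeasure_torus)
  finally show ?thesis
    by (simp add: c_def)
qed

lemma transverse_energy_bounded: "\<bar>transverse_energy j0 E x\<bar> \<le> 2 * real CARD('d) + 2 * \<bar>E\<bar>"
  for j0 :: "'d::finite"
proof -
  have "\<bar>\<Sum>j\<in>UNIV - {j0}. cos (x j)\<bar> \<le> (\<Sum>j\<in>UNIV - {j0}. 1)"
    by (rule order_trans[OF sum_abs sum_mono]) simp
  also have "\<dots> \<le> real CARD('d)"
    by (simp add: card_mono)
  finally show ?thesis
    unfolding transverse_energy_def by linarith
qed

lemma decay_uniform:
  assumes \<epsilon>: "\<epsilon> > 0"
  obtains \<rho> where "0 \<le> \<rho>" "\<rho> < 1" "\<And>x. cmod (decay (Complex (transverse_energy j0 E x) (- 2 * \<epsilon>))) \<le> \<rho>"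
proof -
  let ?L = "2 * real CARD('a) + 2 * \<bar>E\<bar>"
  let ?f = "\<lambda>s. cmod (decay (Complex s (- 2 * \<epsilon>)))"
  have "continuous_on {- ?L..?L} ?f"
    unfolding complex_eq
    by (intro continuous_intros continuous_on_compose2[OF continuous_on_roots(4)[of UNIV]]) auto
  moreover have "{- ?L..?L} \<noteq> {}" by simp
  ultimately obtain s0 where s0: "\<And>s. s \<in> {- ?L..?L} \<Longrightarrow> ?f s \<le> ?f s0"
    using continuous_attains_sup[OF compact_Icc, of "- ?L" ?L ?f] by blast
  show ?thesis
  proof (rule that[of "?f s0"])
    show "?f s0 < 1"
      using \<epsilon> by (intro norm_decay_less) auto
    show "?f (transverse_energy j0 E x) \<le> ?f s0" for x
      using transverse_energy_bounded[of j0 E x] by (intro s0) (auto simp: abs_le_iff)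
  qed simp
qed

text \<open>
  Bessel's inequality on each slice, together with geometric decay from slice to slice; the rate
  \<open>\<rho> < 1\<close> is uniform in the transverse momentum by compactness.
\<close>

lemma green_l2:
  assumes \<epsilon>: "\<epsilon> > 0"
  shows "green j0 E \<epsilon> \<in> l2"
proof -
  obtain \<rho> where \<rho>: "0 \<le> \<rho>" "\<rho> < 1" "\<And>x. cmod (decay (Complex (transverse_energy j0 E x) (- 2 * \<epsilon>))) \<le> \<rho>"
    using decay_uniform[OF \<epsilon>] by blast
  let ?W = "\<lambda>k::int. (\<rho>\<^sup>2) ^ nat \<bar>k\<bar>"
  have geo: "(\<lambda>m::nat. (\<rho>\<^sup>2) ^ m) summable_on UNIV"
    using \<rho> by (intro summable_on_UNIV_nonneg_real_iff[THEN iffD2] summable_geometric)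
      (auto simp: abs_square_less_1)
  have W: "?W summable_on UNIV"
  proof -
    have "?W summable_on range int"
      by (subst summable_on_reindex) (use geo in \<open>auto simp: o_def\<close>)
    moreover have "?W summable_on range (\<lambda>k. - int k)"
      by (subst summable_on_reindex) (use geo in \<open>auto simp: o_def inj_def\<close>)
    moreover have "UNIV = range int \<union> range (\<lambda>k. - int k)"
    proof -
      have "i \<in> range int \<union> range (\<lambda>k. - int k)" for i :: int
        by (cases i rule: int_cases2) auto
      then show ?thesis by blast
    qed
    ultimately show ?thesis
      using summable_on_union by metis
  qed
  have slice: "(\<Sum>n\<in>F. (cmod (green j0 E \<epsilon> n))\<^sup>2) \<le> ?W k * (1 / \<epsilon>)\<^sup>2"
    if F: "finite F" "\<And>n. n \<in> F \<Longrightarrow> n $ j0 = k" for F k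
  proof -
    let ?\<Phi> = "\<lambda>x. green1 (Complex (transverse_energy j0 E x) (- 2 * \<epsilon>)) k"
    have "cmod (?\<Phi> x) \<le> \<rho> ^ nat \<bar>k\<bar> * (1 / \<epsilon>)" for x
    proof -
      let ?w = "Complex (transverse_energy j0 E x) (- 2 * \<epsilon>)"
      have "2 * \<epsilon> \<le> cmod (disc ?w)"
        using norm_disc_ge(2)[of ?w] \<epsilon> by simp
      then have "2 / cmod (disc ?w) \<le> 2 / (2 * \<epsilon>)"
        using \<epsilon> by (intro frac_le) auto
      then have "2 / cmod (disc ?w) \<le> 1 / \<epsilon>"
        by simp
      moreover have "cmod (decay ?w) ^ nat \<bar>k\<bar> \<le> \<rho> ^ nat \<bar>k\<bar>"
        using \<rho>(3) by (intro power_mono) auto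
      ultimately have "cmod (decay ?w) ^ nat \<bar>k\<bar> * (2 / cmod (disc ?w)) \<le> \<rho> ^ nat \<bar>k\<bar> * (1 / \<epsilon>)"
        using \<rho>(1) by (intro mult_mono) auto
      then show ?thesis
        by (simp add: green1_def norm_divide norm_mult norm_power mult.commute)
    qed
    from bessel_slice[OF F _ this] have "(\<Sum>n\<in>F. (cmod (LINT x|torus. transverse_phase j0 n x * ?\<Phi> x))\<^sup>2) \<le> (\<rho> ^ nat \<bar>k\<bar> * (1 / \<epsilon>))\<^sup>2"
      by measurable
    moreover have "green j0 E \<epsilon> n = (LINT x|torus. transverse_phase j0 n x * ?\<Phi> x)" if "n \<in> F" for n
      using F(2)[OF that] by (simp add: green_def green_integrand_def)
    ultimately show ?thesis
      by (simp add: power_mult_distrib power_divide power_mult[symmetric] mult.commute)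
  qed
  have "(\<Sum>n\<in>F. (cmod (green j0 E \<epsilon> n))\<^sup>2) \<le> infsum ?W UNIV * (1 / \<epsilon>)\<^sup>2" if F: "finite F" for F
  proof -
    let ?K = "(\<lambda>n. n $ j0) ` F"
    have "(\<Sum>n\<in>F. (cmod (green j0 E \<epsilon> n))\<^sup>2) = (\<Sum>k\<in>?K. \<Sum>n\<in>{n \<in> F. n $ j0 = k}. (cmod (green j0 E \<epsilon> n))\<^sup>2)"
      using F by (rule sum.image_gen)
    also have "\<dots> \<le> (\<Sum>k\<in>?K. ?W k * (1 / \<epsilon>)\<^sup>2)"
      using F by (intro sum_mono slice) auto
    also have "\<dots> = (\<Sum>k\<in>?K. ?W k) * (1 / \<epsilon>)\<^sup>2"
      by (simp add: sum_distrib_right)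
    also have "\<dots> \<le> infsum ?W UNIV * (1 / \<epsilon>)\<^sup>2"
      using F W \<rho> by (intro mult_right_mono finite_sum_le_infsum) auto
    finally show ?thesis .
  qed
  then show ?thesis
    by (intro CollectI nonneg_bdd_above_summable_on) (auto intro!: bdd_aboveI)
qed

lemma free_resolvent_kernel:
  assumes E: "E \<notin> \<int>" and \<epsilon>: "\<epsilon> > 0"
  shows "resolvent (\<lambda>_. 0) (Complex E \<epsilon>) (site n) = (\<lambda>m. green j0 E \<epsilon> (m - n))"
proof (rule resolvent_eqI)
  show "(\<lambda>m. green j0 E \<epsilon> (m - n)) \<in> l2"
    using l2_shift_nrm(1)[of "green j0 E \<epsilon>" "- n"] green_l2[OF \<epsilon>, of j0 E] by simp
  have "H0 (\<lambda>m. f (m - n)) m = H0 f (m - n)" for f m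
    by (simp add: H0_def algebra_simps)
  then show "Hop (\<lambda>_. 0) (\<lambda>m. green j0 E \<epsilon> (m - n)) m - Complex E \<epsilon> * green j0 E \<epsilon> (m - n) = site n m" for m
    using green_equation[OF E \<epsilon>, of j0 "m - n"] by (simp add: Hop_0 site_def)
  show "site n \<in> l2"
    by (rule site_l2)
qed (use \<epsilon> in simp_all)

section \<open>Division by the symbol\<close>

abbreviation near :: "('d \<Rightarrow> real) \<Rightarrow> real \<Rightarrow> ('d \<Rightarrow> real) \<Rightarrow> bool" where
  "near x0 \<rho> x \<equiv> (\<forall>j. \<bar>x j - x0 j\<bar> < \<rho>)"

subsection \<open>Plane waves on the energy surface\<close>

text \<open>
  \<open>exp (\<i> n \<cdot> x)\<close> at the point of the energy surface above the transverse momentum \<open>x\<close>.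
\<close>

definition plane_wave :: "'d \<Rightarrow> real \<Rightarrow> ('d::finite \<Rightarrow> real) \<Rightarrow> int ^ 'd \<Rightarrow> complex" where
  "plane_wave j0 E x n = transverse_phase j0 n x * cis (of_int (n $ j0) * arccos (transverse_energy j0 E x))"

lemma transverse_phase_shift:
  "transverse_phase j0 (n + axis j 1) x = transverse_phase j0 n x * (if j = j0 then 1 else cis (x j))"
  "transverse_phase j0 (n - axis j 1) x = transverse_phase j0 n x * (if j = j0 then 1 else cis (- x j))"
proof -
  show "transverse_phase j0 (n + axis j 1) x = transverse_phase j0 n x * (if j = j0 then 1 else cis (x j))"
    by (simp add: transverse_phase_add transverse_phase_axis cis_conv_exp)
  show "transverse_phase j0 (n - axis j 1) x = transverse_phase j0 n x * (if j = j0 then 1 else cis (- x j))"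
    using transverse_phase_add[of j0 n "- axis j 1" x]
    by (simp add: transverse_phase_minus transverse_phase_axis cis_conv_exp exp_cnj)
qed

lemma plane_wave_eigenfunction:
  fixes j0 :: "'d::finite"
  assumes "\<bar>transverse_energy j0 E x\<bar> \<le> 1"
  shows "H0 (plane_wave j0 E x) n = of_real E * plane_wave j0 E x n"
proof -
  let ?\<theta> = "arccos (transverse_energy j0 E x)"
  let ?u = "plane_wave j0 E x"
  have cis2: "cis t + cis (- t) = 2 * of_real (cos t)" for t
    by (simp add: complex_eq_iff)
  have 1: "?u (n + axis j 1) + ?u (n - axis j 1) = 2 * of_real (cos (x j)) * ?u n" if "j \<noteq> j0" for j
  proof -
    have "?u (n + axis j 1) + ?u (n - axis j 1) = ?u n * (cis (x j) + cis (- x j))"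
      using that unfolding plane_wave_def transverse_phase_shift by (simp add: axis_def algebra_simps)
    then show ?thesis by (simp add: cis2)
  qed
  have 2: "?u (n + axis j0 1) + ?u (n - axis j0 1) = 2 * of_real (cos ?\<theta>) * ?u n"
  proof -
    have "?u (n + axis j0 1) + ?u (n - axis j0 1) = ?u n * (cis ?\<theta> + cis (- ?\<theta>))"
      unfolding plane_wave_def transverse_phase_shift
      by (simp add: axis_def cis_mult algebra_simps)
    then show ?thesis by (simp add: cis2)
  qed
  have "(\<Sum>j\<in>UNIV. ?u (n + axis j 1) + ?u (n - axis j 1))
     = 2 * of_real (cos ?\<theta>) * ?u n + (\<Sum>j\<in>UNIV - {j0}. 2 * of_real (cos (x j)) * ?u n)"
    by (subst sum.remove[of _ j0]) (auto simp: 1 2 intro!: sum.cong)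
  also have "\<dots> = 2 * of_real (cos ?\<theta> + (\<Sum>j\<in>UNIV - {j0}. cos (x j))) * ?u n"
    by (simp add: algebra_simps sum_distrib_left sum_distrib_right)
  also have "cos ?\<theta> + (\<Sum>j\<in>UNIV - {j0}. cos (x j)) = real CARD('d) - 2 * E"
    using assms by (simp add: cos_arccos_abs) (simp add: transverse_energy_def)
  finally have S: "(\<Sum>j\<in>UNIV. ?u (n + axis j 1) + ?u (n - axis j 1)) = 2 * of_real (real CARD('d) - 2 * E) * ?u n" .
  show ?thesis
    unfolding H0_def S by (simp add: field_simps)
qed

subsection \<open>Finitely supported sequences modulo the range of \<open>H0 - E\<close>\<close>

lemma finite_support_lin:
  fixes f g :: "'a \<Rightarrow> complex"
  assumes "finite {n. f n \<noteq> 0}" "finite {n. g n \<noteq> 0}"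
  shows "finite {n. a * f n + b * g n \<noteq> 0}"
  by (rule finite_subset[OF _ finite_UnI[OF assms]]) auto

lemma finite_support_Hop:
  fixes f :: "int ^ 'd::finite \<Rightarrow> complex"
  assumes "finite {n. f n \<noteq> 0}"
  shows "finite {n. Hop V f n \<noteq> 0}"
proof -
  let ?S = "{n. f n \<noteq> 0}"
  let ?U = "?S \<union> (\<Union>j\<in>UNIV. (\<lambda>n. n - axis j 1) ` ?S \<union> (\<lambda>n. n + axis j 1) ` ?S)"
  have "n \<in> ?U" if "Hop V f n \<noteq> 0" for n
  proof (rule ccontr)
    assume n: "n \<notin> ?U"
    have "f (n + axis j 1) = 0" "f (n - axis j 1) = 0" for j
    proof -
      show "f (n + axis j 1) = 0"
      proof (rule ccontr)
        assume "f (n + axis j 1) \<noteq> 0"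
        then have "n \<in> (\<lambda>n. n - axis j 1) ` ?S"
          by (intro image_eqI[of _ _ "n + axis j 1"]) auto
        with n show False by blast
      qed
      show "f (n - axis j 1) = 0"
      proof (rule ccontr)
        assume "f (n - axis j 1) \<noteq> 0"
        then have "n \<in> (\<lambda>n. n + axis j 1) ` ?S"
          by (intro image_eqI[of _ _ "n - axis j 1"]) auto
        with n show False by blast
      qed
    qed
    moreover have "f n = 0"
      using n by auto
    ultimately show False
      using that by (simp add: Hop_eq)
  qed
  then have "{n. Hop V f n \<noteq> 0} \<subseteq> ?U"
    by blast
  moreover have "finite ?U"
    using assms by simp
  ultimately show ?thesis
    by (rule finite_subset)
qed

text \<open>
  Congruent modulo \<open>(H0 - E) v\<close> to a sequence on the two slices \<open>n $ j0 = 0\<close> and \<open>n $ j0 = 1\<close>. In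
  Fourier space this is polynomial division by the symbol in the variable \<open>exp (\<i> x\<^bsub>j0\<^esub>)\<close>.
\<close>

definition slice_reducible :: "'d \<Rightarrow> real \<Rightarrow> (int ^ 'd::finite \<Rightarrow> complex) \<Rightarrow> bool" where
  "slice_reducible j0 E c \<longleftrightarrow> (\<exists>v. finite {n. v n \<noteq> 0} \<and>
     (\<forall>n. n $ j0 \<noteq> 0 \<longrightarrow> n $ j0 \<noteq> 1 \<longrightarrow> H0 v n - of_real E * v n = c n))"

lemma slice_reducible_lin:
  assumes "slice_reducible j0 E f" "slice_reducible j0 E g"
  shows "slice_reducible j0 E (\<lambda>n. a * f n + b * g n)"
proof -
  obtain v w where v: "finite {n. v n \<noteq> 0}" "finite {n. w n \<noteq> 0}"
    "\<And>n. n $ j0 \<noteq> 0 \<Longrightarrow> n $ j0 \<noteq> 1 \<Longrightarrow> H0 v n - of_real E * v n = f n"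
    "\<And>n. n $ j0 \<noteq> 0 \<Longrightarrow> n $ j0 \<noteq> 1 \<Longrightarrow> H0 w n - of_real E * w n = g n"
    using assms unfolding slice_reducible_def by metis
  have "H0 (\<lambda>n. a * v n + b * w n) n - of_real E * (a * v n + b * w n) = a * f n + b * g n"
    if "n $ j0 \<noteq> 0" "n $ j0 \<noteq> 1" for n
    unfolding H0_lin v(3,4)[OF that, symmetric] by (simp add: algebra_simps)
  then show ?thesis
    unfolding slice_reducible_def using finite_support_lin[OF v(1,2), of a b]
    by (intro exI[of _ "\<lambda>n. a * v n + b * w n"]) blast
qed

lemma slice_reducible_0: "slice_reducible j0 E (\<lambda>_. 0)"
  unfolding slice_reducible_def by (intro exI[of _ "\<lambda>_. 0"]) (simp add: H0_def)

lemma slice_reducible_sum: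
  assumes "finite I" "\<And>i. i \<in> I \<Longrightarrow> slice_reducible j0 E (f i)"
  shows "slice_reducible j0 E (\<lambda>n. \<Sum>i\<in>I. a i * f i n)"
  using assms
proof (induction I rule: finite_induct)
  case empty
  then show ?case by (simp add: slice_reducible_0)
next
  case (insert i I)
  then have "slice_reducible j0 E (\<lambda>n. a i * f i n + 1 * (\<Sum>i\<in>I. a i * f i n))"
    by (intro slice_reducible_lin) auto
  then show ?case
    using insert by simp
qed

lemma H0_site:
  fixes m :: "int ^ 'd::finite"
  shows "H0 (site m) n = - (1 / 4) * (\<Sum>j\<in>UNIV. site (m - axis j 1) n + site (m + axis j 1) n)
            + of_nat CARD('d) / 2 * site m n"
  unfolding H0_def site_def by (simp add: algebra_simps)

text \<open>
  The equation at \<open>m\<close> expresses the site \<open>m + axis j0 1\<close>, modulo the range of \<open>H0 - E\<close>, by sites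
  on the two slices before it, and \<open>m - axis j0 1\<close> by sites on the two slices after it.
\<close>

lemma slice_reducible_step:
  fixes m :: "int ^ 'd::finite"
  assumes \<sigma>: "\<sigma> = 1 \<or> \<sigma> = - 1"
    and m: "slice_reducible j0 E (site m)" "slice_reducible j0 E (site (m - \<sigma> *s axis j0 1))"
    and others: "\<And>j. j \<noteq> j0 \<Longrightarrow> slice_reducible j0 E (site (m + axis j 1)) \<and> slice_reducible j0 E (site (m - axis j 1))"
  shows "slice_reducible j0 E (site (m + \<sigma> *s axis j0 1))"
proof -
  let ?L = "\<lambda>n. H0 (site m) n - of_real E * site m n"
  have L: "slice_reducible j0 E ?L"
    unfolding slice_reducible_def by (intro exI[of _ "site m"]) simp
  let ?T = "\<lambda>n. \<Sum>j\<in>UNIV - {j0}. 1 * (1 * site (m - axis j 1) n + 1 * site (m + axis j 1) n)"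
  have T: "slice_reducible j0 E ?T"
    using others by (intro slice_reducible_sum slice_reducible_lin) auto
  let ?S = "\<lambda>n. (- 4) * ?L n + 1 * ((- 1) * ?T n + 1 * ((- 1) * site (m - \<sigma> *s axis j0 1) n
      + (4 * (of_nat CARD('d) / 2 - of_real E)) * site m n))"
  have "slice_reducible j0 E ?S"
    by (intro slice_reducible_lin L T m)
  moreover have "?S n = site (m + \<sigma> *s axis j0 1) n" for n
  proof -
    have "(\<Sum>j\<in>UNIV. site (m - axis j 1) n + site (m + axis j 1) n)
       = site (m - axis j0 1) n + site (m + axis j0 1) n + ?T n"
      by (subst sum.remove[of _ j0]) auto
    also have "site (m - axis j0 1) n + site (m + axis j0 1) n
       = site (m - \<sigma> *s axis j0 1) n + site (m + \<sigma> *s axis j0 1) n"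
      using \<sigma> by (auto simp: vector_sneg_minus1[symmetric])
    finally show ?thesis
      unfolding H0_site by (simp add: algebra_simps)
  qed
  ultimately show ?thesis by (simp only:)
qed

lemma slice_reducible_site: "slice_reducible j0 E (site n)"
proof (induction "nat \<bar>2 * n $ j0 - 1\<bar>" arbitrary: n rule: less_induct)
  case less
  consider "n $ j0 = 0 \<or> n $ j0 = 1" | "n $ j0 \<ge> 2" | "n $ j0 < 0" by linarith
  then show ?case
  proof cases
    case 1
    then show ?thesis
      unfolding slice_reducible_def by (intro exI[of _ "\<lambda>_. 0"]) (auto simp: H0_def site_def)
  next
    case 2
    define m where "m = n - axis j0 1"
    have n: "n = m + 1 *s axis j0 1"
      by (simp add: m_def)
    have m: "m $ j0 = n $ j0 - 1"
      by (simp add: m_def axis_def)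
    show ?thesis
      unfolding n using 2 m by (intro slice_reducible_step) (auto intro!: less simp: axis_def)
  next
    case 3
    define m where "m = n + axis j0 1"
    have n: "n = m + (- 1) *s axis j0 1"
      by (simp add: m_def vector_sneg_minus1[symmetric])
    have m: "m $ j0 = n $ j0 + 1"
      by (simp add: m_def axis_def)
    show ?thesis
      unfolding n using 3 m by (intro slice_reducible_step) (auto intro!: less simp: axis_def)
  qed
qed

lemma slice_reducible_all:
  assumes c: "finite {n. c n \<noteq> 0}"
  shows "slice_reducible j0 E c"
proof -
  have "slice_reducible j0 E (\<lambda>n. \<Sum>m | c m \<noteq> 0. c m * site m n)"
    by (intro slice_reducible_sum c slice_reducible_site)
  moreover have "(\<Sum>m | c m \<noteq> 0. c m * site m n) = c n" for n
  proof -
    have "(\<Sum>m | c m \<noteq> 0. c m * site m n) = (\<Sum>m | c m \<noteq> 0. if m = n then c m else 0)"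
      by (intro sum.cong) (auto simp: site_def)
    then show ?thesis
      using c by (simp add: sum.delta)
  qed
  ultimately show ?thesis by (simp only:)
qed

subsection \<open>The discriminant is not a square\<close>

lemma quadratic_simple_root:
  fixes \<mu> :: complex
  assumes "\<mu>\<^sup>2 \<noteq> 4"
  obtains a where "a * (\<mu> - a) = 1" "a \<noteq> \<mu> - a"
proof
  let ?r = "csqrt (\<mu>\<^sup>2 - 4)"
  have r: "?r * ?r = \<mu>\<^sup>2 - 4"
    using power2_csqrt[of "\<mu>\<^sup>2 - 4"] by (simp add: power2_eq_square)
  show "(\<mu> + ?r) / 2 * (\<mu> - (\<mu> + ?r) / 2) = 1"
    using r by (simp add: field_simps power2_eq_square)
  show "(\<mu> + ?r) / 2 \<noteq> \<mu> - (\<mu> + ?r) / 2"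
    using assms by (auto simp: field_simps)
qed

text \<open>
  At \<open>a\<close> the left side vanishes to even order and the right side to odd order.
\<close>

lemma odd_order_not_square:
  fixes p M q :: "complex poly"
  assumes eq: "p\<^sup>2 = [:- a, 1:] * M * q\<^sup>2" and M: "poly M a \<noteq> 0"
  shows "q = 0"
proof (rule ccontr)
  assume q: "q \<noteq> 0"
  have M0: "M \<noteq> 0"
    using M by auto
  have ne: "[:- a, 1:] * M * q\<^sup>2 \<noteq> 0"
    using q M0 unfolding mult_eq_0_iff power_eq_0_iff by simp
  then have p: "p \<noteq> 0"
    using eq by auto
  have "order a (p\<^sup>2) = 2 * order a p"
    using p by (simp add: power2_eq_square order_mult)
  moreover have "order a ([:- a, 1:] * M * q\<^sup>2) = order a [:- a, 1:] + order a M + 2 * order a q"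
    using ne q M0 by (simp add: order_mult power2_eq_square del: mult_pCons_left)
  moreover have "order a [:- a, 1:] = 1"
    using order_power_n_n[of a 1] by simp
  moreover have "order a M = 0"
    using M by (simp add: order_root)
  ultimately have "2 * order a p = 1 + 2 * order a q"
    using eq by simp
  then show False by presburger
qed

text \<open>
  With \<open>2 s = \<kappa> - z - 1 / z\<close> the equation \<open>B\<^sup>2 + 2 s A B + A\<^sup>2 = 0\<close> would make the discriminant
  \<open>s\<^sup>2 - 1\<close> a square of rational functions in \<open>z\<close>, although for \<open>\<kappa> \<noteq> 0\<close> it has a simple zero.
\<close>

lemma quadratic_relation_trivial:
  fixes \<kappa> :: complex and A B :: "complex poly"
  assumes \<kappa>: "\<kappa> \<noteq> 0"
    and rel: "[:0, 1:] * B\<^sup>2 + [:- 1, \<kappa>, - 1:] * (A * B) + [:0, 1:] * A\<^sup>2 = 0"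
  shows "A = 0" "B = 0"
proof -
  let ?X = "[:0, 1:] :: complex poly" and ?\<sigma> = "[:- 1, \<kappa>, - 1:]"
  have "(2 * X * B + S * A)\<^sup>2 = 4 * X * (X * B\<^sup>2 + S * (A * B) + X * A\<^sup>2) + (S\<^sup>2 - 4 * X\<^sup>2) * A\<^sup>2"
    for X S :: "complex poly"
    by algebra
  then have "(2 * ?X * B + ?\<sigma> * A)\<^sup>2
     = 4 * ?X * (?X * B\<^sup>2 + ?\<sigma> * (A * B) + ?X * A\<^sup>2) + (?\<sigma>\<^sup>2 - 4 * ?X\<^sup>2) * A\<^sup>2" .
  then have sq: "(2 * ?X * B + ?\<sigma> * A)\<^sup>2 = (?\<sigma>\<^sup>2 - 4 * ?X\<^sup>2) * A\<^sup>2"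
    unfolding rel by simp
  have "\<exists>a M. ?\<sigma>\<^sup>2 - 4 * ?X\<^sup>2 = [:- a, 1:] * M \<and> poly M a \<noteq> 0"
  proof -
    define \<tau> where "\<tau> = (if \<kappa> = 4 then - 1 else (1::complex))"
    have \<tau>: "\<tau> * \<tau> = 1"
      by (simp add: \<tau>_def)
    define \<mu> where "\<mu> = \<kappa> - 2 * \<tau>"
    have "\<mu>\<^sup>2 - 4 = \<kappa> * (\<kappa> - 4 * \<tau>)"
      using \<tau> by (simp add: \<mu>_def power2_eq_square algebra_simps)
    moreover have "\<kappa> - 4 * \<tau> \<noteq> 0"
      by (auto simp: \<tau>_def)
    ultimately have "\<mu>\<^sup>2 \<noteq> 4"
      using \<kappa> by auto
    then obtain a where a: "a * (\<mu> - a) = 1" "a \<noteq> \<mu> - a"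
      by (rule quadratic_simple_root)
    define M where "M = - [:- (\<mu> - a), 1:] * [:- 1, \<mu> + 4 * \<tau>, - 1:]"
    have \<kappa>\<mu>: "\<kappa> = \<mu> + 2 * \<tau>"
      by (simp add: \<mu>_def)
    have "?\<sigma>\<^sup>2 - 4 * ?X\<^sup>2 = [:- 1, \<mu>, - 1:] * [:- 1, \<mu> + 4 * \<tau>, - 1:]"
      using \<tau> by (simp add: \<kappa>\<mu> power2_eq_square algebra_simps numeral_poly)
    also have "[:- 1, \<mu>, - 1:] = - ([:- a, 1:] * [:- (\<mu> - a), 1:])"
      using a(1) by (simp add: algebra_simps)
    finally have "?\<sigma>\<^sup>2 - 4 * ?X\<^sup>2 = [:- a, 1:] * M"
      unfolding M_def by (simp only: mult_minus_left mult_minus_right mult.assoc)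
    moreover have "poly M a \<noteq> 0"
    proof -
      have "poly [:- 1, \<mu> + 4 * \<tau>, - 1:] a = (a * (\<mu> - a) - 1) + 4 * \<tau> * a"
        by (simp add: algebra_simps)
      also have "\<dots> \<noteq> 0"
        using a(1) by (auto simp: \<tau>_def)
      finally show ?thesis
        unfolding M_def poly_mult poly_minus using a(2) by auto
    qed
    ultimately show ?thesis by blast
  qed
  then show A: "A = 0"
    using sq odd_order_not_square by metis
  from rel show "B = 0"
    unfolding A by simp
qed

subsection \<open>Independence of characters on a box\<close>

lemma transverse_phase_add_momentum:
  "transverse_phase j0 n (x(j := x j + t)) = transverse_phase j0 n x * (if j = j0 then 1 else cis (of_int (n $ j) * t))"
proof (cases "j = j0")
  case True
  then show ?thesis
    by (auto simp: transverse_phase_def intro!: sum.cong)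
next
  case False
  have "(\<Sum>i\<in>UNIV - {j0}. real_of_int (n $ i) * (x(j := x j + t)) i)
     = (\<Sum>i\<in>UNIV - {j0}. real_of_int (n $ i) * x i + (if i = j then of_int (n $ j) * t else 0))"
    by (intro sum.cong) (auto simp: algebra_simps)
  also have "\<dots> = (\<Sum>i\<in>UNIV - {j0}. real_of_int (n $ i) * x i) + of_int (n $ j) * t"
    using False by (simp add: sum.distrib)
  finally show ?thesis
    using False by (simp add: transverse_phase_def cis_conv_exp exp_add[symmetric] distrib_left)
qed

lemma cis_eq_iff: "cis a = cis b \<longleftrightarrow> (\<exists>n::int. a = b + 2 * of_int n * pi)"
  using sin_cos_eq_iff[of a b] by (auto simp: complex_eq_iff algebra_simps)

text \<open>
  Subtracting from the relation a multiple of its translate by a small vector removes the character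
  \<open>n0\<close> and multiplies the other coefficients by factors of which any given one can be made nonzero.
\<close>

lemma characters_independent_on_box:
  fixes c :: "int ^ 'd::finite \<Rightarrow> complex"
  assumes "finite F" "\<rho> > 0" "\<And>n. n \<in> F \<Longrightarrow> n $ j0 = k"
    and "\<And>x. near x0 \<rho> x \<Longrightarrow> (\<Sum>n\<in>F. c n * transverse_phase j0 n x) = 0"
  shows "\<forall>n\<in>F. c n = 0"
  using assms
proof (induction F arbitrary: c \<rho> rule: finite_induct)
  case (insert n0 F)
  have F0: "c n1 = 0" if n1: "n1 \<in> F" for n1
  proof -
    have "n1 \<noteq> n0"
      using n1 insert.hyps by auto
    then obtain j where j: "n1 $ j \<noteq> n0 $ j"
      by (auto simp: vec_eq_iff)
    then have jj0: "j \<noteq> j0"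
      using insert.prems(2)[of n1] insert.prems(2)[of n0] n1 by auto
    define l where "l = n1 $ j - n0 $ j"
    have l: "l \<noteq> 0" using j by (simp add: l_def)
    define t where "t = min (\<rho> / 2) (1 / \<bar>of_int l\<bar>)"
    have t: "t > 0" "t < \<rho>" "\<bar>of_int l * t\<bar> \<le> 1"
      using insert.prems(1) l by (auto simp: t_def min_def abs_mult field_simps)
    let ?c = "\<lambda>n. c n * (cis (of_int (n $ j) * t) - cis (of_int (n0 $ j) * t))"
    have "\<forall>n\<in>F. ?c n = 0"
    proof (rule insert.IH[of "\<rho> - t"])
      show "\<rho> - t > 0" using t by simp
      show "n $ j0 = k" if "n \<in> F" for n
        using insert.prems(2) that by simp
      fix x assume x: "near x0 (\<rho> - t) x"
      have "near x0 \<rho> x"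
        using x t(1) by (auto intro: less_trans[of _ "\<rho> - t"])
      then have 1: "(\<Sum>n\<in>insert n0 F. c n * transverse_phase j0 n x) = 0"
        by (rule insert.prems(3))
      have "near x0 \<rho> (x(j := x j + t))"
        using x t by (auto simp: abs_less_iff) (smt (verit))+
      then have 2: "(\<Sum>n\<in>insert n0 F. c n * transverse_phase j0 n (x(j := x j + t))) = 0"
        by (rule insert.prems(3))
      have "(\<Sum>n\<in>insert n0 F. ?c n * transverse_phase j0 n x)
        = (\<Sum>n\<in>insert n0 F. c n * transverse_phase j0 n (x(j := x j + t)))
         - cis (of_int (n0 $ j) * t) * (\<Sum>n\<in>insert n0 F. c n * transverse_phase j0 n x)"
        unfolding sum_distrib_left sum_subtractf[symmetric] transverse_phase_add_momentum
        using jj0 by (intro sum.cong) (auto simp: algebra_simps)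
      then show "(\<Sum>n\<in>F. ?c n * transverse_phase j0 n x) = 0"
        unfolding 1 2 using insert.hyps by simp
    qed
    moreover have "cis (of_int (n1 $ j) * t) \<noteq> cis (of_int (n0 $ j) * t)"
    proof
      assume "cis (of_int (n1 $ j) * t) = cis (of_int (n0 $ j) * t)"
      then obtain m :: int where "of_int (n1 $ j) * t = of_int (n0 $ j) * t + 2 * of_int m * pi"
        unfolding cis_eq_iff by blast
      then have m: "of_int l * t = 2 * pi * of_int m"
        by (simp add: l_def algebra_simps)
      then have "m \<noteq> 0"
        using l t by auto
      then have "1 \<le> \<bar>of_int m :: real\<bar>"
        by linarith
      then have "2 * pi * 1 \<le> \<bar>of_int l * t\<bar>"
        unfolding m abs_mult by (intro mult_mono) auto
      with t(3) pi_gt3 show False by linarith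
    qed
    ultimately show ?thesis
      using n1 by auto
  qed
  have "near x0 \<rho> x0"
    using insert.prems(1) by simp
  from insert.prems(3)[OF this] have "c n0 * transverse_phase j0 n0 x0 = 0"
    using insert.hyps F0 by simp
  then have "c n0 = 0"
    using norm_transverse_phase[of j0 n0 x0] by (metis mult_eq_0_iff norm_zero zero_neq_one)
  with F0 show ?case by simp
qed simp

subsection \<open>The division theorem\<close>

text \<open>
  Twice the spectral parameter left for the two directions \<open>j0\<close> and \<open>j1\<close> together. Where it
  vanishes, the symbol as a function of \<open>x j0\<close> and \<open>x j1\<close> is a product:
  \<open>cos a + cos b = 2 cos ((a + b) / 2) cos ((a - b) / 2)\<close>.
\<close>

definition transverse_rest :: "'d \<Rightarrow> 'd \<Rightarrow> real \<Rightarrow> ('d::finite \<Rightarrow> real) \<Rightarrow> real" where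
  "transverse_rest j0 j1 E x = 2 * (real CARD('d) - 2 * E - (\<Sum>j\<in>UNIV - {j0, j1}. cos (x j)))"

lemma transverse_energy_split:
  assumes "j1 \<noteq> j0"
  shows "2 * transverse_energy j0 E x = transverse_rest j0 j1 E x - 2 * cos (x j1)"
proof -
  have "(\<Sum>j\<in>UNIV - {j0}. cos (x j)) = cos (x j1) + (\<Sum>j\<in>UNIV - {j0} - {j1}. cos (x j))"
    using assms by (subst sum.remove[of _ j1]) auto
  also have "UNIV - {j0} - {j1} = UNIV - {j0, j1}"
    by auto
  finally show ?thesis
    by (simp add: transverse_energy_def transverse_rest_def)
qed

lemma infinite_arc:
  assumes "\<rho> > 0"
  shows "infinite (cis ` {t. \<bar>t - t0\<bar> < \<rho>})"
proof -
  let ?I = "{t0<..<t0 + min \<rho> 1}"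
  have "inj_on cis ?I"
  proof (rule inj_onI)
    fix a b assume ab: "a \<in> ?I" "b \<in> ?I" "cis a = cis b"
    then obtain m :: int where m: "a = b + 2 * of_int m * pi"
      unfolding cis_eq_iff by blast
    have "m = 0"
    proof (rule ccontr)
      assume "m \<noteq> 0"
      then have "1 \<le> \<bar>of_int m :: real\<bar>"
        by linarith
      then have "2 * pi * 1 \<le> \<bar>2 * pi * of_int m\<bar>"
        unfolding abs_mult by (intro mult_mono) auto
      also have "\<bar>2 * pi * of_int m\<bar> = \<bar>a - b\<bar>"
        using m by (simp add: algebra_simps)
      also have "\<dots> < 1"
        using ab by auto
      finally show False
        using pi_gt3 by linarith
    qed
    with m show "a = b" by simp
  qed
  moreover have "infinite ?I"
    using assms by (intro infinite_Ioo) auto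
  ultimately have "infinite (cis ` ?I)"
    by (simp add: finite_image_iff)
  moreover have "cis ` ?I \<subseteq> cis ` {t. \<bar>t - t0\<bar> < \<rho>}"
    by (intro image_mono) auto
  ultimately show ?thesis
    using finite_subset by blast
qed

text \<open>
  With only the momentum in direction \<open>j1\<close> varying, the remainder of the division has the form
  \<open>A \<zeta> + B\<close> with Laurent polynomials \<open>A\<close>, \<open>B\<close> in \<open>z = exp (\<i> t)\<close> and \<open>\<zeta>\<^sup>2 - 2 s \<zeta> + 1 = 0\<close>. Eliminating \<open>\<zeta>\<close>
  gives a relation between polynomials that holds on an arc, hence identically.
\<close>

lemma two_slice_relation_trivial:
  fixes j0 j1 :: "'d::finite" and c :: "int ^ 'd \<Rightarrow> complex"
  assumes j: "j1 \<noteq> j0" and F: "finite F"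
    and \<rho>: "\<rho> > 0"
    and rest: "transverse_rest j0 j1 E x \<noteq> 0"
    and inside: "\<And>t. \<bar>t - x j1\<bar> < \<rho> \<Longrightarrow> \<bar>transverse_energy j0 E (x(j1 := t))\<bar> < 1"
    and wave: "\<And>t. \<bar>t - x j1\<bar> < \<rho> \<Longrightarrow>
      (\<Sum>n\<in>F. b n * transverse_phase j0 n (x(j1 := t)))
      + cis (arccos (transverse_energy j0 E (x(j1 := t)))) * (\<Sum>n\<in>F. a n * transverse_phase j0 n (x(j1 := t))) = 0"
  shows "(\<Sum>n\<in>F. a n * transverse_phase j0 n x) = 0" "(\<Sum>n\<in>F. b n * transverse_phase j0 n x) = 0"
proof -
  define N where "N = (\<Sum>n\<in>F. \<bar>n $ j1\<bar>)"
  have N: "\<bar>n $ j1\<bar> \<le> N" if "n \<in> F" for n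
    unfolding N_def using F that by (intro member_le_sum) auto
  let ?x = "\<lambda>t. x(j1 := t)"
  define q where "q n = transverse_phase j0 n (x(j1 := 0))" for n
  have ph: "transverse_phase j0 n (?x t) = q n * cis (of_int (n $ j1) * t)" for n t
    using transverse_phase_add_momentum[of j0 n "x(j1 := 0)" j1 t] j by (simp add: q_def)
  define P where "P g = (\<Sum>n\<in>F. monom (g n * q n) (nat (n $ j1 + N)))" for g
  have P: "poly (P g) (cis t) = cis (of_int N * t) * (\<Sum>n\<in>F. g n * transverse_phase j0 n (?x t))" for g t
  proof -
    have "cis t ^ nat (n $ j1 + N) = cis (of_int N * t) * cis (of_int (n $ j1) * t)" if "n \<in> F" for n
    proof -
      have "real (nat (n $ j1 + N)) = of_int (n $ j1) + of_int N"
        using N[OF that] by simp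
      then show ?thesis
        by (simp add: Complex.DeMoivre cis_mult algebra_simps)
    qed
    then show ?thesis
      by (simp add: P_def poly_sum poly_monom ph sum_distrib_left mult_ac cong: sum.cong)
  qed
  let ?\<kappa> = "complex_of_real (transverse_rest j0 j1 E x)"
  let ?R = "[:0, 1:] * (P b)\<^sup>2 + [:- 1, ?\<kappa>, - 1:] * (P a * P b) + [:0, 1:] * (P a)\<^sup>2"
  have "poly ?R (cis t) = 0" if t: "\<bar>t - x j1\<bar> < \<rho>" for t
  proof -
    let ?s = "transverse_energy j0 E (?x t)"
    let ?\<zeta> = "cis (arccos ?s)"
    let ?A = "\<Sum>n\<in>F. a n * transverse_phase j0 n (?x t)" and ?B = "\<Sum>n\<in>F. b n * transverse_phase j0 n (?x t)"
    have B: "?B = - ?\<zeta> * ?A"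
      using wave[OF t] by (simp add: add_eq_0_iff2 add_eq_0_iff)
    have \<zeta>: "?\<zeta> * ?\<zeta> - 2 * of_real ?s * ?\<zeta> + 1 = 0"
    proof -
      have "2 * of_real ?s = ?\<zeta> + cis (- arccos ?s)"
        using inside[OF t] by (simp add: complex_eq_iff cos_arccos_abs)
      then have "2 * of_real ?s * ?\<zeta> = ?\<zeta> * ?\<zeta> + 1"
        by (simp add: algebra_simps cis_mult)
      then show ?thesis by simp
    qed
    have "?B\<^sup>2 + 2 * of_real ?s * (?A * ?B) + ?A\<^sup>2 = (?\<zeta> * ?\<zeta> - 2 * of_real ?s * ?\<zeta> + 1) * ?A\<^sup>2"
      unfolding B by (simp add: algebra_simps power2_eq_square)
    then have rel: "?B\<^sup>2 + 2 * of_real ?s * (?A * ?B) + ?A\<^sup>2 = 0"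
      unfolding \<zeta> by simp
    have "transverse_rest j0 j1 E (?x t) = transverse_rest j0 j1 E x"
      by (auto simp: transverse_rest_def intro!: sum.cong)
    then have "2 * of_real ?s = ?\<kappa> - (cis t + cis (- t))"
      using arg_cong[OF transverse_energy_split[OF j, of E "?x t"], of complex_of_real]
      by (simp add: complex_eq_iff)
    then have s: "cis t * (2 * of_real ?s) = - 1 + cis t * (?\<kappa> + cis t * (- 1))"
      by (simp only: right_diff_distrib distrib_left) (simp add: cis_mult)
    have "poly ?R (cis t) = cis (of_int N * t) * cis (of_int N * t) * cis t * (?B\<^sup>2 + ?A\<^sup>2)
        + cis (of_int N * t) * cis (of_int N * t) * (cis t * (2 * of_real ?s)) * (?A * ?B)"
      unfolding s by (simp add: P power2_eq_square algebra_simps)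
    also have "\<dots> = cis (of_int N * t) * cis (of_int N * t) * cis t * (?B\<^sup>2 + 2 * of_real ?s * (?A * ?B) + ?A\<^sup>2)"
      by (simp only: algebra_simps)
    finally show ?thesis
      unfolding rel by simp
  qed
  then have "cis ` {t. \<bar>t - x j1\<bar> < \<rho>} \<subseteq> {z. poly ?R z = 0}"
    by blast
  then have "?R = 0"
    using infinite_arc[OF \<rho>] finite_subset poly_roots_finite by blast
  then have "P a = 0" "P b = 0"
    using quadratic_relation_trivial[of ?\<kappa> "P b" "P a"] rest by auto
  then show "(\<Sum>n\<in>F. a n * transverse_phase j0 n x) = 0" "(\<Sum>n\<in>F. b n * transverse_phase j0 n x) = 0"
    using P[of a "x j1"] P[of b "x j1"] by auto
qed

text \<open>
  Subtracting \<open>(H0 - E) v\<close> does not change the values of the Fourier transform on the energy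
  surface, because plane waves are eigenfunctions. The remainder on two slices therefore still
  vanishes there, and is zero.
\<close>

theorem division_by_symbol:
  fixes j0 j1 :: "'d::finite" and c :: "int ^ 'd \<Rightarrow> complex"
  assumes j: "j1 \<noteq> j0" and c: "finite {n. c n \<noteq> 0}" and \<rho>: "\<rho> > 0"
    and rest: "\<And>x. transverse_rest j0 j1 E x \<noteq> 0"
    and inside: "\<And>x. near x0 \<rho> x \<Longrightarrow> \<bar>transverse_energy j0 E x\<bar> < 1"
    and vanish: "\<And>x. near x0 \<rho> x \<Longrightarrow> pair c (plane_wave j0 E x) = 0"
  obtains v where "finite {n. v n \<noteq> 0}" "\<And>n. H0 v n - of_real E * v n = c n"
proof -
  obtain v where v: "finite {n. v n \<noteq> 0}"
    "\<And>n. n $ j0 \<noteq> 0 \<Longrightarrow> n $ j0 \<noteq> 1 \<Longrightarrow> H0 v n - of_real E * v n = c n"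
    using slice_reducible_all[OF c, of j0 E] unfolding slice_reducible_def by blast
  let ?L = "\<lambda>n. 1 * H0 v n + (- of_real E) * v n"
  have finL: "finite {n. ?L n \<noteq> 0}"
    using finite_support_Hop[OF v(1), of "\<lambda>_. 0"] by (intro finite_support_lin v(1)) (simp add: Hop_0)
  define r where "r = (\<lambda>n. 1 * c n + (- 1) * ?L n)"
  have finr: "finite {n. r n \<noteq> 0}"
    unfolding r_def by (rule finite_support_lin[OF c finL])
  let ?F = "{n. r n \<noteq> 0}"
  have slices: "n $ j0 = 0 \<or> n $ j0 = 1" if "n \<in> ?F" for n
  proof (rule ccontr)
    assume "\<not> ?thesis"
    then have "H0 v n - of_real E * v n = c n" using v(2)[of n] by blast
    then have "r n = 0" by (simp add: r_def algebra_simps)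
    with that show False by simp
  qed
  have pair_lin: "pair (\<lambda>n. a * f n + b * g n) h = a * pair f h + b * pair g h"
    if "finite {n. f n \<noteq> 0}" "finite {n. g n \<noteq> 0}" for f g h :: "int ^ 'd \<Rightarrow> complex" and a b
  proof -
    have "(\<lambda>n. f n * h n) summable_on UNIV" "(\<lambda>n. g n * h n) summable_on UNIV"
      using that by (auto intro!: finite_nonzero_values_imp_summable_on intro: finite_subset[rotated])
    from infsum_add[OF summable_on_cmult_right[OF this(1), of a] summable_on_cmult_right[OF this(2), of b]]
    show ?thesis
      by (simp add: pair_def algebra_simps infsum_cmult_right')
  qed
  have r: "pair r (plane_wave j0 E x) = 0" if x: "near x0 \<rho> x" for x
  proof -
    have fH: "finite {n. H0 v n \<noteq> 0}"
      using finite_support_Hop[OF v(1), of "\<lambda>_. 0"] by (simp add: Hop_0)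
    have "pair (H0 v) (plane_wave j0 E x) = pair v (H0 (plane_wave j0 E x))"
      using pair_Hop_finite_support[OF v(1), of "\<lambda>_. 0"] by (simp add: Hop_0)
    also have "\<dots> = of_real E * pair v (plane_wave j0 E x)"
      using plane_wave_eigenfunction[OF less_imp_le[OF inside[OF x]]]
      by (simp add: pair_def infsum_cmult_right'[symmetric] algebra_simps)
    finally show ?thesis
      unfolding r_def pair_lin[OF c finL] pair_lin[OF fH v(1)] vanish[OF x] by simp
  qed
  define a where "a n = (if n $ j0 = 1 then r n else 0)" for n
  define b where "b n = (if n $ j0 = 0 then r n else 0)" for n
  have split: "pair r (plane_wave j0 E x) = (\<Sum>n\<in>?F. b n * transverse_phase j0 n x)
      + cis (arccos (transverse_energy j0 E x)) * (\<Sum>n\<in>?F. a n * transverse_phase j0 n x)" for x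
  proof -
    have "pair r (plane_wave j0 E x) = (\<Sum>n\<in>?F. r n * plane_wave j0 E x n)"
      using finr by (intro pair_finite_support) auto
    also have "\<dots> = (\<Sum>n\<in>?F. b n * transverse_phase j0 n x
       + cis (arccos (transverse_energy j0 E x)) * (a n * transverse_phase j0 n x))"
      using slices by (intro sum.cong) (auto simp: a_def b_def plane_wave_def)
    finally show ?thesis
      by (simp add: sum.distrib sum_distrib_left)
  qed
  have zero: "(\<Sum>n\<in>?F. a n * transverse_phase j0 n x) = 0 \<and> (\<Sum>n\<in>?F. b n * transverse_phase j0 n x) = 0"
    if x: "near x0 (\<rho> / 2) x" for x
  proof -
    have t: "near x0 \<rho> (x(j1 := t))" if "\<bar>t - x j1\<bar> < \<rho> / 2" for t
    proof
      fix i
      have "\<bar>x i - x0 i\<bar> < \<rho> / 2" "\<bar>x j1 - x0 j1\<bar> < \<rho> / 2"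
        using x by auto
      then show "\<bar>(x(j1 := t)) i - x0 i\<bar> < \<rho>"
        using that \<rho> abs_triangle_ineq[of "t - x j1" "x j1 - x0 j1"] by (cases "i = j1") auto
    qed
    note * = two_slice_relation_trivial[OF j finr half_gt_zero[OF \<rho>] rest inside[OF t] trans[OF split[symmetric] r[OF t]]]
    from * show ?thesis
      by blast
  qed
  let ?lower = "{n \<in> ?F. n $ j0 = 0}" and ?upper = "{n \<in> ?F. n $ j0 = 1}"
  have F0: "(\<Sum>n\<in>?lower. r n * transverse_phase j0 n x) = (\<Sum>n\<in>?F. b n * transverse_phase j0 n x)" for x
    using finr by (intro sum.mono_neutral_cong_left) (auto simp: b_def)
  have F1: "(\<Sum>n\<in>?upper. r n * transverse_phase j0 n x) = (\<Sum>n\<in>?F. a n * transverse_phase j0 n x)" for x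
    using finr by (intro sum.mono_neutral_cong_left) (auto simp: a_def)
  have "\<forall>n\<in>?lower. r n = 0"
  proof (rule characters_independent_on_box[of ?lower "\<rho> / 2" j0 0 x0])
    show "(\<Sum>n\<in>?lower. r n * transverse_phase j0 n x) = 0" if "near x0 (\<rho> / 2) x" for x
      unfolding F0 using zero[OF that] by blast
  qed (use finr \<rho> in simp_all)
  moreover have "\<forall>n\<in>?upper. r n = 0"
  proof (rule characters_independent_on_box[of ?upper "\<rho> / 2" j0 1 x0])
    show "(\<Sum>n\<in>?upper. r n * transverse_phase j0 n x) = 0" if "near x0 (\<rho> / 2) x" for x
      unfolding F1 using zero[OF that] by blast
  qed (use finr \<rho> in simp_all)
  ultimately have r0: "r n = 0" for n
    using slices[of n] by blast
  have "H0 v n - of_real E * v n = c n" for n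
    using r0[of n] unfolding r_def by algebra
  with v(1) that show ?thesis by blast
qed

section \<open>Absence of embedded eigenvalues and limiting absorption\<close>

text \<open>
  For \<open>d = 2\<close> this is the set of all non-integer energies in \<open>(0, 2)\<close>. For all \<open>d\<close> it is the range
  on which \<open>transverse_rest\<close> has no zeros.
\<close>

definition outer_band :: "nat \<Rightarrow> real \<Rightarrow> bool" where
  "outer_band d E \<longleftrightarrow> 0 < E \<and> E < 1 \<or> real d - 1 < E \<and> E < real d"

lemma outer_band_not_int:
  assumes "outer_band d E"
  shows "E \<notin> \<int>"
proof
  assume "E \<in> \<int>"
  then obtain k :: int where k: "E = of_int k"
    by (auto elim: Ints_cases)
  have "real_of_int k < real_of_int (int d)" "real_of_int (int d - 1) < real_of_int k"
    if "real d - 1 < E" "E < real d"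
    using that k by simp_all
  moreover have "real_of_int 0 < real_of_int k" "real_of_int k < real_of_int 1" if "0 < E" "E < 1"
    using that k by simp_all
  ultimately show False
    using assms unfolding outer_band_def of_int_less_iff by linarith
qed

lemma transverse_rest_nonzero:
  fixes j0 j1 :: "'d::finite"
  assumes "outer_band CARD('d) E" "j1 \<noteq> j0"
  shows "transverse_rest j0 j1 E x \<noteq> 0"
proof -
  have "card {j0, j1} \<le> CARD('d)"
    by (intro card_mono) auto
  then have "real (card (UNIV - {j0, j1})) = real CARD('d) - 2"
    using assms(2) by (simp add: card_Diff_subset of_nat_diff)
  then have "\<bar>\<Sum>j\<in>UNIV - {j0, j1}. cos (x j)\<bar> \<le> real CARD('d) - 2"
    using order_trans[OF sum_abs[of "\<lambda>j. cos (x j)" "UNIV - {j0, j1}"]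
        sum_mono[of "UNIV - {j0, j1}" "\<lambda>j. \<bar>cos (x j)\<bar>" "\<lambda>_. 1"]] by simp
  then show ?thesis
    using assms(1) unfolding transverse_rest_def outer_band_def by (auto simp: abs_le_iff)
qed

lemma transverse_energy_lipschitz:
  fixes j0 :: "'d::finite"
  shows "\<bar>transverse_energy j0 E x - transverse_energy j0 E y\<bar> \<le> (\<Sum>j\<in>UNIV - {j0}. \<bar>x j - y j\<bar>)"
proof -
  have cos: "\<bar>cos a - cos b\<bar> \<le> \<bar>a - b\<bar>" for a b :: real
  proof -
    have "\<bar>cos a - cos b\<bar> = 2 * \<bar>sin ((a + b) / 2)\<bar> * \<bar>sin ((b - a) / 2)\<bar>"
      by (simp add: cos_diff_cos abs_mult)
    also have "\<dots> \<le> 2 * 1 * \<bar>(b - a) / 2\<bar>"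
      by (intro mult_mono abs_sin_x_le_abs_x) auto
    finally show ?thesis by simp
  qed
  have "transverse_energy j0 E x - transverse_energy j0 E y = (\<Sum>j\<in>UNIV - {j0}. cos (y j) - cos (x j))"
    by (simp add: transverse_energy_def sum_subtractf)
  also have "\<bar>\<dots>\<bar> \<le> (\<Sum>j\<in>UNIV - {j0}. \<bar>cos (y j) - cos (x j)\<bar>)"
    by (rule sum_abs)
  also have "\<dots> \<le> (\<Sum>j\<in>UNIV - {j0}. \<bar>x j - y j\<bar>)"
    using cos by (intro sum_mono) (simp add: abs_minus_commute)
  finally show ?thesis .
qed

lemma box_inside_band:
  fixes j0 :: "'d::finite"
  assumes x0: "\<bar>transverse_energy j0 E x0\<bar> < 1"
  obtains \<rho> where "\<rho> > 0" "\<And>x. near x0 \<rho> x \<Longrightarrow> \<bar>transverse_energy j0 E x\<bar> < 1"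
proof
  define \<rho> where "\<rho> = (1 - \<bar>transverse_energy j0 E x0\<bar>) / (2 * (real CARD('d) + 1))"
  show "\<rho> > 0"
    using x0 by (simp add: \<rho>_def)
  fix x assume x: "near x0 \<rho> x"
  have "(\<Sum>j\<in>UNIV - {j0}. \<bar>x j - x0 j\<bar>) \<le> (\<Sum>j\<in>UNIV - {j0}. \<rho>)"
    using x by (intro sum_mono) (auto intro: less_imp_le)
  also have "\<dots> \<le> real CARD('d) * \<rho>"
    using \<open>\<rho> > 0\<close> by (simp add: card_mono mult_right_mono)
  also have "\<dots> < 1 - \<bar>transverse_energy j0 E x0\<bar>"
  proof -
    have "2 * (real CARD('d) + 1) * \<rho> = 1 - \<bar>transverse_energy j0 E x0\<bar>"
      by (simp add: \<rho>_def add_nonneg_eq_0_iff)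
    moreover have "real CARD('d) * \<rho> < 2 * (real CARD('d) + 1) * \<rho>"
      using \<open>\<rho> > 0\<close> by (intro mult_strict_right_mono) auto
    ultimately show ?thesis by linarith
  qed
  finally have "(\<Sum>j\<in>UNIV - {j0}. \<bar>x j - x0 j\<bar>) < 1 - \<bar>transverse_energy j0 E x0\<bar>" .
  with transverse_energy_lipschitz[of j0 E x x0] show "\<bar>transverse_energy j0 E x\<bar> < 1"
    by linarith
qed

text \<open>
  A point of the energy surface around which the division theorem applies, whatever the energy. The
  gradient of the symbol does not vanish there in any direction.
\<close>

lemma diagonal_point:
  fixes j0 :: "'d::finite" and E :: real
  assumes "0 < E" "E < real CARD('d)"
  defines "\<theta> \<equiv> arccos ((real CARD('d) - 2 * E) / real CARD('d))"
  shows "0 < \<theta>" "\<theta> < pi" "transverse_energy j0 E (\<lambda>_. \<theta>) = cos \<theta>" "\<bar>cos \<theta>\<bar> < 1"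
proof -
  let ?c = "(real CARD('d) - 2 * E) / real CARD('d)"
  have c: "- 1 < ?c" "?c < 1"
    using assms(1,2) by (simp_all add: field_simps)
  then have cos: "cos \<theta> = ?c"
    unfolding \<theta>_def by (intro cos_arccos) auto
  show "0 < \<theta>" "\<theta> < pi"
    unfolding \<theta>_def using arccos_lt_bounded[OF c] by auto
  show "\<bar>cos \<theta>\<bar> < 1"
    using c cos by linarith
  have "real (card (UNIV - {j0})) = real CARD('d) - 1"
    using zero_less_card_finite[where 'a = 'd] by (simp add: of_nat_diff Suc_le_eq)
  then show "transverse_energy j0 E (\<lambda>_. \<theta>) = cos \<theta>"
    using assms(2) assms(1) unfolding transverse_energy_def cos by (simp add: field_simps)
qed

lemma outer_band_bounds:
  fixes E :: real
  assumes "outer_band CARD('d::finite) E"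
  shows "0 < E" "E < real CARD('d)"
proof -
  have "1 \<le> real CARD('d)"
    using of_nat_mono[OF one_le_card_finite[where 'a = 'd], where 'a = real] by simp
  with assms show "0 < E" "E < real CARD('d)"
    unfolding outer_band_def by linarith+
qed

text \<open>
  Division by the symbol near the diagonal point of the surface. Applied to \<open>f = - V u\<close> for an
  outgoing eigenfunction \<open>u\<close>, this makes \<open>u\<close> finitely supported, as in Rellich's theorem.
\<close>

theorem rellich:
  fixes j0 j1 :: "'d::finite" and f :: "int ^ 'd \<Rightarrow> complex"
  assumes E: "outer_band CARD('d) E" and j: "j1 \<noteq> j0" and f: "finite {n. f n \<noteq> 0}"
    and vanish: "\<And>x. \<bar>transverse_energy j0 E x\<bar> < 1 \<Longrightarrow> (\<And>j. \<bar>x j\<bar> < pi) \<Longrightarrow> pair f (plane_wave j0 E x) = 0"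
  obtains v where "finite {n. v n \<noteq> 0}" "\<And>n. H0 v n - of_real E * v n = f n"
proof -
  note b = outer_band_bounds[OF E]
  define \<theta> where "\<theta> = arccos ((real CARD('d) - 2 * E) / real CARD('d))"
  note \<theta> = diagonal_point(1,2,4)[OF b, folded \<theta>_def] diagonal_point(3)[OF b, of j0, folded \<theta>_def]
  obtain \<rho> where \<rho>: "\<rho> > 0" "\<And>x. near (\<lambda>_. \<theta>) \<rho> x \<Longrightarrow> \<bar>transverse_energy j0 E x\<bar> < 1"
    using box_inside_band[of j0 E "\<lambda>_. \<theta>"] \<theta> by auto
  define \<rho>' where "\<rho>' = min \<rho> (min \<theta> (pi - \<theta>))"
  have \<rho>': "\<rho>' > 0" "\<rho>' \<le> \<rho>" "\<rho>' \<le> \<theta>" "\<rho>' \<le> pi - \<theta>"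
    using \<rho>(1) \<theta> by (auto simp: \<rho>'_def)
  have inside: "\<bar>transverse_energy j0 E x\<bar> < 1" if "near (\<lambda>_. \<theta>) \<rho>' x" for x
    using that \<rho>'(2) by (intro \<rho>(2)) (auto intro: less_le_trans)
  show ?thesis
  proof (rule division_by_symbol[OF j f \<rho>'(1) transverse_rest_nonzero[OF E j] inside])
    fix x :: "'d \<Rightarrow> real" assume x: "near (\<lambda>_. \<theta>) \<rho>' x"
    have "\<bar>x j\<bar> < pi" for j
    proof -
      have "\<bar>x j - \<theta>\<bar> < \<rho>'" using x by simp
      then show ?thesis
        using \<rho>'(3,4) by (auto simp: abs_less_iff)
    qed
    then show "pair f (plane_wave j0 E x) = 0"
      using inside[OF x] by (intro vanish)
  qed (use that in auto)
qed

text \<open>Unique continuation: in front of the support, the equation reads \<open>v n = 0\<close> at its last site.\<close>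

lemma finitely_supported_eigenfunction_zero:
  fixes v :: "int ^ 'd::finite \<Rightarrow> complex" and j0 :: 'd
  assumes v: "finite {n. v n \<noteq> 0}" and eq: "\<And>n. Hop V v n = z * v n"
  shows "v n = 0"
proof (rule ccontr)
  assume "v n \<noteq> 0"
  then have ne: "{n. v n \<noteq> 0} \<noteq> {}" by auto
  define M where "M = Max ((\<lambda>n. n $ j0) ` {n. v n \<noteq> 0})"
  have "M \<in> (\<lambda>n. n $ j0) ` {n. v n \<noteq> 0}"
    unfolding M_def using v ne by (intro Max_in) auto
  then obtain m where m: "v m \<noteq> 0" "m $ j0 = M" by auto
  have le: "n $ j0 \<le> M" if "v n \<noteq> 0" for n
    unfolding M_def using v that by (intro Max_ge) auto
  then have zero: "v n = 0" if "n $ j0 > M" for n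
    using that by force
  let ?k = "m + axis j0 1"
  have "(\<Sum>j\<in>UNIV. v (?k + axis j 1) + v (?k - axis j 1)) = (\<Sum>j\<in>UNIV. if j = j0 then v m else 0)"
  proof (intro sum.cong refl)
    fix j
    show "v (?k + axis j 1) + v (?k - axis j 1) = (if j = j0 then v m else 0)"
      using m(2) by (auto simp: zero axis_def)
  qed
  then have "- (1 / 4) * v m = 0"
    using eq[of ?k] zero[of ?k] m(2) by (simp add: Hop_eq axis_def)
  with m(1) show False by simp
qed

subsection \<open>The imaginary part of the free Green function\<close>

lemma finite_double_sum_swap_cnj:
  fixes a :: "'a \<Rightarrow> complex" and g :: "'a \<Rightarrow> 'a \<Rightarrow> complex"
  assumes sym: "\<And>n m. g n m = g m n"
  shows "Im (\<Sum>n\<in>F. \<Sum>m\<in>F. cnj (a n) * a m * g n m) = Re (\<Sum>n\<in>F. \<Sum>m\<in>F. cnj (a n) * a m * of_real (Im (g n m)))"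
proof -
  let ?X = "\<Sum>n\<in>F. \<Sum>m\<in>F. cnj (a n) * a m * g n m"
  have "cnj ?X = (\<Sum>n\<in>F. \<Sum>m\<in>F. cnj (a m) * a n * cnj (g n m))"
    by (simp add: mult.commute)
  also have "\<dots> = (\<Sum>n\<in>F. \<Sum>m\<in>F. cnj (a n) * a m * cnj (g n m))"
    by (subst sum.swap) (simp add: sym)
  finally have "?X - cnj ?X = (\<Sum>n\<in>F. \<Sum>m\<in>F. cnj (a n) * a m * (g n m - cnj (g n m)))"
    by (simp add: sum_subtractf algebra_simps)
  also have "\<dots> = 2 * \<i> * (\<Sum>n\<in>F. \<Sum>m\<in>F. cnj (a n) * a m * of_real (Im (g n m)))"
    by (simp add: complex_diff_cnj sum_distrib_left algebra_simps)
  finally have eq: "?X - cnj ?X = 2 * \<i> * (\<Sum>n\<in>F. \<Sum>m\<in>F. cnj (a n) * a m * of_real (Im (g n m)))" .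
  have "Im X = Re W" if "X - cnj X = 2 * \<i> * W" for X W
    using arg_cong[OF that, of Im] by simp
  from this[OF eq] show ?thesis .
qed

text \<open>
  The kernel \<open>cis ((k - l) \<theta>)\<close> has rank one.
\<close>

lemma cis_form:
  fixes a :: "'a \<Rightarrow> complex" and k :: "'a \<Rightarrow> int"
  shows "(\<Sum>n\<in>F. \<Sum>m\<in>F. cnj (a n) * a m * cis (of_int (k n - k m) * \<theta>))
     = of_real ((cmod (\<Sum>n\<in>F. a n * cis (- of_int (k n) * \<theta>)))\<^sup>2)"
proof -
  have "of_real ((cmod (\<Sum>n\<in>F. a n * cis (- of_int (k n) * \<theta>)))\<^sup>2)
    = cnj (\<Sum>n\<in>F. a n * cis (- of_int (k n) * \<theta>)) * (\<Sum>m\<in>F. a m * cis (- of_int (k m) * \<theta>))"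
    by (simp only: complex_norm_square mult.commute)
  also have "\<dots> = (\<Sum>n\<in>F. \<Sum>m\<in>F. cnj (a n) * cis (of_int (k n) * \<theta>) * (a m * cis (- of_int (k m) * \<theta>)))"
    by (simp add: sum_product cis_cnj)
  also have "\<dots> = (\<Sum>n\<in>F. \<Sum>m\<in>F. cnj (a n) * a m * cis (of_int (k n - k m) * \<theta>))"
  proof (intro sum.cong refl)
    fix n m
    have "cis (of_int (k n) * \<theta>) * cis (- of_int (k m) * \<theta>) = cis (of_int (k n - k m) * \<theta>)"
      by (simp add: cis_mult algebra_simps)
    then show "cnj (a n) * cis (of_int (k n) * \<theta>) * (a m * cis (- of_int (k m) * \<theta>))
       = cnj (a n) * a m * cis (of_int (k n - k m) * \<theta>)"
      by (metis (no_types, lifting) mult.assoc mult.left_commute)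
  qed
  finally show ?thesis ..
qed

text \<open>
  Only the transverse momenta with a propagating direction \<open>j0\<close> contribute to the imaginary part.
  There the form is a multiple of the sum of the squared moduli of the Fourier transform at the two
  points of the energy surface above \<open>x\<close>.
\<close>

lemma Im_green_form:
  assumes s: "\<bar>transverse_energy j0 E x\<bar> \<noteq> 1"
    and \<Psi>_def: "\<Psi> = Im (\<Sum>n\<in>F. \<Sum>m\<in>F. cnj (f n) * f m * green_integrand j0 E 0 (n - m) x)"
  shows "0 \<le> \<Psi>"
    and "\<bar>transverse_energy j0 E x\<bar> < 1 \<Longrightarrow> (\<Sum>n\<in>F. cnj (f n) * plane_wave j0 E x n) \<noteq> 0 \<Longrightarrow> 0 < \<Psi>"
proof -
  let ?s = "transverse_energy j0 E x"
  let ?\<theta> = "arccos ?s"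
  let ?p = "\<lambda>n. transverse_phase j0 n x"
  let ?g = "\<lambda>k. green1 (of_real ?s) k"
  define a where "a n = f n * cnj (?p n)" for n
  have C: "Complex ?s 0 = of_real ?s"
    by (simp add: complex_eq_iff)
  have "cnj (f n) * f m * green_integrand j0 E 0 (n - m) x = cnj (a n) * a m * ?g (n $ j0 - m $ j0)" for n m
    using transverse_phase_add[of j0 n "- m" x]
    by (simp add: green_integrand_def C a_def transverse_phase_minus)
  then have "\<Psi> = Im (\<Sum>n\<in>F. \<Sum>m\<in>F. cnj (a n) * a m * ?g (n $ j0 - m $ j0))"
    by (simp add: \<Psi>_def)
  also have "\<dots> = Re (\<Sum>n\<in>F. \<Sum>m\<in>F. cnj (a n) * a m * of_real (Im (?g (n $ j0 - m $ j0))))"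
    by (rule finite_double_sum_swap_cnj) (metis green1_minus minus_diff_eq)
  finally have \<Psi>: "\<Psi> = Re (\<Sum>n\<in>F. \<Sum>m\<in>F. cnj (a n) * a m * of_real (Im (?g (n $ j0 - m $ j0))))" .
  define N where "N \<sigma> = (cmod (\<Sum>n\<in>F. a n * cis (- of_int (n $ j0) * (\<sigma> * ?\<theta>))))\<^sup>2" for \<sigma>
  have N0: "N \<sigma> \<ge> 0" for \<sigma> by (simp add: N_def)
  have inside: "\<Psi> = (N 1 + N (- 1)) / sqrt (1 - ?s\<^sup>2)" if "\<bar>?s\<bar> < 1"
  proof -
    let ?r = "sqrt (1 - ?s\<^sup>2)"
    have "of_real (Im (?g k)) = (cis (of_int k * (1 * ?\<theta>)) + cis (of_int k * (- 1 * ?\<theta>))) / of_real ?r" for k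
      unfolding Im_green1_inside[OF that] by (simp add: complex_eq_iff)
    then have "cnj (a n) * a m * of_real (Im (?g (n $ j0 - m $ j0)))
      = (cnj (a n) * a m * cis (of_int (n $ j0 - m $ j0) * (1 * ?\<theta>))
        + cnj (a n) * a m * cis (of_int (n $ j0 - m $ j0) * (- 1 * ?\<theta>))) / of_real ?r" for n m
      by (simp only: distrib_left times_divide_eq_right)
    then have "(\<Sum>n\<in>F. \<Sum>m\<in>F. cnj (a n) * a m * of_real (Im (?g (n $ j0 - m $ j0))))
       = (of_real (N 1) + of_real (N (- 1))) / of_real ?r"
      unfolding N_def cis_form[symmetric] by (simp only: sum.distrib sum_divide_distrib[symmetric])
    then show ?thesis
      unfolding \<Psi> by (simp flip: of_real_add of_real_divide)
  qed
  have outside: "\<Psi> = 0" if "\<bar>?s\<bar> > 1"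
    unfolding \<Psi> by (simp add: Im_green1_outside[OF that])
  have pos: "sqrt (1 - ?s\<^sup>2) > 0" if "\<bar>?s\<bar> < 1"
    using that by (simp add: abs_square_less_1)
  show "0 \<le> \<Psi>"
  proof (cases "\<bar>?s\<bar> < 1")
    case True
    then show ?thesis
      unfolding inside[OF True] using N0 pos[OF True] by (intro divide_nonneg_pos add_nonneg_nonneg) auto
  next
    case False
    then show ?thesis using s outside by auto
  qed
  assume in_band: "\<bar>?s\<bar> < 1" and ne: "(\<Sum>n\<in>F. cnj (f n) * plane_wave j0 E x n) \<noteq> 0"
  have "cnj (\<Sum>n\<in>F. cnj (f n) * plane_wave j0 E x n) = (\<Sum>n\<in>F. a n * cis (- of_int (n $ j0) * (1 * ?\<theta>)))"
    by (simp add: plane_wave_def a_def cis_cnj mult.assoc)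
  then have "N 1 > 0"
    unfolding N_def using ne by (metis complex_cnj_zero_iff zero_less_norm_iff zero_less_power)
  then show "0 < \<Psi>"
    unfolding inside[OF in_band] using N0[of "- 1"] pos[OF in_band] by (intro divide_pos_pos add_pos_nonneg)
qed

lemma emeasure_torus_open_pos:
  fixes U :: "('d::finite \<Rightarrow> real) set"
  assumes U: "open U" "x0 \<in> U" and x0: "\<And>j. \<bar>x0 j\<bar> < pi"
  obtains B where "B \<subseteq> U" "B \<in> sets torus" "emeasure torus B > 0"
proof -
  obtain X where X: "x0 \<in> PiE UNIV X" "\<And>i. open (X i)" "PiE UNIV X \<subseteq> U"
    using product_topology_open_contains_basis[of "\<lambda>_. euclidean" UNIV U x0] U
    unfolding open_fun_def by auto
  have "\<exists>a b. a < x0 i \<and> x0 i < b \<and> {a<..<b} \<subseteq> X i \<and> - pi \<le> a \<and> b \<le> pi" for i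
  proof -
    have "x0 i \<in> X i \<inter> {- pi<..<pi}"
      using X(1) x0[of i] by (auto simp: PiE_iff abs_less_iff)
    moreover have "open (X i \<inter> {- pi<..<pi})"
      using X(2) by (intro open_Int) auto
    ultimately obtain e where e: "e > 0" "ball (x0 i) e \<subseteq> X i \<inter> {- pi<..<pi}"
      using openE by blast
    have "x0 i - e / 2 \<in> ball (x0 i) e" "x0 i + e / 2 \<in> ball (x0 i) e"
      using e(1) by (auto simp: dist_real_def)
    then have "x0 i - e / 2 \<in> {- pi<..<pi}" "x0 i + e / 2 \<in> {- pi<..<pi}"
      using e(2) by blast+
    moreover have "{x0 i - e / 2<..<x0 i + e / 2} \<subseteq> ball (x0 i) e"
      using e(1) by (auto simp: dist_real_def abs_less_iff)
    ultimately show ?thesis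
      using e by (intro exI[of _ "x0 i - e / 2"] exI[of _ "x0 i + e / 2"]) auto
  qed
  then obtain a b where ab: "\<And>i. a i < x0 i" "\<And>i. x0 i < b i" "\<And>i. {a i<..<b i} \<subseteq> X i"
    "\<And>i. - pi \<le> a i" "\<And>i. b i \<le> pi"
    by metis
  let ?B = "PiE UNIV (\<lambda>i. {a i<..<b i})"
  have "emeasure torus ?B = (\<Prod>i\<in>UNIV. emeasure circle {a i<..<b i})"
    unfolding torus_def by (rule circle_product.emeasure_PiM) auto
  also have "\<dots> > 0"
  proof -
    have "emeasure circle {a i<..<b i} \<noteq> 0" for i
      using emeasure_circle_pos[of "a i" "b i"] ab(1,2,4,5)[of i] by auto
    then have "(\<Prod>i\<in>UNIV. emeasure circle {a i<..<b i}) \<noteq> 0"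
      by simp
    then show ?thesis
      by (simp add: zero_less_iff_neq_zero)
  qed
  finally have "emeasure torus ?B > 0" .
  moreover have "?B \<in> sets torus"
    unfolding torus_def by (rule sets_PiM_I_finite) auto
  moreover have "?B \<subseteq> U"
    by (rule subset_trans[OF PiE_mono[OF ab(3)] X(3)])
  ultimately show ?thesis
    using that[of ?B] by simp
qed

lemma continuous_transverse_energy: "continuous_on A (transverse_energy j0 E)"
  unfolding transverse_energy_def
  by (intro continuous_intros continuous_on_subset[OF continuous_on_product_coordinates]) auto

lemma continuous_plane_wave:
  "continuous_on {x. \<bar>transverse_energy j0 E x\<bar> < 1} (\<lambda>x. plane_wave j0 E x n)"
proof -
  have 1: "continuous_on A (\<lambda>x. transverse_phase j0 n x)" for A
    unfolding transverse_phase_def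
    by (intro continuous_intros continuous_on_subset[OF continuous_on_product_coordinates]) auto
  have arc: "continuous_on {x. \<bar>transverse_energy j0 E x\<bar> < 1} (\<lambda>x. arccos (transverse_energy j0 E x))"
    by (intro continuous_intros continuous_transverse_energy) (auto simp: abs_less_iff)
  show ?thesis
    unfolding plane_wave_def cis_conv_exp
    by (intro continuous_on_mult continuous_on_exp continuous_on_of_real continuous_on_const 1 arc)
qed

text \<open>
  A nonnegative integrand with integral \<open>0\<close> vanishes almost everywhere, and by continuity
  everywhere: no outgoing flux, no Fourier transform on the energy surface.
\<close>

theorem Im_green_form_zero:
  fixes f :: "int ^ 'd::finite \<Rightarrow> complex"
  assumes E: "E \<notin> \<int>" and F: "finite F"
    and zero: "Im (\<Sum>n\<in>F. \<Sum>m\<in>F. cnj (f n) * f m * green j0 E 0 (n - m)) = 0"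
    and x0: "\<bar>transverse_energy j0 E x0\<bar> < 1" "\<And>j. \<bar>x0 j\<bar> < pi"
  shows "(\<Sum>n\<in>F. cnj (f n) * plane_wave j0 E x0 n) = 0"
proof (rule ccontr)
  let ?I = "\<lambda>x. \<Sum>n\<in>F. \<Sum>m\<in>F. cnj (f n) * f m * green_integrand j0 E 0 (n - m) x"
  let ?Q = "\<lambda>x. \<Sum>n\<in>F. cnj (f n) * plane_wave j0 E x n"
  assume Q: "?Q x0 \<noteq> 0"
  note int = green_integrand_integrable[OF E order_refl, of j0]
  have I: "integrable torus ?I"
    by (intro Bochner_Integration.integrable_sum integrable_mult_right int)
  have "(LINT x|torus. ?I x) = (\<Sum>n\<in>F. \<Sum>m\<in>F. cnj (f n) * f m * green j0 E 0 (n - m))"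
    using int by (simp add: green_def)
  then have "(LINT x|torus. Im (?I x)) = 0"
    using zero integral_Im[OF I] by simp
  moreover have "AE x in torus. 0 \<le> Im (?I x)"
    using transverse_energy_AE[OF E, of j0] by eventually_elim (rule Im_green_form(1)[OF _ refl])
  ultimately have AE0: "AE x in torus. Im (?I x) = 0"
    using integral_nonneg_eq_0_iff_AE[OF integrable_Im[OF I]] by blast
  let ?S = "{x. \<bar>transverse_energy j0 E x\<bar> < 1}"
  have S: "open ?S"
    by (intro open_Collect_less continuous_intros continuous_transverse_energy)
  have "continuous_on ?S ?Q"
    by (intro continuous_intros continuous_plane_wave)
  then have "open (?S \<inter> ?Q -` (- {0}))"
    by (rule continuous_open_preimage[OF _ S]) auto
  moreover have "x0 \<in> ?S \<inter> ?Q -` (- {0})"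
    using x0(1) Q by simp
  ultimately obtain B where B: "B \<subseteq> ?S \<inter> ?Q -` (- {0})" "B \<in> sets torus" "emeasure torus B > 0"
    using emeasure_torus_open_pos x0(2) by blast
  have "AE x in torus. x \<notin> B"
    using AE0
  proof eventually_elim
    case (elim x)
    show ?case
    proof
      assume "x \<in> B"
      then have "\<bar>transverse_energy j0 E x\<bar> < 1" "?Q x \<noteq> 0"
        using B(1) by auto
      then have "0 < Im (?I x)"
        by (intro Im_green_form(2)[OF _ refl]) auto
      with elim show False by simp
    qed
  qed
  then have "emeasure torus B = 0"
    using B(2) by (simp add: AE_iff_measurable[OF B(2)])
  with B(3) show False by simp
qed

subsection \<open>Identities for the boundary values\<close>

lemma green_even:
  assumes "E \<notin> \<int>"
  shows "green j0 E 0 (- n) = green j0 E 0 n"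
proof -
  have "\<forall>\<^sub>F \<epsilon> in at_right 0. green j0 E \<epsilon> (- n) = green j0 E \<epsilon> n"
    using eventually_pos_at_right
  proof eventually_elim
    case (elim \<epsilon>)
    then show ?case
      using resolvent_kernel_symmetric[of "\<lambda>_. 0" "Complex E \<epsilon>" 0 n]
      by (simp add: free_resolvent_kernel[OF assms elim, of _ j0])
  qed
  from tendsto_cong[OF this] have "((\<lambda>\<epsilon>. green j0 E \<epsilon> n) \<longlongrightarrow> green j0 E 0 (- n)) (at_right 0)"
    using green_tendsto[OF assms, of j0 "- n"] by simp
  then show ?thesis
    using green_tendsto[OF assms, of j0 n] tendsto_unique trivial_limit_at_right_real by blast
qed

definition free_conv :: "'d \<Rightarrow> real \<Rightarrow> (int ^ 'd \<Rightarrow> complex) \<Rightarrow> int ^ 'd::finite \<Rightarrow> complex" where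
  "free_conv j0 E f n = pair (\<lambda>m. green j0 E 0 (n - m)) f"

lemma free_conv_sum:
  assumes "finite F" "\<And>m. m \<notin> F \<Longrightarrow> f m = 0"
  shows "free_conv j0 E f n = (\<Sum>m\<in>F. green j0 E 0 (n - m) * f m)"
  unfolding free_conv_def pair_commute[of _ f] using pair_finite_support[OF assms] by (simp add: mult.commute)

lemma free_resolvent_sum:
  assumes E: "E \<notin> \<int>" and \<epsilon>: "\<epsilon> > 0" and F: "finite F" "\<And>m. m \<notin> F \<Longrightarrow> f m = 0"
  shows "resolvent (\<lambda>_. 0) (Complex E \<epsilon>) f n = (\<Sum>m\<in>F. green j0 E \<epsilon> (n - m) * f m)"
proof -
  have fin: "finite {m. f m \<noteq> 0}"
    by (rule finite_subset[OF _ F(1)]) (use F(2) in auto)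
  have "resolvent (\<lambda>_. 0) (Complex E \<epsilon>) f n = pair f (resolvent (\<lambda>_. 0) (Complex E \<epsilon>) (site n))"
    using resolvent_kernel[OF _ _ finite_support_l2[OF fin], of "\<lambda>_. 0" "Complex E \<epsilon>" n] \<epsilon>
    by (simp add: pair_commute)
  also have "\<dots> = (\<Sum>m\<in>F. f m * resolvent (\<lambda>_. 0) (Complex E \<epsilon>) (site n) m)"
    by (rule pair_finite_support[OF F])
  also have "\<dots> = (\<Sum>m\<in>F. green j0 E \<epsilon> (n - m) * f m)"
    using resolvent_kernel_symmetric[of "\<lambda>_. 0" "Complex E \<epsilon>" n] \<epsilon>
    by (simp add: free_resolvent_kernel[OF E \<epsilon>, of _ j0] mult.commute)
  finally show ?thesis .
qed

text \<open>
  The outgoing solution of \<open>(H0 - E) u = f\<close> is the finitely supported one, if there is one.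
\<close>

lemma free_conv_range:
  assumes E: "E \<notin> \<int>" and v: "finite {n. v n \<noteq> 0}"
  shows "free_conv j0 E (\<lambda>n. H0 v n - of_real E * v n) n = v n"
proof -
  let ?F = "{n. v n \<noteq> 0} \<union> {n. H0 v n \<noteq> 0}"
  have F: "finite ?F"
    using v finite_support_Hop[OF v, of "\<lambda>_. 0"] by (simp add: Hop_0)
  let ?f = "\<lambda>\<epsilon> m. H0 v m - Complex E \<epsilon> * v m"
  have "\<forall>\<^sub>F \<epsilon> in at_right 0. (\<Sum>m\<in>?F. green j0 E \<epsilon> (n - m) * ?f \<epsilon> m) = v n"
    using eventually_pos_at_right
  proof eventually_elim
    case (elim \<epsilon>)
    have fin: "finite {m. ?f \<epsilon> m \<noteq> 0}"
      by (rule finite_subset[OF _ F]) auto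
    have "resolvent (\<lambda>_. 0) (Complex E \<epsilon>) (?f \<epsilon>) = v"
      using elim by (intro resolvent_eqI finite_support_l2 fin v) (auto simp: Hop_0)
    then show ?case
      using free_resolvent_sum[OF E elim F, of "?f \<epsilon>" n j0] by auto
  qed
  then have "((\<lambda>\<epsilon>. \<Sum>m\<in>?F. green j0 E \<epsilon> (n - m) * ?f \<epsilon> m) \<longlongrightarrow> v n) (at_right 0)"
    by (rule tendsto_eventually)
  moreover have "((\<lambda>\<epsilon>. \<Sum>m\<in>?F. green j0 E \<epsilon> (n - m) * ?f \<epsilon> m)
     \<longlongrightarrow> (\<Sum>m\<in>?F. green j0 E 0 (n - m) * ?f 0 m)) (at_right 0)"
    by (intro tendsto_intros green_tendsto[OF E])
  ultimately have "v n = (\<Sum>m\<in>?F. green j0 E 0 (n - m) * ?f 0 m)"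
    using tendsto_unique trivial_limit_at_right_real by blast
  also have "Complex E 0 = of_real E"
    by (simp add: complex_eq_iff)
  also have "(\<Sum>m\<in>?F. green j0 E 0 (n - m) * (H0 v m - of_real E * v m)) = free_conv j0 E (\<lambda>n. H0 v n - of_real E * v n) n"
    by (rule free_conv_sum[OF F, symmetric]) auto
  finally show ?thesis ..
qed

lemma limiting_absorption_free:
  assumes E: "E \<notin> \<int>"
  shows "limiting_absorption (\<lambda>_. 0) E (\<lambda>n m. green j0 E 0 (m - n))"
  unfolding limiting_absorption_def
proof (intro conjI allI exI)
  fix n m :: "int ^ 'a"
  have "\<forall>\<^sub>F \<epsilon> in at_right 0. green j0 E \<epsilon> (m - n) = resolvent (\<lambda>_. 0) (Complex E \<epsilon>) (site n) m"
    using eventually_pos_at_right by eventually_elim (simp add: free_resolvent_kernel[OF E, of _ _ j0])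
  from tendsto_cong[OF this] green_tendsto[OF E, of j0 "m - n"]
  show "((\<lambda>\<epsilon>. resolvent (\<lambda>_. 0) (Complex E \<epsilon>) (site n) m) \<longlongrightarrow> green j0 E 0 (m - n)) (at_right 0)"
    by simp
next
  show "\<forall>\<^sub>F \<epsilon> in at_right 0. \<forall>n m. cmod (resolvent (\<lambda>_. 0) (Complex E \<epsilon>) (site n) (m :: int ^ 'a)) \<le> (LINT x|torus. envelope j0 E x)"
    using eventually_pos_at_right
  proof eventually_elim
    case (elim \<epsilon>)
    then show ?case
      using norm_green_le[OF E less_imp_le[OF elim], of j0] by (simp add: free_resolvent_kernel[OF E elim, of _ j0])
  qed
qed

lemma limiting_absorption_symmetric:
  assumes V: "finite {n. V n \<noteq> 0}" and K: "limiting_absorption V E K"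
  shows "K n m = K m n"
proof -
  have lim: "((\<lambda>\<epsilon>. resolvent V (Complex E \<epsilon>) (site n) m) \<longlongrightarrow> K n m) (at_right 0)" for n m
    using K by (simp add: limiting_absorption_def)
  have "\<forall>\<^sub>F \<epsilon> in at_right 0. resolvent V (Complex E \<epsilon>) (site n) m = resolvent V (Complex E \<epsilon>) (site m) n"
    using eventually_pos_at_right by eventually_elim (rule resolvent_kernel_symmetric[OF V], simp)
  from tendsto_cong[OF this] lim[of n m] have "((\<lambda>\<epsilon>. resolvent V (Complex E \<epsilon>) (site m) n) \<longlongrightarrow> K n m) (at_right 0)"
    by simp
  then show ?thesis
    using lim[of m n] tendsto_unique trivial_limit_at_right_real by blast
qed

text \<open>The second resolvent identity \<open>R = R\<^sub>0 - R\<^sub>0 V R\<close>; only the values on the support of \<open>V\<close> enter, so that it passes to the limit.\<close>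

lemma boundary_resolvent_identity:
  assumes E: "E \<notin> \<int>" and V: "finite {n. V n \<noteq> 0}" and K: "limiting_absorption V E K"
  shows "K n m = free_conv j0 E (\<lambda>p. site n p - of_real (V p) * K n p) m"
proof -
  let ?F = "insert n {n. V n \<noteq> 0}"
  let ?k = "\<lambda>\<epsilon>. resolvent V (Complex E \<epsilon>) (site n)"
  have lim: "((\<lambda>\<epsilon>. ?k \<epsilon> m) \<longlongrightarrow> K n m) (at_right 0)" for m
    using K by (simp add: limiting_absorption_def)
  have F: "finite ?F" using V by simp
  have "\<forall>\<^sub>F \<epsilon> in at_right 0. (\<Sum>p\<in>?F. green j0 E \<epsilon> (m - p) * (site n p - of_real (V p) * ?k \<epsilon> p)) = ?k \<epsilon> m"
    using eventually_pos_at_right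
  proof eventually_elim
    case (elim \<epsilon>)
    let ?f = "\<lambda>p. site n p - of_real (V p) * ?k \<epsilon> p"
    have f0: "?f p = 0" if "p \<notin> ?F" for p
      using that by (simp add: site_def)
    have fin: "finite {p. ?f p \<noteq> 0}"
      by (rule finite_subset[OF _ F]) (use f0 in blast)
    have z: "Im (Complex E \<epsilon>) > 0" using elim by simp
    have "resolvent (\<lambda>_. 0) (Complex E \<epsilon>) ?f = ?k \<epsilon>"
    proof (rule resolvent_eqI[OF _ z resolvent_l2[OF V z site_l2] finite_support_l2[OF fin]])
      fix p
      have "Hop V (?k \<epsilon>) p = Hop (\<lambda>_. 0) (?k \<epsilon>) p + of_real (V p) * ?k \<epsilon> p"
        by (simp add: Hop_def mult_op_def)
      with Hop_resolvent[OF V z site_l2, of n p]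
      show "Hop (\<lambda>_. 0) (?k \<epsilon>) p - Complex E \<epsilon> * ?k \<epsilon> p = ?f p"
        by (simp add: algebra_simps)
    qed simp
    then show ?case
      using free_resolvent_sum[OF E elim F, of ?f m j0] f0 by simp
  qed
  from tendsto_cong[OF this] lim[of m]
  have "((\<lambda>\<epsilon>. \<Sum>p\<in>?F. green j0 E \<epsilon> (m - p) * (site n p - of_real (V p) * ?k \<epsilon> p)) \<longlongrightarrow> K n m) (at_right 0)"
    by simp
  moreover have "((\<lambda>\<epsilon>. \<Sum>p\<in>?F. green j0 E \<epsilon> (m - p) * (site n p - of_real (V p) * ?k \<epsilon> p))
     \<longlongrightarrow> (\<Sum>p\<in>?F. green j0 E 0 (m - p) * (site n p - of_real (V p) * K n p))) (at_right 0)"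
    by (intro tendsto_intros green_tendsto[OF E] lim)
  ultimately have "K n m = (\<Sum>p\<in>?F. green j0 E 0 (m - p) * (site n p - of_real (V p) * K n p))"
    using tendsto_unique trivial_limit_at_right_real by blast
  also have "\<dots> = free_conv j0 E (\<lambda>p. site n p - of_real (V p) * K n p) m"
    by (rule free_conv_sum[OF F, symmetric]) (simp add: site_def)
  finally show ?thesis .
qed

subsection \<open>Adding one site to the potential\<close>

text \<open>
  If the denominator vanished, \<open>K p\<close> would be an outgoing eigenfunction for the potential changed
  at \<open>p\<close>. As the potential is real, such a function has no outgoing flux; by Rellich's theorem it is
  finitely supported, and by unique continuation zero.
\<close>

lemma rank_one_denominator:
  fixes V :: "int ^ 'd::finite \<Rightarrow> real" and j0 j1 :: 'd
  assumes E: "outer_band CARD('d) E" and j: "j1 \<noteq> j0"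
    and V: "finite {n. V n \<noteq> 0}" and K: "limiting_absorption V E K" and p: "V p = 0"
  shows "1 + of_real a * K p p \<noteq> 0"
proof
  assume eq: "1 + of_real a * K p p = 0"
  note E' = outer_band_not_int[OF E]
  define u where "u = K p"
  define f where "f = (\<lambda>n. site p n - of_real (V n) * u n)"
  let ?F = "insert p {n. V n \<noteq> 0}"
  have F: "finite ?F" using V by simp
  have f0: "f n = 0" if "n \<notin> ?F" for n
    using that by (simp add: f_def site_def)
  have finf: "finite {n. f n \<noteq> 0}"
    by (rule finite_subset[OF _ F]) (use f0 in blast)
  have u: "u m = free_conv j0 E f m" for m
    unfolding u_def f_def using boundary_resolvent_identity[OF E' V K] .
  have up: "of_real a * u p = - 1"
    using eq by (simp add: u_def add_eq_0_iff)
  then have a: "a \<noteq> 0" by auto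
  have "u p = of_real (- 1 / a)"
    using up a by (simp add: field_simps)
  then have Im_up: "Im (u p) = 0" by simp
  have "(\<Sum>n\<in>?F. \<Sum>m\<in>?F. cnj (f n) * f m * green j0 E 0 (n - m)) = (\<Sum>n\<in>?F. cnj (f n) * u n)"
  proof -
    have conv: "free_conv j0 E f n = (\<Sum>m\<in>?F. green j0 E 0 (n - m) * f m)" for n
      by (rule free_conv_sum[OF F f0])
    show ?thesis
      unfolding u conv by (simp add: sum_distrib_left algebra_simps)
  qed
  also have "\<dots> = (\<Sum>n\<in>?F. site p n * u n - of_real (V n * (cmod (u n))\<^sup>2))"
    by (intro sum.cong refl) (simp add: f_def site_def complex_norm_square algebra_simps del: of_real_power)
  also have "Im \<dots> = Im (\<Sum>n\<in>?F. site p n * u n)"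
    by (simp add: sum_subtractf)
  also have "(\<Sum>n\<in>?F. site p n * u n) = u p"
    using pair_finite_support[OF F, of "site p" u] by (simp add: site_def)
  finally have "Im (\<Sum>n\<in>?F. \<Sum>m\<in>?F. cnj (f n) * f m * green j0 E 0 (n - m)) = 0"
    using Im_up by simp
  note zero = Im_green_form_zero[OF E' F this]
  have fincf: "finite {n. cnj (f n) \<noteq> 0}"
    using finf by simp
  obtain w where w: "finite {n. w n \<noteq> 0}" "\<And>n. H0 w n - of_real E * w n = cnj (f n)"
  proof (rule rellich[OF E j fincf])
    fix x assume x: "\<bar>transverse_energy j0 E x\<bar> < 1" "\<And>j. \<bar>x j\<bar> < pi"
    have "pair (\<lambda>n. cnj (f n)) (plane_wave j0 E x) = (\<Sum>n\<in>?F. cnj (f n) * plane_wave j0 E x n)"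
      using f0 by (intro pair_finite_support[OF F]) auto
    then show "pair (\<lambda>n. cnj (f n)) (plane_wave j0 E x) = 0"
      using zero[OF x] by simp
  qed (rule that)
  define v where "v = (\<lambda>n. cnj (w n))"
  have v: "finite {n. v n \<noteq> 0}"
    using w(1) by (simp add: v_def)
  have Hv: "H0 v n - of_real E * v n = f n" for n
  proof -
    have "H0 v n = cnj (H0 w n)"
      unfolding v_def using Hop_cnj[of "\<lambda>_. 0" w n] by (simp add: Hop_0)
    then have "H0 v n - of_real E * v n = cnj (H0 w n - of_real E * w n)"
      by (simp add: v_def)
    then show ?thesis
      unfolding w(2) by simp
  qed
  have uv: "u = v"
  proof
    fix m
    have "u m = free_conv j0 E (\<lambda>n. H0 v n - of_real E * v n) m"
      unfolding u Hv ..
    then show "u m = v m"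
      by (simp add: free_conv_range[OF E' v])
  qed
  have "Hop (V(p := a)) v n = of_real E * v n" for n
  proof -
    have "Hop (V(p := a)) v n = H0 v n + of_real (V n) * v n + of_real a * v p * site p n"
      using p by (auto simp: Hop_def mult_op_def site_def)
    also have "of_real a * v p = - 1"
      using up uv by simp
    also have "H0 v n + of_real (V n) * v n + (- 1) * site p n = of_real E * v n"
      using Hv[of n] unfolding f_def uv by (simp add: algebra_simps)
    finally show ?thesis .
  qed
  then have "v p = 0"
    by (rule finitely_supported_eigenfunction_zero[OF v])
  with up uv show False by simp
qed

text \<open>
  The rank-one perturbation formula \<open>R' = R - a R \<delta>\<^sub>p \<langle>\<delta>\<^sub>p, R \<cdot>\<rangle> / (1 + a \<langle>\<delta>\<^sub>p, R \<delta>\<^sub>p\<rangle>)\<close>, in which the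
  denominator stays away from \<open>0\<close> for small \<open>\<epsilon>\<close>.
\<close>

lemma limiting_absorption_rank_one:
  fixes V :: "int ^ 'd::finite \<Rightarrow> real" and j0 j1 :: 'd
  assumes E: "outer_band CARD('d) E" and j: "j1 \<noteq> j0"
    and V: "finite {n. V n \<noteq> 0}" and K: "limiting_absorption V E K" and p: "V p = 0"
  shows "limiting_absorption (V(p := a)) E (\<lambda>n m. K n m - of_real a * K n p * K p m / (1 + of_real a * K p p))"
proof -
  let ?k = "\<lambda>\<epsilon> n. resolvent V (Complex E \<epsilon>) (site n)"
  let ?V' = "V(p := a)"
  let ?D = "\<lambda>\<epsilon>. 1 + of_real a * ?k \<epsilon> p p"
  let ?Dlim = "1 + of_real a * K p p"
  have lim: "((\<lambda>\<epsilon>. ?k \<epsilon> n m) \<longlongrightarrow> K n m) (at_right 0)" for n m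
    using K by (simp add: limiting_absorption_def)
  obtain B where B: "\<forall>\<^sub>F \<epsilon> in at_right 0. \<forall>n m. cmod (?k \<epsilon> n m) \<le> B"
    using K by (auto simp: limiting_absorption_def)
  have D0: "?Dlim \<noteq> 0"
    by (rule rank_one_denominator[OF E j V K p])
  have limD: "(?D \<longlongrightarrow> ?Dlim) (at_right 0)"
    by (intro tendsto_intros lim)
  have V': "finite {n. ?V' n \<noteq> 0}"
    by (rule finite_subset[of _ "insert p {n. V n \<noteq> 0}"]) (use V in auto)
  have half: "\<forall>\<^sub>F \<epsilon> in at_right 0. cmod ?Dlim / 2 < cmod (?D \<epsilon>)"
    using D0 by (intro order_tendstoD(1)[OF tendsto_norm[OF limD]]) simp
  let ?r = "\<lambda>\<epsilon> n m. ?k \<epsilon> n m - of_real a * ?k \<epsilon> n p * ?k \<epsilon> p m / ?D \<epsilon>"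
  have formula: "\<forall>\<^sub>F \<epsilon> in at_right 0. \<forall>n m. resolvent ?V' (Complex E \<epsilon>) (site n) m = ?r \<epsilon> n m"
    using eventually_pos_at_right half
  proof eventually_elim
    case (elim \<epsilon>)
    have z: "Im (Complex E \<epsilon>) > 0" using elim by simp
    have D: "?D \<epsilon> \<noteq> 0" using elim(2) by auto
    have "resolvent ?V' (Complex E \<epsilon>) (site n) = ?r \<epsilon> n" for n
    proof (rule resolvent_eqI[OF V' z])
      let ?c = "of_real a * ?k \<epsilon> n p / ?D \<epsilon>"
      have r: "?r \<epsilon> n = (\<lambda>m. 1 * ?k \<epsilon> n m + (- ?c) * ?k \<epsilon> p m)"
        by (simp add: fun_eq_iff)
      show "?r \<epsilon> n \<in> l2"
        unfolding r by (intro l2_add_nrm(1) l2_scale resolvent_l2[OF V z] site_l2)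
      show "site n \<in> l2" by (rule site_l2)
      fix m
      have "Hop ?V' (?r \<epsilon> n) m = Hop V (?r \<epsilon> n) m + of_real a * ?r \<epsilon> n p * site p m"
        using p by (auto simp: Hop_def mult_op_def site_def)
      also have "Hop V (?r \<epsilon> n) m = 1 * Hop V (?k \<epsilon> n) m + (- ?c) * Hop V (?k \<epsilon> p) m"
        unfolding r by (rule Hop_lin)
      also have "Hop V (?k \<epsilon> n) m = Complex E \<epsilon> * ?k \<epsilon> n m + site n m"
        using Hop_resolvent[OF V z site_l2, of n m] by (simp add: algebra_simps)
      also have "Hop V (?k \<epsilon> p) m = Complex E \<epsilon> * ?k \<epsilon> p m + site p m"
        using Hop_resolvent[OF V z site_l2, of p m] by (simp add: algebra_simps)
      also have "of_real a * ?r \<epsilon> n p = ?c"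
        using D by (simp add: field_simps)
      finally have eq: "Hop ?V' (?r \<epsilon> n) m = 1 * (Complex E \<epsilon> * ?k \<epsilon> n m + site n m)
          + (- ?c) * (Complex E \<epsilon> * ?k \<epsilon> p m + site p m) + ?c * site p m" .
      have "?r \<epsilon> n m = 1 * ?k \<epsilon> n m + (- ?c) * ?k \<epsilon> p m"
        using fun_cong[OF r] .
      then show "Hop ?V' (?r \<epsilon> n) m - Complex E \<epsilon> * ?r \<epsilon> n m = site n m"
        unfolding eq by (simp only: ring_distribs mult_ac) simp
    qed
    then show ?case by simp
  qed
  show ?thesis
    unfolding limiting_absorption_def
  proof (intro conjI allI exI)
    fix n m
    have "(( \<lambda>\<epsilon>. ?r \<epsilon> n m) \<longlongrightarrow> K n m - of_real a * K n p * K p m / ?Dlim) (at_right 0)"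
      by (intro tendsto_intros lim limD D0)
    moreover have "\<forall>\<^sub>F \<epsilon> in at_right 0. ?r \<epsilon> n m = resolvent ?V' (Complex E \<epsilon>) (site n) m"
      using formula by eventually_elim simp
    ultimately show "((\<lambda>\<epsilon>. resolvent ?V' (Complex E \<epsilon>) (site n) m) \<longlongrightarrow> K n m - of_real a * K n p * K p m / ?Dlim) (at_right 0)"
      by (rule Lim_transform_eventually)
  next
    show "\<forall>\<^sub>F \<epsilon> in at_right 0. \<forall>n m. cmod (resolvent ?V' (Complex E \<epsilon>) (site n) m) \<le> B + \<bar>a\<bar> * B * B / (cmod ?Dlim / 2)"
      using formula half B
    proof eventually_elim
      case (elim \<epsilon>)
      have B0: "B \<ge> 0"
        using elim(3) norm_ge_zero order_trans by blast
      have "cmod (?r \<epsilon> n m) \<le> B + \<bar>a\<bar> * B * B / (cmod ?Dlim / 2)" for n m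
      proof -
        have "cmod (?r \<epsilon> n m) \<le> cmod (?k \<epsilon> n m) + \<bar>a\<bar> * cmod (?k \<epsilon> n p) * cmod (?k \<epsilon> p m) / cmod (?D \<epsilon>)"
          by (rule order_trans[OF norm_triangle_ineq4]) (simp add: norm_mult norm_divide)
        also have "\<dots> \<le> B + \<bar>a\<bar> * B * B / (cmod ?Dlim / 2)"
          using elim(2,3) B0 D0
          by (intro add_mono frac_le mult_mono mult_nonneg_nonneg) auto
        finally show ?thesis .
      qed
      with elim(1) show ?case by simp
    qed
  qed
qed

theorem limiting_absorption_exists:
  fixes V :: "int ^ 'd::finite \<Rightarrow> real" and j0 j1 :: 'd
  assumes E: "outer_band CARD('d) E" and j: "j1 \<noteq> j0" and V: "finite {n. V n \<noteq> 0}"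
  shows "\<exists>K. limiting_absorption V E K"
proof -
  have "\<exists>K. limiting_absorption V E K" if "finite S" "{n. V n \<noteq> 0} \<subseteq> S" for S and V :: "int ^ 'd \<Rightarrow> real"
    using that
  proof (induction S arbitrary: V rule: finite_induct)
    case empty
    then have "V = (\<lambda>_. 0)" by auto
    then show ?case
      using limiting_absorption_free[OF outer_band_not_int[OF E], of j0] by auto
  next
    case (insert p S)
    let ?W = "V(p := 0)"
    have W: "{n. ?W n \<noteq> 0} \<subseteq> S"
      using insert.prems by auto
    then obtain K where K: "limiting_absorption ?W E K"
      using insert.IH by blast
    have "finite {n. ?W n \<noteq> 0}"
      by (rule finite_subset[OF W insert.hyps(1)])
    from limiting_absorption_rank_one[OF E j this K, of p "V p"] show ?case
      by auto
  qed
  then show ?thesis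
    using V by blast
qed

section \<open>Hausdorff measure\<close>

subsection \<open>Hausdorff outer measure\<close>

definition cover_term :: "nat \<Rightarrow> 'a::euclidean_space set \<Rightarrow> ennreal" where
  "cover_term k C = (if C = {} then 0 else ennreal (unit_ball_vol (real k) * (diameter C / 2) ^ k))"

definition fine_cover :: "real \<Rightarrow> 'a::euclidean_space set \<Rightarrow> (nat \<Rightarrow> 'a set) \<Rightarrow> bool" where
  "fine_cover \<delta> A C \<longleftrightarrow> A \<subseteq> (\<Union>i. C i) \<and> (\<forall>i. bounded (C i) \<and> diameter (C i) \<le> \<delta>)"

lemma hausdorff_pre_eq: "hausdorff_pre k \<delta> A = (INF C\<in>Collect (fine_cover \<delta> A). \<Sum>i. cover_term k (C i))"
  by (simp add: hausdorff_pre_def cover_term_def[abs_def] fine_cover_def[abs_def])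

lemma cover_term_empty [simp]: "cover_term k {} = 0"
  by (simp add: cover_term_def)

lemma hausdorff_pre_le: "fine_cover \<delta> A C \<Longrightarrow> hausdorff_pre k \<delta> A \<le> (\<Sum>i. cover_term k (C i))"
  unfolding hausdorff_pre_eq by (rule INF_lower) simp

lemma hausdorff_pre_mono: "A \<subseteq> B \<Longrightarrow> hausdorff_pre k \<delta> A \<le> hausdorff_pre k \<delta> B"
  unfolding hausdorff_pre_eq fine_cover_def by (rule INF_superset_mono) (blast, simp)

lemma hausdorff_pre_antimono: "\<delta> \<le> \<delta>' \<Longrightarrow> hausdorff_pre k \<delta>' A \<le> hausdorff_pre k \<delta> A"
  unfolding hausdorff_pre_eq fine_cover_def by (rule INF_superset_mono) (blast intro: order_trans, simp)

lemma hausdorff_pre_finite_cover: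
  assumes I: "finite I" and \<delta>: "\<delta> \<ge> 0" and A: "A \<subseteq> (\<Union>i\<in>I. C i)"
    and C: "\<And>i. i \<in> I \<Longrightarrow> bounded (C i)" "\<And>i. i \<in> I \<Longrightarrow> diameter (C i) \<le> \<delta>"
  shows "hausdorff_pre k \<delta> A \<le> (\<Sum>i\<in>I. cover_term k (C i))"
proof -
  obtain h where h: "bij_betw h {0..<card I} I"
    using ex_bij_betw_nat_finite[OF I] by blast
  define D where "D n = (if n < card I then C (h n) else {})" for n
  have hI: "h n \<in> I" if "n < card I" for n
    using h that by (auto simp: bij_betw_def)
  have "x \<in> (\<Union>n. D n)" if "x \<in> A" for x
  proof -
    obtain i where i: "i \<in> I" "x \<in> C i"
      using A \<open>x \<in> A\<close> by blast
    then obtain n where "n < card I" "h n = i"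
      using h by (metis bij_betw_imp_surj_on imageE atLeastLessThan_iff)
    then show ?thesis
      using i(2) by (auto simp: D_def intro!: exI[of _ n])
  qed
  then have "fine_cover \<delta> A D"
    using C hI \<delta> by (auto simp: fine_cover_def D_def)
  then have "hausdorff_pre k \<delta> A \<le> (\<Sum>n. cover_term k (D n))"
    by (rule hausdorff_pre_le)
  also have "\<dots> = (\<Sum>n\<in>{0..<card I}. cover_term k (D n))"
    by (rule suminf_finite) (auto simp: D_def)
  also have "\<dots> = (\<Sum>n\<in>{0..<card I}. cover_term k (C (h n)))"
    by (rule sum.cong) (auto simp: D_def)
  also have "\<dots> = (\<Sum>i\<in>I. cover_term k (C i))"
    by (rule sum.reindex_bij_betw[OF h])
  finally show ?thesis .
qed

lemma hausdorff_pre_empty: "\<delta> \<ge> 0 \<Longrightarrow> hausdorff_pre k \<delta> {} = 0"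
  using hausdorff_pre_finite_cover[of "{}" \<delta> "{}" "\<lambda>_. {}" k] by simp

text \<open>
  Near-optimal covers of the sets, with an excess of \<open>e / 2 ^ (n + 1)\<close> for the \<open>n\<close>-th one, are merged
  into one cover.
\<close>

lemma hausdorff_pre_countably_subadditive:
  "hausdorff_pre k \<delta> (\<Union>i. A i) \<le> (\<Sum>i. hausdorff_pre k \<delta> (A i))"
proof (rule ennreal_le_epsilon)
  fix e :: real assume "0 < e" "(\<Sum>n. hausdorff_pre k \<delta> (A n)) < top"
  then have *: "\<And>n. hausdorff_pre k \<delta> (A n) < hausdorff_pre k \<delta> (A n) + e * (1/2)^Suc n"
    by (auto simp add: less_top dest!: ennreal_suminf_lessD)
  have "\<exists>B. fine_cover \<delta> (A n) B \<and> (\<Sum>i. cover_term k (B i)) < hausdorff_pre k \<delta> (A n) + e * (1/2)^Suc n" for n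
    using *[of n] unfolding hausdorff_pre_eq[of k \<delta> "A n"] INF_less_iff by auto
  then obtain B where B: "\<And>n. fine_cover \<delta> (A n) (B n)"
    "\<And>n. (\<Sum>i. cover_term k (B n i)) \<le> hausdorff_pre k \<delta> (A n) + e * (1/2)^Suc n"
    by (metis less_imp_le)
  define C where "C = case_prod B o prod_decode"
  have "fine_cover \<delta> (\<Union>i. A i) C"
    unfolding fine_cover_def
  proof (intro conjI allI)
    show "(\<Union>i. A i) \<subseteq> (\<Union>i. C i)"
      using B(1) by (auto simp: C_def subset_eq fine_cover_def) (metis prod.case prod_encode_inverse)
  qed (use B(1) in \<open>auto simp: C_def fine_cover_def split: prod.split\<close>)
  then have "hausdorff_pre k \<delta> (\<Union>i. A i) \<le> (\<Sum>i. cover_term k (C i))"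
    by (rule hausdorff_pre_le)
  also have "\<dots> = (\<Sum>n. \<Sum>i. cover_term k (B n i))"
    using suminf_ennreal_2dimen[of "\<lambda>m. \<Sum>i. cover_term k (B m i)" "\<lambda>p. cover_term k (case_prod B p)"]
    by (simp add: C_def)
  also have "\<dots> \<le> (\<Sum>n. hausdorff_pre k \<delta> (A n) + e * (1/2) ^ Suc n)"
    by (intro suminf_le B(2)) auto
  also have "\<dots> = (\<Sum>n. hausdorff_pre k \<delta> (A n)) + (\<Sum>n. ennreal e * ennreal ((1/2) ^ Suc n))"
    using \<open>0 < e\<close> by (subst suminf_add[symmetric])
      (auto simp del: ennreal_suminf_cmult simp add: ennreal_mult[symmetric])
  also have "\<dots> = (\<Sum>n. hausdorff_pre k \<delta> (A n)) + e"
    unfolding ennreal_suminf_cmult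
    by (subst suminf_ennreal_eq[OF zero_le_power power_half_series]) auto
  finally show "hausdorff_pre k \<delta> (\<Union>i. A i) \<le> (\<Sum>n. hausdorff_pre k \<delta> (A n)) + e" .
qed

lemma hausdorff_pre_le_outer: "\<delta> > 0 \<Longrightarrow> hausdorff_pre k \<delta> A \<le> hausdorff_outer k A"
  unfolding hausdorff_outer_def by (rule SUP_upper) simp

lemma hausdorff_outer_least: "(\<And>\<delta>. \<delta> > 0 \<Longrightarrow> hausdorff_pre k \<delta> A \<le> c) \<Longrightarrow> hausdorff_outer k A \<le> c"
  unfolding hausdorff_outer_def by (rule SUP_least) simp

lemma hausdorff_outer_mono: "A \<subseteq> B \<Longrightarrow> hausdorff_outer k A \<le> hausdorff_outer k B"
  by (rule hausdorff_outer_least) (blast intro: order_trans hausdorff_pre_mono hausdorff_pre_le_outer)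

lemma hausdorff_outer_empty [simp]: "hausdorff_outer k {} = 0"
proof -
  have "hausdorff_outer k {} \<le> 0"
    by (rule hausdorff_outer_least) (simp add: hausdorff_pre_empty)
  then show ?thesis by simp
qed

lemma hausdorff_outer_countably_subadditive:
  "hausdorff_outer k (\<Union>i. A i) \<le> (\<Sum>i. hausdorff_outer k (A i))"
proof (rule hausdorff_outer_least)
  fix \<delta> :: real assume "\<delta> > 0"
  then have "(\<Sum>i. hausdorff_pre k \<delta> (A i)) \<le> (\<Sum>i. hausdorff_outer k (A i))"
    by (intro suminf_le hausdorff_pre_le_outer) auto
  then show "hausdorff_pre k \<delta> (\<Union>i. A i) \<le> (\<Sum>i. hausdorff_outer k (A i))"
    using hausdorff_pre_countably_subadditive order_trans by blast
qed

lemma hausdorff_outer_Un: "hausdorff_outer k (A \<union> B) \<le> hausdorff_outer k A + hausdorff_outer k B"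
proof -
  have "hausdorff_outer k (\<Union>i. binaryset A B i) \<le> (\<Sum>i. hausdorff_outer k (binaryset A B i))"
    by (rule hausdorff_outer_countably_subadditive)
  then show ?thesis
    by (simp add: UN_binaryset_eq suminf_binaryset_eq)
qed

lemma ennreal_SUP_add_le:
  fixes f g :: "'b \<Rightarrow> ennreal"
  assumes "I \<noteq> {}" "\<And>i j. i \<in> I \<Longrightarrow> j \<in> I \<Longrightarrow> f i + g j \<le> c"
  shows "(SUP i\<in>I. f i) + (SUP j\<in>I. g j) \<le> c"
proof -
  have "f i + (SUP j\<in>I. g j) \<le> c" if "i \<in> I" for i
    unfolding ennreal_SUP_add_right[OF assms(1)] using assms(2) that by (intro SUP_least)
  then show ?thesis
    unfolding ennreal_SUP_add_left[OF assms(1), symmetric] by (intro SUP_least)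
qed

text \<open>Sets of diameter less than the distance of \<open>A\<close> and \<open>B\<close> cannot meet both.\<close>

lemma hausdorff_outer_separated:
  assumes \<rho>: "\<rho> > 0" and sep: "\<And>a b. a \<in> A \<Longrightarrow> b \<in> B \<Longrightarrow> \<rho> \<le> dist a b"
  shows "hausdorff_outer k A + hausdorff_outer k B \<le> hausdorff_outer k (A \<union> B)"
proof -
  have pre: "hausdorff_pre k \<delta> A + hausdorff_pre k \<delta> B \<le> hausdorff_pre k \<delta> (A \<union> B)" if \<delta>: "0 < \<delta>" "\<delta> < \<rho>" for \<delta>
    unfolding hausdorff_pre_eq[of k \<delta> "A \<union> B"]
  proof (rule INF_greatest)
    fix C assume "C \<in> Collect (fine_cover \<delta> (A \<union> B))"
    then have C: "A \<union> B \<subseteq> (\<Union>i. C i)" "\<And>i. bounded (C i)" "\<And>i. diameter (C i) \<le> \<delta>"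
      by (auto simp: fine_cover_def)
    define D where "D S i = (if C i \<inter> S = {} then {} else C i)" for S i
    have D: "fine_cover \<delta> S (D S)" if "S \<subseteq> A \<union> B" for S
      unfolding fine_cover_def
    proof (intro conjI allI)
      show "S \<subseteq> (\<Union>i. D S i)"
      proof
        fix x assume x: "x \<in> S"
        then obtain i where "x \<in> C i"
          using C(1) \<open>S \<subseteq> A \<union> B\<close> by blast
        with x have "x \<in> D S i"
          by (auto simp: D_def)
        then show "x \<in> (\<Union>i. D S i)" by blast
      qed
      show "bounded (D S i)" "diameter (D S i) \<le> \<delta>" for i
        using C(2,3)[of i] \<delta> by (auto simp: D_def)
    qed
    have "C i \<inter> A = {} \<or> C i \<inter> B = {}" for i
    proof (rule ccontr)
      assume "\<not> ?thesis"
      then obtain a b where ab: "a \<in> C i" "a \<in> A" "b \<in> C i" "b \<in> B"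
        by blast
      then show False
        using sep[OF ab(2,4)] diameter_bounded_bound[OF C(2) ab(1,3)] C(3)[of i] \<delta> by linarith
    qed
    then have disj: "C i \<inter> A = {} \<or> C i \<inter> B = {}" for i by blast
    have le: "cover_term k (D A i) + cover_term k (D B i) \<le> cover_term k (C i)" for i
      using disj[of i] by (cases "C i \<inter> A = {}") (simp_all add: D_def)
    have "hausdorff_pre k \<delta> A + hausdorff_pre k \<delta> B
       \<le> (\<Sum>i. cover_term k (D A i)) + (\<Sum>i. cover_term k (D B i))"
      by (intro add_mono hausdorff_pre_le D) auto
    also have "\<dots> = (\<Sum>i. cover_term k (D A i) + cover_term k (D B i))"
      by (intro suminf_add) auto
    also have "\<dots> \<le> (\<Sum>i. cover_term k (C i))"
      by (intro suminf_le le) auto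
    finally show "hausdorff_pre k \<delta> A + hausdorff_pre k \<delta> B \<le> (\<Sum>i. cover_term k (C i))" .
  qed
  show ?thesis
    unfolding hausdorff_outer_def[of k A] hausdorff_outer_def[of k B]
  proof (rule ennreal_SUP_add_le)
    fix d1 d2 :: real assume "d1 \<in> {0<..}" "d2 \<in> {0<..}"
    then have d: "d1 > 0" "d2 > 0" by auto
    define m where "m = min (min d1 d2) (\<rho> / 2)"
    have m: "0 < m" "m < \<rho>" "m \<le> d1" "m \<le> d2"
      using d \<rho> by (auto simp: m_def)
    have "hausdorff_pre k d1 A + hausdorff_pre k d2 B \<le> hausdorff_pre k m A + hausdorff_pre k m B"
      using m by (intro add_mono hausdorff_pre_antimono)
    also have "\<dots> \<le> hausdorff_pre k m (A \<union> B)"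
      by (rule pre[OF m(1,2)])
    also have "\<dots> \<le> hausdorff_outer k (A \<union> B)"
      by (rule hausdorff_pre_le_outer[OF m(1)])
    finally show "hausdorff_pre k d1 A + hausdorff_pre k d2 B \<le> hausdorff_outer k (A \<union> B)" .
  qed auto
qed

subsection \<open>Closed sets are measurable\<close>

text \<open>
  The part of \<open>T\<close> outside \<open>F\<close> is exhausted by the sets \<open>P n\<close> at distance at least \<open>1 / (n + 1)\<close>
  from \<open>F\<close>. Every second one of the shells \<open>R k\<close> between them are pairwise separated, so that the
  outer measures of the shells are summable and the outer measure of \<open>T - P n\<close> tends to that of
  \<open>T \<inter> F\<close>.
\<close>

context
  fixes k :: nat and F T :: "'a::euclidean_space set"
  assumes F: "closed F" "F \<noteq> {}"
begin

private definition P :: "nat \<Rightarrow> 'a set" where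
  "P n = {x \<in> T. 1 / (real n + 1) \<le> infdist x F}"

private definition R :: "nat \<Rightarrow> 'a set" where
  "R n = {x \<in> T. 1 / (real n + 2) \<le> infdist x F \<and> infdist x F < 1 / (real n + 1)}"

private lemma shells_cover: "T - F \<subseteq> P n \<union> (\<Union>i. R (i + n))"
proof
  fix x assume x: "x \<in> T - F"
  let ?d = "infdist x F"
  have d: "?d > 0"
    using x F in_closed_iff_infdist_zero[OF F] infdist_nonneg[of x F] by force
  show "x \<in> P n \<union> (\<Union>i. R (i + n))"
  proof (cases "x \<in> P n")
    case False
    define m where "m = (LEAST m. 1 / (real m + 1) \<le> ?d)"
    obtain m0 :: nat where "1 / ?d < real m0"
      using reals_Archimedean2 by blast
    then have "1 / (real m0 + 1) \<le> ?d"
      using d by (simp add: field_simps)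
    then have m: "1 / (real m + 1) \<le> ?d"
      unfolding m_def by (rule LeastI)
    have least: "\<not> 1 / (real i + 1) \<le> ?d" if "i < m" for i
      using that unfolding m_def by (rule not_less_Least)
    have nm: "n < m"
    proof (rule ccontr)
      assume "\<not> n < m"
      then have "1 / (real n + 1) \<le> 1 / (real m + 1)"
        by (intro divide_left_mono) auto
      with m False x show False
        by (auto simp: P_def)
    qed
    then obtain i where i: "m = Suc (i + n)"
      by (metis add.commute add_Suc_right less_imp_Suc_add)
    have "x \<in> R (i + n)"
      using x m least[of "i + n"] by (simp add: R_def i add.commute add.left_commute)
    then show ?thesis by blast
  qed simp
qed

private lemma P_separated: "hausdorff_outer k (T \<inter> F) + hausdorff_outer k (P n) \<le> hausdorff_outer k T"
proof -
  have "hausdorff_outer k (T \<inter> F) + hausdorff_outer k (P n) \<le> hausdorff_outer k ((T \<inter> F) \<union> P n)"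
  proof (rule hausdorff_outer_separated)
    show "1 / (real n + 1) > 0" by simp
    fix a b assume "a \<in> T \<inter> F" "b \<in> P n"
    then show "1 / (real n + 1) \<le> dist a b"
      using infdist_le[of a F b] by (auto simp: P_def dist_commute)
  qed
  also have "\<dots> \<le> hausdorff_outer k T"
    by (rule hausdorff_outer_mono) (auto simp: P_def)
  finally show ?thesis .
qed

private lemma alternate_shells: "(\<Sum>i<N. hausdorff_outer k (R (2 * i + p))) \<le> hausdorff_outer k (\<Union>i<N. R (2 * i + p))"
proof (induction N)
  case (Suc N)
  let ?U = "\<Union>i<N. R (2 * i + p)"
  have "(\<Sum>i<Suc N. hausdorff_outer k (R (2 * i + p))) \<le> hausdorff_outer k ?U + hausdorff_outer k (R (2 * N + p))"
    using Suc by (simp add: add_right_mono)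
  also have "\<dots> \<le> hausdorff_outer k (?U \<union> R (2 * N + p))"
  proof (cases "N = 0")
    case False
    let ?\<rho> = "1 / (real (2 * N + p)) - 1 / (real (2 * N + p) + 1)"
    show ?thesis
    proof (rule hausdorff_outer_separated)
      have "0 < real (2 * N + p)"
        using False unfolding of_nat_0_less_iff by simp
      then show "?\<rho> > 0"
        using frac_less2[of 1 1 "real (2 * N + p)" "real (2 * N + p) + 1"] by simp
      fix a b assume ab: "a \<in> ?U" "b \<in> R (2 * N + p)"
      then obtain i where i: "i < N" "a \<in> R (2 * i + p)" by auto
      have "1 / real (2 * N + p) \<le> 1 / (real (2 * i + p) + 2)"
        using i(1) by (intro divide_left_mono) auto
      also have "\<dots> \<le> infdist a F"
        using i(2) by (simp add: R_def)
      finally have "1 / real (2 * N + p) \<le> infdist a F" .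
      moreover have "infdist b F < 1 / (real (2 * N + p) + 1)"
        using ab(2) by (simp add: R_def)
      ultimately show "?\<rho> \<le> dist a b"
        using infdist_triangle[of a F b] by linarith
    qed
  qed simp
  also have "?U \<union> R (2 * N + p) = (\<Union>i<Suc N. R (2 * i + p))"
    by (auto simp: lessThan_Suc)
  finally show ?case .
qed simp

private lemma shells_bounded: "(\<Sum>i<n. hausdorff_outer k (R i)) \<le> 2 * hausdorff_outer k T"
proof -
  have "(\<Sum>i<n. hausdorff_outer k (R i)) \<le> (\<Sum>i<2 * n. hausdorff_outer k (R i))"
    by (intro sum_mono2) auto
  also have "\<dots> = (\<Sum>i<n. hausdorff_outer k (R (2 * i + 0))) + (\<Sum>i<n. hausdorff_outer k (R (2 * i + 1)))"
    by (induction n) (auto simp: algebra_simps)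
  also have "\<dots> \<le> hausdorff_outer k T + hausdorff_outer k T"
    by (intro add_mono order_trans[OF alternate_shells] hausdorff_outer_mono) (auto simp: R_def)
  finally show ?thesis
    by (simp add: mult_2)
qed

lemma hausdorff_outer_closed_split:
  "hausdorff_outer k (T \<inter> F) + hausdorff_outer k (T - F) \<le> hausdorff_outer k T"
proof (cases "hausdorff_outer k T = top")
  case False
  define r where "r i = enn2real (hausdorff_outer k (R i))" for i
  have fin: "hausdorff_outer k (R i) < top" for i
    using hausdorff_outer_mono[of "R i" T k] False by (auto simp: R_def less_top intro: le_less_trans)
  then have r: "hausdorff_outer k (R i) = ennreal (r i)" for i
    by (simp add: r_def)
  have r0: "r i \<ge> 0" for i
    by (simp add: r_def)
  have "summable r"
  proof (rule summableI_nonneg_bounded)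
    show "(\<Sum>i<n. r i) \<le> enn2real (2 * hausdorff_outer k T)" for n
    proof -
      have "ennreal (\<Sum>i<n. r i) \<le> 2 * hausdorff_outer k T"
        using shells_bounded[of n] by (simp add: r sum_ennreal r0)
      moreover have "2 * hausdorff_outer k T < top"
        using False by (simp add: ennreal_mult_less_top less_top)
      ultimately show ?thesis
        using enn2real_mono[of "ennreal (\<Sum>i<n. r i)"] by (simp add: sum_nonneg r0)
    qed
  qed (rule r0)
  show ?thesis
  proof (rule ennreal_le_epsilon)
    fix e :: real assume e: "0 < e"
    obtain n where n: "norm (\<Sum>i. r (i + n)) < e"
      using suminf_exist_split[OF e \<open>summable r\<close>] by blast
    have "(\<Sum>i. hausdorff_outer k (R (i + n))) = ennreal (\<Sum>i. r (i + n))"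
      unfolding r using r0 \<open>summable r\<close> by (intro suminf_ennreal2) (auto simp: summable_iff_shift)
    also have "\<dots> \<le> ennreal e"
      using n by (intro ennreal_leI) simp
    finally have tail: "(\<Sum>i. hausdorff_outer k (R (i + n))) \<le> ennreal e" .
    have "hausdorff_outer k (T - F) \<le> hausdorff_outer k (P n \<union> (\<Union>i. R (i + n)))"
      by (rule hausdorff_outer_mono[OF shells_cover])
    also have "\<dots> \<le> hausdorff_outer k (P n) + hausdorff_outer k (\<Union>i. R (i + n))"
      by (rule hausdorff_outer_Un)
    also have "\<dots> \<le> hausdorff_outer k (P n) + e"
      by (intro add_left_mono order_trans[OF hausdorff_outer_countably_subadditive tail])
    finally have "hausdorff_outer k (T \<inter> F) + hausdorff_outer k (T - F)
       \<le> hausdorff_outer k (T \<inter> F) + (hausdorff_outer k (P n) + e)"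
      by (rule add_left_mono)
    also have "\<dots> = (hausdorff_outer k (T \<inter> F) + hausdorff_outer k (P n)) + e"
      by (simp add: add.assoc)
    also have "\<dots> \<le> hausdorff_outer k T + e"
      by (intro add_right_mono P_separated)
    finally show "hausdorff_outer k (T \<inter> F) + hausdorff_outer k (T - F) \<le> hausdorff_outer k T + e" .
  qed
qed simp

end

lemma sets_hausdorff_measure [simp, measurable_cong]: "sets (hausdorff_measure k) = sets borel"
  using sets.sets_measure_of_eq[of borel] by (simp add: hausdorff_measure_def)

lemma space_hausdorff_measure [simp]: "space (hausdorff_measure k) = UNIV"
  by (simp add: hausdorff_measure_def space_measure_of_conv)

text \<open>
  Caratheodory's criterion holds for closed sets, hence for the Borel sets. This is what makes
  \<open>hausdorff_measure\<close> a nontrivial measure: \<open>measure_of\<close> assigns \<open>0\<close> to every set if the given set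
  function is not countably additive.
\<close>

theorem emeasure_hausdorff_measure:
  fixes A :: "'a::euclidean_space set"
  assumes "A \<in> sets borel"
  shows "emeasure (hausdorff_measure k) A = hausdorff_outer k A"
proof -
  let ?f = "hausdorff_outer k :: 'a set \<Rightarrow> ennreal"
  interpret P: sigma_algebra UNIV "Pow UNIV :: 'a set set"
    by (rule sigma_algebra_Pow)
  let ?L = "lambda_system UNIV (Pow UNIV) ?f"
  have "outer_measure_space (Pow UNIV) ?f"
    unfolding outer_measure_space_def positive_def increasing_def countably_subadditive_def
    using hausdorff_outer_mono hausdorff_outer_countably_subadditive by auto
  then have L: "measure_space UNIV ?L ?f"
    by (rule P.caratheodory_lemma)
  have closed: "F \<in> ?L" if "closed F" for F
  proof (cases "F = {}")
    case True
    then show ?thesis by (simp add: lambda_system_def)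
  next
    case False
    have "?f (F \<inter> T) + ?f ((UNIV - F) \<inter> T) = ?f T" for T
    proof (rule antisym)
      have "(UNIV - F) \<inter> T = T - F" by auto
      then show "?f (F \<inter> T) + ?f ((UNIV - F) \<inter> T) \<le> ?f T"
        using hausdorff_outer_closed_split[OF that False, of k T] by (simp add: Int_commute)
      have "T = (F \<inter> T) \<union> ((UNIV - F) \<inter> T)" by auto
      then show "?f T \<le> ?f (F \<inter> T) + ?f ((UNIV - F) \<inter> T)"
        using hausdorff_outer_Un by metis
    qed
    then show ?thesis
      by (simp add: lambda_system_def)
  qed
  have sa: "sigma_algebra UNIV ?L"
    using L by (simp add: measure_space_def)
  have "sets borel \<subseteq> ?L"
    unfolding borel_eq_closed
    using sigma_algebra.sigma_sets_subset[OF sa, of "Collect closed"] closed by auto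
  then have "measure_space UNIV (sets borel) ?f"
    using measure_down[OF L] sets.sigma_algebra_axioms[of borel] by simp
  then show ?thesis
    unfolding hausdorff_measure_def measure_space_def
    using assms by (intro emeasure_measure_of_sigma) auto
qed

section \<open>The surface measure\<close>

subsection \<open>Pieces of the energy surface\<close>

text \<open>
  The energy surface as a pair of graphs over the transverse momenta.
\<close>

lemma symb_eq_iff:
  fixes x :: "real ^ 'd"
  shows "symb x = E \<longleftrightarrow> cos (x $ j0) = transverse_energy j0 E (($) x)"
proof -
  have "(\<Sum>j\<in>UNIV. cos (x $ j)) = cos (x $ j0) + (\<Sum>j\<in>UNIV - {j0}. cos (x $ j))"
    by (subst sum.remove[of _ j0]) auto
  then show ?thesis
    by (auto simp: symb_def transverse_energy_def)
qed

definition surface_piece :: "'d \<Rightarrow> real \<Rightarrow> real \<Rightarrow> (real ^ 'd::finite) set" where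
  "surface_piece j0 E \<alpha> = energy_surface E \<inter> {x. \<alpha> \<le> x $ j0 \<and> x $ j0 \<le> pi - \<alpha>}"

lemma energy_surface_borel [measurable]: "(energy_surface E :: (real ^ 'd) set) \<in> sets borel"
proof -
  have "energy_surface E = (\<Inter>j. {x. - pi \<le> x $ j} \<inter> {x. x $ j < pi}) \<inter> {x :: real ^ 'd. symb x = E}"
    by (auto simp: energy_surface_def)
  moreover have "{x. - pi \<le> x $ j} \<in> sets borel" "{x. x $ j < pi} \<in> sets borel" for j :: 'd
    by (auto intro!: borel_closed closed_Collect_le borel_open open_Collect_less continuous_intros)
  moreover have "{x :: real ^ 'd. symb x = E} \<in> sets borel"
    unfolding symb_def by (intro borel_closed closed_Collect_eq continuous_intros)
  ultimately show ?thesis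
    by (auto intro!: sets.Int sets.countable_INT'')
qed

lemma surface_piece_borel [measurable]: "(surface_piece j0 E \<alpha> :: (real ^ 'd::finite) set) \<in> sets borel"
proof -
  have "{x :: real ^ 'd. \<alpha> \<le> x $ j0 \<and> x $ j0 \<le> pi - \<alpha>} \<in> sets borel"
    by (intro borel_closed closed_Collect_conj closed_Collect_le continuous_intros)
  then show ?thesis
    unfolding surface_piece_def by (intro sets.Int energy_surface_borel)
qed

text \<open>
  The equation \<open>cos (x $ j0) = transverse_energy\<close> with a sine bounded below: over its projection
  along the axis \<open>j0\<close>, a piece is a Lipschitz graph.
\<close>

lemma surface_piece_graph:
  fixes x y :: "real ^ 'd::finite"
  assumes \<alpha>: "0 < \<alpha>" "\<alpha> < pi / 2" and x: "x \<in> surface_piece j0 E \<alpha>" and y: "y \<in> surface_piece j0 E \<alpha>"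
  shows "sin \<alpha> * \<bar>x $ j0 - y $ j0\<bar> \<le> (\<Sum>j\<in>UNIV - {j0}. \<bar>x $ j - y $ j\<bar>)"
proof -
  have sin: "sin \<alpha> \<le> sin t" if "\<alpha> \<le> t" "t \<le> pi - \<alpha>" for t
  proof (cases "t \<le> pi / 2")
    case True
    then show ?thesis
      using \<alpha> that by (intro sin_monotone_2pi_le) auto
  next
    case False
    then have "sin \<alpha> \<le> sin (pi - t)"
      using \<alpha> that by (intro sin_monotone_2pi_le) auto
    then show ?thesis by simp
  qed
  have "sin \<alpha> * \<bar>x $ j0 - y $ j0\<bar> \<le> \<bar>cos (x $ j0) - cos (y $ j0)\<bar>"
    using x y \<alpha> by (intro cos_diff_lower_bound sin) (auto simp: surface_piece_def)
  also have "\<dots> = \<bar>transverse_energy j0 E (($) x) - transverse_energy j0 E (($) y)\<bar>"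
  proof -
    have "symb x = E" "symb y = E"
      using x y by (auto simp: surface_piece_def energy_surface_def)
    then show ?thesis
      by (simp add: symb_eq_iff[of _ _ j0])
  qed
  also have "\<dots> \<le> (\<Sum>j\<in>UNIV - {j0}. \<bar>x $ j - y $ j\<bar>)"
    by (rule transverse_energy_lipschitz)
  finally show ?thesis .
qed

lemma card_other_coordinates: "card (UNIV - {j0}) = CARD('d) - 1" for j0 :: "'d::finite"
  by (simp add: card_Diff_singleton)

text \<open>
  A grid of \<open>N ^ (d - 1)\<close> cubes of side \<open>2 \<pi> / N\<close> below the graph; by the Lipschitz estimate the parts of
  the piece above them have diameter at most \<open>M / N\<close>, with \<open>M\<close> independent of \<open>N\<close>.
\<close>

lemma hausdorff_outer_surface_piece_finite:
  fixes j0 :: "'d::finite"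
  assumes \<alpha>: "0 < \<alpha>" "\<alpha> < pi / 2"
  shows "hausdorff_outer (CARD('d) - 1) (surface_piece j0 E \<alpha>) < top"
proof -
  let ?B = "surface_piece j0 E \<alpha>" and ?d = "real CARD('d)" and ?k = "CARD('d) - 1"
  let ?u = "unit_ball_vol (real ?k)"
  define M where "M = 2 * pi * (?d + ?d / sin \<alpha>)"
  have sin: "sin \<alpha> > 0"
    using \<alpha> by (intro sin_gt_zero) auto
  have M: "M > 0"
    using sin by (auto simp: M_def intro!: mult_pos_pos add_pos_nonneg)
  have pre: "hausdorff_pre ?k \<delta> ?B \<le> ennreal (?u * (M / 2) ^ ?k)" if \<delta>: "\<delta> > 0" for \<delta>
  proof -
    obtain N0 :: nat where N0: "M / \<delta> < real N0"
      using reals_Archimedean2 by blast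
    define N where "N = Suc N0"
    have N: "real N > 0" "M / real N \<le> \<delta>"
      using N0 \<delta> by (auto simp: N_def field_simps)
    let ?I = "PiE (UNIV - {j0}) (\<lambda>_. {0..<N})"
    let ?l = "\<lambda>i::nat. - pi + 2 * pi * real i / real N"
    define C where "C a = {x \<in> ?B. \<forall>j\<in>UNIV - {j0}. ?l (a j) \<le> x $ j \<and> x $ j \<le> ?l (a j) + 2 * pi / real N}" for a
    have finI: "finite ?I"
      by (intro finite_PiE) auto
    have dist: "norm (x - y) \<le> M / real N" if "x \<in> C a" "y \<in> C a" for a x y
    proof -
      let ?S = "\<Sum>j\<in>UNIV - {j0}. \<bar>x $ j - y $ j\<bar>"
      have xy: "x \<in> ?B" "y \<in> ?B"
        using that by (auto simp: C_def)
      have "\<bar>x $ j - y $ j\<bar> \<le> 2 * pi / real N" if "j \<in> UNIV - {j0}" for j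
      proof -
        have "?l (a j) \<le> x $ j" "x $ j \<le> ?l (a j) + 2 * pi / real N"
             "?l (a j) \<le> y $ j" "y $ j \<le> ?l (a j) + 2 * pi / real N"
          using \<open>x \<in> C a\<close> \<open>y \<in> C a\<close> that unfolding C_def by auto
        then show ?thesis by linarith
      qed
      then have "?S \<le> (\<Sum>j\<in>UNIV - {j0}. 2 * pi / real N)"
        by (rule sum_mono)
      also have "\<dots> \<le> ?d * (2 * pi / real N)"
        by (simp only: sum_constant card_other_coordinates) (intro mult_right_mono; simp)
      finally have S: "?S \<le> ?d * (2 * pi / real N)" .
      have "sin \<alpha> * \<bar>x $ j0 - y $ j0\<bar> \<le> ?d * (2 * pi / real N)"
        using surface_piece_graph[OF \<alpha> xy] S by linarith
      then have j0: "\<bar>x $ j0 - y $ j0\<bar> \<le> ?d * (2 * pi / real N) / sin \<alpha>"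
        by (simp only: pos_le_divide_eq[OF sin] mult.commute)
      have "norm (x - y) \<le> (\<Sum>j\<in>UNIV. \<bar>(x - y) $ j\<bar>)"
        by (rule norm_le_l1_cart)
      also have "\<dots> = \<bar>x $ j0 - y $ j0\<bar> + ?S"
        by (subst sum.remove[of _ j0]) auto
      also have "\<dots> \<le> ?d * (2 * pi / real N) / sin \<alpha> + ?d * (2 * pi / real N)"
        by (intro add_mono j0 S)
      also have "\<dots> = M / real N"
        by (simp add: M_def algebra_simps add_divide_distrib)
      finally show ?thesis .
    qed
    have bdd: "bounded (C a)" for a
      unfolding bounded_def using dist by (metis dist_norm)
    have diam: "diameter (C a) \<le> M / real N" for a
      using dist M N by (intro diameter_le) auto
    have "?B \<subseteq> (\<Union>a\<in>?I. C a)"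
    proof
      fix x assume x: "x \<in> ?B"
      define b where "b j = nat \<lfloor>(x $ j + pi) * real N / (2 * pi)\<rfloor>" for j
      have b: "b j < N \<and> ?l (b j) \<le> x $ j \<and> x $ j \<le> ?l (b j) + 2 * pi / real N" for j
      proof -
        let ?t = "(x $ j + pi) * real N / (2 * pi)"
        have xj: "- pi \<le> x $ j" "x $ j < pi"
          using x by (auto simp: surface_piece_def energy_surface_def)
        have "0 \<le> ?t"
          using xj N(1) by (intro divide_nonneg_nonneg mult_nonneg_nonneg) auto
        moreover have "(x $ j + pi) * real N < (2 * pi) * real N"
          using xj N(1) by (intro mult_strict_right_mono) auto
        then have "?t < real N"
          by (subst pos_divide_less_eq) (simp_all add: mult.commute)
        ultimately have t: "0 \<le> ?t" "?t < real N"
          by simp_all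
        have bj: "real (b j) \<le> ?t" "?t < real (b j) + 1"
          unfolding b_def using t(1) by (simp_all add: of_nat_nat)
        have "b j < N"
          using bj(1) t(2) by linarith
        moreover have "x $ j = - pi + 2 * pi * ?t / real N"
          using N(1) by (simp add: field_simps)
        moreover have "2 * pi * real (b j) / real N \<le> 2 * pi * ?t / real N"
          "2 * pi * ?t / real N \<le> 2 * pi * (real (b j) + 1) / real N"
          using bj N(1) by (intro divide_right_mono mult_left_mono; simp)+
        ultimately show ?thesis
          by (simp add: add_divide_distrib distrib_left)
      qed
      let ?a = "restrict b (UNIV - {j0})"
      have "?a \<in> ?I"
        using b by (auto simp: PiE_iff)
      moreover have "x \<in> C ?a"
        using x b by (auto simp: C_def)
      ultimately show "x \<in> (\<Union>a\<in>?I. C a)"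
        by blast
    qed
    then have "hausdorff_pre ?k \<delta> ?B \<le> (\<Sum>a\<in>?I. cover_term ?k (C a))"
      using \<delta> order_trans[OF diam N(2)] bdd by (intro hausdorff_pre_finite_cover finI) auto
    also have "\<dots> \<le> (\<Sum>a\<in>?I. ennreal (?u * (M / real N / 2) ^ ?k))"
    proof (rule sum_mono)
      fix a
      show "cover_term ?k (C a) \<le> ennreal (?u * (M / real N / 2) ^ ?k)"
      proof (cases "C a = {}")
        case False
        have "?u * (diameter (C a) / 2) ^ ?k \<le> ?u * (M / real N / 2) ^ ?k"
          using diam[of a] diameter_ge_0[OF bdd[of a]]
          by (intro mult_left_mono power_mono unit_ball_vol_nonneg) auto
        with False show ?thesis
          by (simp add: cover_term_def ennreal_leI)
      qed simp
    qed
    also have "\<dots> = ennreal (real (N ^ ?k) * (?u * (M / real N / 2) ^ ?k))"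
      using M N(1)
      by (simp add: card_PiE card_other_coordinates ennreal_mult ennreal_of_nat_eq_real_of_nat unit_ball_vol_nonneg
          flip: of_nat_power)
    also have "real (N ^ ?k) * (?u * (M / real N / 2) ^ ?k) = ?u * (M / 2) ^ ?k"
      using N(1) by (simp add: power_divide)
    finally show ?thesis .
  qed
  have "hausdorff_outer ?k ?B \<le> ennreal (?u * (M / 2) ^ ?k)"
    by (rule hausdorff_outer_least[OF pre])
  then show ?thesis
    by (rule le_less_trans) simp
qed

text \<open>
  Each member of a cover of \<open>A\<close> is enlarged to a box of unit length along the axis \<open>j0\<close> and of
  half-width equal to its diameter across. These boxes cover a fixed box of volume \<open>r ^ (d - 1)\<close>, and
  their volumes are, up to the factor \<open>K\<close>, the terms of the Hausdorff sum.
\<close>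

lemma hausdorff_outer_graph_pos:
  fixes j0 :: "'d::finite" and A :: "(real ^ 'd) set"
  assumes r: "r > 0"
    and proj: "\<And>y. near (($) c) r y \<Longrightarrow> \<exists>x\<in>A. \<forall>j. j \<noteq> j0 \<longrightarrow> x $ j = y j"
  shows "hausdorff_outer (CARD('d) - 1) A > 0"
proof -
  let ?k = "CARD('d) - 1"
  let ?u = "unit_ball_vol (real ?k)"
  have u: "?u > 0"
    by (rule unit_ball_vol_pos) simp
  define K where "K = 4 ^ ?k / ?u"
  have K: "K > 0"
    using u by (simp add: K_def)
  \<comment> \<open>The thickened boxes with half-width \<open>w\<close> across and unit length along the axis \<open>j0\<close>.\<close>
  let ?lo = "\<lambda>p w. (\<chi> j. if j = j0 then 0 else p $ j - w) :: real ^ 'd"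
  let ?hi = "\<lambda>p w. (\<chi> j. if j = j0 then 1 else p $ j + w) :: real ^ 'd"
  have vol: "emeasure lborel (cbox (?lo p w) (?hi p w)) = ennreal ((2 * w) ^ ?k)" if w: "w \<ge> 0" for p w
  proof -
    have ne: "cbox (?lo p w) (?hi p w) \<noteq> {}"
      using w by (simp add: interval_ne_empty_cart)
    have "measure lborel (cbox (?lo p w) (?hi p w)) = (\<Prod>j\<in>UNIV. ?hi p w $ j - ?lo p w $ j)"
      using content_cbox_cart[OF ne] .
    also have "\<dots> = (\<Prod>j\<in>UNIV - {j0}. 2 * w)"
      by (subst prod.remove[of _ j0]) auto
    also have "\<dots> = (2 * w) ^ ?k"
      by (simp add: card_other_coordinates)
    finally show ?thesis
      using emeasure_lborel_cbox_finite[of "?lo p w" "?hi p w"] by (simp add: emeasure_eq_ennreal_measure less_top)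
  qed
  have lower: "ennreal (r ^ ?k) \<le> ennreal K * hausdorff_pre ?k 1 A"
  proof -
    have "ennreal (r ^ ?k) \<le> ennreal K * (\<Sum>i. cover_term ?k (C i))" if "fine_cover 1 A C" for C
    proof -
      have C: "A \<subseteq> (\<Union>i. C i)" "\<And>i. bounded (C i)"
        using that by (auto simp: fine_cover_def)
      define p where "p i = (SOME x. x \<in> C i)" for i
      define T where "T i = (if C i = {} then {} else cbox (?lo (p i) (diameter (C i))) (?hi (p i) (diameter (C i))))" for i
      have T_sets: "T i \<in> sets lborel" for i
        by (simp add: T_def)
      have T_vol: "emeasure lborel (T i) \<le> ennreal K * cover_term ?k (C i)" for i
      proof (cases "C i = {}")
        case False
        have "K * (?u * (diameter (C i) / 2) ^ ?k) = 4 ^ ?k * (diameter (C i) / 2) ^ ?k"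
        proof -
          have "a / v * (v * X) = a * X" if "v > 0" for a v X :: real
            using that by simp
          from this[OF u] show ?thesis
            unfolding K_def .
        qed
        also have "\<dots> = (4 * (diameter (C i) / 2)) ^ ?k"
          by (rule power_mult_distrib[symmetric])
        also have "4 * (diameter (C i) / 2) = 2 * diameter (C i)"
          by simp
        finally have "K * (?u * (diameter (C i) / 2) ^ ?k) = (2 * diameter (C i)) ^ ?k" .
        then have "ennreal K * cover_term ?k (C i) = ennreal ((2 * diameter (C i)) ^ ?k)"
          using False K u diameter_ge_0[OF C(2)[of i]] by (simp add: cover_term_def ennreal_mult[symmetric])
        then show ?thesis
          using False vol[OF diameter_ge_0[OF C(2)[of i]]] by (simp add: T_def)
      qed (simp add: T_def)
      have "cbox (?lo c (r / 2)) (?hi c (r / 2)) \<subseteq> (\<Union>i. T i)"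
      proof
        fix x assume x: "x \<in> cbox (?lo c (r / 2)) (?hi c (r / 2))"
        let ?y = "\<lambda>j. if j = j0 then c $ j else x $ j"
        have bx: "?lo c (r / 2) $ j \<le> x $ j" "x $ j \<le> ?hi c (r / 2) $ j" for j
          using x by (auto simp: mem_box_cart)
        have "near (($) c) r ?y"
        proof
          fix j show "\<bar>?y j - c $ j\<bar> < r"
            using bx[of j] r by (auto simp: abs_if split: if_splits)
        qed
        then obtain a where a: "a \<in> A" "\<And>j. j \<noteq> j0 \<Longrightarrow> a $ j = x $ j"
          using proj[of ?y] by auto
        then obtain i where i: "a \<in> C i"
          using C(1) by blast
        then have pi: "p i \<in> C i"
          unfolding p_def by (rule someI)
        have "\<bar>a $ j - p i $ j\<bar> \<le> diameter (C i)" for j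
          using component_le_norm_cart[of "a - p i" j] diameter_bounded_bound[OF C(2) i pi]
          by (simp add: dist_norm)
        then have "x \<in> T i"
          using i a(2) bx[of j0] by (auto simp: T_def mem_box_cart abs_le_iff) (smt (verit))+
        then show "x \<in> (\<Union>i. T i)" by blast
      qed
      then have "emeasure lborel (cbox (?lo c (r / 2)) (?hi c (r / 2))) \<le> emeasure lborel (\<Union>i. T i)"
        using T_sets by (intro emeasure_mono sets.countable_UN) auto
      also have "\<dots> \<le> (\<Sum>i. emeasure lborel (T i))"
        using T_sets by (intro emeasure_subadditive_countably) auto
      also have "\<dots> \<le> (\<Sum>i. ennreal K * cover_term ?k (C i))"
        by (intro suminf_le T_vol) auto
      also have "\<dots> = ennreal K * (\<Sum>i. cover_term ?k (C i))"
        by simp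
      finally show ?thesis
        using vol[of "r / 2" c] r by simp
    qed
    then have "ennreal (r ^ ?k) / ennreal K \<le> (\<Sum>i. cover_term ?k (C i))" if "fine_cover 1 A C" for C
      using that K by (intro divide_le_posI_ennreal) (auto simp: mult.commute)
    then have "ennreal (r ^ ?k) / ennreal K \<le> hausdorff_pre ?k 1 A"
      unfolding hausdorff_pre_eq by (intro INF_greatest) auto
    then have "ennreal K * (ennreal (r ^ ?k) / ennreal K) \<le> ennreal K * hausdorff_pre ?k 1 A"
      by (rule mult_left_mono) simp
    moreover have "ennreal K * (ennreal (r ^ ?k) / ennreal K) = ennreal (r ^ ?k)"
      using K r by (simp add: divide_ennreal ennreal_mult[symmetric])
    ultimately show ?thesis by simp
  qed
  have "hausdorff_pre ?k 1 A \<noteq> 0"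
  proof
    assume "hausdorff_pre ?k 1 A = 0"
    with lower r show False by simp
  qed
  then have "0 < hausdorff_pre ?k 1 A"
    by (simp add: zero_less_iff_neq_zero)
  also have "\<dots> \<le> hausdorff_outer ?k A"
    by (rule hausdorff_pre_le_outer) simp
  finally show ?thesis .
qed

subsection \<open>The gradient of the symbol\<close>

lemma gradient_symb:
  fixes x :: "real ^ 'd::finite"
  shows "gradient symb x = (\<chi> j. sin (x $ j) / 2)"
proof -
  have D: "GDERIV symb x :> (\<chi> j. sin (x $ j) / 2)"
  proof -
    have "(symb has_derivative (\<lambda>h. 1 / 2 * (0 - (\<Sum>j\<in>UNIV. - sin (x $ j) * h $ j)))) (at x)"
      unfolding symb_def
      by (auto intro!: derivative_eq_intros bounded_linear.has_derivative[OF bounded_linear_vec_nth] simp: fun_eq_iff mult.commute)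
    moreover have "(\<lambda>h. 1 / 2 * (0 - (\<Sum>j\<in>UNIV. - sin (x $ j) * h $ j))) = (\<lambda>h. inner h (\<chi> j. sin (x $ j) / 2))"
      by (simp add: fun_eq_iff inner_vec_def sum_negf sum_distrib_left algebra_simps)
    ultimately show ?thesis
      by (simp add: gderiv_def)
  qed
  show ?thesis
    unfolding gradient_def
  proof (rule the_equality)
    show "GDERIV symb x :> (\<chi> j. sin (x $ j) / 2)"
      by (rule D)
    fix D' assume "GDERIV symb x :> D'"
    then have "(\<lambda>h. inner h D') = (\<lambda>h. inner h (\<chi> j. sin (x $ j) / 2))"
      using D has_derivative_unique unfolding gderiv_def by blast
    then have "inner (D' - (\<chi> j. sin (x $ j) / 2)) D' = inner (D' - (\<chi> j. sin (x $ j) / 2)) (\<chi> j. sin (x $ j) / 2)"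
      by (rule fun_cong)
    then have "inner (D' - (\<chi> j. sin (x $ j) / 2)) (D' - (\<chi> j. sin (x $ j) / 2)) = 0"
      by (simp add: inner_diff_right)
    then show "D' = (\<chi> j. sin (x $ j) / 2)"
      by simp
  qed
qed

definition inverse_speed :: "real ^ 'd::finite \<Rightarrow> real" where
  "inverse_speed x = 1 / norm (gradient symb x)"

lemma inverse_speed_measurable [measurable]: "inverse_speed \<in> borel_measurable borel"
proof -
  have "(\<lambda>x :: real ^ 'd. gradient symb x) \<in> borel_measurable borel"
    unfolding gradient_symb by (intro borel_measurable_continuous_onI continuous_intros) auto
  then show ?thesis
    unfolding inverse_speed_def by measurable
qed

lemma inverse_speed_piece:
  fixes x :: "real ^ 'd::finite"
  assumes \<alpha>: "0 < \<alpha>" "\<alpha> < pi / 2" and x: "x \<in> surface_piece j0 E \<alpha>"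
  shows "inverse_speed x > 0" "inverse_speed x \<le> 2 / sin \<alpha>"
proof -
  have sin_\<alpha>: "sin \<alpha> > 0"
    using \<alpha> by (intro sin_gt_zero) auto
  have t: "\<alpha> \<le> x $ j0" "x $ j0 \<le> pi - \<alpha>"
    using x by (auto simp: surface_piece_def)
  have "sin \<alpha> \<le> sin (x $ j0)"
  proof (cases "x $ j0 \<le> pi / 2")
    case True
    then show ?thesis
      using \<alpha> t by (intro sin_monotone_2pi_le) auto
  next
    case False
    then have "sin \<alpha> \<le> sin (pi - x $ j0)"
      using \<alpha> t by (intro sin_monotone_2pi_le) auto
    then show ?thesis by simp
  qed
  also have "\<dots> \<le> 2 * norm (gradient symb x)"
    using component_le_norm_cart[of "gradient symb x" j0] unfolding gradient_symb by simp
  finally have "sin \<alpha> / 2 \<le> norm (gradient symb x)" by simp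
  then have g: "norm (gradient symb x) > 0" "sin \<alpha> / 2 \<le> norm (gradient symb x)"
    using sin_\<alpha> by linarith+
  show "inverse_speed x > 0"
    unfolding inverse_speed_def using g(1) by simp
  have "inverse_speed x \<le> 1 / (sin \<alpha> / 2)"
    unfolding inverse_speed_def using g sin_\<alpha> by (intro divide_left_mono) auto
  then show "inverse_speed x \<le> 2 / sin \<alpha>" by simp
qed

subsection \<open>Integration over the surface\<close>

lemma surface_measure_eq:
  "surface_measure E = density (restrict_space (hausdorff_measure (CARD('d) - 1)) (energy_surface E))
     (\<lambda>x :: real ^ 'd::finite. ennreal (inverse_speed x))"
  by (simp add: surface_measure_def inverse_speed_def)

lemma surface_measurable:
  assumes "f \<in> borel_measurable borel"
  shows "f \<in> borel_measurable (surface_measure E)"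
proof -
  have "f \<in> borel_measurable (restrict_space (hausdorff_measure (CARD('a) - 1)) (energy_surface E))"
    using assms by (intro measurable_restrict_space1) (simp cong: measurable_cong_sets)
  then show ?thesis
    by (simp add: surface_measure_eq)
qed

lemma AE_surface_iff:
  fixes P :: "real ^ 'd::finite \<Rightarrow> bool"
  shows "(AE x in surface_measure E. P x) \<longleftrightarrow>
     (AE x in hausdorff_measure (CARD('d) - 1). x \<in> energy_surface E \<longrightarrow> 0 < inverse_speed x \<longrightarrow> P x)"
proof -
  let ?H = "hausdorff_measure (CARD('d) - 1) :: (real ^ 'd) measure"
  have "(\<lambda>x. ennreal (inverse_speed x)) \<in> borel_measurable (restrict_space ?H (energy_surface E))"
    by (intro measurable_restrict_space1) (simp cong: measurable_cong_sets)
  then have "(AE x in surface_measure E. P x)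
     \<longleftrightarrow> (AE x in restrict_space ?H (energy_surface E). 0 < ennreal (inverse_speed x) \<longrightarrow> P x)"
    unfolding surface_measure_eq by (rule AE_density)
  also have "\<dots> \<longleftrightarrow> (AE x in ?H. x \<in> energy_surface E \<longrightarrow> 0 < ennreal (inverse_speed x) \<longrightarrow> P x)"
    by (rule AE_restrict_space_iff) simp
  finally show ?thesis by simp
qed

lemma emeasure_surface_piece_finite:
  fixes j0 :: "'d::finite"
  assumes \<alpha>: "0 < \<alpha>" "\<alpha> < pi / 2"
  shows "emeasure (surface_measure E) (surface_piece j0 E \<alpha>) < top"
proof -
  let ?H = "hausdorff_measure (CARD('d) - 1) :: (real ^ 'd) measure" and ?S = "energy_surface E :: (real ^ 'd) set"
  let ?B = "surface_piece j0 E \<alpha>"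
  have BS: "?B \<subseteq> ?S"
    by (simp add: surface_piece_def)
  have B: "?B \<in> sets (restrict_space ?H ?S)"
    using BS by (simp add: sets_restrict_space_iff)
  have meas: "(\<lambda>x. ennreal (inverse_speed x)) \<in> borel_measurable (restrict_space ?H ?S)"
    by (intro measurable_restrict_space1) (simp cong: measurable_cong_sets)
  have "emeasure (surface_measure E) ?B
     = (\<integral>\<^sup>+ x. ennreal (inverse_speed x) * indicator ?B x \<partial>restrict_space ?H ?S)"
    unfolding surface_measure_eq by (rule emeasure_density[OF meas B])
  also have "\<dots> \<le> (\<integral>\<^sup>+ x. ennreal (2 / sin \<alpha>) * indicator ?B x \<partial>restrict_space ?H ?S)"
    using inverse_speed_piece(2)[OF \<alpha>] by (intro nn_integral_mono) (auto simp: indicator_def intro!: ennreal_leI)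
  also have "\<dots> = ennreal (2 / sin \<alpha>) * emeasure (restrict_space ?H ?S) ?B"
    by (rule nn_integral_cmult_indicator[OF B])
  also have "emeasure (restrict_space ?H ?S) ?B = hausdorff_outer (CARD('d) - 1) ?B"
    using BS by (subst emeasure_restrict_space) (auto simp: emeasure_hausdorff_measure)
  also have "ennreal (2 / sin \<alpha>) * \<dots> < top"
    using hausdorff_outer_surface_piece_finite[OF \<alpha>, of j0 E] by (simp add: ennreal_mult_less_top)
  finally show ?thesis .
qed

definition lift_point :: "'d \<Rightarrow> real \<Rightarrow> ('d::finite \<Rightarrow> real) \<Rightarrow> real ^ 'd" where
  "lift_point j0 E y = (\<chi> j. if j = j0 then arccos (transverse_energy j0 E y) else y j)"

lemma plane_wave_eq_exp: "plane_wave j0 E y n = exp (\<i> * of_real (pairing n (lift_point j0 E y)))"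
proof -
  have "pairing n (lift_point j0 E y)
     = of_int (n $ j0) * arccos (transverse_energy j0 E y) + (\<Sum>j\<in>UNIV - {j0}. of_int (n $ j) * y j)"
    unfolding pairing_def by (subst sum.remove[of _ j0]) (auto simp: lift_point_def intro!: sum.cong)
  then show ?thesis
    by (simp add: plane_wave_def transverse_phase_def cis_conv_exp exp_add[symmetric] algebra_simps)
qed

lemma lift_point_in_surface:
  fixes y :: "'d::finite \<Rightarrow> real"
  assumes "\<bar>transverse_energy j0 E y\<bar> < 1" "\<And>j. \<bar>y j\<bar> < pi"
  shows "lift_point j0 E y \<in> energy_surface E"
proof -
  have same: "transverse_energy j0 E (($) (lift_point j0 E y)) = transverse_energy j0 E y"
    by (auto simp: transverse_energy_def lift_point_def intro!: sum.cong)
  have "symb (lift_point j0 E y) = E"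
    unfolding symb_eq_iff[of _ _ j0] same using assms(1) by (simp add: lift_point_def cos_arccos_abs)
  moreover have "- 1 < transverse_energy j0 E y" "transverse_energy j0 E y < 1"
    using assms(1) by (auto simp: abs_less_iff)
  then have "0 < arccos (transverse_energy j0 E y)" "arccos (transverse_energy j0 E y) < pi"
    using arccos_lt_bounded by auto
  moreover have "- pi < y j" "y j < pi" for j
    using assms(2)[of j] by (auto simp: abs_less_iff)
  ultimately show ?thesis
    by (auto simp: energy_surface_def lift_point_def less_imp_le intro: order_trans[of _ 0])
qed

lemma lift_point_components_continuous:
  assumes "\<bar>transverse_energy j0 E y0\<bar> < 1" "e > 0"
  obtains \<rho> where "\<rho> > 0" "\<And>y. near y0 \<rho> y \<Longrightarrow> \<bar>transverse_energy j0 E y\<bar> < 1"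
    "\<And>y j. near y0 \<rho> y \<Longrightarrow> \<bar>lift_point j0 E y $ j - lift_point j0 E y0 $ j\<bar> < e"
proof -
  obtain \<rho>1 where \<rho>1: "\<rho>1 > 0" "\<And>y. near y0 \<rho>1 y \<Longrightarrow> \<bar>transverse_energy j0 E y\<bar> < 1"
    using box_inside_band[OF assms(1)] by blast
  have "isCont arccos (transverse_energy j0 E y0)"
    using assms(1) by (intro isCont_arccos) (auto simp: abs_less_iff)
  then obtain d where d: "d > 0" "\<And>s. \<bar>s - transverse_energy j0 E y0\<bar> < d \<Longrightarrow> \<bar>arccos s - arccos (transverse_energy j0 E y0)\<bar> < e"
    using assms(2) unfolding continuous_at_eps_delta dist_real_def by blast
  define \<rho> where "\<rho> = min (min \<rho>1 e) (d / (real CARD('a) + 1))"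
  have \<rho>: "\<rho> > 0" "\<rho> \<le> \<rho>1" "\<rho> \<le> e" "real CARD('a) * \<rho> < d"
  proof -
    show "\<rho> > 0" "\<rho> \<le> \<rho>1" "\<rho> \<le> e"
      using \<rho>1(1) assms(2) d(1) by (auto simp: \<rho>_def)
    have "\<rho> \<le> d / (real CARD('a) + 1)"
      by (simp add: \<rho>_def)
    then have "(real CARD('a) + 1) * \<rho> \<le> d"
      by (simp add: pos_le_divide_eq mult.commute)
    with \<open>\<rho> > 0\<close> show "real CARD('a) * \<rho> < d"
      by (simp add: algebra_simps)
  qed
  show ?thesis
  proof (rule that[OF \<rho>(1)])
    fix y assume y: "near y0 \<rho> y"
    show "\<bar>transverse_energy j0 E y\<bar> < 1"
      using y \<rho>(2) by (intro \<rho>1(2)) (auto intro: less_le_trans)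
    fix j
    show "\<bar>lift_point j0 E y $ j - lift_point j0 E y0 $ j\<bar> < e"
    proof (cases "j = j0")
      case True
      have "\<bar>transverse_energy j0 E y - transverse_energy j0 E y0\<bar> \<le> (\<Sum>j\<in>UNIV - {j0}. \<bar>y j - y0 j\<bar>)"
        by (rule transverse_energy_lipschitz)
      also have "\<dots> \<le> (\<Sum>j\<in>UNIV - {j0}. \<rho>)"
        using y by (intro sum_mono) (auto intro: less_imp_le)
      also have "\<dots> \<le> real CARD('a) * \<rho>"
        using \<rho>(1) by (simp add: card_mono mult_right_mono)
      also have "\<dots> < d"
        by (rule \<rho>(4))
      finally show ?thesis
        using True d(2) by (simp add: lift_point_def)
    next
      case False
      have "\<bar>y j - y0 j\<bar> < \<rho>"
        using y by blast
      then show ?thesis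
        using False \<rho>(3) by (simp add: lift_point_def)
    qed
  qed
qed

text \<open>
  Otherwise \<open>g\<close> is nonzero on the part of the piece above a small cube, and that part is not a null
  set.
\<close>

lemma surface_AE_continuous_zero:
  fixes j0 :: "'d::finite" and g :: "real ^ 'd \<Rightarrow> complex"
  assumes \<alpha>: "0 < \<alpha>" "\<alpha> < pi / 2" and g: "continuous_on UNIV g"
    and AE: "AE x in surface_measure E. x \<in> surface_piece j0 E \<alpha> \<longrightarrow> g x = 0"
    and y: "\<bar>transverse_energy j0 E y\<bar> < 1" "\<And>j. \<bar>y j\<bar> < pi"
      "\<alpha> < arccos (transverse_energy j0 E y)" "arccos (transverse_energy j0 E y) < pi - \<alpha>"
  shows "g (lift_point j0 E y) = 0"
proof (rule ccontr)
  let ?x = "lift_point j0 E y"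
  assume nz: "g ?x \<noteq> 0"
  have "open (g -` (- {0}))"
    using continuous_open_preimage[OF g, of "- {0}"] by auto
  moreover have "?x \<in> g -` (- {0})"
    using nz by simp
  ultimately obtain e where e: "e > 0" "ball ?x e \<subseteq> g -` (- {0})"
    by (rule openE)
  let ?\<theta> = "arccos (transverse_energy j0 E y)"
  define \<mu> where "\<mu> = Min (range (\<lambda>j. pi - \<bar>y j\<bar>))"
  have \<mu>: "\<mu> > 0" "\<And>j. \<mu> \<le> pi - \<bar>y j\<bar>"
    using y(2) by (auto simp: \<mu>_def)
  define e' where "e' = min (e / real CARD('d)) (min (?\<theta> - \<alpha>) (pi - \<alpha> - ?\<theta>))"
  have e': "e' > 0" "e' \<le> e / real CARD('d)" "e' \<le> ?\<theta> - \<alpha>" "e' \<le> pi - \<alpha> - ?\<theta>"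
    using e(1) y(3,4) by (auto simp: e'_def)
  obtain \<rho> where \<rho>: "\<rho> > 0" "\<And>z. near y \<rho> z \<Longrightarrow> \<bar>transverse_energy j0 E z\<bar> < 1"
    "\<And>z j. near y \<rho> z \<Longrightarrow> \<bar>lift_point j0 E z $ j - ?x $ j\<bar> < e'"
    using lift_point_components_continuous[OF y(1) e'(1)] by metis
  define r where "r = min \<rho> \<mu>"
  have r: "r > 0" "r \<le> \<rho>" "r \<le> \<mu>"
    using \<rho>(1) \<mu>(1) by (auto simp: r_def)
  define A where "A = {x \<in> surface_piece j0 E \<alpha>. g x \<noteq> 0}"
  have A_borel: "A \<in> sets borel"
  proof -
    have "A = surface_piece j0 E \<alpha> \<inter> g -` (- {0})"
      by (auto simp: A_def)
    then show ?thesis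
      using \<open>open (g -` (- {0}))\<close> by (auto intro!: sets.Int surface_piece_borel)
  qed
  have "hausdorff_outer (CARD('d) - 1) A > 0"
  proof (rule hausdorff_outer_graph_pos[OF r(1)])
    fix z assume z: "near (($) (\<chi> j. y j)) r z"
    have zr: "\<bar>z j - y j\<bar> < r" for j
      using z by simp
    have z\<rho>: "near y \<rho> z"
      using zr r(2) less_le_trans by blast
    have z_pi: "\<bar>z j\<bar> < pi" for j
      using zr[of j] r(3) \<mu>(2)[of j] by linarith
    let ?z = "lift_point j0 E z"
    have "?z \<in> energy_surface E"
      by (rule lift_point_in_surface[OF \<rho>(2)[OF z\<rho>] z_pi])
    moreover have "\<alpha> \<le> ?z $ j0" "?z $ j0 \<le> pi - \<alpha>"
    proof -
      have "\<bar>?z $ j0 - ?\<theta>\<bar> < e'"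
        using \<rho>(3)[OF z\<rho>, of j0] by (simp add: lift_point_def)
      then show "\<alpha> \<le> ?z $ j0" "?z $ j0 \<le> pi - \<alpha>"
        using e'(3,4) by linarith+
    qed
    moreover have "g ?z \<noteq> 0"
    proof -
      have "norm (?z - ?x) \<le> (\<Sum>j\<in>UNIV. \<bar>(?z - ?x) $ j\<bar>)"
        by (rule norm_le_l1_cart)
      also have "\<dots> < (\<Sum>j\<in>(UNIV :: 'd set). e')"
        using \<rho>(3)[OF z\<rho>] by (intro sum_strict_mono) auto
      also have "\<dots> \<le> e"
        using e'(2) zero_less_card_finite[where 'a = 'd] by (simp add: pos_le_divide_eq mult.commute)
      finally have "?z \<in> ball ?x e"
        by (simp add: dist_norm norm_minus_commute)
      then show ?thesis
        using e(2) by auto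
    qed
    ultimately have "?z \<in> A"
      by (simp add: A_def surface_piece_def)
    moreover have "\<forall>j. j \<noteq> j0 \<longrightarrow> ?z $ j = z j"
      by (simp add: lift_point_def)
    ultimately show "\<exists>x\<in>A. \<forall>j. j \<noteq> j0 \<longrightarrow> x $ j = z j"
      by blast
  qed
  moreover have "AE x in hausdorff_measure (CARD('d) - 1). x \<notin> A"
    using AE unfolding AE_surface_iff
  proof eventually_elim
    case (elim x)
    show ?case
    proof
      assume x: "x \<in> A"
      then have "x \<in> surface_piece j0 E \<alpha>" "g x \<noteq> 0"
        by (auto simp: A_def)
      with elim inverse_speed_piece(1)[OF \<alpha>] show False
        by (auto simp: surface_piece_def)
    qed
  qed
  then have "emeasure (hausdorff_measure (CARD('d) - 1)) A = 0"
    using A_borel AE_iff_measurable[of A "hausdorff_measure (CARD('d) - 1)" "\<lambda>x. x \<notin> A"] by simp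
  ultimately show False
    by (simp add: emeasure_hausdorff_measure[OF A_borel])
qed

text \<open>
  Division by the symbol under a hypothesis that an identity in \<open>L\<^sup>2\<close> of the surface can provide. One
  piece of the surface suffices, so that its total measure need not be known.
\<close>

theorem vanishing_on_surface_piece:
  fixes E :: real and j0 j1 :: "'d::finite"
  assumes E: "outer_band CARD('d) E" and j: "j1 \<noteq> j0"
  obtains B :: "(real ^ 'd) set"
  where "B \<in> sets borel" "B \<subseteq> energy_surface E" "emeasure (surface_measure E) B < top"
    "\<And>c :: int ^ 'd \<Rightarrow> complex. finite {n. c n \<noteq> 0} \<Longrightarrow>
       (AE x in surface_measure E. x \<in> B \<longrightarrow> pair c (\<lambda>n. exp (\<i> * of_real (pairing n x))) = 0) \<Longrightarrow>
       \<exists>v. finite {n. v n \<noteq> 0} \<and> (\<forall>n. H0 v n - of_real E * v n = c n)"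
proof -
  note b = outer_band_bounds[OF E]
  define \<theta> where "\<theta> = arccos ((real CARD('d) - 2 * E) / real CARD('d))"
  note \<theta> = diagonal_point(1,2,4)[OF b, folded \<theta>_def] diagonal_point(3)[OF b, of j0, folded \<theta>_def]
  define \<alpha> where "\<alpha> = min \<theta> (pi - \<theta>) / 2"
  have \<alpha>: "0 < \<alpha>" "\<alpha> < pi / 2" "\<alpha> < \<theta>" "\<theta> < pi - \<alpha>"
    using \<theta>(1,2) by (auto simp: \<alpha>_def min_def field_simps)
  have arccos: "arccos (transverse_energy j0 E (\<lambda>_. \<theta>)) = \<theta>"
    using \<theta> by (simp add: arccos_cos)
  define e where "e = min (\<theta> - \<alpha>) (pi - \<alpha> - \<theta>)"
  have e: "e > 0" "e \<le> \<theta> - \<alpha>" "e \<le> pi - \<alpha> - \<theta>"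
    using \<alpha> by (auto simp: e_def)
  have "\<bar>transverse_energy j0 E (\<lambda>_. \<theta>)\<bar> < 1"
    using \<theta>(3,4) by simp
  from lift_point_components_continuous[OF this e(1)]
  obtain \<rho> where \<rho>: "\<rho> > 0" "\<And>y. near (\<lambda>_. \<theta>) \<rho> y \<Longrightarrow> \<bar>transverse_energy j0 E y\<bar> < 1"
    "\<And>y j. near (\<lambda>_. \<theta>) \<rho> y \<Longrightarrow> \<bar>lift_point j0 E y $ j - lift_point j0 E (\<lambda>_. \<theta>) $ j\<bar> < e"
    by metis
  define r where "r = min \<rho> e"
  have r: "r > 0" "r \<le> \<rho>" "r \<le> e"
    using \<rho>(1) e(1) by (auto simp: r_def)
  let ?B = "surface_piece j0 E \<alpha>"
  show ?thesis
  proof (rule that[of ?B])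
    show "?B \<in> sets borel"
      by (rule surface_piece_borel)
    show "?B \<subseteq> energy_surface E"
      by (simp add: surface_piece_def)
    show "emeasure (surface_measure E) ?B < top"
      by (rule emeasure_surface_piece_finite[OF \<alpha>(1,2)])
    fix c :: "int ^ 'd \<Rightarrow> complex"
    assume c: "finite {n. c n \<noteq> 0}"
      and AE: "AE x in surface_measure E. x \<in> ?B \<longrightarrow> pair c (\<lambda>n. exp (\<i> * of_real (pairing n x))) = 0"
    let ?g = "\<lambda>x. pair c (\<lambda>n. exp (\<i> * of_real (pairing n x)))"
    have g_eq: "?g = (\<lambda>x. \<Sum>n | c n \<noteq> 0. c n * exp (\<i> * of_real (pairing n x)))"
      using pair_finite_support[OF c] by (simp add: fun_eq_iff)
    have g: "continuous_on UNIV ?g"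
      unfolding g_eq unfolding pairing_def by (intro continuous_intros)
    have in_band: "\<bar>transverse_energy j0 E y\<bar> < 1" if "near (\<lambda>_. \<theta>) r y" for y
      using that r(2) by (intro \<rho>(2)) (auto intro: less_le_trans)
    have van: "pair c (plane_wave j0 E y) = 0" if y: "near (\<lambda>_. \<theta>) r y" for y
    proof -
      have y\<rho>: "near (\<lambda>_. \<theta>) \<rho> y"
        using y r(2) by (auto intro: less_le_trans)
      have "\<bar>arccos (transverse_energy j0 E y) - \<theta>\<bar> < e"
        using \<rho>(3)[OF y\<rho>, of j0] by (simp add: lift_point_def arccos)
      then have "\<alpha> < arccos (transverse_energy j0 E y)" "arccos (transverse_energy j0 E y) < pi - \<alpha>"
        using e by linarith+
      moreover have "\<bar>y j\<bar> < pi" for j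
      proof -
        have "\<bar>y j - \<theta>\<bar> < r"
          using y by blast
        then show ?thesis
          using r(3) e \<alpha> by linarith
      qed
      ultimately have "?g (lift_point j0 E y) = 0"
        by (intro surface_AE_continuous_zero[OF \<alpha>(1,2) g AE in_band[OF y]])
      then show ?thesis
        by (simp add: plane_wave_eq_exp[abs_def])
    qed
    obtain v where "finite {n. v n \<noteq> 0}" "\<And>n. H0 v n - of_real E * v n = c n"
    proof (rule division_by_symbol[OF j c r(1) transverse_rest_nonzero[OF E j] in_band])
      fix y :: "'d \<Rightarrow> real" assume "near (\<lambda>_. \<theta>) r y"
      then show "pair c (plane_wave j0 E y) = 0"
        by (rule van)
    qed (use that in auto)
    then show "\<exists>v. finite {n. v n \<noteq> 0} \<and> (\<forall>n. H0 v n - of_real E * v n = c n)"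
      by blast
  qed
qed

section \<open>Solutions supported in a wedge\<close>

lemma site_neighbour_count:
  fixes m :: "int ^ 'd::finite"
  assumes "n = m + axis i 1 \<or> n = m - axis i 1"
  shows "(\<Sum>j\<in>UNIV. site n (m + axis j 1) + site n (m - axis j 1)) = 1"
proof -
  have ax: "axis j (1::int) = axis i 1 \<longleftrightarrow> j = i" "axis j (1::int) \<noteq> - axis i 1" "- axis j (1::int) \<noteq> axis i 1"
    for i j :: 'd
  proof -
    show "axis j (1::int) = axis i 1 \<longleftrightarrow> j = i"
      by (simp add: axis_eq_axis)
    have "axis j (1::int) $ j = 1" "(- axis i (1::int)) $ j \<le> 0"
      by (simp_all add: axis_def)
    then show "axis j (1::int) \<noteq> - axis i 1"
      by (metis not_one_le_zero)
    have "axis i (1::int) $ i = 1" "(- axis j (1::int)) $ i \<le> 0"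
      by (simp_all add: axis_def)
    then show "- axis j (1::int) \<noteq> axis i 1"
      by (metis not_one_le_zero)
  qed
  have "(\<Sum>j\<in>UNIV. site n (m + axis j 1) + site n (m - axis j 1)) = (\<Sum>j\<in>UNIV. if j = i then 1 else 0)"
  proof (intro sum.cong refl)
    fix j :: 'd
    have eqs: "m + axis j 1 = m + axis i 1 \<longleftrightarrow> axis j (1::int) = axis i 1" "m - axis j 1 = m - axis i 1 \<longleftrightarrow> axis j (1::int) = axis i 1"
      "m + axis j 1 = m - axis i 1 \<longleftrightarrow> axis j (1::int) = - axis i 1" "m - axis j 1 = m + axis i 1 \<longleftrightarrow> - axis j (1::int) = axis i 1"
      by (simp_all only: diff_conv_add_uminus add_left_cancel neg_equal_iff_equal)
    show "site n (m + axis j 1) + site n (m - axis j 1) = (if j = i then 1 else 0)"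
      using assms by (elim disjE) (simp_all only: site_def eqs ax, auto)
  qed
  then show ?thesis by simp
qed

text \<open>
  The equation centred at \<open>ctr n\<close> is solved for the value at its neighbour \<open>n\<close>. The sites in \<open>D\<close> are
  those whose value is free.
\<close>

lemma solution_by_recursion:
  fixes V :: "int ^ 'd::finite \<Rightarrow> real" and E :: real and ctr :: "int ^ 'd \<Rightarrow> int ^ 'd"
  assumes wf: "wf r"
    and ctr: "\<And>n. n \<notin> D \<Longrightarrow> \<exists>i. n = ctr n + axis i 1 \<or> n = ctr n - axis i 1"
    and r0: "\<And>n. n \<notin> D \<Longrightarrow> (ctr n, n) \<in> r"
    and r1: "\<And>n j. n \<notin> D \<Longrightarrow> ctr n + axis j 1 \<noteq> n \<Longrightarrow> (ctr n + axis j 1, n) \<in> r"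
    and r2: "\<And>n j. n \<notin> D \<Longrightarrow> ctr n - axis j 1 \<noteq> n \<Longrightarrow> (ctr n - axis j 1, n) \<in> r"
  obtains u :: "int ^ 'd \<Rightarrow> complex"
  where "\<And>n. n \<in> D \<Longrightarrow> u n = data n" "\<And>n. n \<notin> D \<Longrightarrow> Hop V u (ctr n) = of_real E * u (ctr n)"
proof
  let ?q = "\<lambda>m. of_nat (2 * CARD('d)) + 4 * of_real (V m) - 4 * of_real E :: complex"
  define H where "H = (\<lambda>u n. if n \<in> D then data n else ?q (ctr n) * u (ctr n)
     - (\<Sum>j\<in>UNIV. (u(n := 0)) (ctr n + axis j 1) + (u(n := 0)) (ctr n - axis j 1)))"
  define u where "u = wfrec r H"
  have u: "u n = H u n" for n
  proof -
    have "u n = H (cut u r n) n"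
      unfolding u_def by (rule wfrec[OF wf])
    also have "\<dots> = H u n"
    proof (cases "n \<in> D")
      case False
      have 0: "cut u r n (ctr n) = u (ctr n)"
        using r0[OF False] by (simp add: cut_apply)
      have 1: "((cut u r n)(n := 0)) (ctr n + axis j 1) = (u(n := 0)) (ctr n + axis j 1)" for j
        using r1[OF False, of j] by (simp add: cut_apply)
      have 2: "((cut u r n)(n := 0)) (ctr n - axis j 1) = (u(n := 0)) (ctr n - axis j 1)" for j
        using r2[OF False, of j] by (simp add: cut_apply)
      show ?thesis
        unfolding H_def 0 1 2 ..
    qed (simp add: H_def)
    finally show ?thesis .
  qed
  show "u n = data n" if "n \<in> D" for n
    using u[of n] that by (simp add: H_def)
  show "Hop V u (ctr n) = of_real E * u (ctr n)" if n: "n \<notin> D" for n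
  proof -
    let ?m = "ctr n"
    obtain i where i: "n = ?m + axis i 1 \<or> n = ?m - axis i 1"
      using ctr[OF n] by blast
    have split: "u k = (u(n := 0)) k + u n * site n k" for k
      by (simp add: site_def)
    have "(\<Sum>j\<in>UNIV. u (?m + axis j 1) + u (?m - axis j 1))
       = (\<Sum>j\<in>UNIV. ((u(n := 0)) (?m + axis j 1) + u n * site n (?m + axis j 1))
          + ((u(n := 0)) (?m - axis j 1) + u n * site n (?m - axis j 1)))"
      by (intro sum.cong refl arg_cong2[where f = "(+)"] split)
    also have "\<dots> = (\<Sum>j\<in>UNIV. (u(n := 0)) (?m + axis j 1) + (u(n := 0)) (?m - axis j 1))
       + u n * (\<Sum>j\<in>UNIV. site n (?m + axis j 1) + site n (?m - axis j 1))"
      by (simp only: sum.distrib sum_distrib_left distrib_left add_ac)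
    also have "\<dots> = (\<Sum>j\<in>UNIV. (u(n := 0)) (?m + axis j 1) + (u(n := 0)) (?m - axis j 1)) + u n"
      unfolding site_neighbour_count[OF i] by simp
    also have "\<dots> = ?q ?m * u ?m"
      using u[of n] n by (simp add: H_def)
    finally have S: "(\<Sum>j\<in>UNIV. u (?m + axis j 1) + u (?m - axis j 1)) = ?q ?m * u ?m" .
    show ?thesis
      unfolding Hop_eq S by (simp add: field_simps)
  qed
qed

text \<open>
  Cauchy data on two neighbouring slices: a unit value at \<open>n0\<close> on the slice of \<open>n0\<close>, and zero on the
  slice before. Influence spreads by one site per step, so that behind the slice of \<open>n0\<close> the solution
  lives in a cone with apex at \<open>n0 - 2 axis j0 1\<close>, below the diagonal through \<open>n0\<close>.
\<close>

lemma slab_solution: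
  fixes V :: "int ^ 'd::finite \<Rightarrow> real" and E :: real and j0 j1 :: 'd
  assumes j: "j1 \<noteq> j0"
  obtains u :: "int ^ 'd \<Rightarrow> complex"
  where "\<And>n. Hop V u n = of_real E * u n" "u n0 = 1"
    "\<And>n. n $ j0 \<le> n0 $ j0 \<Longrightarrow> n \<noteq> n0 \<Longrightarrow> n0 $ j0 + n0 $ j1 - 2 < n $ j0 + n $ j1 \<Longrightarrow> u n = 0"
proof -
  let ?a = "n0 $ j0"
  let ?D = "{n. n $ j0 = ?a \<or> n $ j0 = ?a - 1}"
  let ?ctr = "\<lambda>n. if n $ j0 > ?a then n - axis j0 1 else n + axis j0 1"
  let ?rk = "\<lambda>n :: int ^ 'd. if n $ j0 \<ge> ?a then nat (n $ j0 - ?a) else nat (?a - 1 - n $ j0)"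
  have ax: "axis i 1 $ k = (if k = i then 1 else 0 :: int)" for i k :: 'd
    by (auto simp: axis_def)
  obtain u :: "int ^ 'd \<Rightarrow> complex" where u: "\<And>n. n \<in> ?D \<Longrightarrow> u n = site n0 n"
    "\<And>n. n \<notin> ?D \<Longrightarrow> Hop V u (?ctr n) = of_real E * u (?ctr n)"
  proof (rule solution_by_recursion[where r = "inv_image less_than ?rk" and D = ?D and ctr = ?ctr and V = V and E = E and data = "site n0"])
    show "wf (inv_image less_than ?rk)" by (intro wf_inv_image) auto
    fix n :: "int ^ 'd" assume n: "n \<notin> ?D"
    show "\<exists>i. n = ?ctr n + axis i 1 \<or> n = ?ctr n - axis i 1"
      by (intro exI[of _ j0]) auto
    show "(?ctr n, n) \<in> inv_image less_than ?rk"
      using n by (auto simp: ax)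
    fix i :: 'd
    have ne: "i \<noteq> j0" if "?ctr n + axis i 1 \<noteq> n" "n $ j0 > ?a"
      using that by auto
    show "(?ctr n + axis i 1, n) \<in> inv_image less_than ?rk" if "?ctr n + axis i 1 \<noteq> n"
      using n that ne by (cases "n $ j0 > ?a"; cases "i = j0") (auto simp: ax)
    show "(?ctr n - axis i 1, n) \<in> inv_image less_than ?rk" if "?ctr n - axis i 1 \<noteq> n"
      using n that by (cases "n $ j0 > ?a"; cases "i = j0") (auto simp: ax)
  qed (rule that)
  have eq: "Hop V u m = of_real E * u m" for m
  proof (cases "m $ j0 \<ge> ?a")
    case True
    then show ?thesis
      using u(2)[of "m + axis j0 1"] by (simp add: ax)
  next
    case False
    then show ?thesis
      using u(2)[of "m - axis j0 1"] by (simp add: ax)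
  qed
  have supp: "u n = 0"
    if "n $ j0 \<le> ?a" "n \<noteq> n0" "?a + n0 $ j1 - 2 < n $ j0 + n $ j1" for n
    using that
  proof (induction "nat (?a - n $ j0)" arbitrary: n rule: less_induct)
    case less
    show ?case
    proof (cases "n \<in> ?D")
      case True
      then show ?thesis
        using u(1)[OF True] less.prems by (simp add: site_def)
    next
      case False
      then have n: "n $ j0 \<le> ?a - 2"
        using less.prems(1) by auto
      let ?m = "n + axis j0 1"
      have zero: "u k = 0"
        if "k $ j0 = n $ j0 + 1 \<or> k $ j0 = n $ j0 + 2 \<and> k $ j1 = n $ j1" "n $ j0 + n $ j1 \<le> k $ j0 + k $ j1" for k
      proof (rule less.hyps)
        show "nat (?a - k $ j0) < nat (?a - n $ j0)" "k $ j0 \<le> ?a"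
          using that n by auto
        show "?a + n0 $ j1 - 2 < k $ j0 + k $ j1"
          using that(2) less.prems(3) by linarith
        show "k \<noteq> n0"
        proof
          assume "k = n0"
          with that n less.prems(3) show False by auto
        qed
      qed
      have "u (?m + axis i 1) + u (?m - axis i 1) = (if i = j0 then u n else 0)" for i
      proof (cases "i = j0")
        case True
        then show ?thesis
          using zero[of "?m + axis j0 1"] j by (simp add: ax)
      next
        case False
        then show ?thesis
          using zero[of "?m + axis i 1"] zero[of "?m - axis i 1"] j by (simp add: ax)
      qed
      then have "Hop V u ?m = - (1 / 4) * u n"
        using zero[of ?m] j by (simp add: Hop_eq ax)
      then show ?thesis
        using eq[of ?m] zero[of ?m] j by (simp add: ax)
    qed
  qed
  show ?thesis
  proof (rule that[OF eq])
    show "u n0 = 1"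
      using u(1)[of n0] by (simp add: site_def)
    show "u n = 0" if "n $ j0 \<le> ?a" "n \<noteq> n0" "?a + n0 $ j1 - 2 < n $ j0 + n $ j1" for n
      using that by (rule supp)
  qed
qed

text \<open>
  Of the sites in the equation at \<open>m\<close> only \<open>m + axis j0 1\<close> and \<open>m + axis j1 1\<close> lie on the next diagonal.
  Once the lower diagonals are known, the equation is a first-order recursion along that diagonal,
  which leaves the value at \<open>n $ j0 = n0 $ j0\<close> free.
\<close>

lemma half_space_solution:
  fixes V :: "int ^ 'd::finite \<Rightarrow> real" and E :: real and j0 j1 :: 'd
  assumes j: "j1 \<noteq> j0"
  obtains u :: "int ^ 'd \<Rightarrow> complex"
  where "\<And>n. Hop V u n = of_real E * u n" "u n0 = 1"
    "\<And>n. n $ j0 + n $ j1 < n0 $ j0 + n0 $ j1 \<Longrightarrow> u n = 0"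
proof -
  let ?a = "n0 $ j0" and ?p = "\<lambda>n :: int ^ 'd. n $ j0 + n $ j1"
  let ?D = "{n. ?p n < ?p n0 \<or> n $ j0 = ?a}"
  let ?ctr = "\<lambda>n. if n $ j0 > ?a then n - axis j0 1 else n - axis j1 1"
  let ?r = "inv_image (less_than <*lex*> less_than) (\<lambda>n. (nat (?p n - ?p n0 + 1), nat \<bar>n $ j0 - ?a\<bar>))"
  have ax: "axis i 1 $ k = (if k = i then 1 else 0 :: int)" for i k :: 'd
    by (auto simp: axis_def)
  have lower: "(k, n) \<in> ?r" if "?p k < ?p n" "n \<notin> ?D" for k n
    using that by auto
  have level: "(k, n) \<in> ?r" if "?p k = ?p n" "\<bar>k $ j0 - ?a\<bar> < \<bar>n $ j0 - ?a\<bar>" for k n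
    using that by auto
  obtain u :: "int ^ 'd \<Rightarrow> complex" where u: "\<And>n. n \<in> ?D \<Longrightarrow> u n = site n0 n"
    "\<And>n. n \<notin> ?D \<Longrightarrow> Hop V u (?ctr n) = of_real E * u (?ctr n)"
  proof (rule solution_by_recursion[where r = ?r and D = ?D and ctr = ?ctr and V = V and E = E and data = "site n0"])
    show "wf ?r" by (intro wf_inv_image wf_lex_prod) auto
    fix n :: "int ^ 'd" assume n: "n \<notin> ?D"
    show "\<exists>i. n = ?ctr n + axis i 1 \<or> n = ?ctr n - axis i 1"
      by (cases "n $ j0 > ?a") auto
    show "(?ctr n, n) \<in> ?r"
      using j by (intro lower n) (auto simp: ax)
    fix i :: 'd
    show "(?ctr n - axis i 1, n) \<in> ?r"
      using j by (intro lower n) (auto simp: ax)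
    show "(?ctr n + axis i 1, n) \<in> ?r" if ne: "?ctr n + axis i 1 \<noteq> n"
    proof (cases "i = j0 \<or> i = j1")
      case False
      then show ?thesis
        using j by (intro lower n) (auto simp: ax)
    next
      case True
      show ?thesis
      proof (cases "n $ j0 > ?a")
        case gt: True
        then have "i = j1"
          using True ne by auto
        then show ?thesis
          using gt j by (intro level) (auto simp: ax)
      next
        case le: False
        then have "i = j0" "n $ j0 < ?a"
          using True ne n by auto
        then show ?thesis
          using le j by (intro level) (auto simp: ax)
      qed
    qed
  qed (rule that)
  have below: "u n = 0" if "?p n < ?p n0" for n
    using u(1)[of n] that by (auto simp: site_def)
  have eq: "Hop V u m = of_real E * u m" for m
  proof (cases "?p m \<ge> ?p n0 - 1")
    case True
    show ?thesis
    proof (cases "m $ j0 \<ge> ?a")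
      case ge: True
      then show ?thesis
        using u(2)[of "m + axis j0 1"] True j by (simp add: ax)
    next
      case lt: False
      then show ?thesis
        using u(2)[of "m + axis j1 1"] True j by (simp add: ax)
    qed
  next
    case False
    have "u (m + axis i 1) = 0" "u (m - axis i 1) = 0" for i
      using False j by (auto intro!: below simp: ax)
    moreover have "u m = 0"
      using False by (intro below) auto
    ultimately show ?thesis
      by (simp add: Hop_eq)
  qed
  show ?thesis
  proof (rule that[OF eq])
    show "u n0 = 1"
      using u(1)[of n0] by (simp add: site_def)
  qed (rule below)
qed

section \<open>The amplitude on generalised eigenfunctions\<close>

text \<open>
  All solutions of the difference equation, without any growth condition.
\<close>

definition eigenspace :: "(int ^ 'd::finite \<Rightarrow> real) \<Rightarrow> real \<Rightarrow> (int ^ 'd \<Rightarrow> complex) set" where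
  "eigenspace V E = {u. \<forall>n. Hop V u n = of_real E * u n}"

lemma H0_sum:
  assumes "finite I"
  shows "H0 (\<lambda>n. \<Sum>i\<in>I. a i * f i n) n = (\<Sum>i\<in>I. a i * H0 (f i) n)"
  using assms
proof (induction I rule: finite_induct)
  case empty
  then show ?case by (simp add: H0_def)
next
  case (insert i I)
  then show ?case
    using H0_lin[of "a i" "f i" 1 "\<lambda>n. \<Sum>i\<in>I. a i * f i n" n] by simp
qed

lemma green_boundary_equation:
  assumes E: "E \<notin> \<int>"
  shows "H0 (green j0 E 0) n - of_real E * green j0 E 0 n = site 0 n"
proof -
  have "((\<lambda>\<epsilon>. Hop (\<lambda>_. 0) (green j0 E \<epsilon>) n - Complex E \<epsilon> * green j0 E \<epsilon> n)
     \<longlongrightarrow> Hop (\<lambda>_. 0) (green j0 E 0) n - Complex E 0 * green j0 E 0 n) (at_right 0)"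
    by (intro tendsto_intros tendsto_Hop green_tendsto[OF E])
  moreover have "\<forall>\<^sub>F \<epsilon> in at_right 0. Hop (\<lambda>_. 0) (green j0 E \<epsilon>) n - Complex E \<epsilon> * green j0 E \<epsilon> n = site 0 n"
    using eventually_pos_at_right by eventually_elim (simp add: Hop_0 green_equation[OF E])
  then have "((\<lambda>\<epsilon>. Hop (\<lambda>_. 0) (green j0 E \<epsilon>) n - Complex E \<epsilon> * green j0 E \<epsilon> n) \<longlongrightarrow> site 0 n) (at_right 0)"
    by (rule tendsto_eventually)
  ultimately have "Hop (\<lambda>_. 0) (green j0 E 0) n - Complex E 0 * green j0 E 0 n = site 0 n"
    using tendsto_unique trivial_limit_at_right_real by blast
  moreover have "Complex E 0 = of_real E"
    by (simp add: complex_eq_iff)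
  ultimately show ?thesis
    by (simp add: Hop_0)
qed

lemma free_conv_equation:
  assumes E: "E \<notin> \<int>" and f: "finite {n. f n \<noteq> 0}"
  shows "H0 (free_conv j0 E f) n - of_real E * free_conv j0 E f n = f n"
proof -
  let ?F = "{n. f n \<noteq> 0}"
  have fc: "free_conv j0 E f = (\<lambda>n. \<Sum>m\<in>?F. f m * green j0 E 0 (n - m))"
    using free_conv_sum[OF f] by (simp add: fun_eq_iff mult.commute)
  have shift: "H0 (\<lambda>n. green j0 E 0 (n - m)) n = H0 (green j0 E 0) (n - m)" for m
    by (simp add: H0_def algebra_simps)
  have "H0 (free_conv j0 E f) n - of_real E * free_conv j0 E f n
     = (\<Sum>m\<in>?F. f m * (H0 (green j0 E 0) (n - m) - of_real E * green j0 E 0 (n - m)))"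
    unfolding fc H0_sum[OF f] shift by (simp add: sum_distrib_left sum_subtractf algebra_simps)
  also have "\<dots> = (\<Sum>m\<in>?F. if m = n then f n else 0)"
    unfolding green_boundary_equation[OF E] by (intro sum.cong) (auto simp: site_def)
  also have "\<dots> = f n"
    using f by (auto simp: sum.delta)
  finally show ?thesis .
qed

text \<open>The operator \<open>(1 - V R(E + \<i>0)) V\<close> of the stationary formula, in terms of the kernel of \<open>R(E + \<i>0)\<close>.\<close>

definition amplitude_op ::
    "(int ^ 'd::finite \<Rightarrow> real) \<Rightarrow> (int ^ 'd \<Rightarrow> int ^ 'd \<Rightarrow> complex) \<Rightarrow> (int ^ 'd \<Rightarrow> complex) \<Rightarrow> int ^ 'd \<Rightarrow> complex" where
  "amplitude_op V K w n = mult_op V w n - of_real (V n) * pair (K n) (mult_op V w)"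

context
  fixes V :: "int ^ 'd::finite \<Rightarrow> real" and E :: real and K and j0 :: 'd and F :: "(int ^ 'd) set"
  assumes E: "E \<notin> \<int>" and F: "finite F" and V: "\<And>n. n \<notin> F \<Longrightarrow> V n = 0"
    and K: "limiting_absorption V E K"
begin

private lemma V_finite: "finite {n. V n \<noteq> 0}"
  by (rule finite_subset[OF _ F]) (use V in auto)

private lemma mult_op_0: "n \<notin> F \<Longrightarrow> mult_op V u n = 0"
  by (simp add: mult_op_def V)

private lemma mult_op_finite: "finite {n. mult_op V u n \<noteq> 0}"
  by (rule finite_subset[OF _ F]) (use mult_op_0 in blast)

private lemma pair_mult_op: "pair (mult_op V u) g = (\<Sum>n\<in>F. mult_op V u n * g n)"
  by (rule pair_finite_support[OF F]) (rule mult_op_0)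

lemma amplitude_op_0: "n \<notin> F \<Longrightarrow> amplitude_op V K w n = 0"
  by (simp add: amplitude_op_def mult_op_def V)

private lemma K_symmetric: "K n m = K m n"
  by (rule limiting_absorption_symmetric[OF V_finite K])

text \<open>
  Inherited from the symmetry of the kernel of the resolvent.
\<close>

lemma amplitude_op_symmetric: "(\<Sum>n\<in>F. w n * amplitude_op V K w' n) = (\<Sum>n\<in>F. amplitude_op V K w n * w' n)"
proof -
  let ?v = "\<lambda>n. complex_of_real (V n)"
  have K_sum: "pair (K n) (mult_op V w) = (\<Sum>m\<in>F. K n m * (?v m * w m))" for n w
    unfolding pair_commute[of "K n"] pair_mult_op by (simp add: mult_op_def mult_ac)
  have "(\<Sum>n\<in>F. w n * amplitude_op V K w' n)
     = (\<Sum>n\<in>F. w n * (?v n * w' n)) - (\<Sum>n\<in>F. \<Sum>m\<in>F. w n * ?v n * K n m * (?v m * w' m))"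
    by (simp add: amplitude_op_def K_sum mult_op_def sum_subtractf right_diff_distrib sum_distrib_left mult.assoc)
  also have "(\<Sum>n\<in>F. \<Sum>m\<in>F. w n * ?v n * K n m * (?v m * w' m)) = (\<Sum>n\<in>F. \<Sum>m\<in>F. w m * ?v m * K m n * (?v n * w' n))"
    by (rule sum.swap)
  also have "\<dots> = (\<Sum>n\<in>F. \<Sum>m\<in>F. ?v n * (K n m * (?v m * w m)) * w' n)"
    by (intro sum.cong refl) (subst K_symmetric, simp only: mult_ac)
  also have "(\<Sum>n\<in>F. w n * (?v n * w' n)) - \<dots> = (\<Sum>n\<in>F. amplitude_op V K w n * w' n)"
    by (simp add: amplitude_op_def K_sum mult_op_def sum_subtractf left_diff_distrib right_diff_distrib sum_distrib_left sum_distrib_right mult_ac)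
  finally show ?thesis .
qed

text \<open>\<open>1 + R\<^sub>0 V\<close> takes solutions of the perturbed equation to solutions of the free one, growing ones included.\<close>

lemma free_solution_mem:
  assumes "u \<in> eigenspace V E"
  shows "(\<lambda>n. u n + free_conv j0 E (mult_op V u) n) \<in> eigenspace (\<lambda>_. 0) E"
proof -
  have u: "H0 u n + mult_op V u n = of_real E * u n" for n
    using assms by (simp add: eigenspace_def Hop_def)
  have "H0 (\<lambda>n. 1 * u n + 1 * free_conv j0 E (mult_op V u) n) n
     = of_real E * (u n + free_conv j0 E (mult_op V u) n)" for n
    unfolding H0_lin using u[of n] free_conv_equation[OF E mult_op_finite, of j0 u n]
    by (simp add: algebra_simps)
  then show ?thesis
    by (simp add: eigenspace_def Hop_0)
qed

text \<open>
  The resolvent identity \<open>R V R\<^sub>0 = R\<^sub>0 - R\<close> gives \<open>R V (1 + R\<^sub>0 V) u = R\<^sub>0 V u\<close>, and the terms with \<open>R\<^sub>0\<close>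
  cancel.
\<close>

lemma amplitude_op_free_solution:
  "amplitude_op V K (\<lambda>n. u n + free_conv j0 E (mult_op V u) n) = mult_op V u"
proof
  fix n
  let ?v = "\<lambda>n. complex_of_real (V n)"
  let ?f = "mult_op V u"
  let ?F = "insert n F"
  have F': "finite ?F" using F by simp
  have f0: "?f m = 0" if "m \<notin> ?F" for m
    using that mult_op_0 by simp
  let ?g = "\<lambda>p. site n p - ?v p * K n p"
  have g0: "?g p = 0" if "p \<notin> ?F" for p
    using that V[of p] by (simp add: site_def)
  have fc: "free_conv j0 E ?f p = (\<Sum>m\<in>?F. green j0 E 0 (p - m) * ?f m)" for p
    by (rule free_conv_sum[OF F' f0])
  have green_sym: "green j0 E 0 (m - p) = green j0 E 0 (p - m)" for m p
    using green_even[OF E, of j0 "p - m"] by simp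
  have K_eq: "K n m = (\<Sum>p\<in>?F. green j0 E 0 (m - p) * ?g p)" for m
    by (rule trans[OF boundary_resolvent_identity[OF E V_finite K] free_conv_sum[OF F' g0]])
  have "pair (K n) ?f = (\<Sum>m\<in>?F. ?f m * K n m)"
    unfolding pair_commute[of "K n"] by (rule pair_finite_support[OF F' f0])
  also have "\<dots> = (\<Sum>m\<in>?F. \<Sum>p\<in>?F. ?f m * (green j0 E 0 (m - p) * ?g p))"
    by (intro sum.cong refl) (subst K_eq, rule sum_distrib_left)
  also have "\<dots> = (\<Sum>p\<in>?F. \<Sum>m\<in>?F. ?f m * (green j0 E 0 (m - p) * ?g p))"
    by (rule sum.swap)
  also have "\<dots> = (\<Sum>p\<in>?F. ?g p * free_conv j0 E ?f p)"
    unfolding fc sum_distrib_left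
    by (intro sum.cong refl) (subst green_sym, simp only: mult_ac)
  also have "\<dots> = (\<Sum>p\<in>?F. site n p * free_conv j0 E ?f p) - (\<Sum>p\<in>?F. (?v p * free_conv j0 E ?f p) * K n p)"
    by (simp add: left_diff_distrib right_diff_distrib sum_subtractf mult_ac)
  also have "(\<Sum>p\<in>?F. site n p * free_conv j0 E ?f p) = free_conv j0 E ?f n"
    using pair_finite_support[OF F', of "site n" "free_conv j0 E ?f"] by (simp add: site_def)
  also have "(\<Sum>p\<in>?F. (?v p * free_conv j0 E ?f p) * K n p) = pair (K n) (mult_op V (free_conv j0 E ?f))"
    unfolding pair_commute[of "K n"]
    using pair_finite_support[OF F', of "mult_op V (free_conv j0 E ?f)" "K n"] mult_op_0 by (simp add: mult_op_def)
  finally have res: "pair (K n) ?f + pair (K n) (mult_op V (free_conv j0 E ?f)) = free_conv j0 E ?f n"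
    by simp
  have "pair (K n) (mult_op V (\<lambda>n. u n + free_conv j0 E ?f n)) = pair (K n) ?f + pair (K n) (mult_op V (free_conv j0 E ?f))"
    unfolding pair_commute[of "K n"] pair_mult_op
    by (simp add: mult_op_def algebra_simps sum.distrib)
  then show "amplitude_op V K (\<lambda>n. u n + free_conv j0 E ?f n) n = ?f n"
    unfolding amplitude_op_def res by (simp add: mult_op_def algebra_simps)
qed

end

lemma free_conv_symmetric:
  assumes E: "E \<notin> \<int>" and F: "finite F" and "\<And>n. n \<notin> F \<Longrightarrow> f n = 0" "\<And>n. n \<notin> F \<Longrightarrow> g n = 0"
  shows "(\<Sum>n\<in>F. free_conv j0 E f n * g n) = (\<Sum>n\<in>F. f n * free_conv j0 E g n)"
proof -
  have conv: "free_conv j0 E f n = (\<Sum>m\<in>F. green j0 E 0 (n - m) * f m)"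
      "free_conv j0 E g n = (\<Sum>m\<in>F. green j0 E 0 (n - m) * g m)" for n
    by (rule free_conv_sum[OF F assms(3)], assumption) (rule free_conv_sum[OF F assms(4)])
  have even: "green j0 E 0 (m - n) = green j0 E 0 (n - m)" for n m
    using green_even[OF E, of j0 "n - m"] by simp
  have "(\<Sum>n\<in>F. free_conv j0 E f n * g n) = (\<Sum>n\<in>F. \<Sum>m\<in>F. green j0 E 0 (n - m) * f m * g n)"
    unfolding conv by (simp only: sum_distrib_right)
  also have "\<dots> = (\<Sum>n\<in>F. \<Sum>m\<in>F. green j0 E 0 (m - n) * f n * g m)"
    by (rule sum.swap)
  also have "\<dots> = (\<Sum>n\<in>F. \<Sum>m\<in>F. f n * (green j0 E 0 (n - m) * g m))"
  proof (intro sum.cong refl)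
    fix n m
    show "green j0 E 0 (m - n) * f n * g m = f n * (green j0 E 0 (n - m) * g m)"
      unfolding even[of m n] by (simp add: mult_ac)
  qed
  also have "\<dots> = (\<Sum>n\<in>F. f n * free_conv j0 E g n)"
    unfolding conv by (simp only: sum_distrib_left)
  finally show ?thesis .
qed

text \<open>
  With \<open>w\<^sub>i = u\<^sub>i + R\<^sub>0 V\<^sub>i u\<^sub>i\<close> the hypothesis on the amplitudes reads \<open>\<langle>w\<^sub>2, V\<^sub>1 u\<^sub>1\<rangle> = \<langle>V\<^sub>2 u\<^sub>2, w\<^sub>1\<rangle>\<close>, in which the
  terms with \<open>R\<^sub>0\<close> agree by symmetry.
\<close>

lemma orthogonality_of_products:
  fixes V1 V2 :: "int ^ 'd::finite \<Rightarrow> real"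
  assumes E: "E \<notin> \<int>" and F: "finite F"
    and V1: "\<And>n. n \<notin> F \<Longrightarrow> V1 n = 0" and V2: "\<And>n. n \<notin> F \<Longrightarrow> V2 n = 0"
    and K1: "limiting_absorption V1 E K1" and K2: "limiting_absorption V2 E K2"
    and eq: "\<And>w w'. w \<in> eigenspace (\<lambda>_. 0) E \<Longrightarrow> w' \<in> eigenspace (\<lambda>_. 0) E \<Longrightarrow>
       (\<Sum>n\<in>F. w n * amplitude_op V1 K1 w' n) = (\<Sum>n\<in>F. w n * amplitude_op V2 K2 w' n)"
    and u1: "u1 \<in> eigenspace V1 E" and u2: "u2 \<in> eigenspace V2 E"
  shows "(\<Sum>n\<in>F. of_real (V1 n - V2 n) * (u1 n * u2 n)) = 0"
proof -
  obtain j0 :: 'd where True by simp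
  let ?f1 = "mult_op V1 u1" and ?f2 = "mult_op V2 u2"
  define w1 where "w1 = (\<lambda>n. u1 n + free_conv j0 E ?f1 n)"
  define w2 where "w2 = (\<lambda>n. u2 n + free_conv j0 E ?f2 n)"
  have w: "w1 \<in> eigenspace (\<lambda>_. 0) E" "w2 \<in> eigenspace (\<lambda>_. 0) E"
    unfolding w1_def w2_def
    using free_solution_mem[OF E F V1 K1 u1] free_solution_mem[OF E F V2 K2 u2] by auto
  have A: "amplitude_op V1 K1 w1 = ?f1" "amplitude_op V2 K2 w2 = ?f2"
    unfolding w1_def w2_def
    using amplitude_op_free_solution[OF E F V1 K1] amplitude_op_free_solution[OF E F V2 K2] by auto
  have "(\<Sum>n\<in>F. w2 n * ?f1 n) = (\<Sum>n\<in>F. w2 n * amplitude_op V2 K2 w1 n)"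
    using eq[OF w(2,1)] unfolding A .
  also have "\<dots> = (\<Sum>n\<in>F. amplitude_op V2 K2 w2 n * w1 n)"
    by (rule amplitude_op_symmetric[OF E F V2 K2])
  also have "\<dots> = (\<Sum>n\<in>F. ?f2 n * w1 n)"
    unfolding A ..
  finally have "(\<Sum>n\<in>F. u2 n * ?f1 n) + (\<Sum>n\<in>F. free_conv j0 E ?f2 n * ?f1 n)
     = (\<Sum>n\<in>F. ?f2 n * u1 n) + (\<Sum>n\<in>F. ?f2 n * free_conv j0 E ?f1 n)"
    by (simp add: w1_def w2_def algebra_simps sum.distrib)
  moreover have "(\<Sum>n\<in>F. free_conv j0 E ?f2 n * ?f1 n) = (\<Sum>n\<in>F. ?f2 n * free_conv j0 E ?f1 n)"
    by (rule free_conv_symmetric[OF E F]) (simp_all add: mult_op_def V1 V2)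
  ultimately have "(\<Sum>n\<in>F. u2 n * ?f1 n) - (\<Sum>n\<in>F. ?f2 n * u1 n) = 0"
    by simp
  then show ?thesis
    unfolding sum_subtractf[symmetric] by (simp add: mult_op_def algebra_simps)
qed

section \<open>From the S-matrix to the amplitudes\<close>

text \<open>
  Summation by parts, one factor being finitely supported.
\<close>

lemma range_orthogonal_eigenspace:
  assumes v: "finite {n. v n \<noteq> 0}" and w: "w \<in> eigenspace (\<lambda>_. 0) E"
  shows "pair (\<lambda>n. H0 v n - of_real E * v n) w = 0"
proof -
  have Hw: "H0 w n = of_real E * w n" for n
    using w by (simp add: eigenspace_def Hop_0)
  have fH: "finite {n. H0 v n \<noteq> 0}"
    using finite_support_Hop[OF v, of "\<lambda>_. 0"] by (simp add: Hop_0)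
  let ?F = "{n. v n \<noteq> 0} \<union> {n. H0 v n \<noteq> 0}"
  have F: "finite ?F" using v fH by simp
  have "pair (\<lambda>n. H0 v n - of_real E * v n) w = (\<Sum>n\<in>?F. (H0 v n - of_real E * v n) * w n)"
    by (rule pair_finite_support[OF F]) auto
  also have "\<dots> = (\<Sum>n\<in>?F. H0 v n * w n) - of_real E * (\<Sum>n\<in>?F. v n * w n)"
    by (simp add: sum_subtractf left_diff_distrib sum_distrib_left mult.assoc)
  also have "(\<Sum>n\<in>?F. H0 v n * w n) = pair (H0 v) w"
    by (rule pair_finite_support[OF F, symmetric]) auto
  also have "\<dots> = pair v (H0 w)"
    using pair_Hop_finite_support[OF v, of "\<lambda>_. 0"] by (simp add: Hop_0)
  also have "\<dots> = (\<Sum>n\<in>?F. v n * (of_real E * w n))"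
    unfolding Hw by (rule pair_finite_support[OF F]) auto
  also have "\<dots> = of_real E * (\<Sum>n\<in>?F. v n * w n)"
    by (simp add: sum_distrib_left mult.left_commute)
  finally show ?thesis by simp
qed

lemma scattering_amplitude_eq:
  fixes V :: "int ^ 'd::finite \<Rightarrow> real"
  assumes V: "finite {n. V n \<noteq> 0}" and K: "limiting_absorption V E K"
  shows "scattering_amplitude V E \<phi> = F0 (amplitude_op V K (F0_adj E \<phi>))"
proof -
  have "finite {n. mult_op V (F0_adj E \<phi>) n \<noteq> 0}"
    by (rule finite_subset[OF _ V]) (auto simp: mult_op_def)
  from boundary_resolvent_eq[where f = "mult_op V (F0_adj E \<phi>)", OF V K this] show ?thesis
    unfolding scattering_amplitude_def Let_def amplitude_op_def[abs_def]
    by (simp only: mult_op_def)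
qed

lemma F0_eq:
  fixes f :: "int ^ 'd::finite \<Rightarrow> complex"
  assumes "finite F" "\<And>n. n \<notin> F \<Longrightarrow> f n = 0"
  shows "F0 f x = of_real ((2 * pi) powr (- (real CARD('d) / 2))) * (\<Sum>n\<in>F. exp (- (\<i> * of_real (pairing n x))) * f n)"
  unfolding F0_def using assms by (subst infsum_finite_support[OF assms(1)]) auto

lemma continuous_on_exp_pairing: "continuous_on A (\<lambda>x. exp (\<i> * of_real (pairing n x)))"
  unfolding pairing_def by (intro continuous_intros)

text \<open>
  Test against the complex conjugate of the trigonometric polynomial, cut off to \<open>B\<close>; finiteness of
  the measure of \<open>B\<close> makes it square integrable.
\<close>

lemma F0_adj_orthogonal:
  fixes c :: "int ^ 'd::finite \<Rightarrow> complex" and B :: "(real ^ 'd) set"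
  assumes F: "finite F" and c: "\<And>n. n \<notin> F \<Longrightarrow> c n = 0"
    and B: "B \<in> sets borel" "B \<subseteq> energy_surface E" "emeasure (surface_measure E) B < top"
    and orth: "\<And>\<phi>. \<phi> \<in> L2_surface E \<Longrightarrow> (\<Sum>n\<in>F. c n * F0_adj E \<phi> n) = 0"
  shows "AE x in surface_measure E. x \<in> B \<longrightarrow> pair c (\<lambda>n. exp (\<i> * of_real (pairing n x))) = 0"
proof -
  let ?M = "surface_measure E :: (real ^ 'd) measure"
  let ?e = "\<lambda>n x. exp (\<i> * complex_of_real (pairing n x))"
  define g where "g x = (\<Sum>n\<in>F. c n * ?e n x)" for x
  have pair_g: "pair c (\<lambda>n. ?e n x) = g x" for x
    unfolding g_def by (rule pair_finite_support[OF F c])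
  have e_meas: "?e n \<in> borel_measurable borel" for n
    by (intro borel_measurable_continuous_onI continuous_on_exp_pairing)
  have g_meas: "g \<in> borel_measurable borel"
    unfolding g_def by (intro borel_measurable_sum borel_measurable_times borel_measurable_const e_meas)
  define C where "C = (\<Sum>n\<in>F. cmod (c n))"
  have gC: "cmod (g x) \<le> C" for x
    unfolding g_def C_def by (rule sum_norm_le) (simp add: norm_mult)
  have C0: "C \<ge> 0"
    by (simp add: C_def sum_nonneg)
  define \<phi> where "\<phi> x = (if x \<in> B then cnj (g x) else 0)" for x
  have \<phi>_meas: "\<phi> \<in> borel_measurable borel"
    unfolding \<phi>_def using B(1) g_meas by (intro measurable_If_set) auto
  have B_M: "B \<in> sets ?M"
    using B by (simp add: surface_measure_eq sets_restrict_space_iff)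
  have int: "integrable ?M h" if "h \<in> borel_measurable borel" "\<And>x. norm (h x) \<le> C' * indicator B x"
    for h :: "real ^ 'd \<Rightarrow> 'b::{banach, second_countable_topology}" and C'
  proof (rule Bochner_Integration.integrable_bound)
    show "integrable ?M (\<lambda>x. C' * indicator B x :: real)"
      using B_M B(3) by (intro integrable_mult_right integrable_real_indicator) auto
    show "h \<in> borel_measurable ?M"
      by (rule surface_measurable[OF that(1)])
    have "norm (h x) \<le> norm (C' * indicator B x :: real)" for x
      unfolding real_norm_def by (rule order_trans[OF that(2) abs_ge_self])
    then show "AE x in ?M. norm (h x) \<le> norm (C' * indicator B x :: real)"
      by simp
  qed
  have sq_meas: "(\<lambda>x. (cmod (\<phi> x))\<^sup>2) \<in> borel_measurable borel"
    using \<phi>_meas by measurable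
  have sq_int: "integrable ?M (\<lambda>x. (cmod (\<phi> x))\<^sup>2)"
    using gC by (intro int[of _ "C\<^sup>2"] sq_meas) (auto simp: \<phi>_def intro!: power_mono)
  have "\<phi> \<in> L2_surface E"
    unfolding L2_surface_def using surface_measurable[OF \<phi>_meas] sq_int by simp
  then have "(\<Sum>n\<in>F. c n * F0_adj E \<phi> n) = 0"
    by (rule orth)
  then have "of_real ((2 * pi) powr (- (real CARD('d) / 2))) * (\<Sum>n\<in>F. c n * (LINT x|?M. ?e n x * \<phi> x)) = 0"
    unfolding F0_adj_def by (simp add: sum_distrib_left mult.left_commute)
  then have sum0: "(\<Sum>n\<in>F. c n * (LINT x|?M. ?e n x * \<phi> x)) = 0"
    by simp
  have ie: "integrable ?M (\<lambda>x. ?e n x * \<phi> x)" for n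
    using gC C0 by (intro int[of _ C] borel_measurable_times e_meas \<phi>_meas) (auto simp: \<phi>_def norm_mult)
  have "(LINT x|?M. (\<Sum>n\<in>F. c n * (?e n x * \<phi> x))) = 0"
    using ie sum0 by simp
  also have "(\<lambda>x. \<Sum>n\<in>F. c n * (?e n x * \<phi> x)) = (\<lambda>x. complex_of_real ((cmod (\<phi> x))\<^sup>2))"
  proof
    fix x
    have "(\<Sum>n\<in>F. c n * (?e n x * \<phi> x)) = g x * \<phi> x"
      by (simp add: g_def sum_distrib_right mult.assoc)
    also have "\<dots> = complex_of_real ((cmod (\<phi> x))\<^sup>2)"
      unfolding \<phi>_def complex_norm_square by (cases "x \<in> B") (simp_all add: mult.commute)
    finally show "(\<Sum>n\<in>F. c n * (?e n x * \<phi> x)) = complex_of_real ((cmod (\<phi> x))\<^sup>2)" .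
  qed
  finally have "(LINT x|?M. (cmod (\<phi> x))\<^sup>2) = 0"
    by (simp only: integral_complex_of_real of_real_eq_0_iff)
  then have "AE x in ?M. (cmod (\<phi> x))\<^sup>2 = 0"
    using integral_nonneg_eq_0_iff_AE[OF sq_int] by simp
  then show ?thesis
    unfolding pair_g by eventually_elim (auto simp: \<phi>_def)
qed

text \<open>
  The difference \<open>D\<close> of the two amplitudes maps into finitely supported sequences whose Fourier
  transform vanishes on the surface, that is, into the range of \<open>H0 - E\<close> on finitely supported
  sequences, which is orthogonal to every solution of \<open>(H0 - E) w = 0\<close>. So far the input has to be a
  superposition of plane waves; since \<open>D\<close> is symmetric, the same argument applied to \<open>D w\<close> extends
  the input to all solutions.
\<close>

lemma S_matrix_amplitudes:
  fixes V1 V2 :: "int ^ 'd::finite \<Rightarrow> real" and j0 j1 :: 'd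
  assumes band: "outer_band CARD('d) E" and j: "j1 \<noteq> j0" and F: "finite F"
    and V1: "\<And>n. n \<notin> F \<Longrightarrow> V1 n = 0" and V2: "\<And>n. n \<notin> F \<Longrightarrow> V2 n = 0"
    and K1: "limiting_absorption V1 E K1" and K2: "limiting_absorption V2 E K2"
    and S: "\<forall>\<phi>\<in>L2_surface E. AE x in surface_measure E. S_matrix V1 E \<phi> x = S_matrix V2 E \<phi> x"
    and w: "w \<in> eigenspace (\<lambda>_. 0) E" "w' \<in> eigenspace (\<lambda>_. 0) E"
  shows "(\<Sum>n\<in>F. w n * amplitude_op V1 K1 w' n) = (\<Sum>n\<in>F. w n * amplitude_op V2 K2 w' n)"
proof -
  note E = outer_band_not_int[OF band]
  have fin: "finite {n. V1 n \<noteq> 0}" "finite {n. V2 n \<noteq> 0}"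
    by (rule finite_subset[OF _ F]; use V1 V2 in auto)+
  obtain B :: "(real ^ 'd) set" where B: "B \<in> sets borel" "B \<subseteq> energy_surface E" "emeasure (surface_measure E) B < top"
    and vanish: "\<And>c :: int ^ 'd \<Rightarrow> complex. finite {n. c n \<noteq> 0} \<Longrightarrow>
       (AE x in surface_measure E. x \<in> B \<longrightarrow> pair c (\<lambda>n. exp (\<i> * of_real (pairing n x))) = 0) \<Longrightarrow>
       \<exists>v. finite {n. v n \<noteq> 0} \<and> (\<forall>n. H0 v n - of_real E * v n = c n)"
    using vanishing_on_surface_piece[OF band j] by blast
  define D where "D w n = amplitude_op V1 K1 w n - amplitude_op V2 K2 w n" for w n
  have D0: "D w n = 0" if "n \<notin> F" for w n
    using that amplitude_op_0[OF E F V1 K1] amplitude_op_0[OF E F V2 K2] by (simp add: D_def)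
  have D_sym: "(\<Sum>n\<in>F. u n * D u' n) = (\<Sum>n\<in>F. D u n * u' n)" for u u'
    using amplitude_op_symmetric[OF E F V1 K1, of u u'] amplitude_op_symmetric[OF E F V2 K2, of u u']
    by (simp add: D_def right_diff_distrib left_diff_distrib sum_subtractf)
  have orth: "(\<Sum>n\<in>F. c n * u n) = 0"
    if c: "\<And>n. n \<notin> F \<Longrightarrow> c n = 0" and u: "u \<in> eigenspace (\<lambda>_. 0) E"
      and AE: "AE x in surface_measure E. x \<in> B \<longrightarrow> pair c (\<lambda>n. exp (\<i> * of_real (pairing n x))) = 0" for c u
  proof -
    have "finite {n. c n \<noteq> 0}"
      by (rule finite_subset[OF _ F]) (use c in blast)
    from vanish[OF this AE] obtain v where v: "finite {n. v n \<noteq> 0}" "\<And>n. H0 v n - of_real E * v n = c n"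
      by blast
    have "pair c u = 0"
      using range_orthogonal_eigenspace[OF v(1) u] unfolding v(2) .
    then show ?thesis
      using pair_finite_support[OF F c] by simp
  qed
  \<comment> \<open>The output of the difference of the amplitudes is orthogonal to \<open>w\<close>.\<close>
  have out: "(\<Sum>n\<in>F. w n * D (F0_adj E \<phi>) n) = 0" if \<phi>: "\<phi> \<in> L2_surface E" for \<phi>
  proof -
    let ?d = "D (F0_adj E \<phi>)"
    let ?\<gamma> = "complex_of_real ((2 * pi) powr (- (real CARD('d) / 2)))"
    have amp: "scattering_amplitude V1 E \<phi> x - scattering_amplitude V2 E \<phi> x
       = ?\<gamma> * (\<Sum>n\<in>F. exp (- (\<i> * of_real (pairing n x))) * ?d n)" for x
      unfolding scattering_amplitude_eq[OF fin(1) K1] scattering_amplitude_eq[OF fin(2) K2]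
      by (simp add: F0_eq[OF F] amplitude_op_0[OF E F V1 K1] amplitude_op_0[OF E F V2 K2] D_def right_diff_distrib sum_subtractf)
    have "AE x in surface_measure E. pair (\<lambda>n. cnj (?d n)) (\<lambda>n. exp (\<i> * of_real (pairing n x))) = 0"
      using bspec[OF S \<phi>]
    proof eventually_elim
      case (elim x)
      then have "scattering_amplitude V1 E \<phi> x = scattering_amplitude V2 E \<phi> x"
        by (simp add: S_matrix_def)
      then have "(\<Sum>n\<in>F. exp (- (\<i> * of_real (pairing n x))) * ?d n) = 0"
        using amp[of x] by simp
      then have "cnj (\<Sum>n\<in>F. exp (- (\<i> * of_real (pairing n x))) * ?d n) = 0"
        by simp
      then have "(\<Sum>n\<in>F. cnj (?d n) * exp (\<i> * of_real (pairing n x))) = 0"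
        by (simp add: exp_cnj mult.commute)
      then show ?case
        using pair_finite_support[OF F, of "\<lambda>n. cnj (?d n)"] D0 by simp
    qed
    then have AE: "AE x in surface_measure E. x \<in> B \<longrightarrow> pair (\<lambda>n. cnj (?d n)) (\<lambda>n. exp (\<i> * of_real (pairing n x))) = 0"
      by eventually_elim blast
    have cw: "(\<lambda>n. cnj (w n)) \<in> eigenspace (\<lambda>_. 0) E"
      using w(1) by (simp add: eigenspace_def Hop_cnj)
    have "(\<Sum>n\<in>F. cnj (?d n) * cnj (w n)) = 0"
      using D0 by (intro orth[OF _ cw AE]) simp
    then have "cnj (\<Sum>n\<in>F. w n * ?d n) = 0"
      by (simp add: mult.commute)
    then show ?thesis by (simp only: complex_cnj_zero_iff)
  qed
  \<comment> \<open>By symmetry this is a statement about the input.\<close>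
  have "AE x in surface_measure E. x \<in> B \<longrightarrow> pair (D w) (\<lambda>n. exp (\<i> * of_real (pairing n x))) = 0"
    using out unfolding D_sym by (intro F0_adj_orthogonal[OF F D0 B])
  then have "(\<Sum>n\<in>F. D w n * w' n) = 0"
    by (intro orth D0 w(2))
  then have "(\<Sum>n\<in>F. w n * D w' n) = 0"
    unfolding D_sym .
  then show ?thesis
    by (simp add: D_def right_diff_distrib sum_subtractf)
qed

section \<open>Uniqueness of the potential\<close>

theorem theorem1p1:
  fixes V1 V2 :: "int ^ 'd \<Rightarrow> real" and E :: real
  assumes "CARD('d) \<ge> 2"
    and "E \<in> energy_range CARD('d)"
    and "finite {n. V1 n \<noteq> 0}"
    and "finite {n. V2 n \<noteq> 0}"
    and "\<forall>\<phi>\<in>L2_surface E. AE x in surface_measure E. S_matrix V1 E \<phi> x = S_matrix V2 E \<phi> x"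
  shows "V1 = V2"
proof (rule ccontr)
  assume ne: "V1 \<noteq> V2"
  have band: "outer_band CARD('d) E"
    using assms(1,2) by (auto simp: energy_range_def outer_band_def split: if_splits)
  note E = outer_band_not_int[OF band]
  obtain j0 j1 :: 'd where j: "j1 \<noteq> j0"
    using assms(1) by (metis (full_types) UNIV_I card_2_iff' card_le_Suc0_iff_eq finite not_numeral_le_zero
        numeral_2_eq_2 not_less_eq_eq)
  let ?F = "{n. V1 n \<noteq> 0} \<union> {n. V2 n \<noteq> 0}"
  have F: "finite ?F" using assms(3,4) by simp
  have V0: "V1 n = 0" "V2 n = 0" if "n \<notin> ?F" for n
    using that by auto
  obtain K1 K2 where K: "limiting_absorption V1 E K1" "limiting_absorption V2 E K2"
    using limiting_absorption_exists[OF band j] assms(3,4) by blast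
  \<comment> \<open>A site of the support of \<open>V1 - V2\<close> that lies farthest in the direction \<open>j0\<close>.\<close>
  let ?S = "{n. V1 n \<noteq> V2 n}"
  have S: "finite ?S" "?S \<noteq> {}"
    using ne by (auto intro: finite_subset[OF _ F])
  define M where "M = Max ((\<lambda>n. n $ j0) ` ?S)"
  have "M \<in> (\<lambda>n. n $ j0) ` ?S"
    unfolding M_def using S by (intro Max_in) auto
  then obtain n0 where n0: "V1 n0 \<noteq> V2 n0" "n0 $ j0 = M"
    by auto
  have max: "n $ j0 \<le> n0 $ j0" if "V1 n \<noteq> V2 n" for n
    unfolding n0(2) M_def using S that by (intro Max_ge) auto
  obtain u1 :: "int ^ 'd \<Rightarrow> complex" where u1: "\<And>n. Hop V1 u1 n = of_real E * u1 n" "u1 n0 = 1"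
    "\<And>n. n $ j0 + n $ j1 < n0 $ j0 + n0 $ j1 \<Longrightarrow> u1 n = 0"
    using half_space_solution[OF j] by blast
  obtain u2 :: "int ^ 'd \<Rightarrow> complex" where u2: "\<And>n. Hop V2 u2 n = of_real E * u2 n" "u2 n0 = 1"
    "\<And>n. n $ j0 \<le> n0 $ j0 \<Longrightarrow> n \<noteq> n0 \<Longrightarrow> n0 $ j0 + n0 $ j1 - 2 < n $ j0 + n $ j1 \<Longrightarrow> u2 n = 0"
    using slab_solution[OF j] by blast
  have "(\<Sum>n\<in>?F. of_real (V1 n - V2 n) * (u1 n * u2 n)) = 0"
  proof (rule orthogonality_of_products[OF E F V0 K])
    show "u1 \<in> eigenspace V1 E" "u2 \<in> eigenspace V2 E"
      using u1(1) u2(1) by (auto simp: eigenspace_def)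
    fix w w' :: "int ^ 'd \<Rightarrow> complex"
    assume "w \<in> eigenspace (\<lambda>_. 0) E" "w' \<in> eigenspace (\<lambda>_. 0) E"
    then show "(\<Sum>n\<in>?F. w n * amplitude_op V1 K1 w' n) = (\<Sum>n\<in>?F. w n * amplitude_op V2 K2 w' n)"
      by (intro S_matrix_amplitudes[OF band j F V0 K assms(5)])
  qed
  moreover have "of_real (V1 n - V2 n) * (u1 n * u2 n) = (if n = n0 then of_real (V1 n0 - V2 n0) else 0)" for n
  proof (cases "V1 n = V2 n \<or> n = n0")
    case False
    then have "u1 n = 0 \<or> u2 n = 0"
      using max[of n] u1(3)[of n] u2(3)[of n] by linarith
    with False show ?thesis by auto
  next
    case True
    then show ?thesis
      using n0(1) u1(2) u2(2) by auto
  qed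
  ultimately have "(\<Sum>n\<in>?F. if n = n0 then complex_of_real (V1 n0 - V2 n0) else 0) = 0"
    by simp
  moreover have "n0 \<in> ?F"
    using n0(1) by auto
  ultimately show False
    using F n0(1) by simp
qed

end
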